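(* Let $V$ be a spectrally negative Lévy process which is not the opposite of a subordinator, with Laplace exponent $\Psi_V$, let $\kappa$ be as defined in the context, let $V^{\uparrow}$ be $V$ conditioned to stay positive (starting from $0$), and let $I(V^{\uparrow}) := \int_0^{+\infty} e^{-V^{\uparrow}(t)}\,dt$. Let $\varphi_V(x) := \inf\{\lambda\geq 0 : \Psi_V(\lambda+\kappa)/\lambda > x\}$. Assume that $\Psi_V$ has $\alpha$-regular variation at $+\infty$ for some $\alpha\in]1,2]$. Then $$\log\left(\mathbb{P}\left(I(V^{\uparrow})\leq x\right)\right) \underset{x\to 0}{\sim} -(\alpha-1)\,\varphi_V\left(\frac1x\right).$$
   Context: In the definition of $\varphi_V$, the ratio $\Psi_V(\lambda+\kappa)/\lambda$ at $\lambda=0$ is understood as its limit $\Psi_V'(\kappa)$. A function $f$ has $\alpha$-regular variation at $+\infty$ if $f(t\lambda)/f(\lambda)\to t^{\alpha}$ as $\lambda\to+\infty$ for every $t>0$. The notation $f\sim g$ means that $f/g\to 1$. A spectrally negative Lévy process is a real-valued càdlàg Lévy process $V$ with $V(0)=0$ and no positive jumps. Its Laplace exponent $\Psi_V$ is given by $\mathbb{E}[e^{\lambda V(t)}] = e^{t\Psi_V(\lambda)}$ for $t,\lambda \geq 0$. If $V$ drifts to $-\infty$ (i.e. $V(t)\to-\infty$ a.s.), $\kappa := \inf\{\lambda>0 : \Psi_V(\lambda)=0\}$; otherwise $\kappa := 0$. Write $V_x := x+V$. Scale function: $W:[0,+\infty[\to[0,+\infty[$ is the continuous increasing function with $\int_0^{+\infty}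 e^{-\lambda x}W(x)\,dx = 1/\Psi_V(\lambda)$ for all $\lambda>\kappa$. $V$ conditioned to stay positive: for $x>0$, $V^{\uparrow}_x$ is the Markov process started from $x$, with values in $]0,+\infty[$ and infinite lifetime, whose transition semigroup is $p^{\uparrow}_t(x,dy) := \frac{W(y)}{W(x)}\,\mathbb{P}\left(V_x(t)\in dy,\ \inf_{[0,t]}V_x>0\right)$. $V^{\uparrow}=V^{\uparrow}_0$ is the process started from $0$ obtained as the limit in distribution of $V^{\uparrow}_x$ as $x\to 0+$; it is a Feller process whose transition laws restricted to $]0,+\infty[$ are given by $p^{\uparrow}_t$. *)

theory Defs
  imports "HOL-Probability.Probability"
begin

(* Time runs over [0,\<infinity>): processes have type real \<Rightarrow> 'a \<Rightarrow> real, and their values at negative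
   times are never used. *)

definition cadlag :: "(real \<Rightarrow> real) \<Rightarrow> bool" where
  "cadlag f \<longleftrightarrow>
     (\<forall>t\<ge>0. continuous (at_right t) f) \<and> (\<forall>t>0. \<exists>l. (f \<longlongrightarrow> l) (at_left t))"

(* Convergence of sequences in the Skorokhod space D([0,\<infinity>)), by time changes
   (Jacod and Shiryaev, Limit Theorems for Stochastic Processes, VI.1.14). *)
definition skorokhod_tendsto :: "(nat \<Rightarrow> real \<Rightarrow> real) \<Rightarrow> (real \<Rightarrow> real) \<Rightarrow> bool" where
  "skorokhod_tendsto g f \<longleftrightarrow>
     (\<exists>\<rho>. (\<forall>n. continuous_on {0..} (\<rho> n) \<and> strict_mono_on {0..} (\<rho> n) \<and> \<rho> n ` {0..} = {0..}) \<and>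
          uniform_limit {0..} \<rho> (\<lambda>s. s) sequentially \<and>
          (\<forall>T. uniform_limit {0..T} (\<lambda>n s. g n (\<rho> n s)) f sequentially))"

(* The J1 topology is metrizable, so sequential continuity is continuity. *)
definition skorokhod_continuous :: "((real \<Rightarrow> real) \<Rightarrow> real) \<Rightarrow> bool" where
  "skorokhod_continuous F \<longleftrightarrow>
     (\<forall>g f. (\<forall>n. cadlag (g n)) \<and> cadlag f \<and> skorokhod_tendsto g f \<longrightarrow> (\<lambda>n. F (g n)) \<longlonglongrightarrow> F f)"

(* Convergence in distribution, in D([0,\<infinity>)), of the processes X x on the probability spaces N x
   to the process Y on the probability space K, as x runs through a filter. *)
definition process_converges_in_distribution ::
  "('x \<Rightarrow> 'b measure) \<Rightarrow> ('x \<Rightarrow> real \<Rightarrow> 'b \<Rightarrow> real) \<Rightarrow> 'c measure \<Rightarrow> (real \<Rightarrow> 'c \<Rightarrow> real) \<Rightarrow> 'x filter \<Rightarrow> bool"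
where
  "process_converges_in_distribution N X K Y \<F> \<longleftrightarrow>
     (\<forall>F. skorokhod_continuous F \<and> bounded (F ` Collect cadlag) \<longrightarrow>
        ((\<lambda>x. LINT \<omega>|N x. F (\<lambda>t. X x t \<omega>)) \<longlongrightarrow> (LINT \<omega>|K. F (\<lambda>t. Y t \<omega>))) \<F>)"

definition levy_process :: "'a measure \<Rightarrow> (real \<Rightarrow> 'a \<Rightarrow> real) \<Rightarrow> bool" where
  "levy_process M V \<longleftrightarrow>
     prob_space M \<and>
     (\<forall>t\<ge>0. V t \<in> borel_measurable M) \<and>
     (\<forall>\<omega>\<in>space M. cadlag (\<lambda>t. V t \<omega>)) \<and>
     (AE \<omega> in M. V 0 \<omega> = 0) \<and>
     (\<forall>s\<ge>0. \<forall>t\<ge>0. distr M borel (\<lambda>\<omega>. V (s + t) \<omega> - V s \<omega>) = distr M borel (V t)) \<and>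
     (\<forall>n. \<forall>\<tau> :: nat \<Rightarrow> real. 0 \<le> \<tau> 0 \<and> (\<forall>i<n. \<tau> i \<le> \<tau> (Suc i)) \<longrightarrow>
        prob_space.indep_vars M (\<lambda>_. borel) (\<lambda>i \<omega>. V (\<tau> (Suc i)) \<omega> - V (\<tau> i) \<omega>) {..<n})"

definition subordinator :: "'a measure \<Rightarrow> (real \<Rightarrow> 'a \<Rightarrow> real) \<Rightarrow> bool" where
  "subordinator M S \<longleftrightarrow> levy_process M S \<and> (AE \<omega> in M. mono_on {0..} (\<lambda>t. S t \<omega>))"

definition no_positive_jumps :: "(real \<Rightarrow> real) \<Rightarrow> bool" where
  "no_positive_jumps f \<longleftrightarrow> (\<forall>t>0. \<forall>l. (f \<longlongrightarrow> l) (at_left t) \<longrightarrow> f t \<le> l)"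

definition spectrally_negative_levy_process :: "'a measure \<Rightarrow> (real \<Rightarrow> 'a \<Rightarrow> real) \<Rightarrow> bool" where
  "spectrally_negative_levy_process M V \<longleftrightarrow>
     levy_process M V \<and> (AE \<omega> in M. no_positive_jumps (\<lambda>t. V t \<omega>))"

(* This determines \<Psi> on [0,\<infinity>); its values elsewhere are never used.  Finiteness of the
   exponential moments is included: the Bochner integral of a non-integrable function is 0. *)
definition laplace_exponent :: "'a measure \<Rightarrow> (real \<Rightarrow> 'a \<Rightarrow> real) \<Rightarrow> (real \<Rightarrow> real) \<Rightarrow> bool" where
  "laplace_exponent M V \<Psi> \<longleftrightarrow>
     (\<forall>t\<ge>0. \<forall>q\<ge>0. (LINT \<omega>|M. exp (q * V t \<omega>)) = exp (t * \<Psi> q))"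

definition drifts_to_minus_infinity :: "'a measure \<Rightarrow> (real \<Rightarrow> 'a \<Rightarrow> real) \<Rightarrow> bool" where
  "drifts_to_minus_infinity M V \<longleftrightarrow> (AE \<omega> in M. filterlim (\<lambda>t. V t \<omega>) at_bot at_top)"

definition kappa :: "'a measure \<Rightarrow> (real \<Rightarrow> 'a \<Rightarrow> real) \<Rightarrow> (real \<Rightarrow> real) \<Rightarrow> real" where
  "kappa M V \<Psi> = (if drifts_to_minus_infinity M V then Inf {q. 0 < q \<and> \<Psi> q = 0} else 0)"

(* The limit is one-sided because \<Psi> lives on [0,\<infinity>) and \<kappa> may be 0. *)
definition phi_ratio :: "(real \<Rightarrow> real) \<Rightarrow> real \<Rightarrow> real \<Rightarrow> real" where
  "phi_ratio \<Psi> \<kappa> q =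
     (if q = 0 then Lim (at_right 0) (\<lambda>l. \<Psi> (l + \<kappa>) / l) else \<Psi> (q + \<kappa>) / q)"

definition phi :: "(real \<Rightarrow> real) \<Rightarrow> real \<Rightarrow> real \<Rightarrow> real" where
  "phi \<Psi> \<kappa> x = Inf {q. 0 \<le> q \<and> phi_ratio \<Psi> \<kappa> q > x}"

definition regularly_varying :: "real \<Rightarrow> (real \<Rightarrow> real) \<Rightarrow> bool" where
  "regularly_varying \<alpha> f \<longleftrightarrow> (\<forall>t>0. ((\<lambda>l. f (t * l) / f l) \<longlongrightarrow> t powr \<alpha>) at_top)"

definition scale_function :: "(real \<Rightarrow> real) \<Rightarrow> real \<Rightarrow> (real \<Rightarrow> real) \<Rightarrow> bool" where
  "scale_function \<Psi> \<kappa> W \<longleftrightarrow>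
     continuous_on {0..} W \<and> mono_on {0..} W \<and> (\<forall>x\<ge>0. 0 \<le> W x) \<and>
     (\<forall>q>\<kappa>. set_integrable lborel {0..} (\<lambda>x. exp (- q * x) * W x) \<and>
            (LBINT x:{0..}. exp (- q * x) * W x) = 1 / \<Psi> q)"

(* p_t(x,dy) = W(y)/W(x) P(x + V(t) \<in> dy, inf over [0,t] of x + V is > 0), for x > 0.
   The cut-off at y > 0 does not change this measure, which lives on ]0,\<infinity>[; it keeps the
   unspecified values of W on the negative half-line out of the density. *)
definition p_up ::
  "'a measure \<Rightarrow> (real \<Rightarrow> 'a \<Rightarrow> real) \<Rightarrow> (real \<Rightarrow> real) \<Rightarrow> real \<Rightarrow> real \<Rightarrow> real measure" where
  "p_up M V W t x =
     density
       (distr (density M (indicator {\<omega> \<in> space M. 0 < (INF s\<in>{0..t}. x + V s \<omega>)}))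
          borel (\<lambda>\<omega>. x + V t \<omega>))
       (\<lambda>y. ennreal (if 0 < y then W y / W x else 0))"

definition natural_filtration :: "'b measure \<Rightarrow> (real \<Rightarrow> 'b \<Rightarrow> real) \<Rightarrow> real \<Rightarrow> 'b measure" where
  "natural_filtration N X s =
     sigma (space N) {X u -` B \<inter> space N | u B. 0 \<le> u \<and> u \<le> s \<and> B \<in> sets borel}"

(* X is a cadlag Markov process with values in E, started from x, with transition laws P t y. *)
definition markov_process ::
  "'b measure \<Rightarrow> (real \<Rightarrow> 'b \<Rightarrow> real) \<Rightarrow> real set \<Rightarrow> (real \<Rightarrow> real \<Rightarrow> real measure) \<Rightarrow> real \<Rightarrow> bool" where
  "markov_process N X E P x \<longleftrightarrow>
     prob_space N \<and>
     (\<forall>t\<ge>0. X t \<in> borel_measurable N) \<and>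
     (\<forall>\<omega>\<in>space N. cadlag (\<lambda>t. X t \<omega>)) \<and>
     (AE \<omega> in N. \<forall>t\<ge>0. X t \<omega> \<in> E) \<and>
     (AE \<omega> in N. X 0 \<omega> = x) \<and>
     (\<forall>s\<ge>0. \<forall>t\<ge>0. \<forall>B\<in>sets borel. AE \<omega> in N.
        real_cond_exp N (natural_filtration N X s) (indicator (X (s + t) -` B \<inter> space N)) \<omega> =
        measure (P t (X s \<omega>)) B)"

(* A conservative Feller semigroup on [0,\<infinity>), given by its transition laws P t x for t, x \<ge> 0. *)
definition feller_semigroup :: "(real \<Rightarrow> real \<Rightarrow> real measure) \<Rightarrow> bool" where
  "feller_semigroup P \<longleftrightarrow>
     (\<forall>t\<ge>0. \<forall>x\<ge>0. prob_space (P t x) \<and> sets (P t x) = sets borel \<and> measure (P t x) {0..} = 1) \<and>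
     (\<forall>x\<ge>0. P 0 x = return borel x) \<and>
     (\<forall>s\<ge>0. \<forall>t\<ge>0. \<forall>x\<ge>0. \<forall>B\<in>sets borel.
        emeasure (P (s + t) x) B = (\<integral>\<^sup>+y\<in>{0..}. emeasure (P t y) B \<partial>P s x)) \<and>
     (\<forall>f :: real \<Rightarrow> real. continuous_on {0..} f \<and> (f \<longlongrightarrow> 0) at_top \<longrightarrow>
        (\<forall>t\<ge>0. continuous_on {0..} (\<lambda>x. LINT y:{0..}|P t x. f y) \<and>
               ((\<lambda>x. LINT y:{0..}|P t x. f y) \<longlongrightarrow> 0) at_top) \<and>
        uniform_limit {0..} (\<lambda>t x. LINT y:{0..}|P t x. f y) f (at_right 0))"

(* The whole family of V conditioned to stay positive: Vup x on the probability space N x is the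
   process started from x \<ge> 0.  The process started from 0 is the limit in distribution of the
   others; it is a Feller process whose transition laws from points of ]0,\<infinity>[ are those above. *)
definition conditioned_to_stay_positive ::
  "'a measure \<Rightarrow> (real \<Rightarrow> 'a \<Rightarrow> real) \<Rightarrow> (real \<Rightarrow> real) \<Rightarrow>
   (real \<Rightarrow> 'b measure) \<Rightarrow> (real \<Rightarrow> real \<Rightarrow> 'b \<Rightarrow> real) \<Rightarrow> bool" where
  "conditioned_to_stay_positive M V W N Vup \<longleftrightarrow>
     (\<forall>x>0. markov_process (N x) (Vup x) {0<..} (p_up M V W) x) \<and>
     (\<exists>P. feller_semigroup P \<and> (\<forall>t\<ge>0. \<forall>x>0. P t x = p_up M V W t x) \<and>
          markov_process (N 0) (Vup 0) {0..} P 0) \<and>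
     process_converges_in_distribution N Vup (N 0) (Vup 0) (at_right 0)"

definition exponential_functional :: "(real \<Rightarrow> real) \<Rightarrow> ennreal" where
  "exponential_functional f = (\<integral>\<^sup>+t\<in>{0..}. ennreal (exp (- f t)) \<partial>lborel)"

end

theory Submission
  imports Defs "HOL-Real_Asymp.Real_Asymp"
begin

text \<open>
  Write \<open>P q = \<Psi> (q + \<kappa>)\<close>. The key is the closed form
  \<open>E exp (- l * I) = 1 / J l\<close> with \<open>J l = (\<Sum>n. l ^ n / (P 1 * \<dots> * P n))\<close>.
  Let \<open>G\<close> solve the renewal equation \<open>G = W + l * (W convolved with exp (- y) G y)\<close> and let
  \<open>g = G / W\<close>, which tends to 1 at 0. Comparing Laplace transforms in the starting point of the process killed
  below 0, which fluctuation theory (first passage times and time reversal) provides, shows that \<open>J l - g\<close>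
  is the potential of \<open>l * exp (- x) * g x\<close> under the conditioned semigroup. Hence
  \<open>g (X t) * exp (- l * (integral of exp (- X s) for s \<le> t))\<close> has expectation 1 under the process \<open>X\<close> started
  from 0, and since \<open>E (g (X t))\<close> tends to its upper bound \<open>J l\<close>, letting \<open>t\<close> grow yields the closed form.

  Convexity upgrades the regular variation of \<open>P\<close> to its logarithmic increments, so
  \<open>ln (J (P t)) / t\<close> tends to \<open>\<alpha>\<close>. A de Bruijn type Tauberian argument with \<open>l = P t\<close> and
  \<open>t = phi (1 / x)\<close>, so that \<open>l * x = t\<close>, converts this into the asymptotics of the distribution function:
  the exponent is \<open>t - \<alpha> * t\<close>.
\<close>

section \<open>Growth of the series\<close>

text \<open>The weight \<open>exp (- y)\<close> in the renewal equation moves the Laplace variable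
  by one, so the transforms of \<open>G\<close> at \<open>q\<close> and at \<open>q + 1\<close> are
  linked by \<open>Gr_recursion\<close>. Unrolling that link produces the products
  \<open>P 1 * ... * P n\<close>, and \<open>J l\<close> is the right-hand side of the recursion at
  \<open>q = \<kappa>\<close>.

  The obstacle is the starting point 0. The transition laws are explicit only from
  \<open>x > 0\<close>, and equality of Laplace transforms identifies functions only almost
  everywhere. Identities between continuous functions reach 0 by the Feller property. The potential
  is an integral over infinite time and not visibly continuous, yet its value at 0 decides whether
  the mean of \<open>g\<close> really tends to \<open>J l\<close>. That value is approached through
  resolvents of positive rate, which are continuous up to 0: the Laplace variable is sent to
  infinity, and the rate to 0.

  \<open>P\<close> is the natural scale for \<open>J\<close> because the summands of
  \<open>J (P t)\<close> increase up to index \<open>t\<close> and decrease afterwards, so that only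
  one summand counts up to a factor linear in \<open>t\<close>.\<close>

lemma cesaro_tendsto:
  fixes d :: "nat \<Rightarrow> real"
  assumes "d \<longlonglongrightarrow> l"
  shows "(\<lambda>n. (\<Sum>k<n. d k) / real n) \<longlonglongrightarrow> l"
proof (rule LIMSEQ_I)
  fix e :: real assume e: "0 < e"
  obtain N where N: "\<And>n. n \<ge> N \<Longrightarrow> norm (d n - l) < e / 2"
    using LIMSEQ_D[OF assms, of "e / 2"] e by auto
  define C where "C = (\<Sum>k<N. norm (d k - l))"
  have C: "0 \<le> C" by (simp add: C_def sum_nonneg)
  obtain N' where N': "real N' > 2 * C / e" using reals_Archimedean2 by blast
  show "\<exists>no. \<forall>n\<ge>no. norm ((\<Sum>k<n. d k) / real n - l) < e"
  proof (intro exI allI impI)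
    fix n assume n: "n \<ge> max 1 (max N N')"
    then have n0: "real n > 0" and nN: "N \<le> n" and nN': "N' \<le> n" by auto
    have split: "{..<n} = {..<N} \<union> {N..<n}" using nN by auto
    have "(\<Sum>k<n. d k) / real n - l = (\<Sum>k<n. d k - l) / real n"
      using n0 by (simp add: sum_subtractf field_simps)
    then have "norm ((\<Sum>k<n. d k) / real n - l) = norm (\<Sum>k<n. d k - l) / real n"
      using n0 by simp
    also have "\<dots> \<le> (\<Sum>k<n. norm (d k - l)) / real n"
      using n0 by (intro divide_right_mono norm_sum) auto
    also have "(\<Sum>k<n. norm (d k - l)) = C + (\<Sum>k\<in>{N..<n}. norm (d k - l))"
      unfolding C_def split by (subst sum.union_disjoint) auto
    also have "(\<Sum>k\<in>{N..<n}. norm (d k - l)) \<le> (\<Sum>k\<in>{N..<n}. e / 2)"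
      using N by (intro sum_mono) (auto intro: less_imp_le)
    also have "\<dots> \<le> real n * (e / 2)" using e by (simp add: mult_right_mono)
    finally have "norm ((\<Sum>k<n. d k) / real n - l) \<le> (C + real n * (e / 2)) / real n"
      using n0 by (simp add: divide_right_mono)
    also have "\<dots> = C / real n + e / 2" using n0 by (simp add: field_simps)
    also have "C / real n < e / 2"
    proof -
      have "2 * C / e < real n" using N' nN' by linarith
      then show ?thesis using e n0 by (simp add: field_simps)
    qed
    finally show "norm ((\<Sum>k<n. d k) / real n - l) < e" by simp
  qed
qed

locale convex_rv =
  fixes P :: "real \<Rightarrow> real" and \<alpha> :: real
  assumes P_convex: "convex_on {0..} P" and P_zero: "P 0 = 0"
    and P_pos: "\<And>x. 0 < x \<Longrightarrow> 0 < P x"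
    and rv: "\<And>t. 0 < t \<Longrightarrow> ((\<lambda>l. P (t * l) / P l) \<longlongrightarrow> t powr \<alpha>) at_top"
    and alpha: "1 < \<alpha>"
begin

lemma ratio_mono: "0 < x \<Longrightarrow> x \<le> y \<Longrightarrow> P x / x \<le> P y / y"
proof -
  assume xy: "0 < x" "x \<le> y"
  have "P ((1 - x / y) *\<^sub>R 0 + (x / y) *\<^sub>R y) \<le> (1 - x / y) * P 0 + (x / y) * P y"
    using xy by (intro convex_onD[OF P_convex]) auto
  then show ?thesis using xy P_zero by (simp add: field_simps)
qed

lemma P_strict_mono: "0 < x \<Longrightarrow> x < y \<Longrightarrow> P x < P y"
proof -
  assume xy: "0 < x" "x < y"
  have "P x \<le> x * (P y / y)" using ratio_mono[of x y] xy by (simp add: field_simps)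
  also have "\<dots> < y * (P y / y)" using xy P_pos[of y] by (intro mult_strict_right_mono) auto
  finally show ?thesis using xy by simp
qed

lemma P_mono: "0 < x \<Longrightarrow> x \<le> y \<Longrightarrow> P x \<le> P y"
  using P_strict_mono[of x y] by (cases "x = y") auto

lemma P_slope: "0 \<le> x \<Longrightarrow> x < y \<Longrightarrow> y < z \<Longrightarrow> (P y - P x) / (y - x) \<le> (P z - P y) / (z - y)"
proof -
  assume xyz: "0 \<le> x" "x < y" "y < z"
  define t where "t = (y - x) / (z - x)"
  have t: "t * (z - x) = y - x" using xyz by (simp add: t_def)
  then have y: "y = (1 - t) *\<^sub>R x + t *\<^sub>R z" by (simp add: algebra_simps)
  have "P y \<le> (1 - t) * P x + t * P z"
    by (subst y, rule convex_onD[OF P_convex]) (use xyz in \<open>auto simp: t_def\<close>)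
  then have "(z - x) * P y \<le> (z - x) * ((1 - t) * P x + t * P z)"
    using xyz by (intro mult_left_mono) auto
  also have "\<dots> = (z - x - t * (z - x)) * P x + (t * (z - x)) * P z" by (simp add: algebra_simps)
  finally have "(z - x) * P y \<le> (z - y) * P x + (y - x) * P z" by (simp add: t)
  then show ?thesis using xyz by (simp add: divide_simps) (simp add: algebra_simps)
qed

text \<open>A discrete monotone density theorem. Regular variation controls only increments over
  proportional intervals; convexity squeezes the unit increment at \<open>n\<close> between the mean
  slopes over \<open>[(1 - h) n, n]\<close> and \<open>[n, (1 + h) n]\<close>. Their rescaled limits
  are difference quotients of \<open>t powr \<alpha>\<close> at 1, whose derivative there is
  \<open>\<alpha>\<close>.\<close>

lemma slope_tendsto: "(\<lambda>n. real n * (P (real n + 1) - P (real n)) / P (real n)) \<longlonglongrightarrow> \<alpha>"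
proof (rule LIMSEQ_I)
  fix e :: real assume e: "0 < e"
  have der: "((\<lambda>t. t powr \<alpha>) has_real_derivative \<alpha>) (at 1)"
    by (auto intro!: derivative_eq_intros)
  have lim: "((\<lambda>h. ((1 + h) powr \<alpha> - 1) / h) \<longlongrightarrow> \<alpha>) (at 0)"
    using der unfolding DERIV_def by simp
  from tendstoD[OF lim, of "e/2"] e obtain d where d: "0 < d"
    and dd: "\<And>h. h \<noteq> 0 \<Longrightarrow> \<bar>h\<bar> < d \<Longrightarrow> \<bar>((1 + h) powr \<alpha> - 1) / h - \<alpha>\<bar> < e / 2"
    unfolding eventually_at by (auto simp: dist_real_def)
  \<comment> \<open>Below 1 so that \<open>1 - h\<close> stays positive, and below \<open>d\<close>
    so that the difference quotients at \<open>h\<close> and at \<open>- h\<close> are both within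
    \<open>e / 2\<close> of \<open>\<alpha>\<close>.\<close>
  define h where "h = min (d / 2) (1 / 2)"
  have h: "0 < h" "h < 1" "h < d" using d by (auto simp: h_def)
  have nat: "filterlim real at_top sequentially" by (rule filterlim_real_sequentially)
  have "((\<lambda>l. (P ((1 + h) * l) / P l - 1) / h) \<longlongrightarrow> ((1 + h) powr \<alpha> - 1) / h) at_top"
    using h by (intro tendsto_intros rv) auto
  then have U: "(\<lambda>n. (P ((1 + h) * real n) / P (real n) - 1) / h) \<longlonglongrightarrow> ((1 + h) powr \<alpha> - 1) / h"
    using nat by (rule filterlim_compose)
  have "((\<lambda>l. (P ((1 - h) * l) / P l - 1) / (- h)) \<longlongrightarrow> ((1 + - h) powr \<alpha> - 1) / (- h)) at_top"
    using h rv[of "1 - h"] by (intro tendsto_intros) auto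
  then have L: "(\<lambda>n. (P ((1 - h) * real n) / P (real n) - 1) / (- h)) \<longlonglongrightarrow> ((1 + - h) powr \<alpha> - 1) / (- h)"
    using nat by (rule filterlim_compose)
  have "((1 + h) powr \<alpha> - 1) / h < \<alpha> + e / 2" using dd[of h] h by linarith
  moreover have "((1 + - h) powr \<alpha> - 1) / (- h) > \<alpha> - e / 2" using dd[of "-h"] h by linarith
  ultimately have "eventually (\<lambda>n. (P ((1 + h) * real n) / P (real n) - 1) / h < \<alpha> + e / 2) sequentially"
    and "eventually (\<lambda>n. (P ((1 - h) * real n) / P (real n) - 1) / (- h) > \<alpha> - e / 2) sequentially"
    using order_tendstoD[OF U] order_tendstoD[OF L] by auto
  \<comment> \<open>With \<open>h * n > 1\<close> the point \<open>n + 1\<close> lies strictly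
    inside \<open>[n, (1 + h) n]\<close>, as the three-point slope inequality demands.\<close>
  moreover have "eventually (\<lambda>n. real n > 1 / h) sequentially"
    using nat by (auto simp: filterlim_at_top_dense)
  ultimately have "eventually (\<lambda>n. norm (real n * (P (real n + 1) - P (real n)) / P (real n) - \<alpha>) < e) sequentially"
  proof eventually_elim
    case (elim n)
    define x where "x = real n"
    have "0 < 1 / h" using h by simp
    then have x: "x > 0" using elim unfolding x_def by linarith
    have "h * x > 1" using elim h by (simp add: x_def field_simps)
    note x = x this
    note p = P_pos[OF x(1)]
    have s1: "P (x + 1) - P x \<le> (P ((1 + h) * x) - P x) / (h * x)"
    proof -
      have "(P (x + 1) - P x) / (x + 1 - x) \<le> (P ((1 + h) * x) - P (x + 1)) / ((1 + h) * x - (x + 1))"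
        using x by (intro P_slope) (auto simp: algebra_simps)
      then have "(P (x + 1) - P x) * (h * x - 1) \<le> P ((1 + h) * x) - P (x + 1)"
        using x by (simp add: field_simps)
      then have "(P (x + 1) - P x) * (h * x) \<le> P ((1 + h) * x) - P x" by (simp add: algebra_simps)
      then show ?thesis using x by (simp add: pos_le_divide_eq)
    qed
    have s2: "P (x + 1) - P x \<ge> (P ((1 - h) * x) - P x) / (- h * x)"
    proof -
      have "(P x - P ((1 - h) * x)) / (x - (1 - h) * x) \<le> (P (x + 1) - P x) / (x + 1 - x)"
        using x h by (intro P_slope) (auto simp: algebra_simps)
      also have "x - (1 - h) * x = h * x" by (simp add: algebra_simps)
      finally show ?thesis by (simp add: minus_divide_left)
    qed
    have aux: "x * ((A - P x) / (c * x)) / P x = (A / P x - 1) / c" if "c \<noteq> 0" for A c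
      using x(1) p that by (simp add: divide_simps)
    have "x * (P (x + 1) - P x) / P x \<le> x * ((P ((1 + h) * x) - P x) / (h * x)) / P x"
      using s1 x p by (intro divide_right_mono mult_left_mono) auto
    also have "\<dots> = (P ((1 + h) * x) / P x - 1) / h" by (rule aux) (use h in auto)
    finally have 1: "x * (P (x + 1) - P x) / P x < \<alpha> + e / 2" using elim(1) unfolding x_def[symmetric] by linarith
    have "(P ((1 - h) * x) / P x - 1) / (- h) = x * ((P ((1 - h) * x) - P x) / (- h * x)) / P x"
      by (rule aux[symmetric]) (use h in auto)
    also have "\<dots> \<le> x * (P (x + 1) - P x) / P x"
      using s2 x p by (intro divide_right_mono mult_left_mono) auto
    finally have 2: "x * (P (x + 1) - P x) / P x > \<alpha> - e / 2" using elim(2) unfolding x_def[symmetric] by linarith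
    have "\<bar>Y - \<alpha>\<bar> < e" if "Y < \<alpha> + e / 2" "Y > \<alpha> - e / 2" for Y using that e by linarith
    from this[OF 1 2] show ?case unfolding x_def[symmetric] real_norm_def .
  qed
  then show "\<exists>no. \<forall>n\<ge>no. norm (real n * (P (real n + 1) - P (real n)) / P (real n) - \<alpha>) < e"
    by (simp add: eventually_sequentially)
qed

text \<open>For the relative increment \<open>x n\<close>, convergence of \<open>n * x n\<close>
  forces \<open>x n\<close> to 0, so the quadratic error of \<open>ln (1 + x)\<close> vanishes even
  after multiplication by \<open>n\<close>.\<close>

lemma ln_slope_tendsto: "(\<lambda>n. real n * (ln (P (real n + 1)) - ln (P (real n)))) \<longlonglongrightarrow> \<alpha>"
proof -
  define x where "x = (\<lambda>n. (P (real n + 1) - P (real n)) / P (real n))"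
  have nx: "(\<lambda>n. real n * x n) \<longlonglongrightarrow> \<alpha>" using slope_tendsto by (simp add: x_def)
  have "(\<lambda>n. (real n * x n) * (1 / real n)) \<longlonglongrightarrow> \<alpha> * 0"
    by (intro tendsto_mult nx lim_1_over_n)
  moreover have "eventually (\<lambda>n. (real n * x n) * (1 / real n) = x n) sequentially"
    using eventually_gt_at_top[of 0] by eventually_elim auto
  ultimately have x0: "x \<longlonglongrightarrow> 0" using tendsto_cong by fastforce
  have "(\<lambda>n. real n * x n - (real n * x n) * x n) \<longlonglongrightarrow> \<alpha> - \<alpha> * 0"
    by (intro tendsto_intros nx x0)
  then have lo: "(\<lambda>n. real n * x n - (real n * x n) * x n) \<longlonglongrightarrow> \<alpha>" by simp
  have ev: "eventually (\<lambda>n. n \<ge> 1 \<and> x n \<le> 1) sequentially"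
    using eventually_ge_at_top[of 1] order_tendstoD(2)[OF x0, of 1, simplified]
    by eventually_elim auto
  have key: "ln (P (real n + 1)) - ln (P (real n)) = ln (1 + x n)" if "n \<ge> 1" for n
  proof -
    have "P (real n) > 0" "P (real n + 1) > 0" using that by (auto intro!: P_pos)
    then show ?thesis by (simp add: x_def diff_divide_distrib ln_div add.commute)
  qed
  have xp: "x n \<ge> 0" if "n \<ge> 1" for n
  proof -
    have "P (real n) > 0" "P (real n + 1) \<ge> P (real n)" using that by (auto intro!: P_pos P_mono)
    then show ?thesis by (simp add: x_def)
  qed
  show ?thesis
  proof (rule tendsto_sandwich[OF _ _ lo nx])
    show "eventually (\<lambda>n. real n * x n - (real n * x n) * x n \<le> real n * (ln (P (real n + 1)) - ln (P (real n)))) sequentially"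
      using ev
    proof eventually_elim
      case (elim n)
      have "x n - (x n)\<^sup>2 \<le> ln (1 + x n)" using elim xp[of n] by (intro ln_one_plus_pos_lower_bound) auto
      then have "real n * (x n - (x n)\<^sup>2) \<le> real n * ln (1 + x n)" by (intro mult_left_mono) auto
      then show ?case using elim by (subst key) (auto simp: right_diff_distrib power2_eq_square)
    qed
    show "eventually (\<lambda>n. real n * (ln (P (real n + 1)) - ln (P (real n))) \<le> real n * x n) sequentially"
      using ev
    proof eventually_elim
      case (elim n)
      have "ln (1 + x n) \<le> x n" using xp[of n] elim by (intro ln_add_one_self_le_self) auto
      then show ?case using elim by (subst key) (auto intro: mult_left_mono)
    qed
  qed
qed

text \<open>Logarithm of the largest summand of \<open>J (P n)\<close>, namely
  \<open>P n ^ n / (P 1 * ... * P n)\<close>. Passing from \<open>n\<close> to \<open>n + 1\<close>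
  adds \<open>n\<close> logarithmic increments, so its growth is that of a Cesaro mean.\<close>

definition Lsum :: "nat \<Rightarrow> real" where
  "Lsum n = (\<Sum>k=1..n. ln (P (real n)) - ln (P (real k)))"

lemma Lsum_Suc: "Lsum (Suc n) = Lsum n + real n * (ln (P (real n + 1)) - ln (P (real n)))"
  by (simp add: Lsum_def sum_subtractf algebra_simps)

lemma Lsum_tendsto: "(\<lambda>n. Lsum n / real n) \<longlonglongrightarrow> \<alpha>"
proof -
  have "Lsum n = (\<Sum>k<n. real k * (ln (P (real k + 1)) - ln (P (real k))))" for n
    by (induction n) (auto simp: Lsum_Suc, simp add: Lsum_def)
  then show ?thesis using cesaro_tendsto[OF ln_slope_tendsto] by simp
qed

section \<open>The series and its largest summand\<close>

definition J :: "real \<Rightarrow> real" where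
  "J l = (\<Sum>n. l ^ n / (\<Prod>k=1..n. P (real k)))"

lemma P_at_top: "filterlim P at_top at_top"
proof (rule filterlim_at_top_mono)
  show "filterlim (\<lambda>x. x * P 1) at_top at_top"
    using P_pos[of 1] by (intro filterlim_at_top_mult_tendsto_pos[where c="P 1"] filterlim_ident) (auto simp: mult.commute)
  show "eventually (\<lambda>x. x * P 1 \<le> P x) at_top"
    using eventually_ge_at_top[of 1]
  proof eventually_elim
    case (elim x)
    then show ?case using ratio_mono[of 1 x] by (simp add: field_simps)
  qed
qed

lemma P_prod_pos: "0 < (\<Prod>k=1..n. P (real k))"
  by (intro Groups_Big.linordered_semidom_class.prod_pos) (auto intro!: P_pos)

lemma J_summable: "summable (\<lambda>n. l ^ n / (\<Prod>k=1..n. P (real k)))"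
proof -
  have "eventually (\<lambda>x. P x \<ge> 2 * \<bar>l\<bar>) at_top" using P_at_top by (simp add: filterlim_at_top)
  then have "eventually (\<lambda>n. P (real n) \<ge> 2 * \<bar>l\<bar>) sequentially"
    using filterlim_real_sequentially by (rule eventually_compose_filterlim)
  then obtain N where N: "\<And>n. n \<ge> N \<Longrightarrow> P (real n) \<ge> 2 * \<bar>l\<bar>" by (auto simp: eventually_sequentially)
  show ?thesis
  proof (rule summable_ratio_test[of "1/2" N])
    fix n assume "N \<le> n"
    then have 1: "P (real (Suc n)) \<ge> 2 * \<bar>l\<bar>" by (intro N) auto
    have 2: "P (real (Suc n)) > 0" by (intro P_pos) auto
    have "norm (l ^ Suc n / (\<Prod>k=1..Suc n. P (real k))) = (\<bar>l\<bar> / P (real (Suc n))) * norm (l ^ n / (\<Prod>k=1..n. P (real k)))"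
      using 2 P_prod_pos by (simp add: abs_mult power_abs del: of_nat_Suc)
    also have "\<dots> \<le> (1/2) * norm (l ^ n / (\<Prod>k=1..n. P (real k)))"
      using 1 2 by (intro mult_right_mono) (auto simp: divide_simps)
    finally show "norm (l ^ Suc n / (\<Prod>k=1..Suc n. P (real k))) \<le> 1/2 * norm (l ^ n / (\<Prod>k=1..n. P (real k)))" .
  qed auto
qed

lemma J_ge_term: "0 \<le> l \<Longrightarrow> l ^ n / (\<Prod>k=1..n. P (real k)) \<le> J l"
proof -
  assume l: "0 \<le> l"
  have "sum (\<lambda>n. l ^ n / (\<Prod>k=1..n. P (real k))) {n} \<le> J l"
    unfolding J_def using l P_prod_pos by (intro sum_le_suminf J_summable) (auto intro!: divide_nonneg_pos)
  then show ?thesis by simp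
qed

lemma J_ge_1: "0 \<le> l \<Longrightarrow> 1 \<le> J l"
  using J_ge_term[of l 0] by simp

lemma J_mono: "0 \<le> l \<Longrightarrow> l \<le> m \<Longrightarrow> J l \<le> J m"
  unfolding J_def using P_prod_pos
  by (intro suminf_le J_summable divide_right_mono power_mono) (auto intro: less_imp_le)

text \<open>Consecutive summands have ratio \<open>l / P (k + 1)\<close>, which is at least 1 as
  long as \<open>k + 1 \<le> th\<close> and at most 1 afterwards, because \<open>P\<close>
  increases.\<close>

lemma J_eq_max_term:
  assumes th: "1 \<le> th" and n: "n = nat \<lfloor>th\<rfloor>"
  shows "l = P th \<Longrightarrow> l ^ m / (\<Prod>k=1..m. P (real k)) \<le> l ^ n / (\<Prod>k=1..n. P (real k))"
proof -
  assume l: "l = P th"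
  define a where "a = (\<lambda>n. l ^ n / (\<Prod>k=1..n. P (real k)))"
  have lp: "l > 0" using th by (auto simp: l intro!: P_pos)
  have ap: "a n > 0" for n using lp P_prod_pos by (simp add: a_def)
  have step: "a (Suc k) = a k * (l / P (real (Suc k)))" for k
    using P_prod_pos[of k] by (simp add: a_def)
  have up: "a k \<le> a (Suc k)" if "k < n" for k
  proof -
    have "real (Suc k) \<le> th" using that n th by linarith
    then have "P (real (Suc k)) \<le> l" "P (real (Suc k)) > 0" unfolding l by (auto intro!: P_mono P_pos)
    then have "1 \<le> l / P (real (Suc k))" by simp
    then show ?thesis unfolding step using mult_left_mono[of 1 "l / P (real (Suc k))" "a k"] ap[of k] by linarith
  qed
  have down: "a (Suc k) \<le> a k" if "k \<ge> n" for k
  proof -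
    have "real (Suc k) \<ge> th" using that n th by linarith
    then have "P (real (Suc k)) \<ge> l" "P (real (Suc k)) > 0" unfolding l using th by (auto intro!: P_mono P_pos)
    then have "l / P (real (Suc k)) \<le> 1" by simp
    then show ?thesis unfolding step using mult_left_mono[of "l / P (real (Suc k))" 1 "a k"] ap[of k] by linarith
  qed
  show ?thesis
  proof (cases "m \<le> n")
    case True
    have "m \<le> k \<Longrightarrow> k \<le> n \<Longrightarrow> a m \<le> a k" for k
    proof (induction k rule: dec_induct)
      case (step k)
      then show ?case using up[of k] by simp
    qed simp
    from this[of n] True show ?thesis by (simp add: a_def)
  next
    case False
    have "n \<le> k \<Longrightarrow> a k \<le> a n" for k
    proof (induction k rule: dec_induct)
      case (step k)
      then show ?case using down[of k] by simp
    qed simp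
    from this[of m] False show ?thesis by (simp add: a_def)
  qed
qed

text \<open>From index \<open>2 * th\<close> on, \<open>l2\<close> makes every ratio at most 1/2, so
  the tail is worth at most two largest summands; at most \<open>2 * th + 1\<close> summands precede
  it. The linear factor that is lost disappears after taking logarithms and dividing by
  \<open>th\<close>.\<close>

lemma J_le_max_term:
  assumes th: "1 \<le> th" and n: "n = nat \<lfloor>th\<rfloor>" and l: "l = P th" and l2: "2 * P th \<le> P (2 * th)"
  shows "J l \<le> (2 * th + 5) * (l ^ n / (\<Prod>k=1..n. P (real k)))"
proof -
  define a where "a = (\<lambda>n. l ^ n / (\<Prod>k=1..n. P (real k)))"
  have max: "a m \<le> a n" for m using J_eq_max_term[OF th n l] by (simp add: a_def)
  have lp: "l > 0" using th by (auto simp: l intro!: P_pos)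
  have ap: "a n > 0" for n using lp P_prod_pos by (simp add: a_def)
  have step: "a (Suc k) = a k * (l / P (real (Suc k)))" for k
    using P_prod_pos[of k] by (simp add: a_def)
  define K where "K = nat \<lceil>2 * th\<rceil>"
  have K: "real K \<ge> 2 * th" "real K \<le> 2 * th + 1" using th by (simp_all add: K_def)
  have down: "a (j + K) \<le> a n * (1/2) ^ j" for j
  proof (induction j)
    case (Suc j)
    have "2 * th \<le> real (Suc (j + K))" using K by simp
    then have "P (real (Suc (j + K))) \<ge> P (2 * th)" using th by (intro P_mono) auto
    then have "P (real (Suc (j + K))) \<ge> 2 * l" using l2 l by simp
    then have "l / P (real (Suc (j + K))) \<le> 1 / 2" using lp by (simp add: field_simps)
    then have "a (Suc (j + K)) \<le> a (j + K) * (1/2)"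
      unfolding step using ap[of "j+K"] by (intro mult_left_mono) auto
    also have "\<dots> \<le> (a n * (1/2) ^ j) * (1/2)" using Suc by (intro mult_right_mono) auto
    finally show ?case by simp
  qed (use max in auto)
  have sa: "summable a" unfolding a_def by (rule J_summable)
  have "J l = (\<Sum>j. a (j + K)) + (\<Sum>i<K. a i)"
    unfolding J_def a_def[symmetric] using sa by (rule suminf_split_initial_segment)
  also have "(\<Sum>j. a (j + K)) \<le> (\<Sum>j. a n * (1/2) ^ j)"
    using down sa by (intro suminf_le summable_mult) (auto simp: summable_iff_shift)
  also have "\<dots> = a n * 2" by (subst suminf_mult) (auto simp: suminf_geometric)
  also have "(\<Sum>i<K. a i) \<le> (\<Sum>i<K. a n)" using max by (intro sum_mono)
  also have "\<dots> = real K * a n" by simp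
  also have "\<dots> \<le> (2 * th + 1) * a n" using K ap[of n] by (intro mult_right_mono) auto
  finally have "J l \<le> (2 * th + 3) * a n" by (simp add: algebra_simps)
  also have "\<dots> \<le> (2 * th + 5) * a n" using ap[of n] by (intro mult_right_mono) auto
  finally show ?thesis by (simp add: a_def)
qed

lemma filterlim_nat_floor: "filterlim (\<lambda>x::real. nat \<lfloor>x\<rfloor>) at_top at_top"
  by (intro filterlim_compose[OF filterlim_nat_sequentially] filterlim_floor_sequentially)

text \<open>With \<open>n\<close> the integer part of \<open>th\<close>, the logarithm exceeds
  \<open>Lsum n\<close> by \<open>n * (ln (P th) - ln (P n))\<close>. This lies between 0 and the
  increment that converges by \<open>ln_slope_tendsto\<close>, hence is negligible against
  \<open>th\<close>.\<close>

lemma ln_max_term_tendsto: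
  "((\<lambda>th. ln (P th ^ nat \<lfloor>th\<rfloor> / (\<Prod>k=1..nat \<lfloor>th\<rfloor>. P (real k))) / th) \<longlongrightarrow> \<alpha>) at_top"
proof -
  let ?n = "\<lambda>th::real. nat \<lfloor>th\<rfloor>"
  let ?d = "\<lambda>n. real n * (ln (P (real n + 1)) - ln (P (real n)))"
  have fl: "((\<lambda>th. real (?n th) / th) \<longlongrightarrow> 1) at_top" by real_asymp
  have lo: "((\<lambda>th. Lsum (?n th) / real (?n th) * (real (?n th) / th)) \<longlongrightarrow> \<alpha> * 1) at_top"
    by (intro tendsto_mult fl filterlim_compose[OF Lsum_tendsto filterlim_nat_floor])
  have up: "((\<lambda>th. Lsum (?n th) / real (?n th) * (real (?n th) / th) + ?d (?n th) * (1 / th)) \<longlongrightarrow> \<alpha> * 1 + \<alpha> * 0) at_top"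
    by (intro tendsto_add tendsto_mult fl filterlim_compose[OF Lsum_tendsto filterlim_nat_floor]
        filterlim_compose[OF ln_slope_tendsto filterlim_nat_floor]) real_asymp
  have ev: "eventually (\<lambda>th. Lsum (?n th) / real (?n th) * (real (?n th) / th) \<le> ln (P th ^ ?n th / (\<Prod>k=1..?n th. P (real k))) / th
     \<and> ln (P th ^ ?n th / (\<Prod>k=1..?n th. P (real k))) / th \<le> Lsum (?n th) / real (?n th) * (real (?n th) / th) + ?d (?n th) * (1 / th)) at_top"
    using eventually_ge_at_top[of 1]
  proof eventually_elim
    case (elim th)
    define n where "n = ?n th"
    have n: "n \<ge> 1" "real n \<le> th" "th \<le> real n + 1" using elim unfolding n_def by linarith+
    have Pp: "P th > 0" "P (real n) > 0" using elim n by (auto intro!: P_pos)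
    have "ln (P th ^ n / (\<Prod>k=1..n. P (real k))) = real n * ln (P th) - ln (\<Prod>k=1..n. P (real k))"
      using ln_divide_pos[of "P th ^ n", OF _ P_prod_pos[of n]] Pp by (simp add: ln_realpow)
    also have "ln (\<Prod>k=1..n. P (real k)) = (\<Sum>k=1..n. ln (P (real k)))"
    proof (rule ln_prod)
      show "P (real i) \<noteq> 0" if "i \<in> {1..n}" for i using P_pos[of "real i"] that by auto
    qed auto
    also have "real n * ln (P th) - \<dots> = Lsum n + real n * (ln (P th) - ln (P (real n)))"
      by (simp add: Lsum_def sum_subtractf algebra_simps)
    finally have eq: "ln (P th ^ n / (\<Prod>k=1..n. P (real k))) = \<dots>" .
    have "ln (P th) - ln (P (real n)) \<ge> 0" using n Pp P_mono[of "real n" th] by simp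
    moreover have "ln (P th) \<le> ln (P (real n + 1))" using Pp elim n by (subst ln_le_cancel_iff) (auto intro!: P_mono P_pos)
    ultimately have "real n * (ln (P th) - ln (P (real n))) \<ge> 0" "real n * (ln (P th) - ln (P (real n))) \<le> ?d n"
      by (auto intro!: mult_left_mono)
    then show ?case unfolding n_def[symmetric] eq using elim n by (simp add: field_simps)
  qed
  show ?thesis
    by (rule tendsto_sandwich[OF eventually_mono[OF ev] eventually_mono[OF ev] lo[simplified mult_1_right] up[simplified mult_1_right mult_zero_right add_0_right]])
      auto
qed

theorem ln_J_tendsto: "((\<lambda>th. ln (J (P th)) / th) \<longlongrightarrow> \<alpha>) at_top"
proof -
  let ?b = "\<lambda>th. P th ^ nat \<lfloor>th\<rfloor> / (\<Prod>k=1..nat \<lfloor>th\<rfloor>. P (real k))"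
  have "((\<lambda>th. ln (2 * th + 5) / th + ln (?b th) / th) \<longlongrightarrow> 0 + \<alpha>) at_top"
    by (intro tendsto_add ln_max_term_tendsto) real_asymp
  then have up: "((\<lambda>th. ln (2 * th + 5) / th + ln (?b th) / th) \<longlongrightarrow> \<alpha>) at_top" by simp
  show ?thesis
  proof (rule tendsto_sandwich[OF _ _ ln_max_term_tendsto up])
    show "eventually (\<lambda>th. ln (?b th) / th \<le> ln (J (P th)) / th) at_top"
      using eventually_ge_at_top[of 1]
    proof eventually_elim
      case (elim th)
      then have "P th > 0" by (intro P_pos) auto
      then have "?b th > 0" "?b th \<le> J (P th)" using P_prod_pos J_ge_term[of "P th"] by auto
      then show ?case using elim by (intro divide_right_mono) auto
    qed
    show "eventually (\<lambda>th. ln (J (P th)) / th \<le> ln (2 * th + 5) / th + ln (?b th) / th) at_top"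
      using eventually_ge_at_top[of 1]
    proof eventually_elim
      case (elim th)
      then have Pp: "P th > 0" by (intro P_pos) auto
      then have b: "?b th > 0" using P_prod_pos by auto
      have J: "J (P th) > 0" using J_ge_1[of "P th"] Pp by linarith
      have "2 * P th \<le> P (2 * th)" using ratio_mono[of th "2 * th"] elim by (simp add: field_simps)
      from J_le_max_term[OF elim refl refl this]
      have "ln (J (P th)) \<le> ln ((2 * th + 5) * ?b th)" using J b elim by (subst ln_le_cancel_iff) auto
      also have "\<dots> = ln (2 * th + 5) + ln (?b th)" using b elim by (intro ln_mult_pos) auto
      finally show ?case using elim by (simp add: divide_right_mono flip: add_divide_distrib)
    qed
  qed
qed

section \<open>Tauberian argument\<close>

lemma P_cont: "continuous_on {0<..} P"
  by (rule convex_on_continuous) (auto intro: convex_on_subset[OF P_convex])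

text \<open>Since \<open>\<alpha> > 1\<close>, doubling the argument eventually multiplies
  \<open>P q / q\<close> by at least a fixed \<open>c > 1\<close>; monotonicity of the ratio covers
  the arguments between successive doublings.\<close>

lemma ratio_at_top: "filterlim (\<lambda>q. P q / q) at_top at_top"
proof -
  \<comment> \<open>Midway between 1 and \<open>2 powr (\<alpha> - 1)\<close>, the limiting growth
    factor of the ratio under doubling.\<close>
  define c where "c = (1 + 2 powr (\<alpha> - 1)) / 2"
  have "(2::real) powr 0 < 2 powr (\<alpha> - 1)" using alpha by (intro powr_less_mono) auto
  then have c: "1 < c" "c < 2 powr (\<alpha> - 1)" by (auto simp: c_def)
  have "2 powr \<alpha> = 2 * (2::real) powr (\<alpha> - 1)" by (simp add: powr_diff)
  then have "eventually (\<lambda>l. P (2 * l) / P l > 2 * c) at_top"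
    using order_tendstoD(1)[OF rv[of 2], of "2 * c"] c by auto
  then obtain l0 where l0: "\<And>l. l \<ge> l0 \<Longrightarrow> P (2 * l) / P l > 2 * c" by (auto simp: eventually_at_top_linorder)
  define m where "m = max l0 1"
  have m: "m \<ge> 1" "m \<ge> l0" by (auto simp: m_def)
  have grow: "P (2 ^ n * m) / (2 ^ n * m) \<ge> c ^ n * (P m / m)" for n
  proof (induction n)
    case (Suc n)
    have "1 * m \<le> 2 ^ n * m" using m by (intro mult_right_mono) auto
    then have l: "2 ^ n * m \<ge> l0" "2 ^ n * m > 0" using m by linarith+
    have "P (2 * (2 ^ n * m)) > 2 * c * P (2 ^ n * m)"
      using l0[OF l(1)] P_pos[OF l(2)] by (simp add: field_simps)
    then have "(2 * c * P (2 ^ n * m)) / (2 * (2 ^ n * m)) \<le> P (2 * (2 ^ n * m)) / (2 * (2 ^ n * m))"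
      using l by (intro divide_right_mono) auto
    then have "P (2 * (2 ^ n * m)) / (2 * (2 ^ n * m)) \<ge> c * (P (2 ^ n * m) / (2 ^ n * m))" by simp
    also have "c * (P (2 ^ n * m) / (2 ^ n * m)) \<ge> c * (c ^ n * (P m / m))"
      using Suc c by (intro mult_left_mono) auto
    finally show ?case by (simp add: mult.assoc)
  qed simp
  have "P m / m > 0" using m P_pos[of m] by auto
  show ?thesis
    unfolding filterlim_at_top
  proof
    fix Z :: real
    obtain n where n: "Z / (P m / m) < c ^ n" using real_arch_pow[OF c(1)] by blast
    then have "Z \<le> c ^ n * (P m / m)" using \<open>P m / m > 0\<close> by (metis less_imp_le pos_divide_less_eq)
    then have Z: "Z \<le> P (2 ^ n * m) / (2 ^ n * m)" using grow[of n] by linarith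
    show "eventually (\<lambda>q. Z \<le> P q / q) at_top"
      using eventually_ge_at_top[of "2 ^ n * m"]
    proof eventually_elim
      case (elim q)
      show ?case using ratio_mono[of "2 ^ n * m" q] elim Z m by force
    qed
  qed
qed

text \<open>Generalised inverse of the ratio \<open>P q / q\<close>. The parameter \<open>c\<close>
  is the value given to the ratio at 0, where the quotient is meaningless; in the application it is
  the right-hand limit.\<close>

definition inv_ratio :: "real \<Rightarrow> real \<Rightarrow> real" where
  "inv_ratio c y = Inf {q. 0 \<le> q \<and> (if q = 0 then c else P q / q) > y}"

lemma inv_ratio_at_top: "filterlim (inv_ratio c) at_top at_top"
  unfolding filterlim_at_top
proof
  fix Z :: real
  define K where "K = max Z 1"
  show "eventually (\<lambda>y. Z \<le> inv_ratio c y) at_top"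
    \<comment> \<open>For such \<open>y\<close> neither 0 nor, by monotonicity of the ratio, any
      \<open>q\<close> below \<open>K\<close> belongs to the set whose infimum is taken.\<close>
    using eventually_ge_at_top[of "max c (P K / K)"]
  proof eventually_elim
    case (elim y)
    have "eventually (\<lambda>q. q > 0 \<and> P q / q > y) at_top"
      using ratio_at_top eventually_gt_at_top[of 0] by (auto simp: filterlim_at_top_dense eventually_conj)
    then obtain q0 where "q0 > 0" "P q0 / q0 > y" by (auto simp: eventually_at_top_linorder)
    then have ne: "{q. 0 \<le> q \<and> (if q = 0 then c else P q / q) > y} \<noteq> {}" by (auto intro!: exI[of _ q0])
    have "K \<le> inv_ratio c y"
      unfolding inv_ratio_def
    proof (rule cInf_greatest[OF ne])
      fix q assume q: "q \<in> {q. 0 \<le> q \<and> (if q = 0 then c else P q / q) > y}"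
      show "K \<le> q"
      proof (rule ccontr)
        assume "\<not> K \<le> q"
        moreover have "0 \<le> q" using q by auto
        ultimately have "q = 0 \<or> P q / q \<le> P K / K" using ratio_mono[of q K] by (cases "q = 0") auto
        then show False using q elim by (auto split: if_splits)
      qed
    qed
    then show ?case by (simp add: K_def)
  qed
qed

text \<open>A convex function is continuous on the open half-line, so a positive infimum solves the
  equation exactly. Hence \<open>t = inv_ratio c (1 / x)\<close> satisfies
  \<open>P t * x = t\<close> without error for small \<open>x\<close>.\<close>

lemma ratio_inv_ratio:
  "eventually (\<lambda>y. inv_ratio c y > 0 \<and> P (inv_ratio c y) / inv_ratio c y = y) at_top"
proof -
  have "eventually (\<lambda>y. inv_ratio c y > 0) at_top"
    using inv_ratio_at_top by (simp add: filterlim_at_top_dense)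
  then show ?thesis
  proof eventually_elim
    case (elim y)
    define S where "S = {q. 0 \<le> q \<and> (if q = 0 then c else P q / q) > y}"
    define t where "t = inv_ratio c y"
    have t: "t = Inf S" "t > 0" using elim by (auto simp: t_def S_def inv_ratio_def)
    have bdd: "bdd_below S" by (auto simp: S_def intro!: bdd_belowI[of _ 0])
    have "eventually (\<lambda>q. P q / q > y) at_top"
      using ratio_at_top by (auto simp: filterlim_at_top_dense)
    then have "eventually (\<lambda>q. q > 0 \<and> P q / q > y) at_top"
      using eventually_gt_at_top[of 0] by eventually_elim auto
    then obtain q0 where "q0 > 0" "P q0 / q0 > y" by (auto simp: eventually_at_top_linorder)
    then have ne: "S \<noteq> {}" by (auto intro!: exI[of _ q0] simp: S_def)
    have ct: "isCont (\<lambda>q. P q / q) t"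
      using t(2) continuous_on_eq_continuous_at[of "{0<..}" P] P_cont by (intro continuous_intros) auto
    have "P t / t = y"
    proof (rule antisym)
      show "P t / t \<le> y"
      proof (rule ccontr)
        assume "\<not> P t / t \<le> y"
        then have "eventually (\<lambda>q. P q / q > y) (at t)"
          using ct by (auto simp: isCont_def order_tendsto_iff)
        then obtain d where d: "d > 0" "\<And>q. q \<noteq> t \<Longrightarrow> dist q t < d \<Longrightarrow> P q / q > y"
          by (auto simp: eventually_at)
        define q where "q = max (t - d / 2) (t / 2)"
        have q: "q < t" "q > 0" "dist q t < d" using d(1) t(2) by (auto simp: q_def dist_real_def max_def)
        then have "P q / q > y" using d(2)[of q] by auto
        with q have "q < t" "q > 0" "P q / q > y" by auto
        then have "q \<in> S" by (auto simp: S_def)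
        then have "t \<le> q" unfolding t(1) using bdd by (rule cInf_lower)
        with \<open>q < t\<close> show False by simp
      qed
      show "y \<le> P t / t"
      proof (rule ccontr)
        assume "\<not> y \<le> P t / t"
        then have "eventually (\<lambda>q. P q / q < y) (at t)"
          using ct by (auto simp: isCont_def order_tendsto_iff)
        then obtain d where d: "d > 0" "\<And>q. q \<noteq> t \<Longrightarrow> dist q t < d \<Longrightarrow> P q / q < y"
          by (auto simp: eventually_at)
        obtain q where q: "q \<in> S" "q < t + d"
          using cInf_lessD[OF ne, of "t + d"] d t(1) by auto
        moreover have "q \<ge> t" unfolding t(1) using q bdd by (intro cInf_lower)
        ultimately have "P q / q < y" using d \<open>\<not> y \<le> P t / t\<close> by (cases "q = t") (auto simp: dist_real_def)
        then show False using q \<open>t \<le> q\<close> t(2) by (auto simp: S_def split: if_splits)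
      qed
    qed
    then show ?case using elim by (simp add: t_def)
  qed
qed

text \<open>Scaling the argument of \<open>J\<close> by \<open>s\<close> is compared with scaling
  \<open>t\<close> by \<open>c\<close>: regular variation gives
  \<open>P (c * t) \<le> s * P t\<close> eventually, \<open>J\<close> is monotone, and
  \<open>ln (J (P (c * t)))\<close> is asymptotic to \<open>\<alpha> * c * t\<close>.\<close>

lemma ln_J_scaled_lower:
  assumes c: "0 < c" "c powr \<alpha> < s" and b: "\<beta> < \<alpha> * c"
  shows "eventually (\<lambda>t. \<beta> * t \<le> ln (J (s * P t))) at_top"
proof -
  have ct: "filterlim (\<lambda>t. c * t) at_top at_top" using c by real_asymp
  have "((\<lambda>t. c * (ln (J (P (c * t))) / (c * t))) \<longlongrightarrow> c * \<alpha>) at_top"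
    by (intro tendsto_mult tendsto_const filterlim_compose[OF ln_J_tendsto ct])
  then have "eventually (\<lambda>t. c * (ln (J (P (c * t))) / (c * t)) > \<beta>) at_top"
    using b by (intro order_tendstoD(1)) (auto simp: mult.commute)
  moreover have "eventually (\<lambda>t. P (c * t) / P t < s) at_top"
    using rv[OF c(1)] c(2) by (intro order_tendstoD(2))
  ultimately show ?thesis using eventually_gt_at_top[of 0]
  proof eventually_elim
    case (elim t)
    have p: "P t > 0" "P (c * t) > 0" using elim c by (auto intro!: P_pos)
    then have "P (c * t) \<le> s * P t" using elim by (simp add: field_simps)
    then have "J (P (c * t)) \<le> J (s * P t)" using p by (intro J_mono) auto
    moreover have "1 \<le> J (P (c * t))" using p by (intro J_ge_1) auto
    ultimately have "ln (J (P (c * t))) \<le> ln (J (s * P t))" by (subst ln_le_cancel_iff) auto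
    moreover have "\<beta> * t \<le> ln (J (P (c * t)))" using elim c by (simp add: field_simps)
    ultimately show ?case by linarith
  qed
qed

text \<open>Both sides equal 1 at \<open>d = 0\<close>, with derivatives \<open>m\<close> and 1
  there. It supplies the constant \<open>c\<close> with \<open>c powr \<alpha> < 1 + d\<close> which
  a small exponential tilt requires.\<close>

lemma powr_slope_lt:
  assumes "m < 1"
  shows "eventually (\<lambda>d. (1 + d * m / \<alpha>) powr \<alpha> < 1 + d) (at_right 0)"
proof -
  define f where "f = (\<lambda>d. (1 + d * m / \<alpha>) powr \<alpha> - (1 + d))"
  have "(f has_real_derivative m - 1) (at 0)"
    unfolding f_def using alpha by (auto intro!: derivative_eq_intros)
  from DERIV_neg_dec_right[OF this] assms obtain e where "e > 0" "\<And>h. 0 < h \<Longrightarrow> h < e \<Longrightarrow> f (0 + h) < f 0" by auto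
  then show ?thesis
    unfolding eventually_at_right_field by (intro exI[of _ e]) (auto simp: f_def)
qed

lemma powr_slope_lt':
  assumes "1 < m"
  shows "eventually (\<lambda>d. (1 - d * m / \<alpha>) powr \<alpha> < 1 - d) (at_right 0)"
proof -
  define f where "f = (\<lambda>d. (1 - d * m / \<alpha>) powr \<alpha> - (1 - d))"
  have "(f has_real_derivative 1 - m) (at 0)"
    unfolding f_def using alpha by (auto intro!: derivative_eq_intros)
  from DERIV_neg_dec_right[OF this] assms obtain e where "e > 0" "\<And>h. 0 < h \<Longrightarrow> h < e \<Longrightarrow> f (0 + h) < f 0" by auto
  then show ?thesis
    unfolding eventually_at_right_field by (intro exI[of _ e]) (auto simp: f_def)
qed

lemma ln_J_upper: "\<gamma> > 0 \<Longrightarrow> eventually (\<lambda>t. ln (J (P t)) \<le> (\<alpha> + \<gamma>) * t) at_top"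
proof -
  assume "\<gamma> > 0"
  then have "eventually (\<lambda>t. ln (J (P t)) / t < \<alpha> + \<gamma>) at_top"
    using order_tendstoD(2)[OF ln_J_tendsto, of "\<alpha> + \<gamma>"] by auto
  then show ?thesis using eventually_gt_at_top[of 0]
    by eventually_elim (simp add: field_simps)
qed

text \<open>Bounds a tail after exponential tilting: \<open>m * t\<close> is the exponent
  contributed by the end of the tail, \<open>s\<close> the factor by which the Laplace variable is
  tilted, and the tail keeps at most a quarter of the whole mass \<open>1 / J (P t)\<close>.\<close>

lemma tail_small:
  assumes c: "0 < c" "c powr \<alpha> < s" and m: "m + \<alpha> < \<alpha> * c"
  shows "eventually (\<lambda>t. exp (m * t) / J (s * P t) \<le> (1 / 4) * (1 / J (P t))) at_top"
proof -
  \<comment> \<open>A quarter of the available gap: one share pays for the lower bound at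
    \<open>s * P t\<close>, one for the upper bound at \<open>P t\<close>, and two for the factor
    4.\<close>
  define \<gamma> where "\<gamma> = (\<alpha> * c - \<alpha> - m) / 4"
  have g: "\<gamma> > 0" using m by (simp add: \<gamma>_def)
  have s: "s > 0" using c powr_gt_zero[of c \<alpha>] by linarith
  have "eventually (\<lambda>t. (\<alpha> * c - \<gamma>) * t \<le> ln (J (s * P t))) at_top"
    using g by (intro ln_J_scaled_lower[OF c]) auto
  moreover have "eventually (\<lambda>t. 2 * \<gamma> * t \<ge> ln 4) at_top" using g by real_asymp
  ultimately show ?thesis using ln_J_upper[OF g] eventually_gt_at_top[of 0]
  proof eventually_elim
    case (elim t)
    have "P t > 0" using elim by (auto intro!: P_pos)
    then have J: "J (P t) \<ge> 1" "J (s * P t) \<ge> 1" using s by (auto intro!: J_ge_1)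
    have "m * t + ln (J (P t)) + ln 4 \<le> m * t + (\<alpha> + \<gamma>) * t + 2 * \<gamma> * t" using elim by simp
    also have "\<dots> = (\<alpha> * c - \<gamma>) * t" by (simp add: \<gamma>_def algebra_simps add_divide_distrib diff_divide_distrib)
    finally have "m * t + ln (J (P t)) + ln 4 \<le> ln (J (s * P t))" using elim by linarith
    then have "exp (m * t + ln (J (P t)) + ln 4) \<le> J (s * P t)" using J by (subst ln_ge_iff[symmetric]) auto
    then have "exp (m * t) * J (P t) * 4 \<le> J (s * P t)" using J by (simp add: exp_add)
    then show ?case using J by (simp add: field_simps)
  qed
qed

text \<open>For a law with transform \<open>L\<close>, reweighting by \<open>exp (- l * y)\<close>
  with \<open>l = P t\<close> concentrates it near \<open>x = t / P t\<close>. Tilting shows that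
  the parts below \<open>(1 - \<epsilon>) * x\<close> and above \<open>(1 + \<epsilon>) * x\<close>
  are each at most a quarter of \<open>L l\<close>. At least half remains between, where the weight
  is at most \<open>exp (- ((1 - \<epsilon>) * t))\<close>.\<close>

lemma middle_mass_lower:
  fixes F L :: "real \<Rightarrow> real"
  assumes L: "\<And>l. 0 < l \<Longrightarrow> L l = 1 / J l"
    and lo: "\<And>a b l d. 0 < a \<Longrightarrow> a < b \<Longrightarrow> 0 < l \<Longrightarrow> 0 < d \<Longrightarrow> d < 1 \<Longrightarrow>
      L l \<le> exp (- l * a) * F b + exp (d * l * a) * L ((1 + d) * l) + exp (- d * l * b) * L ((1 - d) * l)"
    and e: "0 < \<epsilon>" "\<epsilon> < 1"
  shows "eventually (\<lambda>t. exp ((1 - \<epsilon>) * t) / (2 * J (P t)) \<le> F ((1 + \<epsilon>) * (t / P t))) at_top"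
proof -
  \<comment> \<open>The slope \<open>1 - \<epsilon> / 2\<close> lies strictly between
    \<open>1 - \<epsilon>\<close>, the cost of the tilt, and 1, at which the two sides would agree
    to first order. On the other side \<open>1 + \<epsilon> / 2\<close> plays the same role.\<close>
  have "eventually (\<lambda>d. (1 + d * (1 - \<epsilon> / 2) / \<alpha>) powr \<alpha> < 1 + d) (at_right 0)"
    using e by (intro powr_slope_lt) auto
  moreover have "eventually (\<lambda>d. (1 - d * (1 + \<epsilon> / 2) / \<alpha>) powr \<alpha> < 1 - d) (at_right 0)"
    using e by (intro powr_slope_lt') auto
  \<comment> \<open>Below 1/4 the base \<open>1 - d * (1 + \<epsilon> / 2) / \<alpha>\<close> stays
    positive.\<close>
  moreover have "eventually (\<lambda>d. 0 < d \<and> d < 1 / 4) (at_right (0::real))"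
    by (auto simp: eventually_at_right_field intro!: exI[of _ "1/4"])
  ultimately have "eventually (\<lambda>d. (1 + d * (1 - \<epsilon> / 2) / \<alpha>) powr \<alpha> < 1 + d \<and>
     (1 - d * (1 + \<epsilon> / 2) / \<alpha>) powr \<alpha> < 1 - d \<and> 0 < d \<and> d < 1 / 4) (at_right 0)"
    by eventually_elim auto
  then obtain d where d: "(1 + d * (1 - \<epsilon> / 2) / \<alpha>) powr \<alpha> < 1 + d"
    "(1 - d * (1 + \<epsilon> / 2) / \<alpha>) powr \<alpha> < 1 - d" "0 < d" "d < 1 / 4"
    using eventually_happens'[of "at_right (0::real)"] by (auto simp: trivial_limit_at_right_real)
  have "d * (1 + \<epsilon> / 2) < 1 / 4 * 2" using d e by (intro mult_strict_mono) auto
  then have c2: "0 < 1 - d * (1 + \<epsilon> / 2) / \<alpha>" using alpha by (simp add: field_simps)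
  have "eventually (\<lambda>t. exp ((d * (1 - \<epsilon>)) * t) / J ((1 + d) * P t) \<le> (1 / 4) * (1 / J (P t))) at_top"
  proof (rule tail_small[OF _ d(1)])
    show "0 < 1 + d * (1 - \<epsilon> / 2) / \<alpha>" using d e alpha by (intro add_pos_nonneg) auto
    show "d * (1 - \<epsilon>) + \<alpha> < \<alpha> * (1 + d * (1 - \<epsilon> / 2) / \<alpha>)"
    proof -
      have "\<alpha> * (d * (1 - \<epsilon> / 2) / \<alpha>) = d * (1 - \<epsilon> / 2)" using alpha by simp
      moreover have "d * \<epsilon> > 0" using d e by simp
      ultimately show ?thesis by (simp add: algebra_simps)
    qed
  qed
  moreover have "eventually (\<lambda>t. exp ((- d * (1 + \<epsilon>)) * t) / J ((1 - d) * P t) \<le> (1 / 4) * (1 / J (P t))) at_top"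
  proof (rule tail_small[OF c2 d(2)])
    have "\<alpha> * (d * (1 + \<epsilon> / 2) / \<alpha>) = d * (1 + \<epsilon> / 2)" using alpha by simp
    moreover have "d * \<epsilon> > 0" using d e by simp
    ultimately show "- d * (1 + \<epsilon>) + \<alpha> < \<alpha> * (1 - d * (1 + \<epsilon> / 2) / \<alpha>)" by (simp add: algebra_simps)
  qed
  ultimately show ?thesis using eventually_gt_at_top[of 0]
  proof eventually_elim
    case (elim t)
    define l where "l = P t"
    have l: "l > 0" unfolding l_def using elim by (auto intro!: P_pos)
    have J: "J l \<ge> 1" using l by (intro J_ge_1) auto
    define x where "x = t / l"
    have x: "x > 0" "l * x = t" using l elim by (auto simp: x_def)
    have eqs: "- l * ((1 - \<epsilon>) * x) = - ((1 - \<epsilon>) * t)" "d * l * ((1 - \<epsilon>) * x) = d * (1 - \<epsilon>) * t"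
      "- d * l * ((1 + \<epsilon>) * x) = - d * (1 + \<epsilon>) * t"
      unfolding x(2)[symmetric] by (simp_all add: algebra_simps)
    have "L l \<le> exp (- l * ((1 - \<epsilon>) * x)) * F ((1 + \<epsilon>) * x) + exp (d * l * ((1 - \<epsilon>) * x)) * L ((1 + d) * l)
        + exp (- d * l * ((1 + \<epsilon>) * x)) * L ((1 - d) * l)"
      using x e l d by (intro lo mult_strict_right_mono) auto
    then have "1 / J l \<le> exp (- ((1 - \<epsilon>) * t)) * F ((1 + \<epsilon>) * x) + exp (d * (1 - \<epsilon>) * t) / J ((1 + d) * l)
        + exp (- d * (1 + \<epsilon>) * t) / J ((1 - d) * l)"
      unfolding eqs using l d by (simp add: L)
    then have "1 / J l \<le> exp (- ((1 - \<epsilon>) * t)) * F ((1 + \<epsilon>) * x) + (1 / 4) * (1 / J l) + (1 / 4) * (1 / J l)"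
      using elim unfolding l_def[symmetric] by linarith
    then have "1 / (2 * J l) \<le> exp (- ((1 - \<epsilon>) * t)) * F ((1 + \<epsilon>) * x)" by simp
    then have "exp ((1 - \<epsilon>) * t) * (1 / (2 * J l)) \<le> exp ((1 - \<epsilon>) * t) * (exp (- ((1 - \<epsilon>) * t)) * F ((1 + \<epsilon>) * x))"
      by (intro mult_left_mono) auto
    also have "\<dots> = F ((1 + \<epsilon>) * x)" by (simp add: exp_minus)
    finally show ?case by (simp add: x_def l_def)
  qed
qed

text \<open>The upper bound is Chernoff's inequality at \<open>l = P t\<close>, where
  \<open>P t * x = t\<close>. The lower bound from \<open>middle_mass_lower\<close> concerns the
  point \<open>(1 + \<epsilon>) * (t / P t)\<close> instead of \<open>t / P t\<close>; it is
  therefore applied at the larger index \<open>(1 + d) * t\<close>, since \<open>t / P t\<close>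
  shrinks there by about \<open>(1 + d) powr (1 - \<alpha>)\<close>, enough to absorb
  \<open>1 + \<epsilon>\<close>.\<close>

theorem tauberian:
  fixes F L :: "real \<Rightarrow> real"
  assumes L: "\<And>l. 0 < l \<Longrightarrow> L l = 1 / J l"
    and up: "\<And>x l. 0 < x \<Longrightarrow> 0 < l \<Longrightarrow> F x \<le> exp (l * x) * L l"
    and lo: "\<And>a b l d. 0 < a \<Longrightarrow> a < b \<Longrightarrow> 0 < l \<Longrightarrow> 0 < d \<Longrightarrow> d < 1 \<Longrightarrow>
      L l \<le> exp (- l * a) * F b + exp (d * l * a) * L ((1 + d) * l) + exp (- d * l * b) * L ((1 - d) * l)"
    and F: "mono F"
  shows "(\<lambda>x. ln (F x)) \<sim>[at_right 0] (\<lambda>x. - (\<alpha> - 1) * inv_ratio c (1 / x))"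
proof -
  define th where "th = (\<lambda>x. inv_ratio c (1 / x))"
  have inv: "filterlim (\<lambda>x::real. 1 / x) at_top (at_right 0)" by real_asymp
  have th: "filterlim th at_top (at_right 0)" unfolding th_def by (rule filterlim_compose[OF inv_ratio_at_top inv])
  have thx: "eventually (\<lambda>x. th x > 0 \<and> x > 0 \<and> th x / P (th x) = x) (at_right 0)"
    using eventually_compose_filterlim[OF ratio_inv_ratio[of c] inv] eventually_at_right_less[of 0]
  proof eventually_elim
    case (elim x)
    then have "inverse (P (th x) / th x) = inverse (1 / x)" using elim unfolding th_def by metis
    then show ?case using elim unfolding inverse_divide by (simp add: th_def)
  qed
  have lower: "eventually (\<lambda>x. F x > 0 \<and> ln (F x) / th x > 1 - \<alpha> - e) (at_right 0)" if e: "e > 0" for e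
  proof -
    have "((\<lambda>d. (1 + d) * (1 - ((1 + d) powr (\<alpha> - 1) - 1) / 2 - \<alpha>)) \<longlongrightarrow> (1 + 0) * (1 - ((1 + 0) powr (\<alpha> - 1) - 1) / 2 - \<alpha>)) (at_right 0)"
      by (intro tendsto_intros) auto
    then have "eventually (\<lambda>d. (1 + d) * (1 - ((1 + d) powr (\<alpha> - 1) - 1) / 2 - \<alpha>) > 1 - \<alpha> - e) (at_right 0)"
      using e by (intro order_tendstoD(1)) auto
    moreover have "((\<lambda>d. ((1 + d) powr (\<alpha> - 1) - 1) / 2) \<longlongrightarrow> ((1 + 0) powr (\<alpha> - 1) - 1) / 2) (at_right (0::real))"
      by (intro tendsto_intros) auto
    then have "eventually (\<lambda>d. ((1 + d) powr (\<alpha> - 1) - 1) / 2 < 1) (at_right 0)"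
      by (intro order_tendstoD(2)) auto
    ultimately have "eventually (\<lambda>d. (1 + d) * (1 - ((1 + d) powr (\<alpha> - 1) - 1) / 2 - \<alpha>) > 1 - \<alpha> - e \<and>
       ((1 + d) powr (\<alpha> - 1) - 1) / 2 < 1 \<and> d > 0) (at_right 0)"
      using eventually_at_right_less[of 0] by eventually_elim auto
    then obtain d where d: "(1 + d) * (1 - ((1 + d) powr (\<alpha> - 1) - 1) / 2 - \<alpha>) > 1 - \<alpha> - e"
       "((1 + d) powr (\<alpha> - 1) - 1) / 2 < 1" "d > 0"
      using eventually_happens'[of "at_right (0::real)"] by (auto simp: trivial_limit_at_right_real)
    \<comment> \<open>Half of the excess of \<open>(1 + d) powr (\<alpha> - 1)\<close> over 1, so
      that \<open>1 + \<epsilon>\<close> stays strictly below that factor. It tends to 0 with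
      \<open>d\<close>, which brings the exponent
      \<open>(1 + d) * (1 - \<epsilon> - \<alpha>)\<close> back to
      \<open>1 - \<alpha>\<close>.\<close>
    define \<epsilon> where "\<epsilon> = ((1 + d) powr (\<alpha> - 1) - 1) / 2"
    have "(1 + d) powr 0 < (1 + d) powr (\<alpha> - 1)" using d alpha by (intro powr_less_mono) auto
    then have eps: "0 < \<epsilon>" "\<epsilon> < 1" using d by (auto simp: \<epsilon>_def)
    have "(1 + \<epsilon>) < (1 + d) powr (\<alpha> - 1)" using eps by (simp add: \<epsilon>_def field_simps)
    then have "(1 + \<epsilon>) * (1 + d) < (1 + d) powr (\<alpha> - 1) * (1 + d)" using d by (intro mult_strict_right_mono) auto
    also have "\<dots> = (1 + d) powr \<alpha>" using d powr_add[of "1 + d" "\<alpha> - 1" 1] by simp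
    finally have "eventually (\<lambda>t. P ((1 + d) * t) / P t > (1 + \<epsilon>) * (1 + d)) at_top"
      using rv[of "1 + d"] d by (intro order_tendstoD(1)) auto
    moreover have d1: "filterlim (\<lambda>t. (1 + d) * t) at_top at_top" using d(3) by real_asymp
    have "eventually (\<lambda>t. exp ((1 - \<epsilon>) * t) / (2 * J (P t)) \<le> F ((1 + \<epsilon>) * (t / P t))) at_top"
      using L lo eps by (rule middle_mass_lower)
    note eventually_compose_filterlim[OF this d1]
    moreover have "((\<lambda>t. (1 + d) * (1 - \<epsilon>) - ln 2 / t - (1 + d) * (ln (J (P ((1 + d) * t))) / ((1 + d) * t))) \<longlongrightarrow>
        (1 + d) * (1 - \<epsilon>) - 0 - (1 + d) * \<alpha>) at_top"
      by (intro tendsto_intros filterlim_compose[OF ln_J_tendsto d1]) real_asymp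
    then have "eventually (\<lambda>t. (1 + d) * (1 - \<epsilon>) - ln 2 / t - (1 + d) * (ln (J (P ((1 + d) * t))) / ((1 + d) * t)) > 1 - \<alpha> - e) at_top"
      using d(1) by (intro order_tendstoD(1)) (auto simp: \<epsilon>_def[symmetric] algebra_simps)
    ultimately have "eventually (\<lambda>t. F (t / P t) > 0 \<and> ln (F (t / P t)) / t > 1 - \<alpha> - e) at_top"
      using eventually_gt_at_top[of 0]
    proof eventually_elim
      case (elim t)
      define s where "s = (1 + d) * t"
      have s: "s > 0" using elim d by (simp add: s_def)
      have p: "P t > 0" "P s > 0" using elim s by (auto intro!: P_pos)
      have J: "J (P s) \<ge> 1" using p by (intro J_ge_1) auto
      have "(1 + \<epsilon>) * (1 + d) * P t < P s" using elim(1) p by (simp add: s_def field_simps)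
      then have "t * ((1 + \<epsilon>) * (1 + d) * P t) \<le> t * P s" using elim by (intro mult_left_mono) auto
      then have "(1 + \<epsilon>) * (s / P s) \<le> t / P t"
        using p by (simp add: s_def field_simps)
      then have "F ((1 + \<epsilon>) * (s / P s)) \<le> F (t / P t)" using F by (rule monoD[rotated])
      moreover have pos1: "exp ((1 - \<epsilon>) * s) / (2 * J (P s)) > 0" using J by auto
      ultimately have Fp: "exp ((1 - \<epsilon>) * s) / (2 * J (P s)) \<le> F (t / P t)" "F (t / P t) > 0"
        using elim(2) unfolding s_def[symmetric] by linarith+
      then have "ln (F (t / P t)) \<ge> ln (exp ((1 - \<epsilon>) * s) / (2 * J (P s)))"
        using pos1 by (subst ln_le_cancel_iff) auto
      also have "ln (exp ((1 - \<epsilon>) * s) / (2 * J (P s))) = (1 - \<epsilon>) * s - ln (2 * J (P s))"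
        using J by (subst ln_divide_pos) auto
      also have "ln (2 * J (P s)) = ln 2 + ln (J (P s))" using J by (intro ln_mult_pos) auto
      finally have "ln (F (t / P t)) / t \<ge> ((1 - \<epsilon>) * s - (ln 2 + ln (J (P s)))) / t"
        using elim by (intro divide_right_mono) auto
      also have "((1 - \<epsilon>) * s - (ln 2 + ln (J (P s)))) / t
          = (1 + d) * (1 - \<epsilon>) - ln 2 / t - (1 + d) * (ln (J (P s)) / s)"
        using elim d(3) by (simp add: s_def diff_divide_distrib add_divide_distrib)
      finally show ?case using Fp elim(3) unfolding s_def[symmetric] by linarith
    qed
    from eventually_compose_filterlim[OF this th] thx show ?thesis
      by eventually_elim auto
  qed
  have upper: "eventually (\<lambda>x. ln (F x) / th x < 1 - \<alpha> + e) (at_right 0)" if e: "e > 0" for e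
  proof -
    have "eventually (\<lambda>t. ln (J (P t)) / t > \<alpha> - e) at_top"
      using e by (intro order_tendstoD(1)[OF ln_J_tendsto]) auto
    \<comment> \<open>The lower bound supplies \<open>F x > 0\<close>, which monotonicity of
      \<open>ln\<close> requires.\<close>
    from eventually_compose_filterlim[OF this th] thx lower[OF e] show ?thesis
    proof eventually_elim
      case (elim x)
      define t where "t = th x"
      have t: "t > 0" "x = t / P t" "x > 0" using elim by (auto simp: t_def)
      have p: "P t > 0" using t by (intro P_pos) auto
      have J: "J (P t) \<ge> 1" using p by (intro J_ge_1) auto
      have "F x \<le> exp (P t * x) * L (P t)" using t p by (intro up) auto
      also have "\<dots> = exp t / J (P t)" using p t by (simp add: L)
      finally have "ln (F x) \<le> ln (exp t / J (P t))" using elim J by (subst ln_le_cancel_iff) auto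
      also have "\<dots> = t - ln (J (P t))" using J by (subst ln_divide_pos) auto
      finally have "ln (F x) / t \<le> (t - ln (J (P t))) / t" using t by (intro divide_right_mono) auto
      also have "\<dots> = 1 - ln (J (P t)) / t" using t(1) by (simp add: diff_divide_distrib)
      finally show ?case using elim by (simp add: t_def)
    qed
  qed
  have "((\<lambda>x. ln (F x) / th x) \<longlongrightarrow> 1 - \<alpha>) (at_right 0)"
  proof (rule tendstoI)
    fix e :: real assume "e > 0"
    from upper[OF this] lower[OF this] show "eventually (\<lambda>x. dist (ln (F x) / th x) (1 - \<alpha>) < e) (at_right 0)"
      by eventually_elim (auto simp: dist_real_def abs_less_iff)
  qed
  then have "((\<lambda>x. (ln (F x) / th x) / (1 - \<alpha>)) \<longlongrightarrow> (1 - \<alpha>) / (1 - \<alpha>)) (at_right 0)"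
    using alpha by (intro tendsto_divide) auto
  then have "((\<lambda>x. ln (F x) / (- (\<alpha> - 1) * inv_ratio c (1 / x))) \<longlongrightarrow> 1) (at_right 0)"
    using alpha by (simp add: th_def mult.commute)
  then show ?thesis by (rule asymp_equivI')
qed

end

section \<open>Uniqueness of Laplace transforms\<close>

text \<open>On a bounded support the exponential series of the characteristic function can be
  integrated term by term, so the moments determine it.\<close>

lemma real_distribution_moments_unique:
  assumes "real_distribution M1" "real_distribution M2"
    and b1: "AE x in M1. \<bar>x\<bar> \<le> 1" and b2: "AE x in M2. \<bar>x\<bar> \<le> 1"
    and eq: "\<And>n::nat. (LINT x|M1. x ^ n) = (LINT x|M2. x ^ n)"
  shows "M1 = M2"
proof (rule Levy_uniqueness[OF assms(1,2)])
  have series: "char M t = (\<Sum>n. ((\<i> * of_real t) ^ n /\<^sub>R fact n) * of_real (LINT x|M. x ^ n))"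
    if M: "real_distribution M" and b: "AE x in M. \<bar>x\<bar> \<le> 1" for M and t :: real
  proof -
    interpret real_distribution M by fact
    let ?f = "\<lambda>n x. (\<i> * of_real t) ^ n /\<^sub>R fact n * of_real (x ^ n)"
    have int: "integrable M (\<lambda>x. x ^ n)" for n :: nat
      by (rule integrable_const_bound[where B=1])
         (use b in \<open>auto elim!: eventually_mono simp: power_abs power_le_one\<close>)
    then have int': "integrable M (?f n)" for n by (intro integrable_mult_right integrable_of_real)
    have "char M t = (LINT x|M. (\<Sum>n. ?f n x))"
      unfolding char_def
    proof (rule Bochner_Integration.integral_cong[OF refl])
      fix x
      have "iexp (t * x) = (\<Sum>n. (\<i> * of_real (t * x)) ^ n /\<^sub>R fact n)" by (simp add: exp_def)
      also have "\<dots> = (\<Sum>n. ?f n x)"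
        by (simp add: power_mult_distrib mult_ac)
      finally show "iexp (t * x) = (\<Sum>n. ?f n x)" .
    qed
    also have "\<dots> = (\<Sum>n. LINT x|M. ?f n x)"
    proof (rule integral_suminf[OF int'])
      show "AE x in M. summable (\<lambda>n. norm (?f n x))"
      proof (intro AE_I2)
        fix x
        have "summable (\<lambda>n. norm ((\<i> * of_real (t * x)) ^ n /\<^sub>R fact n))" by (rule summable_norm_exp)
        then show "summable (\<lambda>n. norm (?f n x))"
          by (simp add: power_mult_distrib norm_mult norm_power abs_mult mult_ac)
      qed
      have b': "AE x in M. norm (?f n x) \<le> \<bar>t\<bar> ^ n /\<^sub>R fact n" for n
        using b
      proof eventually_elim
        case (elim x)
        have "\<bar>x\<bar> ^ n \<le> 1" using elim by (intro power_le_one) auto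
        then show ?case
          by (simp add: norm_mult norm_power power_abs divide_simps mult_left_le)
      qed
      have "(LINT x|M. norm (?f n x)) \<le> (LINT x|M. \<bar>t\<bar> ^ n /\<^sub>R fact n)" for n
        by (intro integral_mono_AE integrable_norm int' b') auto
      then have "norm (LINT x|M. norm (?f n x)) \<le> \<bar>t\<bar> ^ n /\<^sub>R fact n" for n
        using prob_space by simp
      then show "summable (\<lambda>n. LINT x|M. norm (?f n x))"
        by (intro summable_comparison_test'[OF summable_exp_generic[of "\<bar>t\<bar>"]])
    qed
    also have "\<dots> = (\<Sum>n. ((\<i> * of_real t) ^ n /\<^sub>R fact n) * of_real (LINT x|M. x ^ n))"
      by (simp only: integral_mult_right_zero integral_complex_of_real)
    finally show ?thesis .
  qed
  show "char M1 = char M2"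
    using series[OF assms(1) b1] series[OF assms(2) b2] eq by (intro ext) simp
qed

text \<open>After weighting by \<open>exp (- q1 * x)\<close> and normalising, the functions are
  probability densities. The image of such a law under \<open>exp (- x)\<close> lives in the unit
  interval, and its moments are the transforms at \<open>q1 + n\<close>, so the moment theorem
  applies; \<open>- ln\<close> undoes the change of variable.\<close>

lemma laplace_transform_unique:
  fixes f g :: "real \<Rightarrow> ennreal"
  assumes [measurable]: "f \<in> borel_measurable borel" "g \<in> borel_measurable borel"
    and fin: "\<And>q. q > q0 \<Longrightarrow> (\<integral>\<^sup>+x\<in>{0..}. ennreal (exp (- q * x)) * f x \<partial>lborel) < \<infinity>"
    and eq: "\<And>q. q > q0 \<Longrightarrow> (\<integral>\<^sup>+x\<in>{0..}. ennreal (exp (- q * x)) * f x \<partial>lborel) =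
        (\<integral>\<^sup>+x\<in>{0..}. ennreal (exp (- q * x)) * g x \<partial>lborel)"
  shows "AE x in lborel. 0 \<le> x \<longrightarrow> f x = g x"
proof -
  define q1 where "q1 = q0 + 1"
  define w where "w = (\<lambda>h x. ennreal (exp (- q1 * x)) * h x * indicator {0..} x :: ennreal)"
  have [measurable]: "w f \<in> borel_measurable borel" "w g \<in> borel_measurable borel"
    by (auto simp: w_def)
  define C where "C = (\<integral>\<^sup>+x. w f x \<partial>lborel)"
  have Cfin: "C < \<infinity>" using fin[of q1] by (simp add: C_def w_def q1_def)
  have Cg: "C = (\<integral>\<^sup>+x. w g x \<partial>lborel)" using eq[of q1] by (simp add: C_def w_def q1_def)
  have wfg: "AE x in lborel. w f x = w g x"
  proof (cases "C = 0")
    case True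
    then have "(\<integral>\<^sup>+x. w f x \<partial>lborel) = 0" "(\<integral>\<^sup>+x. w g x \<partial>lborel) = 0"
      using C_def Cg by simp_all
    then have "AE x in lborel. w f x = 0" "AE x in lborel. w g x = 0"
      using nn_integral_0_iff_AE[of "w f" lborel] nn_integral_0_iff_AE[of "w g" lborel] by simp_all
    then show ?thesis by eventually_elim simp
  next
    case False
    define D where "D = (\<lambda>h. density lborel (\<lambda>x. w h x / C))"
    define E where "E = (\<lambda>h. distr (D h) borel (\<lambda>x. exp (- x)))"
    have main: "prob_space (D h) \<and> (AE x in D h. x \<ge> 0) \<and> real_distribution (E h) \<and> (AE x in E h. \<bar>x\<bar> \<le> 1) \<and>
       (\<forall>n. (LINT x|E h. x ^ n) = enn2real ((\<integral>\<^sup>+x\<in>{0..}. ennreal (exp (- (q1 + real n) * x)) * h x \<partial>lborel) / C)) \<and>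
       D h = distr (E h) borel (\<lambda>y. - ln y)"
      if h[measurable]: "h \<in> borel_measurable borel" and hC: "C = (\<integral>\<^sup>+x. w h x \<partial>lborel)" for h
    proof -
      have wm[measurable]: "w h \<in> borel_measurable borel" by (auto simp: w_def)
      have "emeasure (D h) (space (D h)) = (\<integral>\<^sup>+x. w h x / C \<partial>lborel)" by (simp add: D_def emeasure_density)
      also have "\<dots> = C / C" unfolding hC by (subst nn_integral_divide) auto
      also have "\<dots> = 1" using False Cfin by (simp add: ennreal_divide_self)
      finally have p: "prob_space (D h)" by (rule prob_spaceI)
      have ae: "AE x in D h. x \<ge> 0"
        unfolding D_def by (subst AE_density) (auto simp: w_def indicator_def)
      have "prob_space (E h)" unfolding E_def
        by (rule prob_space.prob_space_distr[OF p]) (simp add: D_def)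
      then have rd: "real_distribution (E h)"
        by (auto simp: real_distribution_def real_distribution_axioms_def E_def)
      have ae1: "AE x in E h. \<bar>x\<bar> \<le> 1"
        unfolding E_def by (subst AE_distr_iff) (use ae in \<open>auto simp: D_def elim!: eventually_mono\<close>)
      have mom: "(LINT x|E h. x ^ n) = enn2real ((\<integral>\<^sup>+x\<in>{0..}. ennreal (exp (- (q1 + real n) * x)) * h x \<partial>lborel) / C)" for n
      proof -
        have "(LINT x|E h. x ^ n) = (LINT x|D h. exp (- x) ^ n)"
          unfolding E_def by (subst integral_distr) (auto simp: D_def)
        also have "\<dots> = enn2real (\<integral>\<^sup>+x. ennreal (exp (- x) ^ n) \<partial>D h)"
          by (intro integral_eq_nn_integral) (auto simp: D_def)
        also have "(\<integral>\<^sup>+x. ennreal (exp (- x) ^ n) \<partial>D h) = (\<integral>\<^sup>+x. (w h x / C) * ennreal (exp (- x) ^ n) \<partial>lborel)"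
          unfolding D_def by (subst nn_integral_density) auto
        also have "\<dots> = (\<integral>\<^sup>+x. (ennreal (exp (- (q1 + real n) * x)) * h x * indicator {0..} x) / C \<partial>lborel)"
        proof (intro nn_integral_cong)
          fix x
          have "exp (- (q1 + real n) * x) = exp (- q1 * x) * exp (- x) ^ n"
            by (simp add: exp_of_nat_mult[symmetric] exp_add[symmetric] algebra_simps)
          then show "(w h x / C) * ennreal (exp (- x) ^ n) = (ennreal (exp (- (q1 + real n) * x)) * h x * indicator {0..} x) / C"
            by (simp add: w_def ennreal_mult divide_ennreal_def mult_ac)
        qed
        also have "\<dots> = (\<integral>\<^sup>+x\<in>{0..}. ennreal (exp (- (q1 + real n) * x)) * h x \<partial>lborel) / C"
          by (subst nn_integral_divide) auto
        finally show ?thesis .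
      qed
      have "distr (E h) borel (\<lambda>y. - ln y) = distr (D h) borel (\<lambda>x. x)"
        unfolding E_def by (subst distr_distr) (auto simp: D_def o_def)
      also have "\<dots> = D h" by (rule distr_id2) (simp add: D_def)
      finally show ?thesis using p ae rd ae1 mom by simp
    qed
    note F = main[OF assms(1) C_def] and G = main[OF assms(2) Cg]
    have "E f = E g"
    proof (rule real_distribution_moments_unique)
      show "(LINT x|E f. x ^ n) = (LINT x|E g. x ^ n)" for n
        using F G eq[of "q1 + real n"] by (simp add: q1_def)
    qed (use F G in auto)
    then have "D f = D g" using F G by simp
    then have "AE x in lborel. w f x / C = w g x / C"
      unfolding D_def by (intro sigma_finite_measure.density_unique[OF sigma_finite_lborel]) auto
    then show ?thesis
    proof eventually_elim
      case (elim x)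
      then have "w f x / C * C = w g x / C * C" by simp
      then show ?case using False Cfin by (simp add: ennreal_divide_times ennreal_divide_self)
    qed
  qed
  then show ?thesis
  proof eventually_elim
    case (elim x)
    show ?case
    proof
      assume "0 \<le> x"
      then have "ennreal (exp (- q1 * x)) * f x = ennreal (exp (- q1 * x)) * g x" using elim by (simp add: w_def)
      then show "f x = g x" by (subst (asm) ennreal_mult_cancel_left) auto
    qed
  qed
qed

section \<open>The perturbed scale function\<close>

text \<open>Product rule for Laplace transforms of convolutions. With values in
  \<open>ennreal\<close> Tonelli applies without any finiteness condition, so the rule can be used
  before a transform is known to converge.\<close>

lemma nn_integral_convolution_shift:
  fixes f g :: "real \<Rightarrow> ennreal"
  assumes [measurable]: "f \<in> borel_measurable borel" "g \<in> borel_measurable borel"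
  shows "(\<integral>\<^sup>+x\<in>{0..}. ennreal (exp (- q * x)) * (\<integral>\<^sup>+y\<in>{0..x}. f (x - y) * g y \<partial>lborel) \<partial>lborel)
    = (\<integral>\<^sup>+x\<in>{0..}. ennreal (exp (- q * x)) * f x \<partial>lborel) * (\<integral>\<^sup>+x\<in>{0..}. ennreal (exp (- q * x)) * g x \<partial>lborel)"
proof -
  let ?e = "\<lambda>x. ennreal (exp (- q * x))"
  have "(\<integral>\<^sup>+x\<in>{0..}. ?e x * (\<integral>\<^sup>+y\<in>{0..x}. f (x - y) * g y \<partial>lborel) \<partial>lborel)
      = (\<integral>\<^sup>+x. \<integral>\<^sup>+y. ?e x * (f (x - y) * g y) * indicator {0..} (x - y) * indicator {0..} y \<partial>lborel \<partial>lborel)"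
  proof (rule nn_integral_cong)
    fix x :: real
    have "?e x * (\<integral>\<^sup>+y\<in>{0..x}. f (x - y) * g y \<partial>lborel) * indicator {0..} x
        = (\<integral>\<^sup>+y. (?e x * indicator {0..} x) * (f (x - y) * g y * indicator {0..x} y) \<partial>lborel)"
      by (subst nn_integral_cmult) (auto simp: mult_ac)
    also have "\<dots> = (\<integral>\<^sup>+y. ?e x * (f (x - y) * g y) * indicator {0..} (x - y) * indicator {0..} y \<partial>lborel)"
      by (intro nn_integral_cong) (auto simp: indicator_def)
    finally show "?e x * (\<integral>\<^sup>+y\<in>{0..x}. f (x - y) * g y \<partial>lborel) * indicator {0..} x = \<dots>" .
  qed
  also have "\<dots> = (\<integral>\<^sup>+y. \<integral>\<^sup>+x. ?e x * (f (x - y) * g y) * indicator {0..} (x - y) * indicator {0..} y \<partial>lborel \<partial>lborel)"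
    by (rule lborel_pair.Fubini') measurable
  also have "\<dots> = (\<integral>\<^sup>+y. (\<integral>\<^sup>+x\<in>{0..}. ?e x * f x \<partial>lborel) * (?e y * g y * indicator {0..} y) \<partial>lborel)"
  proof (rule nn_integral_cong)
    fix y :: real
    have "(\<integral>\<^sup>+x. ?e x * (f (x - y) * g y) * indicator {0..} (x - y) * indicator {0..} y \<partial>lborel)
        = (\<integral>\<^sup>+x. ?e (y + x) * (f x * g y) * indicator {0..} x * indicator {0..} y \<partial>lborel)"
      by (subst nn_integral_real_affine[where c=1 and t=y]) auto
    also have "\<dots> = (\<integral>\<^sup>+x. (?e x * f x * indicator {0..} x) * (?e y * g y * indicator {0..} y) \<partial>lborel)"
    proof (intro nn_integral_cong)
      fix x
      have "?e (y + x) = ?e x * ?e y"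
        by (simp add: exp_add[symmetric] ennreal_mult[symmetric] algebra_simps)
      then show "?e (y + x) * (f x * g y) * indicator {0..} x * indicator {0..} y
          = (?e x * f x * indicator {0..} x) * (?e y * g y * indicator {0..} y)"
        by (simp add: mult_ac)
    qed
    also have "\<dots> = (\<integral>\<^sup>+x\<in>{0..}. ?e x * f x \<partial>lborel) * (?e y * g y * indicator {0..} y)"
      by (rule nn_integral_multc) measurable
    finally show "(\<integral>\<^sup>+x. ?e x * (f (x - y) * g y) * indicator {0..} (x - y) * indicator {0..} y \<partial>lborel) = \<dots>" .
  qed
  also have "\<dots> = (\<integral>\<^sup>+x\<in>{0..}. ?e x * f x \<partial>lborel) * (\<integral>\<^sup>+x\<in>{0..}. ?e x * g x \<partial>lborel)"
    by (rule nn_integral_cmult) measurable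
  finally show ?thesis .
qed

locale rv_scale = convex_rv +
  fixes W :: "real \<Rightarrow> real" and \<kappa> l :: real
  assumes W_cont: "continuous_on {0..} W" and W_mono: "mono_on {0..} W"
    and W_nonneg: "\<And>x. 0 \<le> x \<Longrightarrow> 0 \<le> W x"
    and W_laplace: "\<And>q. \<kappa> < q \<Longrightarrow> (\<integral>\<^sup>+x\<in>{0..}. ennreal (exp (- q * x)) * ennreal (W x) \<partial>lborel) = ennreal (1 / P (q - \<kappa>))"
    and l_pos: "0 < l"
begin

text \<open>Constant to the left of 0: \<open>W\<close> is specified on the half-line only, and this
  extension is continuous and monotone on the whole line.\<close>

definition Wp :: "real \<Rightarrow> real" where "Wp x = W (max 0 x)"

lemma Wp_cont: "continuous_on UNIV Wp"
  unfolding Wp_def by (intro continuous_on_compose2[OF W_cont] continuous_intros) auto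

lemma Wp_nonneg: "0 \<le> Wp x" by (simp add: Wp_def W_nonneg)

lemma Wp_mono: "x \<le> y \<Longrightarrow> Wp x \<le> Wp y"
  unfolding Wp_def by (intro mono_onD[OF W_mono]) auto

text \<open>A convolution, rescaled to the unit interval so that continuity in \<open>x\<close> is immediate.\<close>

primrec u :: "nat \<Rightarrow> real \<Rightarrow> real" where
  "u 0 = Wp"
| "u (Suc n) = (\<lambda>x. max 0 x * integral {0..1} (\<lambda>s. Wp (x * (1 - s)) * exp (- (x * s)) * u n (x * s)))"

lemma u_cont: "continuous_on UNIV (u n)"
proof (induction n)
  case (Suc n)
  have "continuous_on (UNIV \<times> cbox 0 (1::real)) (\<lambda>(x, s). Wp (x * (1 - s)) * exp (- (x * s)) * u n (x * s))"
    unfolding split_beta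
    by (intro continuous_intros continuous_on_compose2[OF Wp_cont] continuous_on_compose2[OF Suc]) auto
  from integral_continuous_on_param[OF this] show ?case
    by (auto intro!: continuous_intros)
qed (simp add: Wp_cont)

lemma u_integrand_cont: "continuous_on A (\<lambda>s. Wp (x * (1 - s)) * exp (- (x * s)) * u n (x * s))"
  by (intro continuous_intros continuous_on_compose2[OF Wp_cont] continuous_on_compose2[OF u_cont]) auto

lemma u_nonneg: "0 \<le> u n x"
proof (induction n arbitrary: x)
  case (Suc n)
  then show ?case using Wp_nonneg by (auto intro!: mult_nonneg_nonneg integral_nonneg integrable_continuous_real u_integrand_cont)
qed (simp add: Wp_nonneg)

text \<open>The usual Volterra estimate: each convolution integrates one more power, which builds up
  the factorial. The separate endpoint \<open>X\<close> keeps the constant \<open>Wp X\<close> fixed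
  in the induction while \<open>x\<close> shrinks to \<open>x * s\<close>.\<close>

lemma u_bound: "0 \<le> x \<Longrightarrow> x \<le> X \<Longrightarrow> u n x \<le> Wp x * ((Wp X * x) ^ n / fact n)"
proof (induction n arbitrary: x)
  case (Suc n)
  have "integral {0..1} (\<lambda>s. Wp (x * (1 - s)) * exp (- (x * s)) * u n (x * s))
      \<le> integral {0..1} (\<lambda>s. Wp x * (Wp X * (Wp X * x) ^ n / fact n) * s ^ n)"
  proof (rule integral_le)
    fix s :: real assume s: "s \<in> {0..1}"
    have xs: "0 \<le> x * s" "x * s \<le> X" using s Suc.prems mult_left_le[of s x] by auto
    have "u n (x * s) \<le> Wp (x * s) * ((Wp X * (x * s)) ^ n / fact n)"
      by (rule Suc.IH) (use xs in auto)
    also have "\<dots> \<le> Wp X * ((Wp X * (x * s)) ^ n / fact n)"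
      using xs Wp_nonneg by (intro mult_right_mono Wp_mono) auto
    finally have 1: "u n (x * s) \<le> Wp X * ((Wp X * (x * s)) ^ n / fact n)" .
    have 2: "Wp (x * (1 - s)) * exp (- (x * s)) \<le> Wp x * 1"
    proof (intro mult_mono Wp_mono)
      show "x * (1 - s) \<le> x" using s Suc.prems by (intro mult_left_le) auto
    qed (use xs Wp_nonneg in auto)
    have "Wp (x * (1 - s)) * exp (- (x * s)) * u n (x * s) \<le> Wp x * 1 * (Wp X * ((Wp X * (x * s)) ^ n / fact n))"
      by (rule mult_mono[OF 2 1]) (use Wp_nonneg u_nonneg in auto)
    then show "Wp (x * (1 - s)) * exp (- (x * s)) * u n (x * s) \<le> Wp x * (Wp X * (Wp X * x) ^ n / fact n) * s ^ n"
      by (simp add: power_mult_distrib mult_ac)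
  qed (auto intro!: integrable_continuous_real u_integrand_cont continuous_intros)
  also have "\<dots> = Wp x * (Wp X * (Wp X * x) ^ n / fact n) * integral {0..1} (\<lambda>s. s ^ n)" by simp
  also have "integral {0..1} (\<lambda>s::real. s ^ n) = 1 / (real n + 1)"
  proof (rule integral_unique)
    have "((\<lambda>s::real. s ^ n) has_integral (1 ^ Suc n / real (Suc n) - 0 ^ Suc n / real (Suc n))) {0..1}"
    proof (rule fundamental_theorem_of_calculus)
      fix s :: real
      have "((\<lambda>s. s ^ Suc n / real (Suc n)) has_real_derivative real (Suc n) * s ^ (Suc n - Suc 0) / real (Suc n)) (at s within {0..1})"
        by (intro DERIV_cdivide DERIV_pow)
      then show "((\<lambda>s. s ^ Suc n / real (Suc n)) has_vector_derivative s ^ n) (at s within {0..1})"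
        unfolding has_real_derivative_iff_has_vector_derivative[symmetric] by (simp del: of_nat_Suc)
    qed simp
    then show "((\<lambda>s::real. s ^ n) has_integral 1 / (real n + 1)) {0..1}" by (simp add: add.commute)
  qed
  finally have "x * integral {0..1} (\<lambda>s. Wp (x * (1 - s)) * exp (- (x * s)) * u n (x * s))
      \<le> x * (Wp x * (Wp X * (Wp X * x) ^ n / fact n) * (1 / (real n + 1)))"
    using Suc.prems by (intro mult_left_mono) auto
  also have "\<dots> = Wp x * ((Wp X * x) ^ Suc n / fact (Suc n))" by (simp add: field_simps)
  finally show ?case using Suc.prems by simp
qed simp

lemma u_neg: "x \<le> 0 \<Longrightarrow> u (Suc n) x = 0"
  by simp

text \<open>Neumann series of the renewal equation. That it solves the equation enters only after
  Laplace transformation, as \<open>Gr_recursion\<close>.\<close>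

definition G :: "real \<Rightarrow> real" where "G x = (\<Sum>n. l ^ n * u n x)"

lemma u_norm_bound: "0 \<le> X \<Longrightarrow> x \<le> X \<Longrightarrow> norm (l ^ n * u n x) \<le> Wp X * ((l * Wp X * X) ^ n / fact n)"
proof -
  assume X: "0 \<le> X" "x \<le> X"
  have 0: "0 \<le> Wp X * ((Wp X * X) ^ n / fact n)" using X Wp_nonneg by auto
  have "u n x \<le> Wp X * ((Wp X * X) ^ n / fact n)"
  proof (cases "0 \<le> x")
    case True
    have "u n x \<le> Wp x * ((Wp X * x) ^ n / fact n)" using True X by (intro u_bound) auto
    also have "\<dots> \<le> Wp X * ((Wp X * X) ^ n / fact n)"
      using True X Wp_nonneg by (intro mult_mono Wp_mono divide_right_mono power_mono mult_left_mono) auto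
    finally show ?thesis .
  next
    case False
    then show ?thesis using 0 X Wp_mono[of x X] by (cases n) (auto simp: u_neg simp del: u.simps(2))
  qed
  then have "l ^ n * u n x \<le> l ^ n * (Wp X * ((Wp X * X) ^ n / fact n))" using l_pos by (intro mult_left_mono) auto
  then show ?thesis using u_nonneg l_pos by (simp add: abs_mult power_mult_distrib mult_ac)
qed

lemma G_terms_summable: "summable (\<lambda>n. l ^ n * u n x)"
proof (rule summable_comparison_test')
  show "summable (\<lambda>n. Wp (max 0 x) * ((l * Wp (max 0 x) * max 0 x) ^ n / fact n))"
    using summable_exp_generic[of "l * Wp (max 0 x) * max 0 x"] by (intro summable_mult) (simp add: divide_inverse mult.commute)
  show "norm (l ^ n * u n x) \<le> Wp (max 0 x) * ((l * Wp (max 0 x) * max 0 x) ^ n / fact n)" for n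
    by (rule u_norm_bound) auto
qed

lemma G_cont: "continuous_on UNIV G"
proof -
  have "continuous_on {..<X} G" if X: "0 \<le> X" for X
  proof -
    have "uniform_limit {..<X} (\<lambda>n x. \<Sum>i<n. l ^ i * u i x) G sequentially"
      unfolding G_def
    proof (rule Weierstrass_m_test)
      show "summable (\<lambda>n. Wp X * ((l * Wp X * X) ^ n / fact n))"
        using summable_exp_generic[of "l * Wp X * X"] by (intro summable_mult) (simp add: divide_inverse mult.commute)
      show "norm (l ^ n * u n x) \<le> Wp X * ((l * Wp X * X) ^ n / fact n)" if "x \<in> {..<X}" for n x
        using that X by (intro u_norm_bound) auto
    qed
    then show ?thesis
      by (rule uniform_limit_theorem[rotated])
         (auto intro!: always_eventually continuous_intros continuous_on_subset[OF u_cont])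
  qed
  then have "continuous_on (\<Union>X\<in>{0..}. {..<X}) G"
    by (intro continuous_on_open_UN) auto
  moreover have "(\<Union>X\<in>{0::real..}. {..<X}) = UNIV"
  proof -
    have "x \<in> {..<max 0 x + 1}" "max 0 x + 1 \<in> {0..}" for x :: real by auto
    then show ?thesis by blast
  qed
  ultimately show ?thesis by simp
qed

lemma G_ge: "0 \<le> x \<Longrightarrow> W x \<le> G x"
proof -
  assume x: "0 \<le> x"
  have "sum (\<lambda>n. l ^ n * u n x) {0} \<le> G x"
    unfolding G_def using u_nonneg l_pos by (intro sum_le_suminf G_terms_summable) auto
  then show ?thesis using x by (simp add: Wp_def)
qed

text \<open>Shows that the perturbation is negligible near 0: division by \<open>W x\<close> leaves
  \<open>exp (l * W x * x)\<close>, which tends to 1 even if \<open>W\<close> itself vanishes at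
  0.\<close>

lemma G_le: "0 \<le> x \<Longrightarrow> G x \<le> W x * exp (l * W x * x)"
proof -
  assume x: "0 \<le> x"
  have "G x \<le> (\<Sum>n. Wp x * ((l * Wp x * x) ^ n / fact n))"
    unfolding G_def
  proof (rule suminf_le[OF _ G_terms_summable])
    show "l ^ n * u n x \<le> Wp x * ((l * Wp x * x) ^ n / fact n)" for n
      using u_norm_bound[of x x n] x by simp
    show "summable (\<lambda>n. Wp x * ((l * Wp x * x) ^ n / fact n))"
      using summable_exp_generic[of "l * Wp x * x"] by (intro summable_mult) (simp add: divide_inverse mult.commute)
  qed
  also have "\<dots> = Wp x * exp (l * Wp x * x)"
    unfolding exp_def using summable_exp_generic[of "l * Wp x * x"]
    by (subst suminf_mult) (simp_all add: divide_inverse mult.commute)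
  finally show ?thesis using x by (simp add: Wp_def max_absorb2)
qed

lemma u_meas[measurable]: "u n \<in> borel_measurable borel"
  by (rule borel_measurable_continuous_onI[OF u_cont])

lemma Wp_meas[measurable]: "Wp \<in> borel_measurable borel"
  by (rule borel_measurable_continuous_onI[OF Wp_cont])

lemma u_Suc_convolution:
  assumes x: "0 \<le> x"
  shows "ennreal (u (Suc n) x) = (\<integral>\<^sup>+y\<in>{0..x}. ennreal (Wp (x - y)) * ennreal (exp (- y) * u n y) \<partial>lborel)"
proof (cases "x = 0")
  case True
  have "(\<integral>\<^sup>+y\<in>{0..0}. ennreal (Wp (0 - y)) * ennreal (exp (- y) * u n y) \<partial>lborel)
      = (\<integral>\<^sup>+y. 0 \<partial>(lborel :: real measure))"
    by (rule nn_integral_cong_AE) (use AE_lborel_singleton[of 0] in \<open>auto elim!: eventually_mono\<close>)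
  then show ?thesis using True by simp
next
  case False
  then have x: "0 < x" using x by simp
  let ?F = "\<lambda>s. Wp (x * (1 - s)) * exp (- (x * s)) * u n (x * s)"
  have "ennreal (u (Suc n) x) = ennreal x * ennreal (integral {0..1} ?F)"
    using x by (simp add: ennreal_mult')
  also have "ennreal (integral {0..1} ?F) = (\<integral>\<^sup>+s. ennreal (?F s) * indicator {0..1} s \<partial>lborel)"
    by (rule nn_integral_has_integral_lebesgue'[symmetric])
       (auto intro!: mult_nonneg_nonneg Wp_nonneg u_nonneg integrable_integral integrable_continuous_real u_integrand_cont)
  also have "ennreal x * \<dots> = (\<integral>\<^sup>+y. ennreal (Wp (x - y)) * ennreal (exp (- y) * u n y) * indicator {0..x} y \<partial>lborel)"
  proof -
    have "(\<integral>\<^sup>+y. ennreal (Wp (x - y)) * ennreal (exp (- y) * u n y) * indicator {0..x} y \<partial>lborel)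
      = ennreal \<bar>x\<bar> * (\<integral>\<^sup>+s. ennreal (Wp (x - (0 + x * s))) * ennreal (exp (- (0 + x * s)) * u n (0 + x * s)) * indicator {0..x} (0 + x * s) \<partial>lborel)"
      by (rule nn_integral_real_affine) (use x in auto)
    also have "\<dots> = ennreal x * (\<integral>\<^sup>+s. ennreal (?F s) * indicator {0..1} s \<partial>lborel)"
    proof -
      have "indicator {0..x} (x * s) = (indicator {0..1} s :: ennreal)" for s
        using x by (auto simp: indicator_def zero_le_mult_iff)
      then show ?thesis using x
        by (simp add: right_diff_distrib ennreal_mult[symmetric] Wp_nonneg u_nonneg mult.assoc)
    qed
    finally show ?thesis by simp
  qed
  finally show ?thesis .
qed

section \<open>Laplace transforms of the iterates and of their sum\<close>

definition uhat :: "nat \<Rightarrow> real \<Rightarrow> ennreal" where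
  "uhat n q = (\<integral>\<^sup>+x\<in>{0..}. ennreal (exp (- q * x)) * ennreal (u n x) \<partial>lborel)"

lemma uhat_0: "\<kappa> < q \<Longrightarrow> uhat 0 q = ennreal (1 / P (q - \<kappa>))"
  unfolding uhat_def W_laplace[symmetric]
  by (intro nn_integral_cong) (auto simp: Wp_def indicator_def)

text \<open>The factor \<open>exp (- y)\<close> inside the convolution is absorbed by the transform
  as a shift of its argument by one.\<close>

lemma uhat_Suc: "uhat (Suc n) q = uhat 0 q * uhat n (q + 1)"
proof -
  have "uhat (Suc n) q = (\<integral>\<^sup>+x\<in>{0..}. ennreal (exp (- q * x)) *
      (\<integral>\<^sup>+y\<in>{0..x}. ennreal (Wp (x - y)) * ennreal (exp (- y) * u n y) \<partial>lborel) \<partial>lborel)"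
    unfolding uhat_def
    by (intro nn_integral_cong) (auto simp: indicator_def u_Suc_convolution simp del: u.simps)
  also have "\<dots> = uhat 0 q * (\<integral>\<^sup>+x\<in>{0..}. ennreal (exp (- q * x)) * ennreal (exp (- x) * u n x) \<partial>lborel)"
    by (subst nn_integral_convolution_shift) (auto simp: uhat_def)
  also have "(\<integral>\<^sup>+x\<in>{0..}. ennreal (exp (- q * x)) * ennreal (exp (- x) * u n x) \<partial>lborel) = uhat n (q + 1)"
    unfolding uhat_def
    by (intro nn_integral_cong)
       (simp add: ennreal_mult[symmetric] u_nonneg mult.assoc[symmetric] exp_add[symmetric] algebra_simps)
  finally show ?thesis .
qed

lemma uhat_eq: "\<kappa> < q \<Longrightarrow> uhat n q = ennreal (1 / (\<Prod>k\<le>n. P (q - \<kappa> + real k)))"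
proof (induction n arbitrary: q)
  case (Suc n)
  have "uhat (Suc n) q = ennreal (1 / P (q - \<kappa>)) * ennreal (1 / (\<Prod>k\<le>n. P (q + 1 - \<kappa> + real k)))"
    using Suc by (simp add: uhat_Suc uhat_0)
  also have "\<dots> = ennreal (1 / P (q - \<kappa>) * (1 / (\<Prod>k\<le>n. P (q + 1 - \<kappa> + real k))))"
    using Suc.prems by (intro ennreal_mult[symmetric]) (auto intro!: less_imp_le[OF P_pos] prod_nonneg)
  also have "1 / P (q - \<kappa>) * (1 / (\<Prod>k\<le>n. P (q + 1 - \<kappa> + real k))) = 1 / (\<Prod>k\<le>Suc n. P (q - \<kappa> + real k))"
    unfolding prod.atMost_Suc_shift by (simp add: algebra_simps)
  finally show ?case .
qed (simp add: uhat_0)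

text \<open>Closed form of the Laplace transform of \<open>G\<close> (see \<open>G_laplace\<close>),
  kept as a real series so that the algebra stays out of \<open>ennreal\<close>.\<close>

definition Gr :: "real \<Rightarrow> real" where
  "Gr q = (\<Sum>n. l ^ n / (\<Prod>k\<le>n. P (q - \<kappa> + real k)))"

lemma Gr_terms:
  assumes q: "\<kappa> < q"
  shows "summable (\<lambda>n. l ^ n / (\<Prod>k\<le>n. P (q - \<kappa> + real k)))"
    and "0 < (\<Prod>k\<le>n. P (q - \<kappa> + real k))"
proof -
  have p: "0 < (\<Prod>k\<le>n. P (q - \<kappa> + real k))" for n using q by (intro Groups_Big.linordered_semidom_class.prod_pos) (auto intro!: P_pos)
  show "0 < (\<Prod>k\<le>n. P (q - \<kappa> + real k))" by (rule p)
  have le: "l ^ n / (\<Prod>k\<le>n. P (q - \<kappa> + real k)) \<le> 1 / P (q - \<kappa>) * (l ^ n / (\<Prod>k=1..n. P (real k)))" for n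
  proof -
    have "(\<Prod>k=1..n. P (real k)) \<le> (\<Prod>k=1..n. P (q - \<kappa> + real k))"
      using q by (intro prod_mono) (auto intro!: P_mono less_imp_le[OF P_pos])
    then have "P (q - \<kappa>) * (\<Prod>k=1..n. P (real k)) \<le> P (q - \<kappa>) * (\<Prod>k=1..n. P (q - \<kappa> + real k))"
      using q by (intro mult_left_mono less_imp_le[OF P_pos]) auto
    also have "\<dots> = (\<Prod>k\<le>n. P (q - \<kappa> + real k))"
      by (simp add: atMost_atLeast0 prod.atLeast_Suc_atMost)
    finally have "l ^ n / (\<Prod>k\<le>n. P (q - \<kappa> + real k)) \<le> l ^ n / (P (q - \<kappa>) * (\<Prod>k=1..n. P (real k)))"
      using q l_pos P_prod_pos p by (intro divide_left_mono mult_pos_pos P_pos) auto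
    then show ?thesis by simp
  qed
  show "summable (\<lambda>n. l ^ n / (\<Prod>k\<le>n. P (q - \<kappa> + real k)))"
  proof (rule summable_comparison_test'[OF summable_mult[OF J_summable]])
    show "norm (l ^ n / (\<Prod>k\<le>n. P (q - \<kappa> + real k))) \<le> 1 / P (q - \<kappa>) * (l ^ n / (\<Prod>k=1..n. P (real k)))" for n
      using le[of n] l_pos p[of n] by simp
  qed
qed

lemma G_laplace:
  assumes q: "\<kappa> < q"
  shows "(\<integral>\<^sup>+x\<in>{0..}. ennreal (exp (- q * x)) * ennreal (G x) \<partial>lborel) = ennreal (Gr q)"
proof -
  have "(\<integral>\<^sup>+x\<in>{0..}. ennreal (exp (- q * x)) * ennreal (G x) \<partial>lborel)
    = (\<integral>\<^sup>+x. (\<Sum>n. ennreal (l ^ n) * (ennreal (exp (- q * x)) * ennreal (u n x) * indicator {0..} x)) \<partial>lborel)"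
  proof (rule nn_integral_cong)
    fix x :: real
    have "ennreal (G x) = (\<Sum>n. ennreal (l ^ n * u n x))"
      unfolding G_def using l_pos u_nonneg G_terms_summable by (intro suminf_ennreal2[symmetric]) auto
    then have "ennreal (exp (- q * x)) * ennreal (G x) * indicator {0..} x
        = (\<Sum>n. ennreal (exp (- q * x)) * indicator {0..} x * ennreal (l ^ n * u n x))"
      by (simp add: mult_ac)
    also have "\<dots> = (\<Sum>n. ennreal (l ^ n) * (ennreal (exp (- q * x)) * ennreal (u n x) * indicator {0..} x))"
      using l_pos u_nonneg by (simp add: ennreal_mult mult_ac)
    finally show "ennreal (exp (- q * x)) * ennreal (G x) * indicator {0..} x = \<dots>" .
  qed
  also have "\<dots> = (\<Sum>n. ennreal (l ^ n) * uhat n q)"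
    unfolding uhat_def by (subst nn_integral_suminf) (auto simp: nn_integral_cmult)
  also have "\<dots> = (\<Sum>n. ennreal (l ^ n / (\<Prod>k\<le>n. P (q - \<kappa> + real k))))"
    using l_pos Gr_terms[OF q] by (simp add: uhat_eq[OF q] ennreal_mult[symmetric] less_imp_le)
  also have "\<dots> = ennreal (Gr q)"
    unfolding Gr_def using l_pos Gr_terms[OF q] by (intro suminf_ennreal2) (auto intro!: less_imp_le)
  finally show ?thesis .
qed

lemma Gr_nonneg: "\<kappa> < q \<Longrightarrow> 0 \<le> Gr q"
  unfolding Gr_def using Gr_terms l_pos by (intro suminf_nonneg) (auto intro!: less_imp_le)

text \<open>The transformed renewal equation: cancelling the factor with \<open>k = 0\<close> turns
  each later summand into one at \<open>q + 1\<close>, and the summand \<open>n = 0\<close> leaves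
  the 1.\<close>

lemma Gr_recursion:
  assumes q: "\<kappa> < q"
  shows "P (q - \<kappa>) * Gr q = 1 + l * Gr (q + 1)"
proof -
  have p: "P (q - \<kappa>) > 0" using q by (auto intro!: P_pos)
  have eq: "P (q - \<kappa>) * (l ^ Suc n / (\<Prod>k\<le>Suc n. P (q - \<kappa> + real k))) = l * (l ^ n / (\<Prod>k\<le>n. P (q + 1 - \<kappa> + real k)))" for n
    unfolding prod.atMost_Suc_shift using p by (simp add: algebra_simps)
  have "P (q - \<kappa>) * Gr q = (\<Sum>n. P (q - \<kappa>) * (l ^ n / (\<Prod>k\<le>n. P (q - \<kappa> + real k))))"
    unfolding Gr_def using Gr_terms[OF q] by (intro suminf_mult[symmetric]) auto
  also have "\<dots> = (\<Sum>n. P (q - \<kappa>) * (l ^ Suc n / (\<Prod>k\<le>Suc n. P (q - \<kappa> + real k)))) + 1"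
    using suminf_split_head[OF summable_mult[OF Gr_terms(1)[OF q], of "P (q - \<kappa>)"]] p by simp
  also have "(\<Sum>n. P (q - \<kappa>) * (l ^ Suc n / (\<Prod>k\<le>Suc n. P (q - \<kappa> + real k)))) = l * Gr (q + 1)"
    unfolding eq Gr_def using Gr_terms[of "q + 1"] q by (intro suminf_mult) auto
  finally show ?thesis by simp
qed

text \<open>This is the right-hand side of \<open>Gr_recursion\<close> at the boundary value
  \<open>q = \<kappa>\<close>, and the way in which \<open>J l\<close> enters the comparison of
  transforms.\<close>

lemma J_eq_Gr: "J l = 1 + l * Gr (\<kappa> + 1)"
proof -
  have eq: "l ^ Suc n / (\<Prod>k=1..Suc n. P (real k)) = l * (l ^ n / (\<Prod>k\<le>n. P (\<kappa> + 1 - \<kappa> + real k)))" for n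
  proof -
    have "(\<Prod>k=1..Suc n. P (real k)) = (\<Prod>k\<le>n. P (1 + real k))"
      using prod.shift_bounds_cl_Suc_ivl[of "\<lambda>k. P (real k)" 0 n] by (simp add: atMost_atLeast0)
    then show ?thesis by simp
  qed
  have "J l = (\<Sum>n. l ^ Suc n / (\<Prod>k=1..Suc n. P (real k))) + 1"
    unfolding J_def by (subst suminf_split_head[OF J_summable]) auto
  also have "(\<Sum>n. l ^ Suc n / (\<Prod>k=1..Suc n. P (real k))) = l * Gr (\<kappa> + 1)"
    unfolding eq Gr_def using Gr_terms[of "\<kappa> + 1"] by (intro suminf_mult) auto
  finally show ?thesis by simp
qed

end

section \<open>Passage times of cadlag paths\<close>

text \<open>Bisection: near each point the path is within 1 of its value on the right and within 1
  of its left limit on the left. Intersecting with \<open>{0..}\<close> lets small intervals around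
  0 extend to negative times, where nothing is known of the path.\<close>

lemma cadlag_bounded:
  assumes "cadlag f" "0 \<le> t"
  shows "bounded (f ` {0..t})"
proof -
  have "bounded (f ` ({0..t} \<inter> {0..}))"
  proof (rule Bolzano[of 0 t "\<lambda>a b. bounded (f ` ({a..b} \<inter> {0..}))"])
    fix a b c :: real
    assume trans: "bounded (f ` ({a..b} \<inter> {0..}))" "bounded (f ` ({b..c} \<inter> {0..}))"
    have "{a..c} \<inter> {0..} \<subseteq> ({a..b} \<inter> {0..}) \<union> ({b..c} \<inter> {0..})" by auto
    then have "f ` ({a..c} \<inter> {0..}) \<subseteq> f ` ({a..b} \<inter> {0..}) \<union> f ` ({b..c} \<inter> {0..})" by blast
    then show "bounded (f ` ({a..c} \<inter> {0..}))" using trans bounded_Un bounded_subset by metis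
  next
    fix x assume local: "0 \<le> x" "x \<le> t"
    have "(f \<longlongrightarrow> f x) (at_right x)" using assms(1) local by (auto simp: cadlag_def continuous_within)
    then have "eventually (\<lambda>y. dist (f y) (f x) < 1) (at_right x)" by (rule tendstoD) simp
    then obtain b where b: "b > x" "\<And>y. x < y \<Longrightarrow> y < b \<Longrightarrow> dist (f y) (f x) < 1"
      unfolding eventually_at_right_field by auto
    define d1 where "d1 = b - x"
    have d1: "d1 > 0" "\<And>y. x < y \<Longrightarrow> y < x + d1 \<Longrightarrow> dist (f y) (f x) < 1"
      using b by (auto simp: d1_def)
    obtain d2 l where d2: "d2 > 0" "\<And>y. 0 \<le> y \<Longrightarrow> x - d2 < y \<Longrightarrow> y < x \<Longrightarrow> dist (f y) l < 1"
    proof (cases "x = 0")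
      case True
      show ?thesis by (rule that[of 1]) (use True in auto)
    next
      case False
      then obtain l where "(f \<longlongrightarrow> l) (at_left x)" using assms(1) local by (force simp: cadlag_def)
      then have "eventually (\<lambda>y. dist (f y) l < 1) (at_left x)" by (rule tendstoD) simp
      then obtain b where "b < x" "\<And>y. b < y \<Longrightarrow> y < x \<Longrightarrow> dist (f y) l < 1"
        unfolding eventually_at_left_field by auto
      then show ?thesis by (intro that[of "x - b" l]) auto
    qed
    show "\<exists>d>0. \<forall>a b. a \<le> x \<and> x \<le> b \<and> b - a < d \<longrightarrow> bounded (f ` ({a..b} \<inter> {0..}))"
    proof (intro exI[of _ "min d1 d2"] conjI allI impI)
      fix a b assume ab: "a \<le> x \<and> x \<le> b \<and> b - a < min d1 d2"
      have "f ` ({a..b} \<inter> {0..}) \<subseteq> ball (f x) 1 \<union> ball l 1"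
      proof clarify
        fix y assume y: "y \<in> {a..b}" "0 \<le> y" "f y \<notin> ball l 1"
        consider "y = x" | "y < x" | "y > x" by linarith
        then show "f y \<in> ball (f x) 1"
          using d1(2)[of y] d2(2)[of y] y ab by cases (auto simp: dist_commute)
      qed
      then show "bounded (f ` ({a..b} \<inter> {0..}))" by (rule bounded_subset[rotated]) simp
    qed (use d1 d2 in auto)
  qed (rule assms)
  then show ?thesis by (simp add: Int_absorb2)
qed

lemma eventually_dyadic_right:
  assumes "0 \<le> s" "s < t" "0 < e"
  shows "eventually (\<lambda>n. \<exists>k\<le>2 ^ n. s < real k * t / 2 ^ n \<and> real k * t / 2 ^ n < s + e) sequentially"
proof -
  have t: "t > 0" using assms by simp
  have "(\<lambda>n. t * (1 / 2) ^ n) \<longlonglongrightarrow> t * 0" by (intro tendsto_intros) auto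
  then have "eventually (\<lambda>n. t * (1 / 2) ^ n < e) sequentially" using assms by (intro order_tendstoD(2)) auto
  then show ?thesis
  proof eventually_elim
    case (elim n)
    define k where "k = nat \<lfloor>s * 2 ^ n / t\<rfloor> + 1"
    have sn: "0 \<le> s * 2 ^ n / t" "s * 2 ^ n / t < 2 ^ n" using assms t by (auto simp: field_simps)
    have k: "real k > s * 2 ^ n / t" "real k \<le> s * 2 ^ n / t + 1" using sn unfolding k_def by linarith+
    have "\<lfloor>s * 2 ^ n / t\<rfloor> < 2 ^ n" using sn by (simp add: floor_less_iff)
    then have "k \<le> 2 ^ n" using sn by (simp add: k_def Suc_le_eq nat_less_iff)
    moreover have "s < real k * t / 2 ^ n" using k t by (simp add: field_simps)
    moreover have "real k * t / 2 ^ n \<le> s + t / 2 ^ n" using k t by (simp add: field_simps)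
    moreover have "t / 2 ^ n < e" using elim by (simp add: power_divide)
    ultimately show ?case by (intro exI[of _ k]) auto
  qed
qed

text \<open>A countable set of times over which infima on \<open>[0, t]\<close> become measurable.
  It contains the endpoint \<open>t\<close>, whose value right-continuity cannot reach from other
  points of the interval.\<close>

definition dyadic :: "real \<Rightarrow> real set" where
  "dyadic t = {real k * t / 2 ^ n | n k. k \<le> 2 ^ n}"

lemma dyadic_subset: "0 \<le> t \<Longrightarrow> dyadic t \<subseteq> {0..t}"
proof
  fix x assume t: "0 \<le> t" and "x \<in> dyadic t"
  then obtain n k where x: "x = real k * t / 2 ^ n" "k \<le> 2 ^ n" by (auto simp: dyadic_def)
  have "real k \<le> 2 ^ n" using x(2) by (metis of_nat_le_iff of_nat_numeral of_nat_power)
  then have "real k * t \<le> 2 ^ n * t" using t by (intro mult_right_mono) auto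
  then have "real k * t / 2 ^ n \<le> t" by (simp add: divide_le_eq mult.commute)
  then show "x \<in> {0..t}" using x(1) t by simp
qed

lemma end_in_dyadic: "t \<in> dyadic t"
  unfolding dyadic_def by (rule CollectI, rule exI[of _ 0], rule exI[of _ 1]) simp

lemma countable_dyadic: "countable (dyadic t)"
proof -
  have "dyadic t \<subseteq> (\<lambda>(n, k). real k * t / 2 ^ n) ` UNIV" by (auto simp: dyadic_def)
  then show ?thesis by (rule countable_subset) simp
qed

lemma cadlag_right_tendsto: "cadlag f \<Longrightarrow> 0 \<le> s \<Longrightarrow> (f \<longlongrightarrow> f s) (at_right s)"
  by (auto simp: cadlag_def continuous_within)

lemma cadlag_right_open:
  assumes "cadlag f" "0 \<le> s" "open U" "f s \<in> U"
  shows "\<exists>d>0. \<forall>u. s \<le> u \<and> u < s + d \<longrightarrow> f u \<in> U"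
proof -
  have "eventually (\<lambda>u. f u \<in> U) (at_right s)"
    using cadlag_right_tendsto[OF assms(1,2)] assms(3,4) by (rule topological_tendstoD)
  then obtain b where "b > s" "\<And>u. s < u \<Longrightarrow> u < b \<Longrightarrow> f u \<in> U"
    unfolding eventually_at_right_field by auto
  then show ?thesis using assms(4) by (intro exI[of _ "b - s"]) (auto simp: le_less)
qed

lemma cadlag_INF_dyadic:
  assumes f: "cadlag f" and t: "0 < t"
  shows "(INF s\<in>{0..t}. x + f s) = x + (INF s\<in>dyadic t. f s)"
    and "bdd_below (f ` dyadic t)"
proof -
  have sub: "dyadic t \<subseteq> {0..t}" using t by (intro dyadic_subset) auto
  have b: "bdd_below (f ` {0..t})" using cadlag_bounded[OF f, of t] t by (simp add: bounded_imp_bdd_below)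
  show bd: "bdd_below (f ` dyadic t)" by (rule bdd_below_mono[OF b]) (use sub in auto)
  have ne: "dyadic t \<noteq> {}" using end_in_dyadic by auto
  have "bdd_below ((\<lambda>s. x + f s) ` {0..t})"
  proof -
    obtain B where "\<And>s. s \<in> {0..t} \<Longrightarrow> B \<le> f s" using b unfolding bdd_below_def by blast
    then show ?thesis by (intro bdd_belowI2[of _ "x + B"]) auto
  qed
  note b' = this
  show "(INF s\<in>{0..t}. x + f s) = x + (INF s\<in>dyadic t. f s)"
  proof (rule antisym)
    have "(INF s\<in>{0..t}. x + f s) - x \<le> (INF s\<in>dyadic t. f s)"
    proof (rule cINF_greatest[OF ne])
      fix s assume "s \<in> dyadic t"
      then have "(INF s\<in>{0..t}. x + f s) \<le> x + f s" using sub by (intro cINF_lower[OF b']) auto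
      then show "(INF s\<in>{0..t}. x + f s) - x \<le> f s" by simp
    qed
    then show "(INF s\<in>{0..t}. x + f s) \<le> x + (INF s\<in>dyadic t. f s)" by simp
  next
    show "x + (INF s\<in>dyadic t. f s) \<le> (INF s\<in>{0..t}. x + f s)"
    proof (rule cINF_greatest)
      fix s assume s: "s \<in> {0..t}"
      have "(INF s\<in>dyadic t. f s) \<le> f s"
      proof (rule ccontr)
        assume "\<not> (INF s\<in>dyadic t. f s) \<le> f s"
        then have lt: "f s < (INF s\<in>dyadic t. f s)" by simp
        \<comment> \<open>The endpoint is itself a grid point; every earlier time has grid points
          immediately to its right.\<close>
        have "s \<noteq> t" using lt cINF_lower[OF bd end_in_dyadic] by auto
        then have st: "0 \<le> s" "s < t" using s by auto
        obtain d where d: "d > 0" "\<And>u. s \<le> u \<and> u < s + d \<Longrightarrow> f u \<in> {..<(INF s\<in>dyadic t. f s)}"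
          using cadlag_right_open[OF f st(1), of "{..<(INF s\<in>dyadic t. f s)}"] lt by auto
        from eventually_happens[OF eventually_dyadic_right[OF st d(1)]]
        obtain n k where k: "k \<le> 2 ^ n" "s < real k * t / 2 ^ n" "real k * t / 2 ^ n < s + d" by auto
        have "f (real k * t / 2 ^ n) < (INF s\<in>dyadic t. f s)" using d(2)[of "real k * t / 2 ^ n"] k by auto
        moreover have "(INF s\<in>dyadic t. f s) \<le> f (real k * t / 2 ^ n)"
          using k by (intro cINF_lower[OF bd]) (auto simp: dyadic_def)
        ultimately show False by simp
      qed
      then show "x + (INF s\<in>dyadic t. f s) \<le> x + f s" by simp
    qed (use t in auto)
  qed
qed

text \<open>A path that starts below \<open>z\<close> and never jumps upwards cannot skip the level,
  so it passes without overshoot: \<open>f T = z\<close>. The first grid time above \<open>z\<close>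
  approaches \<open>T\<close> strictly from the right, which lets right-continuity carry grid
  identities over to \<open>T\<close>.\<close>

lemma passage_path:
  fixes f :: "real \<Rightarrow> real"
  assumes f: "cadlag f" and npj: "no_positive_jumps f" and f0: "f 0 = 0" and z: "0 < z"
    and s0: "0 \<le> s0" "s0 \<le> t" "z < f s0"
  defines "T \<equiv> Inf {s. 0 \<le> s \<and> z < f s}"
    and "\<tau> \<equiv> \<lambda>n. real (LEAST k. z < f (real k * t / 2 ^ n)) * t / 2 ^ n"
  shows "0 \<le> T" "T < t" "f T = z"
    and "eventually (\<lambda>n. \<exists>k\<le>2 ^ n. z < f (real k * t / 2 ^ n)) sequentially"
    and "filterlim \<tau> (at_right T) sequentially"
proof -
  define E where "E = {s. 0 \<le> s \<and> z < f s}"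
  have E: "s0 \<in> E" "bdd_below E" using s0 by (auto simp: E_def intro: bdd_belowI)
  have T: "T = Inf E" by (simp add: T_def E_def)
  have Tle: "s \<in> E \<Longrightarrow> T \<le> s" for s unfolding T using E by (intro cInf_lower)
  show T0: "0 \<le> T" unfolding T by (rule cInf_greatest) (use E in \<open>auto simp: E_def\<close>)
  \<comment> \<open>If the value exceeded \<open>z\<close>, so would the left limit, jumps being
    downward only, and the path would be above \<open>z\<close> before its first passage
    time.\<close>
  have fTz: "f T \<le> z"
  proof (rule ccontr)
    assume "\<not> f T \<le> z"
    moreover from this have Tp: "T > 0" using f0 z T0 by (cases "T = 0") auto
    moreover obtain l where l: "(f \<longlongrightarrow> l) (at_left T)" using f Tp by (auto simp: cadlag_def)
    moreover have "f T \<le> l" using npj Tp l by (auto simp: no_positive_jumps_def)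
    ultimately have "eventually (\<lambda>s. f s > z) (at_left T)" by (intro order_tendstoD(1)[OF l]) auto
    then obtain b where b: "b < T" "\<And>s. b < s \<Longrightarrow> s < T \<Longrightarrow> f s > z"
      unfolding eventually_at_left_field by auto
    define s where "s = (max b 0 + T) / 2"
    have s: "b < s" "s < T" "0 \<le> s" using b Tp by (auto simp: s_def)
    then have "s \<in> E" using b by (auto simp: E_def)
    then show False using Tle s by force
  qed
  have "T \<le> t" using Tle[OF E(1)] s0 by simp
  moreover have "T \<noteq> t" using Tle[OF E(1)] s0 fTz by force
  ultimately show Tt: "T < t" by simp
  have ev: "eventually (\<lambda>n. \<exists>k\<le>2 ^ n. z < f (real k * t / 2 ^ n) \<and> real k * t / 2 ^ n < T + e) sequentially"
    if e: "e > 0" for e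
  proof -
    have "Inf E < min (T + e) t" using e Tt T by simp
    then obtain s where s: "s \<in> E" "s < min (T + e) t" using cInf_lessD[of E] E by blast
    then have "0 \<le> s" "f s \<in> {z<..}" by (auto simp: E_def)
    then obtain d where d: "d > 0" "\<And>u. s \<le> u \<and> u < s + d \<Longrightarrow> f u \<in> {z<..}"
      using cadlag_right_open[OF f, of s "{z<..}"] by auto
    have "eventually (\<lambda>n. \<exists>k\<le>2 ^ n. s < real k * t / 2 ^ n \<and> real k * t / 2 ^ n < s + min d (T + e - s)) sequentially"
      using s \<open>0 \<le> s\<close> d(1) by (intro eventually_dyadic_right) auto
    then show ?thesis
    proof eventually_elim
      case (elim n)
      then obtain k where k: "k \<le> 2 ^ n" "s < real k * t / 2 ^ n" "real k * t / 2 ^ n < s + min d (T + e - s)" by auto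
      then have "z < f (real k * t / 2 ^ n)" using d(2)[of "real k * t / 2 ^ n"] by auto
      then show ?case using k by (intro exI[of _ k]) auto
    qed
  qed
  show "eventually (\<lambda>n. \<exists>k\<le>2 ^ n. z < f (real k * t / 2 ^ n)) sequentially"
    using ev[OF zero_less_one] by (rule eventually_mono) auto
  have hit: "z < f (\<tau> n)" if "z < f (real k * t / 2 ^ n)" for n k
    unfolding \<tau>_def using that by (rule LeastI[of "\<lambda>k. z < f (real k * t / 2 ^ n)"])
  have tp: "t > 0" using T0 Tt by simp
  have gt: "T < \<tau> n" if "z < f (real k * t / 2 ^ n)" for n k
  proof -
    have "\<tau> n \<in> E" using hit[OF that] tp by (auto simp: E_def \<tau>_def)
    then have "T \<le> \<tau> n" by (rule Tle)
    moreover have "T \<noteq> \<tau> n" using hit[OF that] fTz by auto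
    ultimately show ?thesis by simp
  qed
  have evT: "eventually (\<lambda>n. T < \<tau> n \<and> \<tau> n < T + e) sequentially" if "e > 0" for e
    using ev[OF that]
  proof eventually_elim
    case (elim n)
    then obtain k where k: "z < f (real k * t / 2 ^ n)" "real k * t / 2 ^ n < T + e" by auto
    have "(LEAST k. z < f (real k * t / 2 ^ n)) \<le> k" using k(1) by (rule Least_le)
    then have "\<tau> n \<le> real k * t / 2 ^ n" unfolding \<tau>_def using tp by (intro divide_right_mono mult_right_mono) auto
    then show ?case using gt[OF k(1)] k(2) by simp
  qed
  have "\<tau> \<longlonglongrightarrow> T"
  proof (rule LIMSEQ_I)
    fix e :: real assume "e > 0"
    from evT[OF this] obtain N where "\<And>n. n \<ge> N \<Longrightarrow> T < \<tau> n \<and> \<tau> n < T + e"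
      unfolding eventually_sequentially by blast
    then show "\<exists>N. \<forall>n\<ge>N. norm (\<tau> n - T) < e" by (intro exI[of _ N]) force
  qed
  then show lim: "filterlim \<tau> (at_right T) sequentially"
    using evT[OF zero_less_one] unfolding filterlim_at by (auto elim!: eventually_mono)
  have "(\<lambda>n. f (\<tau> n)) \<longlonglongrightarrow> f T"
    by (rule filterlim_compose[OF cadlag_right_tendsto[OF f T0] lim])
  moreover have "eventually (\<lambda>n. z \<le> f (\<tau> n)) sequentially"
    using ev[OF zero_less_one] by (rule eventually_mono) (use hit in \<open>auto intro: less_imp_le\<close>)
  ultimately have "z \<le> f T" by (intro tendsto_lowerbound[of _ _ sequentially]) auto
  then show "f T = z" using fTz by simp
qed

text \<open>Rational times suffice for right-continuous paths and make measurability evident.\<close>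

definition passage :: "(real \<Rightarrow> real) \<Rightarrow> real \<Rightarrow> ennreal" where
  "passage f z = (INF s\<in>\<rat> \<inter> {0..}. if z < f s then ennreal s else \<infinity>)"

lemma passage_less:
  fixes f :: "real \<Rightarrow> real"
  shows "cadlag f \<Longrightarrow> 0 \<le> s \<Longrightarrow> s < t \<Longrightarrow> z < f s \<Longrightarrow> passage f z < ennreal t"
proof -
  assume f: "cadlag f" and s: "0 \<le> s" "s < t" "z < f s"
  then obtain d where d: "d > 0" "\<And>u. s \<le> u \<and> u < s + d \<Longrightarrow> f u \<in> {z<..}"
    using cadlag_right_open[OF f s(1), of "{z<..}"] by auto
  obtain r where r: "r \<in> \<rat>" "s < r" "r < min (s + d) t"
    using Rats_dense_in_real[of s "min (s + d) t"] d s by auto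
  then have "z < f r" using d(2)[of r] by auto
  then have "passage f z \<le> ennreal r"
    unfolding passage_def using r s by (intro INF_lower2[of r]) auto
  also have "\<dots> < ennreal t" using r s by (intro ennreal_lessI) auto
  finally show ?thesis .
qed

lemma passage_less_iff:
  fixes f :: "real \<Rightarrow> real"
  shows "cadlag f \<Longrightarrow> 0 \<le> t \<Longrightarrow> passage f z < ennreal t \<longleftrightarrow> (\<exists>s. 0 \<le> s \<and> s < t \<and> z < f s)"
proof
  assume t: "0 \<le> t" and "passage f z < ennreal t"
  then obtain s where "s \<in> \<rat> \<inter> {0..}" "(if z < f s then ennreal s else \<infinity>) < ennreal t"
    unfolding passage_def by (subst (asm) INF_less_iff) auto
  then show "\<exists>s. 0 \<le> s \<and> s < t \<and> z < f s" using t by (auto split: if_splits simp: ennreal_less_iff)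
qed (auto intro: passage_less)

lemma passage_eq_Inf:
  fixes f :: "real \<Rightarrow> real"
  assumes f: "cadlag f" and s0: "0 \<le> s0" "z < f s0"
  shows "passage f z = ennreal (Inf {s::real. 0 \<le> s \<and> z < f s})"
proof (rule antisym)
  let ?E = "{s::real. 0 \<le> s \<and> z < f s}"
  have E: "?E \<noteq> {}" "bdd_below ?E" using s0 by (auto intro: bdd_belowI)
  have E0: "0 \<le> Inf ?E" by (rule cInf_greatest) (use E in auto)
  show "passage f z \<le> ennreal (Inf ?E)"
  proof (rule ennreal_le_epsilon)
    fix e :: real assume e: "0 < e"
    obtain s where "s \<in> ?E" "s < Inf ?E + e" using cInf_lessD[OF E(1), of "Inf ?E + e"] e by auto
    then have "passage f z < ennreal (Inf ?E + e)" using f by (auto intro: passage_less)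
    then show "passage f z \<le> ennreal (Inf ?E) + ennreal e" using E0 e by (simp add: ennreal_plus[symmetric] less_imp_le del: ennreal_plus)
  qed
  show "ennreal (Inf ?E) \<le> passage f z"
    unfolding passage_def
  proof (rule INF_greatest)
    fix s :: real assume "s \<in> \<rat> \<inter> {0..}"
    then show "ennreal (Inf ?E) \<le> (if z < f s then ennreal s else \<infinity>)"
      using cInf_lower[OF _ E(2), of s] by (auto intro: ennreal_leI)
  qed
qed

text \<open>Absence of positive jumps excludes a passage exactly at time \<open>t\<close>.\<close>

lemma passage_less_iff':
  fixes f :: "real \<Rightarrow> real"
  assumes "cadlag f" "no_positive_jumps f" "f 0 = 0" "0 < z" "0 \<le> t"
  shows "passage f z < ennreal t \<longleftrightarrow> (\<exists>s. 0 \<le> s \<and> s \<le> t \<and> z < f s)"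
proof
  assume "\<exists>s. 0 \<le> s \<and> s \<le> t \<and> z < f s"
  then obtain s where s: "0 \<le> s" "s \<le> t" "z < f s" by auto
  have "Inf {s. 0 \<le> s \<and> z < f s} < t" "0 \<le> Inf {s. 0 \<le> s \<and> z < f s}"
    using passage_path(1,2)[OF assms(1-4) s] by auto
  then show "passage f z < ennreal t" using passage_eq_Inf[OF assms(1) s(1,3)] by (auto intro: ennreal_lessI)
next
  assume "passage f z < ennreal t"
  then obtain s where "0 \<le> s" "s < t" "z < f s" using assms passage_less_iff by blast
  then show "\<exists>s. 0 \<le> s \<and> s \<le> t \<and> z < f s" by (intro exI[of _ s]) auto
qed

section \<open>Spectrally negative processes\<close>

lemma (in prob_space) indep_var_nn_integral_mult:
  fixes X Y :: "'a \<Rightarrow> ennreal"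
  assumes "indep_var borel X borel Y"
  shows "(\<integral>\<^sup>+\<omega>. X \<omega> * Y \<omega> \<partial>M) = (\<integral>\<^sup>+\<omega>. X \<omega> \<partial>M) * (\<integral>\<^sup>+\<omega>. Y \<omega> \<partial>M)"
proof -
  have b: "case_bool borel borel = (\<lambda>_. borel :: ennreal measure)" by (auto split: bool.split)
  have "indep_vars (\<lambda>_. borel) (case_bool X Y) UNIV"
    using assms unfolding indep_var_def b .
  from indep_vars_nn_integral[OF _ this] show ?thesis by (simp add: UNIV_bool mult.commute)
qed

text \<open>A product of equal factors is invariant under permutations of the coordinates; this is
  time reversal for a random walk.\<close>

lemma (in prob_space) iid_reverse_nn_integral:
  fixes D :: "nat \<Rightarrow> 'a \<Rightarrow> real"
  assumes ind: "indep_vars (\<lambda>_. borel) D {..<N}"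
    and id: "\<And>i. i < N \<Longrightarrow> distr M borel (D i) = \<mu>"
    and F[measurable]: "F \<in> borel_measurable (PiM {..<N} (\<lambda>_. borel))"
  shows "(\<integral>\<^sup>+\<omega>. F (\<lambda>i\<in>{..<N}. D (N - 1 - i) \<omega>) \<partial>M) = (\<integral>\<^sup>+\<omega>. F (\<lambda>i\<in>{..<N}. D i \<omega>) \<partial>M)"
proof (cases "N = 0")
  case False
  have rv: "D i \<in> borel_measurable M" if "i < N" for i using ind that by (auto simp: indep_vars_def)
  have mu: "sets \<mu> = sets borel" "prob_space \<mu>"
    using id[of 0] False rv[of 0] by (auto intro!: prob_space_distr)
  have m1[measurable]: "(\<lambda>\<omega>. \<lambda>i\<in>{..<N}. D i \<omega>) \<in> measurable M (PiM {..<N} (\<lambda>_. borel))"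
    using rv by (intro measurable_restrict) auto
  have "distr M (PiM {..<N} (\<lambda>_. borel)) (\<lambda>\<omega>. \<lambda>i\<in>{..<N}. D i \<omega>) = PiM {..<N} (\<lambda>i. distr M borel (D i))"
    using indep_vars_iff_distr_eq_PiM'[of "{..<N}" D "\<lambda>_. borel"] False rv ind by auto
  also have "\<dots> = PiM {..<N} (\<lambda>_. \<mu>)" by (intro PiM_cong) (auto simp: id)
  finally have law: "distr M (PiM {..<N} (\<lambda>_. borel)) (\<lambda>\<omega>. \<lambda>i\<in>{..<N}. D i \<omega>) = PiM {..<N} (\<lambda>_. \<mu>)" .
  have m2: "(\<lambda>d. \<lambda>i\<in>{..<N}. d (N - 1 - i)) \<in> measurable (PiM {..<N} (\<lambda>_. borel)) (PiM {..<N} (\<lambda>_. borel :: real measure))"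
    by (intro measurable_restrict measurable_component_singleton) auto
  have sb: "sets (PiM {..<N} (\<lambda>_. \<mu>)) = sets (PiM {..<N} (\<lambda>_. borel :: real measure))"
    using mu by (intro sets_PiM_cong) auto
  have rev: "distr (PiM {..<N} (\<lambda>_. \<mu>)) (PiM {..<N} (\<lambda>_. \<mu>)) (\<lambda>d. \<lambda>i\<in>{..<N}. d (N - 1 - i)) = PiM {..<N} (\<lambda>_. \<mu>)"
    by (rule distr_PiM_reindex) (use mu in \<open>auto simp: inj_on_def\<close>)
  have "(\<integral>\<^sup>+\<omega>. F (\<lambda>i\<in>{..<N}. D (N - 1 - i) \<omega>) \<partial>M)
      = (\<integral>\<^sup>+\<omega>. F ((\<lambda>d. \<lambda>i\<in>{..<N}. d (N - 1 - i)) (\<lambda>i\<in>{..<N}. D i \<omega>)) \<partial>M)"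
    by (intro nn_integral_cong arg_cong[where f=F]) (auto simp: restrict_def fun_eq_iff)
  also have "\<dots> = (\<integral>\<^sup>+d. F (\<lambda>i\<in>{..<N}. d (N - 1 - i)) \<partial>distr M (PiM {..<N} (\<lambda>_. borel)) (\<lambda>\<omega>. \<lambda>i\<in>{..<N}. D i \<omega>))"
    using m2 by (subst nn_integral_distr) auto
  also have "\<dots> = (\<integral>\<^sup>+d. F d \<partial>distr (PiM {..<N} (\<lambda>_. \<mu>)) (PiM {..<N} (\<lambda>_. \<mu>)) (\<lambda>d. \<lambda>i\<in>{..<N}. d (N - 1 - i)))"
    unfolding law by (subst nn_integral_distr) (use m2 F sb in \<open>simp_all cong: measurable_cong_sets\<close>)
  also have "\<dots> = (\<integral>\<^sup>+d. F d \<partial>distr M (PiM {..<N} (\<lambda>_. borel)) (\<lambda>\<omega>. \<lambda>i\<in>{..<N}. D i \<omega>))"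
    unfolding rev law ..
  also have "\<dots> = (\<integral>\<^sup>+\<omega>. F (\<lambda>i\<in>{..<N}. D i \<omega>) \<partial>M)"
    by (subst nn_integral_distr) auto
  finally show ?thesis .
qed (simp add: restrict_def)

text \<open>Uniform integrability from a bound on second moments, made explicit by
  \<open>y \<le> min y k + y^2 / k\<close>: the truncated variables converge by domination, and the
  remainder is at most \<open>C / k\<close> uniformly in \<open>n\<close>.\<close>

lemma (in prob_space) L2_bounded_nn_integral_tendsto:
  fixes Y :: "nat \<Rightarrow> 'a \<Rightarrow> real"
  assumes [measurable]: "\<And>n. Y n \<in> borel_measurable M" "Z \<in> borel_measurable M"
    and nonneg: "\<And>n \<omega>. 0 \<le> Y n \<omega>" "\<And>\<omega>. 0 \<le> Z \<omega>"
    and lim: "AE \<omega> in M. (\<lambda>n. Y n \<omega>) \<longlonglongrightarrow> Z \<omega>"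
    and C: "\<And>n. (\<integral>\<^sup>+\<omega>. ennreal ((Y n \<omega>)\<^sup>2) \<partial>M) \<le> ennreal C" and C0: "0 \<le> C"
  shows "(\<lambda>n. \<integral>\<^sup>+\<omega>. ennreal (Y n \<omega>) \<partial>M) \<longlonglongrightarrow> (\<integral>\<^sup>+\<omega>. ennreal (Z \<omega>) \<partial>M)"
proof -
  have fin: "(\<integral>\<^sup>+\<omega>. ennreal (Y n \<omega>) \<partial>M) \<le> ennreal (1 + C)" for n
  proof -
    have "(\<integral>\<^sup>+\<omega>. ennreal (Y n \<omega>) \<partial>M) \<le> (\<integral>\<^sup>+\<omega>. 1 + ennreal ((Y n \<omega>)\<^sup>2) \<partial>M)"
    proof (intro nn_integral_mono)
      fix \<omega>
      have "0 \<le> (Y n \<omega> - 1)\<^sup>2" by simp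
      then have "Y n \<omega> \<le> 1 + (Y n \<omega>)\<^sup>2" using nonneg(1)[of n \<omega>] by (simp add: power2_eq_square algebra_simps)
      then show "ennreal (Y n \<omega>) \<le> 1 + ennreal ((Y n \<omega>)\<^sup>2)"
        by (metis ennreal_1 ennreal_leI ennreal_plus zero_le_one zero_le_power2)
    qed
    also have "\<dots> = 1 + (\<integral>\<^sup>+\<omega>. ennreal ((Y n \<omega>)\<^sup>2) \<partial>M)"
      by (subst nn_integral_add) (auto simp: emeasure_space_1)
    also have "\<dots> \<le> 1 + ennreal C" using C by (intro add_left_mono)
    finally show ?thesis using C0 by simp
  qed
  have intY: "integrable M (Y n)" for n
    using fin[of n] nonneg by (intro integrableI_nonneg) (auto simp: less_top[symmetric] top_unique)
  have "(\<integral>\<^sup>+\<omega>. ennreal (Z \<omega>) \<partial>M) = (\<integral>\<^sup>+\<omega>. liminf (\<lambda>n. ennreal (Y n \<omega>)) \<partial>M)"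
    using lim by (intro nn_integral_cong_AE) (auto elim!: eventually_mono intro!: lim_imp_Liminf[symmetric] tendsto_ennrealI)
  also have "\<dots> \<le> liminf (\<lambda>n. \<integral>\<^sup>+\<omega>. ennreal (Y n \<omega>) \<partial>M)"
    by (intro nn_integral_liminf) auto
  also have "\<dots> \<le> ennreal (1 + C)"
    using fin by (intro Liminf_le) (auto intro!: always_eventually)
  finally have "(\<integral>\<^sup>+\<omega>. ennreal (Z \<omega>) \<partial>M) \<le> ennreal (1 + C)" .
  then have intZ: "integrable M Z"
    using nonneg by (intro integrableI_nonneg) (auto simp: less_top[symmetric] top_unique)
  have "(\<lambda>n. LINT \<omega>|M. Y n \<omega>) \<longlonglongrightarrow> (LINT \<omega>|M. Z \<omega>)"
  proof (rule LIMSEQ_I)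
    fix e :: real assume e: "0 < e"
    have "(\<lambda>k. LINT \<omega>|M. min (Z \<omega>) (real k)) \<longlonglongrightarrow> (LINT \<omega>|M. Z \<omega>)"
    proof (rule integral_dominated_convergence[where w=Z])
      show "AE \<omega> in M. (\<lambda>k. min (Z \<omega>) (real k)) \<longlonglongrightarrow> Z \<omega>"
      proof (intro AE_I2)
        fix \<omega>
        have "eventually (\<lambda>k. real k \<ge> Z \<omega>) sequentially"
          using filterlim_real_sequentially by (auto simp: filterlim_at_top)
        then have "eventually (\<lambda>k. min (Z \<omega>) (real k) = Z \<omega>) sequentially" by eventually_elim simp
        then show "(\<lambda>k. min (Z \<omega>) (real k)) \<longlonglongrightarrow> Z \<omega>" by (rule tendsto_eventually)
      qed
    qed (use nonneg intZ in auto)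
    then have "eventually (\<lambda>k. norm ((LINT \<omega>|M. min (Z \<omega>) (real k)) - (LINT \<omega>|M. Z \<omega>)) < e / 3) sequentially"
      using e by (auto dest!: tendstoD[of _ _ _ "e / 3"] simp: dist_norm)
    moreover have "eventually (\<lambda>k. C / real k < e / 3 \<and> k > 0) sequentially"
    proof -
      have "(\<lambda>k. C * (1 / real k)) \<longlonglongrightarrow> C * 0" by (intro tendsto_intros lim_1_over_n)
      then have "eventually (\<lambda>k. C / real k < e / 3) sequentially" using e by (intro order_tendstoD(2)) auto
      then show ?thesis using eventually_gt_at_top[of 0] by eventually_elim auto
    qed
    ultimately have "eventually (\<lambda>k. norm ((LINT \<omega>|M. min (Z \<omega>) (real k)) - (LINT \<omega>|M. Z \<omega>)) < e / 3 \<and> C / real k < e / 3 \<and> k > 0) sequentially"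
      by eventually_elim auto
    then obtain k where k: "norm ((LINT \<omega>|M. min (Z \<omega>) (real k)) - (LINT \<omega>|M. Z \<omega>)) < e / 3" "C / real k < e / 3" "k > 0"
      by (auto simp: eventually_sequentially)
    have "(\<lambda>n. LINT \<omega>|M. min (Y n \<omega>) (real k)) \<longlonglongrightarrow> (LINT \<omega>|M. min (Z \<omega>) (real k))"
    proof (rule integral_dominated_convergence[where w="\<lambda>_. real k"])
      show "AE \<omega> in M. (\<lambda>n. min (Y n \<omega>) (real k)) \<longlonglongrightarrow> min (Z \<omega>) (real k)"
        using lim by eventually_elim (intro tendsto_min tendsto_const)
    qed (use nonneg in auto)
    then obtain N where N: "\<And>n. n \<ge> N \<Longrightarrow> norm ((LINT \<omega>|M. min (Y n \<omega>) (real k)) - (LINT \<omega>|M. min (Z \<omega>) (real k))) < e / 3"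
      using e LIMSEQ_D[of _ _ "e / 3"] by (metis zero_less_divide_iff zero_less_numeral)
    show "\<exists>N. \<forall>n\<ge>N. norm ((LINT \<omega>|M. Y n \<omega>) - (LINT \<omega>|M. Z \<omega>)) < e"
    proof (intro exI allI impI)
      fix n assume n: "N \<le> n"
      have intm: "integrable M (\<lambda>\<omega>. min (Y n \<omega>) (real k))"
        by (rule Bochner_Integration.integrable_bound[OF intY[of n]]) (use nonneg in auto)
      have int2: "integrable M (\<lambda>\<omega>. (Y n \<omega>)\<^sup>2)"
        using C[of n] by (intro integrableI_nonneg) (auto simp: less_top[symmetric] top_unique)
      have "(LINT \<omega>|M. (Y n \<omega>)\<^sup>2) \<le> C"
        using C[of n] C0 by (subst (asm) nn_integral_eq_integral[OF int2]) auto
      moreover have "(LINT \<omega>|M. Y n \<omega>) \<le> (LINT \<omega>|M. min (Y n \<omega>) (real k) + (Y n \<omega>)\<^sup>2 / real k)"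
      proof (intro integral_mono Bochner_Integration.integrable_add intm intY integrable_divide int2)
        fix \<omega>
        show "Y n \<omega> \<le> min (Y n \<omega>) (real k) + (Y n \<omega>)\<^sup>2 / real k"
        proof (cases "Y n \<omega> \<le> real k")
          case False
          then have "Y n \<omega> * 1 \<le> Y n \<omega> * (Y n \<omega> / real k)" using k(3) nonneg(1)[of n \<omega>] by (intro mult_left_mono) auto
          then show ?thesis using False k(3) by (simp add: power2_eq_square)
        qed auto
      qed
      moreover have "\<dots> = (LINT \<omega>|M. min (Y n \<omega>) (real k)) + (LINT \<omega>|M. (Y n \<omega>)\<^sup>2) / real k"
        by (subst Bochner_Integration.integral_add[OF intm integrable_divide[OF int2]]) simp
      moreover have "(LINT \<omega>|M. min (Y n \<omega>) (real k)) \<le> (LINT \<omega>|M. Y n \<omega>)"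
        by (intro integral_mono intm intY) auto
      ultimately have "norm ((LINT \<omega>|M. Y n \<omega>) - (LINT \<omega>|M. min (Y n \<omega>) (real k))) \<le> C / real k"
        using k(3) divide_right_mono[of "LINT \<omega>|M. (Y n \<omega>)\<^sup>2" C "real k"] by auto
      then show "norm ((LINT \<omega>|M. Y n \<omega>) - (LINT \<omega>|M. Z \<omega>)) < e"
        using N[OF n] k unfolding real_norm_def by linarith
    qed
  qed
  then show ?thesis
    using nonneg by (simp add: nn_integral_eq_integral intY intZ tendsto_ennrealI)
qed

locale spectrally_negative =
  fixes M :: "'a measure" and V :: "real \<Rightarrow> 'a \<Rightarrow> real" and \<Psi> :: "real \<Rightarrow> real"
  assumes snlp: "spectrally_negative_levy_process M V" and laplace: "laplace_exponent M V \<Psi>"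
begin

lemma levy: "levy_process M V"
  using snlp by (simp add: spectrally_negative_levy_process_def)

sublocale prob_space M
  using levy by (simp add: levy_process_def)

lemma V_measurable[measurable]: "0 \<le> t \<Longrightarrow> V t \<in> borel_measurable M"
  using levy by (simp add: levy_process_def)

lemma V_cadlag: "\<omega> \<in> space M \<Longrightarrow> cadlag (\<lambda>t. V t \<omega>)"
  using levy by (simp add: levy_process_def)

lemma V_0: "AE \<omega> in M. V 0 \<omega> = 0"
  using levy by (simp add: levy_process_def)

lemma V_npj: "AE \<omega> in M. no_positive_jumps (\<lambda>t. V t \<omega>)"
  using snlp by (simp add: spectrally_negative_levy_process_def)

lemma V_increment_distr: "0 \<le> s \<Longrightarrow> s \<le> t \<Longrightarrow> distr M borel (\<lambda>\<omega>. V t \<omega> - V s \<omega>) = distr M borel (V (t - s))"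
proof -
  assume "0 \<le> s" "s \<le> t"
  moreover have "\<forall>s\<ge>0. \<forall>t\<ge>0. distr M borel (\<lambda>\<omega>. V (s + t) \<omega> - V s \<omega>) = distr M borel (V t)"
    using levy by (simp add: levy_process_def)
  ultimately have "distr M borel (\<lambda>\<omega>. V (s + (t - s)) \<omega> - V s \<omega>) = distr M borel (V (t - s))"
    by (meson diff_ge_0_iff_ge)
  then show ?thesis by simp
qed

text \<open>A non-integrable function has Bochner integral 0, whereas the Laplace exponent
  prescribes a positive value.\<close>

lemma exp_integrable: "0 \<le> t \<Longrightarrow> 0 \<le> q \<Longrightarrow> integrable M (\<lambda>\<omega>. exp (q * V t \<omega>))"
proof (rule ccontr)
  assume t: "0 \<le> t" "0 \<le> q"
  assume "\<not> integrable M (\<lambda>\<omega>. exp (q * V t \<omega>))"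
  then have "(LINT \<omega>|M. exp (q * V t \<omega>)) = 0" by (rule not_integrable_integral_eq)
  then show False using laplace t by (simp add: laplace_exponent_def)
qed

lemma exp_nn_integral:
  assumes "0 \<le> t" "0 \<le> q"
  shows "(\<integral>\<^sup>+\<omega>. ennreal (exp (q * V t \<omega>)) \<partial>M) = ennreal (exp (t * \<Psi> q))"
proof -
  have "(LINT \<omega>|M. exp (q * V t \<omega>)) = exp (t * \<Psi> q)"
    using laplace assms by (auto simp: laplace_exponent_def)
  then show ?thesis using exp_integrable[OF assms] by (subst nn_integral_eq_integral) auto
qed

lemma exp_increment_nn_integral:
  assumes "0 \<le> s" "s \<le> t" "0 \<le> q"
  shows "(\<integral>\<^sup>+\<omega>. ennreal (exp (q * (V t \<omega> - V s \<omega>))) \<partial>M) = ennreal (exp ((t - s) * \<Psi> q))"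
proof -
  have "(\<integral>\<^sup>+\<omega>. ennreal (exp (q * (V t \<omega> - V s \<omega>))) \<partial>M) = (\<integral>\<^sup>+x. ennreal (exp (q * x)) \<partial>distr M borel (\<lambda>\<omega>. V t \<omega> - V s \<omega>))"
    using assms by (subst nn_integral_distr) auto
  also have "\<dots> = (\<integral>\<^sup>+x. ennreal (exp (q * x)) \<partial>distr M borel (V (t - s)))"
    using assms by (simp add: V_increment_distr)
  also have "\<dots> = ennreal (exp ((t - s) * \<Psi> q))"
    using assms by (subst nn_integral_distr) (auto simp: exp_nn_integral)
  finally show ?thesis .
qed

lemma Psi_0: "\<Psi> 0 = 0"
proof -
  have "(LINT \<omega>|M. exp (0 * V 1 \<omega>)) = exp (1 * \<Psi> 0)"
    using laplace unfolding laplace_exponent_def by (metis order_refl zero_le_one)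
  then show ?thesis by (simp add: prob_space)
qed

text \<open>Convexity of \<open>\<Psi>\<close> by applying convexity of \<open>exp\<close> to the exponents normalised to have mean one.\<close>

lemma Psi_convex: "convex_on {0..} \<Psi>"
proof (rule convex_onI)
  fix t x y :: real assume t: "0 < t" "t < 1" and xy: "x \<in> {0..}" "y \<in> {0..}"
  define z where "z = (1 - t) * x + t * y"
  have z: "0 \<le> z" using t xy by (simp add: z_def)
  define c where "c = (1 - t) * \<Psi> x + t * \<Psi> y"
  have mean: "(LINT \<omega>|M. exp (q * V 1 \<omega>)) = exp (\<Psi> q)" if "0 \<le> q" for q
    using laplace that unfolding laplace_exponent_def by (metis mult_1 zero_le_one)
  have int: "integrable M (\<lambda>\<omega>. exp (q * V 1 \<omega> - a))" and val: "(LINT \<omega>|M. exp (q * V 1 \<omega> - a)) = exp (\<Psi> q - a)" if "0 \<le> q" for q a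
    using exp_integrable[of 1 q] mean[OF that] that by (auto simp: exp_diff)
  have "exp (\<Psi> z - c) = (LINT \<omega>|M. exp (z * V 1 \<omega> - c))" using val[OF z] by simp
  also have "\<dots> \<le> (LINT \<omega>|M. (1 - t) * exp (x * V 1 \<omega> - \<Psi> x) + t * exp (y * V 1 \<omega> - \<Psi> y))"
  proof (intro integral_mono Bochner_Integration.integrable_add integrable_mult_right int)
    fix \<omega>
    have "exp ((1 - t) *\<^sub>R (x * V 1 \<omega> - \<Psi> x) + t *\<^sub>R (y * V 1 \<omega> - \<Psi> y))
        \<le> (1 - t) * exp (x * V 1 \<omega> - \<Psi> x) + t * exp (y * V 1 \<omega> - \<Psi> y)"
      using t by (intro convex_onD[OF exp_convex]) auto
    also have "(1 - t) *\<^sub>R (x * V 1 \<omega> - \<Psi> x) + t *\<^sub>R (y * V 1 \<omega> - \<Psi> y) = z * V 1 \<omega> - c"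
      by (simp add: z_def c_def algebra_simps)
    finally show "exp (z * V 1 \<omega> - c) \<le> (1 - t) * exp (x * V 1 \<omega> - \<Psi> x) + t * exp (y * V 1 \<omega> - \<Psi> y)" .
  qed (use z xy in auto)
  also have "\<dots> = (1 - t) * 1 + t * 1"
    using xy by (subst Bochner_Integration.integral_add) (auto intro!: integrable_mult_right int simp: val)
  finally have "\<Psi> z \<le> c" by simp
  then show "\<Psi> ((1 - t) *\<^sub>R x + t *\<^sub>R y) \<le> (1 - t) * \<Psi> x + t * \<Psi> y" by (simp add: z_def c_def)
qed auto

section \<open>Optional stopping on a grid\<close>

lemma grid_indep:
  assumes "0 \<le> h"
  shows "indep_vars (\<lambda>_. borel) (\<lambda>i \<omega>. V (real (Suc i) * h) \<omega> - V (real i * h) \<omega>) {..<n}"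
proof -
  have "\<forall>n. \<forall>\<tau> :: nat \<Rightarrow> real. 0 \<le> \<tau> 0 \<and> (\<forall>i<n. \<tau> i \<le> \<tau> (Suc i)) \<longrightarrow>
        prob_space.indep_vars M (\<lambda>_. borel) (\<lambda>i \<omega>. V (\<tau> (Suc i)) \<omega> - V (\<tau> i) \<omega>) {..<n}"
    using levy by (simp add: levy_process_def)
  from this[rule_format, of "\<lambda>i. real i * h" n] show ?thesis
    using assms by (simp add: mult_right_mono)
qed

lemma grid_telescope:
  "(\<Sum>i<k. V (real (Suc i) * h) \<omega> - V (real i * h) \<omega>) = V (real k * h) \<omega> - V 0 \<omega>"
  by (induction k) auto

text \<open>That \<open>k\<close> is the first grid index above \<open>z\<close> depends on the
  first \<open>k\<close> increments, and \<open>V (N h) - V (k h)\<close> on the later ones.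
  Independence therefore replaces the exponential of the latter by its mean.\<close>

lemma grid_stopping_term:
  assumes h: "0 \<le> h" and q: "0 \<le> q" and k: "k \<le> N"
  shows "(\<integral>\<^sup>+\<omega>. indicator {\<omega>. z < V (real k * h) \<omega> \<and> (\<forall>j<k. V (real j * h) \<omega> \<le> z)} \<omega> * ennreal (exp (q * V (real N * h) \<omega>)) \<partial>M)
    = (\<integral>\<^sup>+\<omega>. indicator {\<omega>. z < V (real k * h) \<omega> \<and> (\<forall>j<k. V (real j * h) \<omega> \<le> z)} \<omega>
         * ennreal (exp (q * V (real k * h) \<omega> + (real N * h - real k * h) * \<Psi> q)) \<partial>M)"
proof -
  define D where "D = (\<lambda>i \<omega>. V (real (Suc i) * h) \<omega> - V (real i * h) \<omega>)"
  have ind: "indep_vars (\<lambda>_. borel) D {..<N}" unfolding D_def by (rule grid_indep[OF h])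
  define A where "A = (\<lambda>d :: nat \<Rightarrow> real. if z < (\<Sum>i<k. d i) \<and> (\<forall>j\<in>{..<k}. (\<Sum>i<j. d i) \<le> z) then ennreal (exp (q * (\<Sum>i<k. d i))) else 0)"
  define B where "B = (\<lambda>d :: nat \<Rightarrow> real. ennreal (exp (q * (\<Sum>i\<in>{k..<N}. d i))))"
  have comp: "(\<lambda>d :: nat \<Rightarrow> real. \<Sum>i<j. d i) \<in> borel_measurable (PiM {..<k} (\<lambda>_. borel))" if "j \<le> k" for j
    using that by (intro borel_measurable_sum measurable_component_singleton) auto
  have [measurable]: "A \<in> borel_measurable (PiM {..<k} (\<lambda>_. borel))"
    unfolding A_def
  proof (intro measurable_If measurable_const)
    show "{d \<in> space (PiM {..<k} (\<lambda>_. borel)). z < (\<Sum>i<k. d i) \<and> (\<forall>j\<in>{..<k}. (\<Sum>i<j. d i) \<le> z)} \<in> sets (PiM {..<k} (\<lambda>_. borel))"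
      using comp by (intro sets.sets_Collect_conj sets.sets_Collect_finite_All borel_measurable_less borel_measurable_le) auto
  qed (use comp[of k] in measurable)
  have [measurable]: "B \<in> borel_measurable (PiM {k..<N} (\<lambda>_. borel))"
  proof -
    have "(\<lambda>d :: nat \<Rightarrow> real. \<Sum>i\<in>{k..<N}. d i) \<in> borel_measurable (PiM {k..<N} (\<lambda>_. borel))"
      by (intro borel_measurable_sum measurable_component_singleton) auto
    then show ?thesis unfolding B_def by measurable
  qed
  have "indep_var borel (A \<circ> (\<lambda>\<omega>. restrict (\<lambda>i. D i \<omega>) {..<k})) borel (B \<circ> (\<lambda>\<omega>. restrict (\<lambda>i. D i \<omega>) {k..<N}))"
    using k by (intro indep_var_compose[OF indep_var_restrict[OF ind]]) auto
  from indep_var_nn_integral_mult[OF this]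
  have prod: "(\<integral>\<^sup>+\<omega>. A (restrict (\<lambda>i. D i \<omega>) {..<k}) * B (restrict (\<lambda>i. D i \<omega>) {k..<N}) \<partial>M) =
     (\<integral>\<^sup>+\<omega>. A (restrict (\<lambda>i. D i \<omega>) {..<k}) \<partial>M) * (\<integral>\<^sup>+\<omega>. B (restrict (\<lambda>i. D i \<omega>) {k..<N}) \<partial>M)"
    by simp
  have Aeq: "A (restrict (\<lambda>i. D i \<omega>) {..<k}) =
      indicator {\<omega>. z < V (real k * h) \<omega> \<and> (\<forall>j<k. V (real j * h) \<omega> \<le> z)} \<omega> * ennreal (exp (q * V (real k * h) \<omega>))"
    if "V 0 \<omega> = 0" for \<omega>
  proof -
    have "(\<Sum>i<j. restrict (\<lambda>i. D i \<omega>) {..<k} i) = V (real j * h) \<omega>" if "j \<le> k" for j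
      using that grid_telescope[of h \<omega> j] \<open>V 0 \<omega> = 0\<close> by (simp add: D_def)
    then show ?thesis by (auto simp: A_def indicator_def)
  qed
  have Beq: "B (restrict (\<lambda>i. D i \<omega>) {k..<N}) = ennreal (exp (q * (V (real N * h) \<omega> - V (real k * h) \<omega>)))" for \<omega>
  proof -
    have "(\<Sum>i\<in>{k..<N}. D i \<omega>) = (\<Sum>i<N. D i \<omega>) - (\<Sum>i<k. D i \<omega>)"
      using k sum_diff_nat_ivl[of 0 k N "\<lambda>i. D i \<omega>"] by (simp add: lessThan_atLeast0)
    also have "\<dots> = V (real N * h) \<omega> - V (real k * h) \<omega>" unfolding D_def grid_telescope by simp
    finally show ?thesis by (simp add: B_def)
  qed
  have kN: "0 \<le> real k * h" "real k * h \<le> real N * h" using h k by (auto intro: mult_right_mono)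
  have "(\<integral>\<^sup>+\<omega>. indicator {\<omega>. z < V (real k * h) \<omega> \<and> (\<forall>j<k. V (real j * h) \<omega> \<le> z)} \<omega> * ennreal (exp (q * V (real N * h) \<omega>)) \<partial>M)
    = (\<integral>\<^sup>+\<omega>. A (restrict (\<lambda>i. D i \<omega>) {..<k}) * B (restrict (\<lambda>i. D i \<omega>) {k..<N}) \<partial>M)"
  proof (rule nn_integral_cong_AE)
    show "AE \<omega> in M. indicator {\<omega>. z < V (real k * h) \<omega> \<and> (\<forall>j<k. V (real j * h) \<omega> \<le> z)} \<omega> * ennreal (exp (q * V (real N * h) \<omega>))
        = A (restrict (\<lambda>i. D i \<omega>) {..<k}) * B (restrict (\<lambda>i. D i \<omega>) {k..<N})"
      using V_0
    proof eventually_elim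
      case (elim \<omega>)
      have "exp (q * V (real N * h) \<omega>) = exp (q * V (real k * h) \<omega>) * exp (q * (V (real N * h) \<omega> - V (real k * h) \<omega>))"
        by (simp add: exp_add[symmetric] algebra_simps)
      then show ?case unfolding Aeq[OF elim] Beq by (simp add: ennreal_mult mult.assoc)
    qed
  qed
  also have "\<dots> = (\<integral>\<^sup>+\<omega>. A (restrict (\<lambda>i. D i \<omega>) {..<k}) \<partial>M) * ennreal (exp ((real N * h - real k * h) * \<Psi> q))"
    using prod exp_increment_nn_integral[OF kN q] unfolding Beq by simp
  also have "(\<integral>\<^sup>+\<omega>. A (restrict (\<lambda>i. D i \<omega>) {..<k}) \<partial>M)
     = (\<integral>\<^sup>+\<omega>. indicator {\<omega>. z < V (real k * h) \<omega> \<and> (\<forall>j<k. V (real j * h) \<omega> \<le> z)} \<omega> * ennreal (exp (q * V (real k * h) \<omega>)) \<partial>M)"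
    by (rule nn_integral_cong_AE) (use V_0 in \<open>auto elim!: eventually_mono simp: Aeq\<close>)
  also have "\<dots> * ennreal (exp ((real N * h - real k * h) * \<Psi> q)) =
     (\<integral>\<^sup>+\<omega>. indicator {\<omega>. z < V (real k * h) \<omega> \<and> (\<forall>j<k. V (real j * h) \<omega> \<le> z)} \<omega> * ennreal (exp (q * V (real k * h) \<omega>))
       * ennreal (exp ((real N * h - real k * h) * \<Psi> q)) \<partial>M)"
  proof (rule nn_integral_multc[symmetric])
    have Vm: "V (real j * h) \<in> borel_measurable M" for j using h by simp
    have "{\<omega> \<in> space M. z < V (real k * h) \<omega> \<and> (\<forall>j\<in>{..<k}. V (real j * h) \<omega> \<le> z)} \<in> sets M"
      using Vm by (intro sets.sets_Collect_conj sets.sets_Collect_finite_All borel_measurable_less borel_measurable_le) auto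
    then have "(\<lambda>\<omega>. indicator {\<omega>. z < V (real k * h) \<omega> \<and> (\<forall>j<k. V (real j * h) \<omega> \<le> z)} \<omega> :: ennreal) \<in> borel_measurable M"
      by (intro borel_measurable_indicator') (auto simp: Collect_conj_eq lessThan_def)
    then show "(\<lambda>\<omega>. indicator {\<omega>. z < V (real k * h) \<omega> \<and> (\<forall>j<k. V (real j * h) \<omega> \<le> z)} \<omega> * ennreal (exp (q * V (real k * h) \<omega>))) \<in> borel_measurable M"
      using Vm[of k] by measurable
  qed
  also have "\<dots> = (\<integral>\<^sup>+\<omega>. indicator {\<omega>. z < V (real k * h) \<omega> \<and> (\<forall>j<k. V (real j * h) \<omega> \<le> z)} \<omega>
         * ennreal (exp (q * V (real k * h) \<omega> + (real N * h - real k * h) * \<Psi> q)) \<partial>M)"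
    by (simp add: exp_add ennreal_mult mult.assoc)
  finally show ?thesis .
qed

end

text \<open>At most one index can be the first with property \<open>Q\<close>, so a decomposition
  over first indices is a value at \<open>LEAST\<close>.\<close>

lemma sum_first:
  fixes c :: "nat \<Rightarrow> 'a::comm_monoid_add" and N :: nat
  shows "(\<Sum>k\<le>N. if Q k \<and> (\<forall>j<k. \<not> Q j) then c k else 0) = (if \<exists>k\<le>N. Q k then c (LEAST k. Q k) else 0)"
proof (cases "\<exists>k\<le>N. Q k")
  case True
  then obtain k where k: "k \<le> N" "Q k" by auto
  define m where "m = (LEAST k. Q k)"
  have m1: "Q m" unfolding m_def using k(2) by (rule LeastI)
  have "m \<le> k" unfolding m_def using k(2) by (rule Least_le)
  then have m2: "m \<le> N" using k(1) by simp
  have m3: "\<not> Q j" if "j < m" for j using not_less_Least that unfolding m_def .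
  have "Q k \<and> (\<forall>j<k. \<not> Q j) \<longleftrightarrow> k = m" for k
  proof
    assume "Q k \<and> (\<forall>j<k. \<not> Q j)"
    then show "k = m" using m1 m3[of k] by (cases k m rule: linorder_cases) auto
  next
    assume "k = m"
    then show "Q k \<and> (\<forall>j<k. \<not> Q j)" using m1 m3 by blast
  qed
  then have "(\<Sum>k\<le>N. if Q k \<and> (\<forall>j<k. \<not> Q j) then c k else 0) = (\<Sum>k\<le>N. if k = m then c k else 0)"
    by simp
  also have "\<dots> = c m" using m2 by simp
  finally show ?thesis using True unfolding m_def by (simp only: if_True)
next
  case False
  then have "(\<Sum>k\<le>N. if Q k \<and> (\<forall>j<k. \<not> Q j) then c k else 0) = (\<Sum>k\<le>N. 0)"
    by (intro sum.cong) auto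
  then show ?thesis using False by (simp only: if_False) simp
qed

context spectrally_negative
begin

definition T :: "real \<Rightarrow> 'a \<Rightarrow> ennreal" where
  "T z \<omega> = passage (\<lambda>t. V t \<omega>) z"

lemma T_measurable: "(\<lambda>(z, \<omega>). T z \<omega>) \<in> borel_measurable (borel \<Otimes>\<^sub>M M)"
  unfolding T_def passage_def split_beta
proof (intro borel_measurable_INF)
  show "countable (\<rat> \<inter> {0::real..})" using countable_rat by blast
  fix s :: real assume "s \<in> \<rat> \<inter> {0..}"
  then have [measurable]: "V s \<in> borel_measurable M" by auto
  show "(\<lambda>p. if fst p < V s (snd p) then ennreal s else \<infinity>) \<in> borel_measurable (borel \<Otimes>\<^sub>M M)" by measurable
qed

lemma T_measurable1[measurable]: "T z \<in> borel_measurable M"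
proof -
  have "(\<lambda>\<omega>. (\<lambda>(z, \<omega>). T z \<omega>) (z, \<omega>)) \<in> borel_measurable M"
    by (rule measurable_compose[OF _ T_measurable]) simp
  then show ?thesis by simp
qed

text \<open>Conditional expectation of \<open>exp (q * V (N * h))\<close>, on the event that the
  grid exceeds \<open>z\<close>, given the grid path up to the first time it does so.\<close>

definition stopped :: "real \<Rightarrow> real \<Rightarrow> nat \<Rightarrow> real \<Rightarrow> 'a \<Rightarrow> real" where
  "stopped q h N z \<omega> = (\<Sum>k\<le>N. if z < V (real k * h) \<omega> \<and> (\<forall>j<k. \<not> z < V (real j * h) \<omega>)
     then exp (q * V (real k * h) \<omega> + (real N * h - real k * h) * \<Psi> q) else 0)"

lemma stopped_eq:
  "stopped q h N z \<omega> = (if \<exists>k\<le>N. z < V (real k * h) \<omega>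
     then exp (q * V (real (LEAST k. z < V (real k * h) \<omega>) * h) \<omega> + (real N * h - real (LEAST k. z < V (real k * h) \<omega>) * h) * \<Psi> q) else 0)"
  unfolding stopped_def
  by (rule sum_first[of "\<lambda>k. z < V (real k * h) \<omega>" "\<lambda>k. exp (q * V (real k * h) \<omega> + (real N * h - real k * h) * \<Psi> q)" N])

lemma first_measurable: "0 \<le> h \<Longrightarrow> {\<omega> \<in> space M. z < V (real k * h) \<omega> \<and> (\<forall>j<k. \<not> z < V (real j * h) \<omega>)} \<in> sets M"
proof -
  assume h: "0 \<le> h"
  have Vm: "V (real j * h) \<in> borel_measurable M" for j using h by simp
  have "{\<omega> \<in> space M. z < V (real k * h) \<omega> \<and> (\<forall>j\<in>{..<k}. V (real j * h) \<omega> \<le> z)} \<in> sets M"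
    using Vm by (intro sets.sets_Collect_conj sets.sets_Collect_finite_All borel_measurable_less borel_measurable_le) auto
  then show ?thesis by (simp add: not_less lessThan_def)
qed

lemma stopped_measurable: "0 \<le> h \<Longrightarrow> stopped q h N z \<in> borel_measurable M"
proof -
  assume h: "0 \<le> h"
  have [measurable]: "V (real j * h) \<in> borel_measurable M" for j using h by simp
  show ?thesis
    unfolding stopped_def[abs_def]
    by (intro borel_measurable_sum measurable_If first_measurable h) auto
qed

lemma hit_measurable: "0 \<le> h \<Longrightarrow> {\<omega> \<in> space M. \<exists>k\<le>N. z < V (real k * h) \<omega>} \<in> sets M"
proof -
  assume h: "0 \<le> h"
  have Vm: "V (real j * h) \<in> borel_measurable M" for j using h by simp
  have "{\<omega> \<in> space M. \<exists>k\<in>{..N}. z < V (real k * h) \<omega>} \<in> sets M"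
    using Vm by (intro sets.sets_Collect_finite_Ex borel_measurable_less) auto
  moreover have "{\<omega> \<in> space M. \<exists>k\<in>{..N}. z < V (real k * h) \<omega>} = {\<omega> \<in> space M. \<exists>k\<le>N. z < V (real k * h) \<omega>}" by blast
  ultimately show ?thesis by (simp only:)
qed

lemma grid_stopping:
  assumes h: "0 \<le> h" and q: "0 \<le> q"
  shows "(\<integral>\<^sup>+\<omega>. (if \<exists>k\<le>N. z < V (real k * h) \<omega> then ennreal (exp (q * V (real N * h) \<omega>)) else 0) \<partial>M)
    = (\<integral>\<^sup>+\<omega>. ennreal (stopped q h N z \<omega>) \<partial>M)"
proof -
  have [measurable]: "V (real j * h) \<in> borel_measurable M" for j using h by simp
  let ?A = "\<lambda>k. {\<omega>. z < V (real k * h) \<omega> \<and> (\<forall>j<k. V (real j * h) \<omega> \<le> z)}"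
  have A: "?A k \<inter> space M \<in> sets M" for k
    using first_measurable[OF h, of z k] by (simp add: not_less Collect_conj_eq Int_commute)
  have "(\<integral>\<^sup>+\<omega>. (if \<exists>k\<le>N. z < V (real k * h) \<omega> then ennreal (exp (q * V (real N * h) \<omega>)) else 0) \<partial>M)
     = (\<integral>\<^sup>+\<omega>. (\<Sum>k\<le>N. indicator (?A k) \<omega> * ennreal (exp (q * V (real N * h) \<omega>))) \<partial>M)"
  proof (intro nn_integral_cong)
    fix \<omega>
    have "(if \<exists>k\<le>N. z < V (real k * h) \<omega> then ennreal (exp (q * V (real N * h) \<omega>)) else 0)
      = (\<Sum>k\<le>N. if z < V (real k * h) \<omega> \<and> (\<forall>j<k. \<not> z < V (real j * h) \<omega>) then ennreal (exp (q * V (real N * h) \<omega>)) else 0)"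
      by (rule sum_first[symmetric])
    also have "\<dots> = (\<Sum>k\<le>N. indicator (?A k) \<omega> * ennreal (exp (q * V (real N * h) \<omega>)))"
      by (rule sum.cong) (simp_all add: not_less)
    finally show "(if \<exists>k\<le>N. z < V (real k * h) \<omega> then ennreal (exp (q * V (real N * h) \<omega>)) else 0) = \<dots>" .
  qed
  also have "\<dots> = (\<Sum>k\<le>N. \<integral>\<^sup>+\<omega>. indicator (?A k) \<omega> * ennreal (exp (q * V (real N * h) \<omega>)) \<partial>M)"
    using A by (intro nn_integral_sum borel_measurable_times_ennreal borel_measurable_indicator') auto
  also have "\<dots> = (\<Sum>k\<le>N. \<integral>\<^sup>+\<omega>. indicator (?A k) \<omega> * ennreal (exp (q * V (real k * h) \<omega> + (real N * h - real k * h) * \<Psi> q)) \<partial>M)"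
    by (intro sum.cong grid_stopping_term h q) auto
  also have "\<dots> = (\<integral>\<^sup>+\<omega>. (\<Sum>k\<le>N. indicator (?A k) \<omega> * ennreal (exp (q * V (real k * h) \<omega> + (real N * h - real k * h) * \<Psi> q))) \<partial>M)"
    using A by (intro nn_integral_sum[symmetric] borel_measurable_times_ennreal borel_measurable_indicator') auto
  also have "\<dots> = (\<integral>\<^sup>+\<omega>. ennreal (stopped q h N z \<omega>) \<partial>M)"
    unfolding stopped_def
  proof (intro nn_integral_cong)
    fix \<omega>
    show "(\<Sum>k\<le>N. indicator (?A k) \<omega> * ennreal (exp (q * V (real k * h) \<omega> + (real N * h - real k * h) * \<Psi> q)))
      = ennreal (\<Sum>k\<le>N. if z < V (real k * h) \<omega> \<and> (\<forall>j<k. \<not> z < V (real j * h) \<omega>)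
         then exp (q * V (real k * h) \<omega> + (real N * h - real k * h) * \<Psi> q) else 0)"
      by (subst sum_ennreal[symmetric]) (simp, rule sum.cong, simp_all add: not_less)
  qed
  finally show ?thesis .
qed

lemma Psi_double: "0 \<le> q \<Longrightarrow> 2 * \<Psi> q \<le> \<Psi> (2 * q)"
proof -
  assume q: "0 \<le> q"
  have "\<Psi> ((1 - 1 / 2) *\<^sub>R 0 + (1 / 2) *\<^sub>R (2 * q)) \<le> (1 - 1 / 2) * \<Psi> 0 + (1 / 2) * \<Psi> (2 * q)"
    using q by (intro convex_onD[OF Psi_convex]) auto
  then show ?thesis by (simp add: Psi_0)
qed

text \<open>Squaring doubles both \<open>q\<close> and \<open>\<Psi> q\<close> in the exponent, and
  \<open>2 * \<Psi> q \<le> \<Psi> (2 * q)\<close> by convexity. Second moments are thus bounded by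
  first moments at \<open>2 * q\<close>, which optional stopping controls uniformly over all
  grids.\<close>

lemma stopped_square:
  assumes "0 \<le> h" "0 \<le> q"
  shows "(stopped q h N z \<omega>)\<^sup>2 \<le> stopped (2 * q) h N z \<omega>"
proof (cases "\<exists>k\<le>N. z < V (real k * h) \<omega>")
  case True
  define k where "k = (LEAST k. z < V (real k * h) \<omega>)"
  obtain m where m: "m \<le> N" "z < V (real m * h) \<omega>" using True by auto
  have "k \<le> N" using Least_le[of "\<lambda>k. z < V (real k * h) \<omega>" m] m by (simp add: k_def)
  then have c: "0 \<le> real N * h - real k * h" using assms by (simp add: mult_right_mono)
  have "(exp (q * V (real k * h) \<omega> + (real N * h - real k * h) * \<Psi> q))\<^sup>2
     = exp (2 * q * V (real k * h) \<omega> + (real N * h - real k * h) * (2 * \<Psi> q))"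
    by (simp add: exp_double[symmetric] algebra_simps)
  also have "\<dots> \<le> exp (2 * q * V (real k * h) \<omega> + (real N * h - real k * h) * \<Psi> (2 * q))"
    using mult_left_mono[OF Psi_double[OF assms(2)] c] by simp
  finally show ?thesis using True by (simp add: stopped_eq k_def)
next
  case False
  then show ?thesis unfolding stopped_eq by (simp only: if_False) simp
qed

lemma stopped_nonneg: "0 \<le> stopped q h N z \<omega>"
  unfolding stopped_def by (rule sum_nonneg) simp

section \<open>The passage identity and its consequences\<close>

lemma T_less_iff: "AE \<omega> in M. T z \<omega> < ennreal t \<longleftrightarrow> (\<exists>s. 0 \<le> s \<and> s \<le> t \<and> z < V s \<omega>)"
  if "0 < z" "0 \<le> t"
  using V_0 V_npj AE_space
proof eventually_elim
  case (elim \<omega>)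
  show ?case
    unfolding T_def by (rule passage_less_iff') (use elim V_cadlag that in auto)
qed

text \<open>Optional stopping of the exponential martingale, restricted to passage before
  \<open>t\<close>; the value at passage is exactly \<open>z\<close>, hence the explicit integrand.
  Both sides of the grid identity are taken to the limit, the stopped side by the second moment
  bound, since the overshoot on the grid offers no dominating variable, the other side by
  domination.\<close>

lemma exp_passage:
  assumes z: "0 < z" and t: "0 < t" and q: "0 \<le> q"
  shows "(\<integral>\<^sup>+\<omega>. (if T z \<omega> < ennreal t then ennreal (exp (q * V t \<omega>)) else 0) \<partial>M)
    = (\<integral>\<^sup>+\<omega>. (if T z \<omega> < ennreal t then ennreal (exp (q * z + (t - enn2real (T z \<omega>)) * \<Psi> q)) else 0) \<partial>M)"
proof -
  define h where "h = (\<lambda>n::nat. t / 2 ^ n)"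
  have h: "0 \<le> h n" for n using t by (simp add: h_def)
  have Nh: "real ((2::nat) ^ n) * h n = t" for n by (simp add: h_def)
  have kh: "real k * h n = real k * t / 2 ^ n" for k n by (simp add: h_def)
  define Z where "Z = (\<lambda>\<omega>. if T z \<omega> < ennreal t then exp (q * z + (t - enn2real (T z \<omega>)) * \<Psi> q) else 0)"
  have [measurable]: "Z \<in> borel_measurable M" unfolding Z_def by measurable
  have Vt[measurable]: "V t \<in> borel_measurable M" using t by simp
  have "(\<lambda>n. \<integral>\<^sup>+\<omega>. ennreal (stopped q (h n) (2 ^ n) z \<omega>) \<partial>M) \<longlonglongrightarrow> (\<integral>\<^sup>+\<omega>. ennreal (Z \<omega>) \<partial>M)"
  proof (rule L2_bounded_nn_integral_tendsto[where C="exp (t * \<Psi> (2 * q))"])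
    show "AE \<omega> in M. (\<lambda>n. stopped q (h n) (2 ^ n) z \<omega>) \<longlonglongrightarrow> Z \<omega>"
      using V_0 V_npj T_less_iff[OF z less_imp_le[OF t]] AE_space
    proof eventually_elim
      case (elim \<omega>)
      let ?f = "\<lambda>t. V t \<omega>"
      note f = V_cadlag[OF elim(4)] elim(2,1) z
      show ?case
      proof (cases "T z \<omega> < ennreal t")
        case True
        then obtain s where s: "0 \<le> s" "s \<le> t" "z < V s \<omega>" using elim(3) by auto
        define I where "I = Inf {s. 0 \<le> s \<and> z < V s \<omega>}"
        have TI: "T z \<omega> = ennreal I" unfolding T_def I_def by (rule passage_eq_Inf[OF f(1) s(1,3)])
        note p = passage_path[OF f s, folded I_def]
        define \<tau> where "\<tau> = (\<lambda>n. real (LEAST k. z < V (real k * t / 2 ^ n) \<omega>) * t / 2 ^ n)"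
        have "(\<lambda>n. V (\<tau> n) \<omega>) \<longlonglongrightarrow> V I \<omega>"
          unfolding \<tau>_def by (rule filterlim_compose[OF cadlag_right_tendsto[OF f(1) p(1)] p(5)])
        moreover have "\<tau> \<longlonglongrightarrow> I" using p(5) by (simp add: \<tau>_def filterlim_at)
        ultimately have "(\<lambda>n. exp (q * V (\<tau> n) \<omega> + (t - \<tau> n) * \<Psi> q)) \<longlonglongrightarrow> exp (q * V I \<omega> + (t - I) * \<Psi> q)"
          by (intro tendsto_intros)
        moreover have "Z \<omega> = exp (q * V I \<omega> + (t - I) * \<Psi> q)"
          using True p by (simp add: Z_def TI)
        moreover have "eventually (\<lambda>n. exp (q * V (\<tau> n) \<omega> + (t - \<tau> n) * \<Psi> q) = stopped q (h n) (2 ^ n) z \<omega>) sequentially"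
          using p(4) by eventually_elim (unfold stopped_eq Nh, simp add: kh \<tau>_def)
        ultimately show ?thesis by (auto intro: Lim_transform_eventually)
      next
        case False
        have "stopped q (h n) (2 ^ n) z \<omega> = 0" for n
        proof -
          have "\<not> z < V (real k * h n) \<omega>" if "k \<le> 2 ^ n" for k
          proof -
            have "real k * h n \<in> dyadic t" using that by (auto simp: dyadic_def kh)
            then have "real k * h n \<in> {0..t}" using dyadic_subset[of t] t by auto
            then show ?thesis using False elim(3) by auto
          qed
          then show ?thesis unfolding stopped_eq by meson
        qed
        then show ?thesis using False by (simp add: Z_def)
      qed
    qed
    show "(\<integral>\<^sup>+\<omega>. ennreal ((stopped q (h n) (2 ^ n) z \<omega>)\<^sup>2) \<partial>M) \<le> ennreal (exp (t * \<Psi> (2 * q)))" for n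
    proof -
      have "(\<integral>\<^sup>+\<omega>. ennreal ((stopped q (h n) (2 ^ n) z \<omega>)\<^sup>2) \<partial>M) \<le> (\<integral>\<^sup>+\<omega>. ennreal (stopped (2 * q) (h n) (2 ^ n) z \<omega>) \<partial>M)"
        using h q by (intro nn_integral_mono ennreal_leI stopped_square)
      also have "\<dots> \<le> (\<integral>\<^sup>+\<omega>. ennreal (exp (2 * q * V t \<omega>)) \<partial>M)"
      proof -
        have "(\<integral>\<^sup>+\<omega>. ennreal (stopped (2 * q) (h n) (2 ^ n) z \<omega>) \<partial>M)
          = (\<integral>\<^sup>+\<omega>. (if \<exists>k\<le>2 ^ n. z < V (real k * h n) \<omega> then ennreal (exp (2 * q * V (real ((2::nat) ^ n) * h n) \<omega>)) else 0) \<partial>M)"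
          using h[of n] q by (intro grid_stopping[symmetric]) auto
        also have "\<dots> \<le> (\<integral>\<^sup>+\<omega>. ennreal (exp (2 * q * V t \<omega>)) \<partial>M)"
          unfolding Nh by (intro nn_integral_mono) simp
        finally show ?thesis .
      qed
      also have "\<dots> = ennreal (exp (t * \<Psi> (2 * q)))" using t q by (intro exp_nn_integral) auto
      finally show ?thesis .
    qed
  qed (auto intro: stopped_measurable h stopped_nonneg simp: Z_def)
  moreover have "(\<lambda>n. \<integral>\<^sup>+\<omega>. ennreal (stopped q (h n) (2 ^ n) z \<omega>) \<partial>M)
     \<longlonglongrightarrow> (\<integral>\<^sup>+\<omega>. (if T z \<omega> < ennreal t then ennreal (exp (q * V t \<omega>)) else 0) \<partial>M)"
    unfolding grid_stopping[OF h q, symmetric] Nh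
  proof (rule nn_integral_dominated_convergence[where w="\<lambda>\<omega>. ennreal (exp (q * V t \<omega>))"])
    show "AE \<omega> in M. (\<lambda>n. if \<exists>k\<le>2 ^ n. z < V (real k * h n) \<omega> then ennreal (exp (q * V t \<omega>)) else 0)
        \<longlonglongrightarrow> (if T z \<omega> < ennreal t then ennreal (exp (q * V t \<omega>)) else 0)"
      using V_0 V_npj T_less_iff[OF z less_imp_le[OF t]] AE_space
    proof eventually_elim
      case (elim \<omega>)
      note f = V_cadlag[OF elim(4)] elim(2,1) z
      show ?case
      proof (cases "T z \<omega> < ennreal t")
        case True
        then obtain s where s: "0 \<le> s" "s \<le> t" "z < V s \<omega>" using elim(3) by auto
        have "eventually (\<lambda>n. (if \<exists>k\<le>2 ^ n. z < V (real k * h n) \<omega> then ennreal (exp (q * V t \<omega>)) else 0)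
            = (if T z \<omega> < ennreal t then ennreal (exp (q * V t \<omega>)) else 0)) sequentially"
          using passage_path(4)[OF f s] by eventually_elim (use True in \<open>simp add: kh\<close>)
        then show ?thesis by (rule tendsto_eventually)
      next
        case False
        have "\<not> z < V (real k * h n) \<omega>" if "k \<le> 2 ^ n" for k n
        proof -
          have "real k * h n \<in> dyadic t" using that by (auto simp: dyadic_def kh)
          then have "real k * h n \<in> {0..t}" using dyadic_subset[of t] t by auto
          then show ?thesis using False elim(3) by auto
        qed
        then have "(if \<exists>k\<le>2 ^ n. z < V (real k * h n) \<omega> then ennreal (exp (q * V t \<omega>)) else 0) = 0" for n by auto
        then show ?thesis using False by simp
      qed
    qed
    show "(\<integral>\<^sup>+\<omega>. ennreal (exp (q * V t \<omega>)) \<partial>M) < \<infinity>"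
      using exp_nn_integral[of t q] t q by simp
  qed (use h hit_measurable in \<open>auto intro!: measurable_If\<close>)
  ultimately have "(\<integral>\<^sup>+\<omega>. (if T z \<omega> < ennreal t then ennreal (exp (q * V t \<omega>)) else 0) \<partial>M) = (\<integral>\<^sup>+\<omega>. ennreal (Z \<omega>) \<partial>M)"
    by (rule LIMSEQ_unique[rotated])
  also have "\<dots> = (\<integral>\<^sup>+\<omega>. (if T z \<omega> < ennreal t then ennreal (exp (q * z + (t - enn2real (T z \<omega>)) * \<Psi> q)) else 0) \<partial>M)"
    by (intro nn_integral_cong) (simp add: Z_def)
  finally show ?thesis .
qed

text \<open>The discount \<open>exp (- (r * T))\<close>, set to 0 on paths that never pass; for
  \<open>r = 0\<close> it is the indicator of passage.\<close>

definition eT :: "real \<Rightarrow> real \<Rightarrow> 'a \<Rightarrow> ennreal" where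
  "eT r z \<omega> = (if T z \<omega> < \<infinity> then ennreal (exp (- (enn2real (T z \<omega>) * r))) else 0)"

lemma eT_measurable[measurable]: "eT r z \<in> borel_measurable M"
  unfolding eT_def[abs_def] by measurable

lemma T_less_top: "T z \<omega> < ennreal t \<Longrightarrow> T z \<omega> < \<infinity>"
  by (simp add: order.strict_trans[OF _ ennreal_less_top])

text \<open>Take the passage identity at time \<open>n\<close> and divide by
  \<open>exp (n * \<Psi> q)\<close>. Paths that have not passed satisfy \<open>V n \<le> z\<close>
  and contribute at most \<open>exp (q * z - n * \<Psi> q)\<close>, which vanishes as
  \<open>n\<close> grows because \<open>\<Psi> q > 0\<close>.\<close>

lemma eT_nn_integral_pos:
  assumes z: "0 < z" and q: "0 \<le> q" and psi: "0 < \<Psi> q"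
  shows "(\<integral>\<^sup>+\<omega>. eT (\<Psi> q) z \<omega> \<partial>M) = ennreal (exp (- (q * z)))"
proof -
  define A where "A = (\<lambda>n::nat. \<integral>\<^sup>+\<omega>. (if T z \<omega> < ennreal (real n) then ennreal (exp (q * z - enn2real (T z \<omega>) * \<Psi> q)) else 0) \<partial>M)"
  have "A \<longlonglongrightarrow> (\<integral>\<^sup>+\<omega>. ennreal (exp (q * z)) * eT (\<Psi> q) z \<omega> \<partial>M)"
    unfolding A_def
  proof (rule nn_integral_dominated_convergence[where w="\<lambda>_. ennreal (exp (q * z))"])
    show "AE \<omega> in M. (\<lambda>n. if T z \<omega> < ennreal (real n) then ennreal (exp (q * z - enn2real (T z \<omega>) * \<Psi> q)) else 0)
       \<longlonglongrightarrow> ennreal (exp (q * z)) * eT (\<Psi> q) z \<omega>"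
    proof (intro AE_I2 tendsto_eventually)
      fix \<omega>
      show "eventually (\<lambda>n. (if T z \<omega> < ennreal (real n) then ennreal (exp (q * z - enn2real (T z \<omega>) * \<Psi> q)) else 0)
         = ennreal (exp (q * z)) * eT (\<Psi> q) z \<omega>) sequentially"
      proof (cases "T z \<omega> < \<infinity>")
        case True
        then obtain r where r: "T z \<omega> = ennreal r" "0 \<le> r" by (cases "T z \<omega>") auto
        obtain N where "r < real N" using reals_Archimedean2 by blast
        then have "T z \<omega> < ennreal (real n)" if "n \<ge> N" for n using r that by (auto intro!: ennreal_lessI)
        then show ?thesis using True
          by (auto simp: eventually_sequentially eT_def ennreal_mult[symmetric] exp_add[symmetric] intro!: exI[of _ N])
      next
        case False
        then have "\<not> T z \<omega> < ennreal (real n)" for n using T_less_top by blast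
        then show ?thesis using False by (simp add: eT_def)
      qed
    qed
    show "AE \<omega> in M. (if T z \<omega> < ennreal (real n) then ennreal (exp (q * z - enn2real (T z \<omega>) * \<Psi> q)) else 0) \<le> ennreal (exp (q * z))" for n
      using psi by (intro AE_I2) (auto intro!: ennreal_leI)
    show "(\<integral>\<^sup>+\<omega>. ennreal (exp (q * z)) \<partial>M) < \<infinity>" by (simp add: emeasure_space_1)
  qed auto
  also have "(\<integral>\<^sup>+\<omega>. ennreal (exp (q * z)) * eT (\<Psi> q) z \<omega> \<partial>M) = ennreal (exp (q * z)) * (\<integral>\<^sup>+\<omega>. eT (\<Psi> q) z \<omega> \<partial>M)"
    by (rule nn_integral_cmult) simp
  finally have lim1: "A \<longlonglongrightarrow> ennreal (exp (q * z)) * (\<integral>\<^sup>+\<omega>. eT (\<Psi> q) z \<omega> \<partial>M)" .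
  have bounds: "A n \<le> 1" "1 \<le> A n + ennreal (exp (q * z - real n * \<Psi> q))" if n: "n \<ge> 1" for n
  proof -
    have t: "0 < real n" using n by simp
    have Vn[measurable]: "V (real n) \<in> borel_measurable M" by simp
    have "(\<integral>\<^sup>+\<omega>. (if T z \<omega> < ennreal (real n) then ennreal (exp (q * V (real n) \<omega>)) else 0) \<partial>M)
       = ennreal (exp (real n * \<Psi> q)) * A n"
    proof -
      have "(\<integral>\<^sup>+\<omega>. (if T z \<omega> < ennreal (real n) then ennreal (exp (q * V (real n) \<omega>)) else 0) \<partial>M)
         = (\<integral>\<^sup>+\<omega>. ennreal (exp (real n * \<Psi> q)) * (if T z \<omega> < ennreal (real n) then ennreal (exp (q * z - enn2real (T z \<omega>) * \<Psi> q)) else 0) \<partial>M)"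
        unfolding exp_passage[OF z t q]
        by (intro nn_integral_cong) (auto simp: ennreal_mult[symmetric] exp_add[symmetric] algebra_simps)
      also have "\<dots> = ennreal (exp (real n * \<Psi> q)) * A n"
        unfolding A_def by (rule nn_integral_cmult) measurable
      finally show ?thesis .
    qed
    note eq = this
    have tot: "(\<integral>\<^sup>+\<omega>. ennreal (exp (q * V (real n) \<omega>)) \<partial>M) = ennreal (exp (real n * \<Psi> q))"
      using q by (intro exp_nn_integral) auto
    have "(\<integral>\<^sup>+\<omega>. (if T z \<omega> < ennreal (real n) then ennreal (exp (q * V (real n) \<omega>)) else 0) \<partial>M)
      \<le> (\<integral>\<^sup>+\<omega>. ennreal (exp (q * V (real n) \<omega>)) \<partial>M)"
      by (intro nn_integral_mono) auto
    then have "ennreal (exp (real n * \<Psi> q)) * A n \<le> ennreal (exp (real n * \<Psi> q)) * 1"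
      unfolding eq tot by simp
    then show "A n \<le> 1" by (subst (asm) ennreal_mult_le_mult_iff) auto
    have "ennreal (exp (real n * \<Psi> q)) \<le> (\<integral>\<^sup>+\<omega>. (if T z \<omega> < ennreal (real n) then ennreal (exp (q * V (real n) \<omega>)) else 0) + ennreal (exp (q * z)) \<partial>M)"
      unfolding tot[symmetric]
    proof (rule nn_integral_mono_AE)
      show "AE \<omega> in M. ennreal (exp (q * V (real n) \<omega>)) \<le> (if T z \<omega> < ennreal (real n) then ennreal (exp (q * V (real n) \<omega>)) else 0) + ennreal (exp (q * z))"
        using T_less_iff[OF z less_imp_le[OF t]]
      proof eventually_elim
        case (elim \<omega>)
        show ?case
        proof (cases "T z \<omega> < ennreal (real n)")
          case False
          then have "V (real n) \<omega> \<le> z" using elim by force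
          then show ?thesis using False q by (auto intro!: ennreal_leI mult_left_mono)
        qed simp
      qed
    qed
    also have "\<dots> = ennreal (exp (real n * \<Psi> q)) * A n + ennreal (exp (q * z))"
      by (subst nn_integral_add) (auto simp: eq emeasure_space_1)
    also have "ennreal (exp (q * z)) = ennreal (exp (real n * \<Psi> q)) * ennreal (exp (q * z - real n * \<Psi> q))"
      by (simp add: ennreal_mult[symmetric] exp_add[symmetric])
    also have "ennreal (exp (real n * \<Psi> q)) * A n + \<dots> = ennreal (exp (real n * \<Psi> q)) * (A n + ennreal (exp (q * z - real n * \<Psi> q)))"
      by (simp add: distrib_left)
    finally have "ennreal (exp (real n * \<Psi> q)) * 1 \<le> ennreal (exp (real n * \<Psi> q)) * (A n + ennreal (exp (q * z - real n * \<Psi> q)))" by simp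
    then show "1 \<le> A n + ennreal (exp (q * z - real n * \<Psi> q))" by (subst (asm) ennreal_mult_le_mult_iff) auto
  qed
  have "(\<lambda>n. exp (q * z - real n * \<Psi> q)) \<longlonglongrightarrow> 0"
    using psi by real_asymp
  then have "(\<lambda>n. A n + ennreal (exp (q * z - real n * \<Psi> q))) \<longlonglongrightarrow> ennreal (exp (q * z)) * (\<integral>\<^sup>+\<omega>. eT (\<Psi> q) z \<omega> \<partial>M) + ennreal 0"
    by (intro tendsto_add lim1 tendsto_ennrealI)
  then have "1 \<le> ennreal (exp (q * z)) * (\<integral>\<^sup>+\<omega>. eT (\<Psi> q) z \<omega> \<partial>M) + ennreal 0"
    by (rule tendsto_lowerbound) (use bounds in \<open>auto simp: eventually_sequentially\<close>)
  moreover have "ennreal (exp (q * z)) * (\<integral>\<^sup>+\<omega>. eT (\<Psi> q) z \<omega> \<partial>M) \<le> 1"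
    by (rule tendsto_upperbound[OF lim1]) (use bounds in \<open>auto simp: eventually_sequentially\<close>)
  ultimately have "ennreal (exp (q * z)) * (\<integral>\<^sup>+\<omega>. eT (\<Psi> q) z \<omega> \<partial>M) = ennreal (exp (q * z)) * ennreal (exp (- (q * z)))"
    by (simp add: ennreal_mult[symmetric] exp_add[symmetric])
  then show ?thesis by (subst (asm) ennreal_mult_cancel_left) auto
qed

text \<open>The case \<open>\<Psi> p = 0\<close> matters because the potential corresponds to
  \<open>p = \<kappa>\<close>. It follows by letting the argument decrease to \<open>p\<close>,
  where convexity forces \<open>\<Psi>\<close> down to 0.\<close>

lemma eT_nn_integral:
  assumes z: "0 < z" and p: "0 \<le> p" and psi: "0 \<le> \<Psi> p" "\<And>q. p < q \<Longrightarrow> 0 < \<Psi> q"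
  shows "(\<integral>\<^sup>+\<omega>. eT (\<Psi> p) z \<omega> \<partial>M) = ennreal (exp (- (p * z)))"
proof (cases "\<Psi> p = 0")
  case True
  define s where "s = (\<lambda>n. 1 / real (Suc n))"
  have s: "0 < s n" "s n \<le> 1" for n by (auto simp: s_def)
  have s0: "s \<longlonglongrightarrow> 0" unfolding s_def using LIMSEQ_inverse_real_of_nat by (simp add: inverse_eq_divide)
  have up: "\<Psi> (p + s n) \<le> s n * \<Psi> (p + 1)" for n
  proof -
    have "\<Psi> ((1 - s n) *\<^sub>R p + s n *\<^sub>R (p + 1)) \<le> (1 - s n) * \<Psi> p + s n * \<Psi> (p + 1)"
      using s[of n] p by (intro convex_onD[OF Psi_convex]) auto
    then show ?thesis using True by (simp add: algebra_simps)
  qed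
  have psi0: "(\<lambda>n. \<Psi> (p + s n)) \<longlonglongrightarrow> 0"
  proof (rule tendsto_sandwich[of "\<lambda>_. 0"])
    show "(\<lambda>n. s n * \<Psi> (p + 1)) \<longlonglongrightarrow> 0" using tendsto_mult[OF s0 tendsto_const[of "\<Psi> (p + 1)"]] by simp
    show "eventually (\<lambda>n. 0 \<le> \<Psi> (p + s n)) sequentially" using psi(2) s by (auto intro!: always_eventually less_imp_le)
  qed (use up in auto)
  have "(\<lambda>n. \<integral>\<^sup>+\<omega>. eT (\<Psi> (p + s n)) z \<omega> \<partial>M) \<longlonglongrightarrow> (\<integral>\<^sup>+\<omega>. eT (\<Psi> p) z \<omega> \<partial>M)"
  proof (rule nn_integral_dominated_convergence[where w="\<lambda>_. 1"])
    show "AE \<omega> in M. (\<lambda>n. eT (\<Psi> (p + s n)) z \<omega>) \<longlonglongrightarrow> eT (\<Psi> p) z \<omega>"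
    proof (intro AE_I2)
      fix \<omega>
      have "(\<lambda>n. exp (- (enn2real (T z \<omega>) * \<Psi> (p + s n)))) \<longlonglongrightarrow> exp (- (enn2real (T z \<omega>) * 0))"
        by (intro tendsto_intros psi0)
      then show "(\<lambda>n. eT (\<Psi> (p + s n)) z \<omega>) \<longlonglongrightarrow> eT (\<Psi> p) z \<omega>"
        using True tendsto_ennrealI by (fastforce simp: eT_def)
    qed
    show "AE \<omega> in M. eT (\<Psi> (p + s n)) z \<omega> \<le> 1" for n
    proof -
      have "0 < \<Psi> (p + s n)" using psi(2) s by auto
      then show ?thesis by (intro AE_I2) (simp add: eT_def)
    qed
  qed (auto simp: emeasure_space_1)
  moreover have "(\<lambda>n. \<integral>\<^sup>+\<omega>. eT (\<Psi> (p + s n)) z \<omega> \<partial>M) = (\<lambda>n. ennreal (exp (- ((p + s n) * z))))"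
  proof
    fix n
    show "(\<integral>\<^sup>+\<omega>. eT (\<Psi> (p + s n)) z \<omega> \<partial>M) = ennreal (exp (- ((p + s n) * z)))"
      using p s[of n] psi(2)[of "p + s n"] by (intro eT_nn_integral_pos z) auto
  qed
  moreover have "(\<lambda>n. ennreal (exp (- ((p + s n) * z)))) \<longlonglongrightarrow> ennreal (exp (- ((p + 0) * z)))"
    by (intro tendsto_ennrealI tendsto_intros s0)
  ultimately have "(\<integral>\<^sup>+\<omega>. eT (\<Psi> p) z \<omega> \<partial>M) = ennreal (exp (- ((p + 0) * z)))"
    by (metis LIMSEQ_unique)
  then show ?thesis by simp
next
  case False
  then show ?thesis using psi by (intro eT_nn_integral_pos z p) auto
qed

text \<open>Exponential moment at time \<open>t\<close> of paths that have not passed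
  \<open>z\<close> before \<open>t\<close>; time reversal will turn the killed semigroup into this
  quantity.\<close>

definition m :: "real \<Rightarrow> real \<Rightarrow> real \<Rightarrow> ennreal" where
  "m q t z = (\<integral>\<^sup>+\<omega>. (if T z \<omega> < ennreal t then 0 else ennreal (exp (q * V t \<omega>))) \<partial>M)"

text \<open>The total \<open>exp (t * \<Psi> q)\<close> is decomposed in two ways, through the value
  at time \<open>t\<close> and through the discounted passage over all time. The parts with passage
  before \<open>t\<close> agree by \<open>exp_passage\<close> and, being finite, cancel.\<close>

lemma m_eq:
  assumes z: "0 < z" and t: "0 < t" and q: "0 \<le> q" and psi: "0 < \<Psi> q"
  shows "m q t z = (\<integral>\<^sup>+\<omega>. (if \<not> T z \<omega> < ennreal t \<and> T z \<omega> < \<infinity>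
     then ennreal (exp (q * z + (t - enn2real (T z \<omega>)) * \<Psi> q)) else 0) \<partial>M)" (is "_ = ?R")
proof -
  have [measurable]: "V t \<in> borel_measurable M" using t by simp
  let ?A = "\<integral>\<^sup>+\<omega>. (if T z \<omega> < ennreal t then ennreal (exp (q * V t \<omega>)) else 0) \<partial>M"
  let ?B = "\<integral>\<^sup>+\<omega>. (if T z \<omega> < ennreal t then ennreal (exp (q * z + (t - enn2real (T z \<omega>)) * \<Psi> q)) else 0) \<partial>M"
  have AB: "?A = ?B" by (rule exp_passage[OF z t q])
  have 1: "?A + m q t z = ennreal (exp (t * \<Psi> q))"
  proof -
    have "?A + m q t z = (\<integral>\<^sup>+\<omega>. ennreal (exp (q * V t \<omega>)) \<partial>M)"
      unfolding m_def by (subst nn_integral_add[symmetric]) (auto intro!: nn_integral_cong)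
    then show ?thesis using t q by (simp add: exp_nn_integral)
  qed
  have 2: "?B + ?R = ennreal (exp (t * \<Psi> q))"
  proof -
    have "?B + ?R = (\<integral>\<^sup>+\<omega>. ennreal (exp (q * z + t * \<Psi> q)) * eT (\<Psi> q) z \<omega> \<partial>M)"
    proof (subst nn_integral_add[symmetric])
      show "(\<integral>\<^sup>+\<omega>. (if T z \<omega> < ennreal t then ennreal (exp (q * z + (t - enn2real (T z \<omega>)) * \<Psi> q)) else 0) +
         (if \<not> T z \<omega> < ennreal t \<and> T z \<omega> < \<infinity> then ennreal (exp (q * z + (t - enn2real (T z \<omega>)) * \<Psi> q)) else 0) \<partial>M)
        = (\<integral>\<^sup>+\<omega>. ennreal (exp (q * z + t * \<Psi> q)) * eT (\<Psi> q) z \<omega> \<partial>M)"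
      proof (intro nn_integral_cong)
        fix \<omega>
        have "ennreal (exp (q * z + (t - enn2real (T z \<omega>)) * \<Psi> q)) = ennreal (exp (q * z + t * \<Psi> q)) * ennreal (exp (- (enn2real (T z \<omega>) * \<Psi> q)))"
          by (simp add: ennreal_mult[symmetric] exp_add[symmetric] algebra_simps)
        then show "(if T z \<omega> < ennreal t then ennreal (exp (q * z + (t - enn2real (T z \<omega>)) * \<Psi> q)) else 0) +
         (if \<not> T z \<omega> < ennreal t \<and> T z \<omega> < \<infinity> then ennreal (exp (q * z + (t - enn2real (T z \<omega>)) * \<Psi> q)) else 0)
         = ennreal (exp (q * z + t * \<Psi> q)) * eT (\<Psi> q) z \<omega>"
          using T_less_top[of z \<omega> t] by (auto simp: eT_def)
      qed
    qed measurable
    also have "\<dots> = ennreal (exp (q * z + t * \<Psi> q)) * ennreal (exp (- (q * z)))"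
      using z q psi by (subst nn_integral_cmult) (auto simp: eT_nn_integral_pos)
    finally show ?thesis by (simp add: ennreal_mult[symmetric] exp_add[symmetric])
  qed
  have "?A \<noteq> top" using 1 by (metis ennreal_add_eq_top ennreal_neq_top)
  moreover have "?A + m q t z = ?A + ?R" using 1 2 AB by simp
  ultimately show ?thesis unfolding ennreal_add_left_cancel infinity_ennreal_def by blast
qed

text \<open>For a path that passes at time \<open>T\<close> the time integral runs over
  \<open>[0, T]\<close> and yields a difference of two discounts, at the rates
  \<open>\<Psi> p\<close> and \<open>\<Psi> q\<close>. Their means are
  \<open>exp (- (p * z))\<close> and \<open>exp (- (q * z))\<close>.\<close>

lemma laplace_m:
  assumes z: "0 < z" and p: "0 \<le> p" "0 \<le> \<Psi> p" "\<And>q. p < q \<Longrightarrow> 0 < \<Psi> q" and q: "p < q" "\<Psi> p < \<Psi> q"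
  shows "(\<integral>\<^sup>+t. ennreal (exp (- \<Psi> p * t)) * m q t z * indicator {0<..} t \<partial>lborel)
    = ennreal ((exp ((q - p) * z) - 1) / (\<Psi> q - \<Psi> p))"
proof -
  define r where "r = \<Psi> p"
  define s where "s = \<Psi> q"
  have rs: "0 \<le> r" "r < s" "0 < s" using p q by (auto simp: r_def s_def)
  define c where "c = exp (q * z) / (s - r)"
  have c: "0 < c" using rs by (simp add: c_def)
  define H where "H = (\<lambda>t \<omega>. (if 0 < t \<and> \<not> T z \<omega> < ennreal t \<and> T z \<omega> < \<infinity>
     then ennreal (exp (- r * t + q * z + (t - enn2real (T z \<omega>)) * s)) else 0))"
  have [measurable]: "(\<lambda>(t, \<omega>). H t \<omega>) \<in> borel_measurable (lborel \<Otimes>\<^sub>M M)"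
    unfolding H_def split_beta by measurable
  interpret P: pair_sigma_finite lborel M ..
  have "(\<integral>\<^sup>+t. ennreal (exp (- \<Psi> p * t)) * m q t z * indicator {0<..} t \<partial>lborel) = (\<integral>\<^sup>+t. \<integral>\<^sup>+\<omega>. H t \<omega> \<partial>M \<partial>lborel)"
  proof (rule nn_integral_cong)
    fix t :: real
    show "ennreal (exp (- \<Psi> p * t)) * m q t z * indicator {0<..} t = (\<integral>\<^sup>+\<omega>. H t \<omega> \<partial>M)"
    proof (cases "0 < t")
      case True
      have "ennreal (exp (- \<Psi> p * t)) * m q t z = (\<integral>\<^sup>+\<omega>. ennreal (exp (- r * t)) * (if \<not> T z \<omega> < ennreal t \<and> T z \<omega> < \<infinity>
        then ennreal (exp (q * z + (t - enn2real (T z \<omega>)) * s)) else 0) \<partial>M)"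
        using m_eq[OF z True, of q] p q rs unfolding r_def s_def
        by (subst nn_integral_cmult) auto
      also have "\<dots> = (\<integral>\<^sup>+\<omega>. H t \<omega> \<partial>M)"
        using True by (intro nn_integral_cong) (auto simp: H_def ennreal_mult[symmetric] exp_add[symmetric] algebra_simps)
      finally show ?thesis using True by simp
    qed (simp add: H_def)
  qed
  also have "\<dots> = (\<integral>\<^sup>+\<omega>. \<integral>\<^sup>+t. H t \<omega> \<partial>lborel \<partial>M)" by (rule P.Fubini'[symmetric]) measurable
  also have "\<dots> = (\<integral>\<^sup>+\<omega>. (if T z \<omega> < \<infinity> then ennreal (c * (exp (- (enn2real (T z \<omega>) * r)) - exp (- (enn2real (T z \<omega>) * s)))) else 0) \<partial>M)"
  proof (rule nn_integral_cong)
    fix \<omega>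
    show "(\<integral>\<^sup>+t. H t \<omega> \<partial>lborel) = (if T z \<omega> < \<infinity> then ennreal (c * (exp (- (enn2real (T z \<omega>) * r)) - exp (- (enn2real (T z \<omega>) * s)))) else 0)"
    proof (cases "T z \<omega> < \<infinity>")
      case True
      then obtain x where x: "T z \<omega> = ennreal x" "0 \<le> x" by (cases "T z \<omega>") auto
      define F where "F = (\<lambda>t. exp (q * z - x * s + (s - r) * t) / (s - r))"
      have "(\<integral>\<^sup>+t. H t \<omega> \<partial>lborel) = (\<integral>\<^sup>+t. ennreal (exp (q * z - x * s + (s - r) * t)) * indicator {0..x} t \<partial>lborel)"
      proof (rule nn_integral_cong_AE)
        show "AE t in lborel. H t \<omega> = ennreal (exp (q * z - x * s + (s - r) * t)) * indicator {0..x} t"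
          using AE_lborel_singleton[of 0]
        proof eventually_elim
          case (elim t)
          have "0 < t \<and> \<not> T z \<omega> < ennreal t \<and> T z \<omega> < \<infinity> \<longleftrightarrow> t \<in> {0..x}"
            using elim x True by (auto simp: ennreal_less_iff)
          moreover have "- r * t + q * z + (t - enn2real (T z \<omega>)) * s = q * z - x * s + (s - r) * t"
            using x by (simp add: algebra_simps)
          ultimately show ?case unfolding H_def by (simp add: indicator_def)
        qed
      qed
      also have "\<dots> = F x - F 0"
      proof (rule nn_integral_FTC_Icc)
        show "(F has_real_derivative exp (q * z - x * s + (s - r) * t)) (at t)" for t
          unfolding F_def using rs by (auto intro!: derivative_eq_intros)
      qed (use x in auto)
      also have "F x - F 0 = c * (exp (- (enn2real (T z \<omega>) * r)) - exp (- (enn2real (T z \<omega>) * s)))"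
      proof -
        have e1: "exp (q * z - x * s + (s - r) * x) = exp (q * z) * exp (- (x * r))"
          by (simp add: exp_add[symmetric] algebra_simps)
        have e2: "exp (q * z - x * s + (s - r) * 0) = exp (q * z) * exp (- (x * s))"
          by (simp add: exp_add[symmetric])
        show ?thesis unfolding F_def c_def e1 e2 using x
          by (simp add: diff_divide_distrib[symmetric] right_diff_distrib)
      qed
      finally show ?thesis using True by simp
    qed (simp add: H_def)
  qed
  also have "\<dots> = ennreal ((exp ((q - p) * z) - 1) / (s - r))" (is "?X = _")
  proof -
    \<comment> \<open>Written as a sum because subtraction in \<open>ennreal\<close> is
      truncated.\<close>
    have "?X + ennreal c * (\<integral>\<^sup>+\<omega>. eT s z \<omega> \<partial>M) = ennreal c * (\<integral>\<^sup>+\<omega>. eT r z \<omega> \<partial>M)"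
    proof -
      have "?X + ennreal c * (\<integral>\<^sup>+\<omega>. eT s z \<omega> \<partial>M) = ?X + (\<integral>\<^sup>+\<omega>. ennreal c * eT s z \<omega> \<partial>M)"
        by (subst nn_integral_cmult) auto
      also have "\<dots> = (\<integral>\<^sup>+\<omega>. ennreal c * eT r z \<omega> \<partial>M)"
      proof (subst nn_integral_add[symmetric])
        show "(\<integral>\<^sup>+\<omega>. (if T z \<omega> < \<infinity> then ennreal (c * (exp (- (enn2real (T z \<omega>) * r)) - exp (- (enn2real (T z \<omega>) * s)))) else 0)
            + ennreal c * eT s z \<omega> \<partial>M) = (\<integral>\<^sup>+\<omega>. ennreal c * eT r z \<omega> \<partial>M)"
        proof (intro nn_integral_cong)
          fix \<omega>
          define x where "x = enn2real (T z \<omega>)"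
          have "x * r \<le> x * s" using rs by (intro mult_left_mono) (auto simp: x_def)
          then have "0 \<le> c * (exp (- (x * r)) - exp (- (x * s)))" using c by simp
          then have "ennreal (c * (exp (- (x * r)) - exp (- (x * s)))) + ennreal c * ennreal (exp (- (x * s))) = ennreal c * ennreal (exp (- (x * r)))"
            using c by (simp add: ennreal_mult[symmetric] ennreal_plus[symmetric] algebra_simps del: ennreal_plus)
          then show "(if T z \<omega> < \<infinity> then ennreal (c * (exp (- (enn2real (T z \<omega>) * r)) - exp (- (enn2real (T z \<omega>) * s)))) else 0)
            + ennreal c * eT s z \<omega> = ennreal c * eT r z \<omega>"
            by (simp add: eT_def x_def)
        qed
      qed measurable
      also have "\<dots> = ennreal c * (\<integral>\<^sup>+\<omega>. eT r z \<omega> \<partial>M)" by (subst nn_integral_cmult) auto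
      finally show ?thesis .
    qed
    moreover have "(\<integral>\<^sup>+\<omega>. eT r z \<omega> \<partial>M) = ennreal (exp (- (p * z)))"
      unfolding r_def by (rule eT_nn_integral[OF z p])
    moreover have "(\<integral>\<^sup>+\<omega>. eT s z \<omega> \<partial>M) = ennreal (exp (- (q * z)))"
      unfolding s_def using p q rs by (intro eT_nn_integral_pos z) auto
    ultimately have sum: "?X + ennreal (c * exp (- (q * z))) = ennreal (c * exp (- (p * z)))"
      using c by (simp add: ennreal_mult[symmetric])
    have "?X = ennreal (c * exp (- (p * z))) - ennreal (c * exp (- (q * z)))"
      unfolding sum[symmetric] by simp
    also have "\<dots> = ennreal (c * exp (- (p * z)) - c * exp (- (q * z)))"
      using c by (intro ennreal_minus) auto
    also have "c * exp (- (p * z)) - c * exp (- (q * z)) = (exp ((q - p) * z) - 1) / (s - r)"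
      unfolding c_def by (simp add: exp_add[symmetric] diff_divide_distrib algebra_simps)
    finally show ?thesis .
  qed
  finally show ?thesis by (simp add: r_def s_def)
qed

section \<open>Duality and the killed semigroup\<close>

text \<open>Reversing the order of the increments replaces the walk by
  \<open>V (N h) - V ((N - k) h)\<close>, with the same law and the same endpoint.\<close>

lemma grid_duality:
  assumes h: "0 \<le> h" and q: "0 \<le> q"
  shows "(\<integral>\<^sup>+\<omega>. (if \<forall>k\<le>N. V (real N * h) \<omega> - V (real k * h) \<omega> \<le> z then ennreal (exp (q * V (real N * h) \<omega>)) else 0) \<partial>M)
    = (\<integral>\<^sup>+\<omega>. (if \<forall>k\<le>N. V (real k * h) \<omega> \<le> z then ennreal (exp (q * V (real N * h) \<omega>)) else 0) \<partial>M)"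
proof -
  define D where "D = (\<lambda>i \<omega>. V (real (Suc i) * h) \<omega> - V (real i * h) \<omega>)"
  have ind: "indep_vars (\<lambda>_. borel) D {..<N}" unfolding D_def by (rule grid_indep[OF h])
  have law: "distr M borel (D i) = distr M borel (V h)" if "i < N" for i
    unfolding D_def using V_increment_distr[of "real i * h" "real (Suc i) * h"] h by (simp add: algebra_simps)
  define F where "F = (\<lambda>d :: nat \<Rightarrow> real. if \<forall>k\<in>{..N}. (\<Sum>i<k. d i) \<le> z then ennreal (exp (q * (\<Sum>i<N. d i))) else 0)"
  have comp: "(\<lambda>d :: nat \<Rightarrow> real. \<Sum>i<j. d i) \<in> borel_measurable (PiM {..<N} (\<lambda>_. borel))" if "j \<le> N" for j
    using that by (intro borel_measurable_sum measurable_component_singleton) auto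
  have F: "F \<in> borel_measurable (PiM {..<N} (\<lambda>_. borel))"
    unfolding F_def
  proof (intro measurable_If measurable_const)
    show "{d \<in> space (PiM {..<N} (\<lambda>_. borel)). \<forall>k\<in>{..N}. (\<Sum>i<k. d i) \<le> z} \<in> sets (PiM {..<N} (\<lambda>_. borel))"
      using comp by (intro sets.sets_Collect_finite_All borel_measurable_le) auto
  qed (use comp[of N] in measurable)
  have D_sum: "(\<Sum>i<k. (\<lambda>i\<in>{..<N}. D i \<omega>) i) = V (real k * h) \<omega>" if "k \<le> N" "V 0 \<omega> = 0" for k \<omega>
    using that grid_telescope[of h \<omega> k] by (simp add: D_def)
  have R_sum: "(\<Sum>i<k. (\<lambda>i\<in>{..<N}. D (N - 1 - i) \<omega>) i) = V (real N * h) \<omega> - V (real (N - k) * h) \<omega>" if "k \<le> N" for k \<omega>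
    using that
  proof (induction k)
    case (Suc k)
    have "N - k = Suc (N - Suc k)" using Suc.prems by simp
    then have "D (N - 1 - k) \<omega> = V (real (N - k) * h) \<omega> - V (real (N - Suc k) * h) \<omega>" by (simp add: D_def)
    then show ?case using Suc by simp
  qed simp
  have "(\<integral>\<^sup>+\<omega>. (if \<forall>k\<le>N. V (real N * h) \<omega> - V (real k * h) \<omega> \<le> z then ennreal (exp (q * V (real N * h) \<omega>)) else 0) \<partial>M)
     = (\<integral>\<^sup>+\<omega>. F (\<lambda>i\<in>{..<N}. D (N - 1 - i) \<omega>) \<partial>M)"
  proof (rule nn_integral_cong_AE)
    show "AE \<omega> in M. (if \<forall>k\<le>N. V (real N * h) \<omega> - V (real k * h) \<omega> \<le> z then ennreal (exp (q * V (real N * h) \<omega>)) else 0)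
      = F (\<lambda>i\<in>{..<N}. D (N - 1 - i) \<omega>)"
      using V_0
    proof eventually_elim
      case (elim \<omega>)
      have "(\<forall>k\<in>{..N}. (\<Sum>i<k. (\<lambda>i\<in>{..<N}. D (N - 1 - i) \<omega>) i) \<le> z) \<longleftrightarrow> (\<forall>k\<le>N. V (real N * h) \<omega> - V (real (N - k) * h) \<omega> \<le> z)"
      proof -
        have "(\<forall>k\<in>{..N}. (\<Sum>i<k. (\<lambda>i\<in>{..<N}. D (N - 1 - i) \<omega>) i) \<le> z) \<longleftrightarrow> (\<forall>k\<in>{..N}. V (real N * h) \<omega> - V (real (N - k) * h) \<omega> \<le> z)"
          by (rule ball_cong) (simp_all only: R_sum atMost_iff)
        then show ?thesis by blast
      qed
      also have "\<dots> \<longleftrightarrow> (\<forall>k\<le>N. V (real N * h) \<omega> - V (real k * h) \<omega> \<le> z)"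
        by (metis diff_diff_cancel diff_le_self)
      finally have 1: "(\<forall>k\<in>{..N}. (\<Sum>i<k. (\<lambda>i\<in>{..<N}. D (N - 1 - i) \<omega>) i) \<le> z) \<longleftrightarrow> (\<forall>k\<le>N. V (real N * h) \<omega> - V (real k * h) \<omega> \<le> z)" .
      have 2: "(\<Sum>i<N. (\<lambda>i\<in>{..<N}. D (N - 1 - i) \<omega>) i) = V (real N * h) \<omega>" using R_sum[of N \<omega>] elim by simp
      show ?case unfolding F_def 1 2 by (simp only:)
    qed
  qed
  also have "\<dots> = (\<integral>\<^sup>+\<omega>. F (\<lambda>i\<in>{..<N}. D i \<omega>) \<partial>M)" by (rule iid_reverse_nn_integral[OF ind law F])
  also have "\<dots> = (\<integral>\<^sup>+\<omega>. (if \<forall>k\<le>N. V (real k * h) \<omega> \<le> z then ennreal (exp (q * V (real N * h) \<omega>)) else 0) \<partial>M)"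
  proof (rule nn_integral_cong_AE)
    show "AE \<omega> in M. F (\<lambda>i\<in>{..<N}. D i \<omega>) = (if \<forall>k\<le>N. V (real k * h) \<omega> \<le> z then ennreal (exp (q * V (real N * h) \<omega>)) else 0)"
      using V_0
    proof eventually_elim
      case (elim \<omega>)
      have 1: "(\<forall>k\<in>{..N}. (\<Sum>i<k. (\<lambda>i\<in>{..<N}. D i \<omega>) i) \<le> z) \<longleftrightarrow> (\<forall>k\<le>N. V (real k * h) \<omega> \<le> z)"
      proof -
        have "(\<forall>k\<in>{..N}. (\<Sum>i<k. (\<lambda>i\<in>{..<N}. D i \<omega>) i) \<le> z) \<longleftrightarrow> (\<forall>k\<in>{..N}. V (real k * h) \<omega> \<le> z)"
          by (rule ball_cong) (use elim in \<open>simp_all only: D_sum atMost_iff\<close>)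
        then show ?thesis by blast
      qed
      have 2: "(\<Sum>i<N. (\<lambda>i\<in>{..<N}. D i \<omega>) i) = V (real N * h) \<omega>" using D_sum[of N \<omega>] elim by simp
      show ?case unfolding F_def 1 2 by (simp only:)
    qed
  qed
  finally show ?thesis .
qed

text \<open>Each dyadic grid contains the coarser ones, so the indicator is either always 1 or
  eventually 0. The general \<open>f\<close> covers both the process and its reversal.\<close>

lemma dyadic_limit:
  fixes f :: "real \<Rightarrow> 'a \<Rightarrow> real"
  assumes t: "0 < t" and q: "0 \<le> q" and f: "\<And>s. 0 \<le> s \<Longrightarrow> f s \<in> borel_measurable M"
  shows "(\<lambda>n. \<integral>\<^sup>+\<omega>. (if \<forall>k\<le>2 ^ n. f (real k * (t / 2 ^ n)) \<omega> \<le> z then ennreal (exp (q * V t \<omega>)) else 0) \<partial>M)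
    \<longlonglongrightarrow> (\<integral>\<^sup>+\<omega>. (if \<forall>s\<in>dyadic t. f s \<omega> \<le> z then ennreal (exp (q * V t \<omega>)) else 0) \<partial>M)"
proof (rule nn_integral_dominated_convergence[where w="\<lambda>\<omega>. ennreal (exp (q * V t \<omega>))"])
  have Vt[measurable]: "V t \<in> borel_measurable M" using t by simp
  show "(\<integral>\<^sup>+\<omega>. ennreal (exp (q * V t \<omega>)) \<partial>M) < \<infinity>"
    using exp_nn_integral[of t q] t q by simp
  show "(\<lambda>\<omega>. if \<forall>k\<le>2 ^ n. f (real k * (t / 2 ^ n)) \<omega> \<le> z then ennreal (exp (q * V t \<omega>)) else 0) \<in> borel_measurable M" for n
  proof (intro measurable_If)
    have "{\<omega> \<in> space M. \<forall>k\<in>{..2 ^ n}. f (real k * (t / 2 ^ n)) \<omega> \<le> z} \<in> sets M"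
    proof (intro sets.sets_Collect_finite_All)
      fix k :: nat
      have fm: "f (real k * (t / 2 ^ n)) \<in> borel_measurable M" using f t by simp
      show "{\<omega> \<in> space M. f (real k * (t / 2 ^ n)) \<omega> \<le> z} \<in> sets M"
        by (rule borel_measurable_le[OF fm borel_measurable_const])
    qed simp
    moreover have "{\<omega> \<in> space M. \<forall>k\<in>{..2 ^ n}. f (real k * (t / 2 ^ n)) \<omega> \<le> z} = {\<omega> \<in> space M. \<forall>k\<le>2 ^ n. f (real k * (t / 2 ^ n)) \<omega> \<le> z}"
      by blast
    ultimately show "{\<omega> \<in> space M. \<forall>k\<le>2 ^ n. f (real k * (t / 2 ^ n)) \<omega> \<le> z} \<in> sets M" by (simp only:)
  qed auto
  show "(\<lambda>\<omega>. if \<forall>s\<in>dyadic t. f s \<omega> \<le> z then ennreal (exp (q * V t \<omega>)) else 0) \<in> borel_measurable M"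
  proof (intro measurable_If)
    have "(\<Union>s\<in>dyadic t. {\<omega> \<in> space M. z < f s \<omega>}) \<in> sets M"
    proof (rule sets.countable_UN'[OF countable_dyadic])
      show "(\<lambda>s. {\<omega> \<in> space M. z < f s \<omega>}) ` dyadic t \<subseteq> sets M"
        using f t dyadic_subset[of t] by (auto intro!: borel_measurable_less)
    qed
    then have "space M - (\<Union>s\<in>dyadic t. {\<omega> \<in> space M. z < f s \<omega>}) \<in> sets M" by auto
    also have "space M - (\<Union>s\<in>dyadic t. {\<omega> \<in> space M. z < f s \<omega>}) = {\<omega> \<in> space M. \<forall>s\<in>dyadic t. f s \<omega> \<le> z}"
      by (auto simp: not_less)
    finally show "{\<omega> \<in> space M. \<forall>s\<in>dyadic t. f s \<omega> \<le> z} \<in> sets M" .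
  qed auto
  show "AE \<omega> in M. (\<lambda>n. if \<forall>k\<le>2 ^ n. f (real k * (t / 2 ^ n)) \<omega> \<le> z then ennreal (exp (q * V t \<omega>)) else 0)
      \<longlonglongrightarrow> (if \<forall>s\<in>dyadic t. f s \<omega> \<le> z then ennreal (exp (q * V t \<omega>)) else 0)"
  proof (intro AE_I2)
    fix \<omega>
    show "(\<lambda>n. if \<forall>k\<le>2 ^ n. f (real k * (t / 2 ^ n)) \<omega> \<le> z then ennreal (exp (q * V t \<omega>)) else 0)
      \<longlonglongrightarrow> (if \<forall>s\<in>dyadic t. f s \<omega> \<le> z then ennreal (exp (q * V t \<omega>)) else 0)"
    proof (cases "\<forall>s\<in>dyadic t. f s \<omega> \<le> z")
      case True
      have "f (real k * (t / 2 ^ n)) \<omega> \<le> z" if "k \<le> 2 ^ n" for n k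
      proof -
        have "real k * (t / 2 ^ n) \<in> dyadic t" using that by (auto simp: dyadic_def)
        then show ?thesis using True by blast
      qed
      then have al: "\<forall>k\<le>2 ^ n. f (real k * (t / 2 ^ n)) \<omega> \<le> z" for n by blast
      show ?thesis unfolding if_P[OF True] if_P[OF al] by (rule tendsto_const)
    next
      case False
      then obtain n0 k0 where nk: "k0 \<le> 2 ^ n0" "\<not> f (real k0 * t / 2 ^ n0) \<omega> \<le> z" by (auto simp: dyadic_def)
      have "\<not> (\<forall>k\<le>2 ^ n. f (real k * (t / 2 ^ n)) \<omega> \<le> z)" if n: "n \<ge> n0" for n
      proof -
        have eq: "(2::nat) ^ n = 2 ^ (n - n0) * 2 ^ n0" using n by (simp flip: power_add)
        have eq': "(2::real) ^ n = 2 ^ (n - n0) * 2 ^ n0" using n by (simp flip: power_add)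
        have "k0 * 2 ^ (n - n0) \<le> 2 ^ n" unfolding eq using nk(1) by simp
        moreover have "real (k0 * 2 ^ (n - n0)) * (t / 2 ^ n) = real k0 * t / 2 ^ n0" unfolding eq' by simp
        ultimately show ?thesis using nk(2) by metis
      qed
      then have "eventually (\<lambda>n. (if \<forall>k\<le>2 ^ n. f (real k * (t / 2 ^ n)) \<omega> \<le> z then ennreal (exp (q * V t \<omega>)) else 0) = 0) sequentially"
        unfolding eventually_sequentially using if_not_P by (intro exI[of _ n0] allI impI) (rule if_not_P, blast)
      then show ?thesis unfolding if_not_P[OF False] by (rule tendsto_eventually)
    qed
  qed
  show "(\<lambda>\<omega>. ennreal (exp (q * V t \<omega>))) \<in> borel_measurable M" by measurable
qed (intro AE_I2, simp)

lemma duality: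
  assumes t: "0 < t" and q: "0 \<le> q" and z: "0 < z"
  shows "(\<integral>\<^sup>+\<omega>. (if \<forall>s\<in>dyadic t. V t \<omega> - V s \<omega> \<le> z then ennreal (exp (q * V t \<omega>)) else 0) \<partial>M) = m q t z"
proof -
  have Nh: "real ((2::nat) ^ n) * (t / 2 ^ n) = t" for n by simp
  have "(\<lambda>n. \<integral>\<^sup>+\<omega>. (if \<forall>k\<le>2 ^ n. V t \<omega> - V (real k * (t / 2 ^ n)) \<omega> \<le> z then ennreal (exp (q * V t \<omega>)) else 0) \<partial>M)
    \<longlonglongrightarrow> (\<integral>\<^sup>+\<omega>. (if \<forall>s\<in>dyadic t. V t \<omega> - V s \<omega> \<le> z then ennreal (exp (q * V t \<omega>)) else 0) \<partial>M)"
    using dyadic_limit[OF t q, of "\<lambda>s \<omega>. V t \<omega> - V s \<omega>" z] t by simp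
  moreover have "(\<integral>\<^sup>+\<omega>. (if \<forall>k\<le>2 ^ n. V t \<omega> - V (real k * (t / 2 ^ n)) \<omega> \<le> z then ennreal (exp (q * V t \<omega>)) else 0) \<partial>M)
     = (\<integral>\<^sup>+\<omega>. (if \<forall>k\<le>2 ^ n. V (real k * (t / 2 ^ n)) \<omega> \<le> z then ennreal (exp (q * V t \<omega>)) else 0) \<partial>M)" for n
    using grid_duality[of "t / 2 ^ n" q "2 ^ n" z] t q unfolding Nh by simp
  ultimately have "(\<lambda>n. \<integral>\<^sup>+\<omega>. (if \<forall>k\<le>2 ^ n. V (real k * (t / 2 ^ n)) \<omega> \<le> z then ennreal (exp (q * V t \<omega>)) else 0) \<partial>M)
    \<longlonglongrightarrow> (\<integral>\<^sup>+\<omega>. (if \<forall>s\<in>dyadic t. V t \<omega> - V s \<omega> \<le> z then ennreal (exp (q * V t \<omega>)) else 0) \<partial>M)"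
    by (simp only:)
  moreover have "(\<lambda>n. \<integral>\<^sup>+\<omega>. (if \<forall>k\<le>2 ^ n. V (real k * (t / 2 ^ n)) \<omega> \<le> z then ennreal (exp (q * V t \<omega>)) else 0) \<partial>M)
    \<longlonglongrightarrow> (\<integral>\<^sup>+\<omega>. (if \<forall>s\<in>dyadic t. V s \<omega> \<le> z then ennreal (exp (q * V t \<omega>)) else 0) \<partial>M)"
    by (rule dyadic_limit[OF t q]) simp
  ultimately have "(\<integral>\<^sup>+\<omega>. (if \<forall>s\<in>dyadic t. V t \<omega> - V s \<omega> \<le> z then ennreal (exp (q * V t \<omega>)) else 0) \<partial>M)
    = (\<integral>\<^sup>+\<omega>. (if \<forall>s\<in>dyadic t. V s \<omega> \<le> z then ennreal (exp (q * V t \<omega>)) else 0) \<partial>M)"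
    by (rule LIMSEQ_unique)
  also have "\<dots> = m q t z"
    unfolding m_def
  proof (rule nn_integral_cong_AE)
    show "AE \<omega> in M. (if \<forall>s\<in>dyadic t. V s \<omega> \<le> z then ennreal (exp (q * V t \<omega>)) else 0) = (if T z \<omega> < ennreal t then 0 else ennreal (exp (q * V t \<omega>)))"
      using V_0 V_npj T_less_iff[OF z less_imp_le[OF t]] AE_space
    proof eventually_elim
      case (elim \<omega>)
      have "T z \<omega> < ennreal t \<longleftrightarrow> \<not> (\<forall>s\<in>dyadic t. V s \<omega> \<le> z)"
      proof
        assume "T z \<omega> < ennreal t"
        then obtain s where s: "0 \<le> s" "s \<le> t" "z < V s \<omega>" using elim(3) by auto
        from eventually_happens[OF passage_path(4)[OF V_cadlag[OF elim(4)] elim(2,1) z s]]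
        obtain n k where "k \<le> 2 ^ n" "z < V (real k * t / 2 ^ n) \<omega>" by auto
        then have "real k * t / 2 ^ n \<in> dyadic t" "\<not> V (real k * t / 2 ^ n) \<omega> \<le> z" by (auto simp: dyadic_def)
        then show "\<not> (\<forall>s\<in>dyadic t. V s \<omega> \<le> z)" by blast
      next
        assume "\<not> (\<forall>s\<in>dyadic t. V s \<omega> \<le> z)"
        then show "T z \<omega> < ennreal t" using elim(3) dyadic_subset[of t] t by force
      qed
      note iff = this
      show ?case
      proof (cases "T z \<omega> < ennreal t")
        case True
        then have n: "\<not> (\<forall>s\<in>dyadic t. V s \<omega> \<le> z)" using iff by blast
        show ?thesis unfolding if_P[OF True] if_not_P[OF n] ..
      next
        case False
        then have n: "\<forall>s\<in>dyadic t. V s \<omega> \<le> z" using iff by blast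
        show ?thesis unfolding if_not_P[OF False] if_P[OF n] ..
      qed
    qed
  qed
  finally show ?thesis .
qed

text \<open>Integrating over the starting point permits the substitution \<open>z = x + V t\<close>.
  The weight becomes \<open>exp (- q * z) * exp (q * V t)\<close>, and survival becomes, up to a
  null set of \<open>z\<close>, the condition that every \<open>V t - V s\<close> is at most
  \<open>z\<close>; duality turns this into \<open>m\<close>.\<close>

lemma killed_semigroup_laplace:
  assumes t: "0 < t" and q: "0 \<le> q" and f[measurable]: "f \<in> borel_measurable borel"
  shows "(\<integral>\<^sup>+x\<in>{0..}. ennreal (exp (- q * x)) * (\<integral>\<^sup>+\<omega>. (if 0 < (INF s\<in>{0..t}. x + V s \<omega>) then f (x + V t \<omega>) else 0) \<partial>M) \<partial>lborel)
    = (\<integral>\<^sup>+z\<in>{0<..}. ennreal (exp (- q * z)) * f z * m q t z \<partial>lborel)"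
proof -
  have Vt[measurable]: "V t \<in> borel_measurable M" using t by simp
  define I where "I = (\<lambda>\<omega>. INF s\<in>dyadic t. V s \<omega>)"
  have [measurable]: "I \<in> borel_measurable M"
    unfolding I_def using dyadic_subset[of t] t by (intro borel_measurable_cINF_real countable_dyadic) auto
  have INF_eq: "(INF s\<in>{0..t}. x + V s \<omega>) = x + I \<omega>" if "\<omega> \<in> space M" for x \<omega>
    unfolding I_def by (rule cadlag_INF_dyadic(1)[OF V_cadlag[OF that] t])
  have bdd: "bdd_below ((\<lambda>s. V s \<omega>) ` dyadic t)" if "\<omega> \<in> space M" for \<omega>
    by (rule cadlag_INF_dyadic(2)[OF V_cadlag[OF that] t])
  interpret P: pair_sigma_finite lborel M ..
  define A where "A = (\<lambda>x \<omega>. ennreal (exp (- q * x)) * (if 0 \<le> x \<and> 0 < x + I \<omega> then f (x + V t \<omega>) else 0))"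
  have [measurable]: "(\<lambda>(x, \<omega>). A x \<omega>) \<in> borel_measurable (lborel \<Otimes>\<^sub>M M)" unfolding A_def split_beta by measurable
  define B where "B = (\<lambda>z \<omega>. ennreal (exp (- q * z)) * f z * (if 0 < z \<and> V t \<omega> - I \<omega> \<le> z then ennreal (exp (q * V t \<omega>)) else 0))"
  have [measurable]: "(\<lambda>(x, \<omega>). B x \<omega>) \<in> borel_measurable (lborel \<Otimes>\<^sub>M M)" unfolding B_def split_beta by measurable
  have "(\<integral>\<^sup>+x\<in>{0..}. ennreal (exp (- q * x)) * (\<integral>\<^sup>+\<omega>. (if 0 < (INF s\<in>{0..t}. x + V s \<omega>) then f (x + V t \<omega>) else 0) \<partial>M) \<partial>lborel)
     = (\<integral>\<^sup>+x. \<integral>\<^sup>+\<omega>. A x \<omega> \<partial>M \<partial>lborel)"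
  proof (rule nn_integral_cong)
    fix x :: real
    have "(\<integral>\<^sup>+\<omega>. A x \<omega> \<partial>M) = ennreal (exp (- q * x)) * (\<integral>\<^sup>+\<omega>. (if 0 \<le> x \<and> 0 < x + I \<omega> then f (x + V t \<omega>) else 0) \<partial>M)"
      unfolding A_def by (rule nn_integral_cmult) measurable
    also have "(\<integral>\<^sup>+\<omega>. (if 0 \<le> x \<and> 0 < x + I \<omega> then f (x + V t \<omega>) else 0) \<partial>M)
       = (\<integral>\<^sup>+\<omega>. (if 0 < (INF s\<in>{0..t}. x + V s \<omega>) then f (x + V t \<omega>) else 0) \<partial>M) * indicator {0..} x"
      by (cases "0 \<le> x") (auto intro!: nn_integral_cong simp: INF_eq)
    finally show "ennreal (exp (- q * x)) * (\<integral>\<^sup>+\<omega>. (if 0 < (INF s\<in>{0..t}. x + V s \<omega>) then f (x + V t \<omega>) else 0) \<partial>M) * indicator {0..} x = (\<integral>\<^sup>+\<omega>. A x \<omega> \<partial>M)"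
      by (simp add: mult.assoc)
  qed
  also have "\<dots> = (\<integral>\<^sup>+\<omega>. \<integral>\<^sup>+x. A x \<omega> \<partial>lborel \<partial>M)" by (rule P.Fubini'[symmetric]) measurable
  also have "\<dots> = (\<integral>\<^sup>+\<omega>. \<integral>\<^sup>+z. B z \<omega> \<partial>lborel \<partial>M)"
  proof (rule nn_integral_cong_AE)
    show "AE \<omega> in M. (\<integral>\<^sup>+x. A x \<omega> \<partial>lborel) = (\<integral>\<^sup>+z. B z \<omega> \<partial>lborel)"
      using V_0 AE_space
    proof eventually_elim
      case (elim \<omega>)
      have "0 \<in> dyadic t" by (auto simp: dyadic_def intro!: exI[of _ 0])
      \<comment> \<open>The infimum lies below both the initial and the final value of the path, so
        survival already implies \<open>x \<ge> 0\<close> and \<open>z > 0\<close>.\<close>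
      then have I0: "I \<omega> \<le> 0" unfolding I_def using cINF_lower[OF bdd[OF elim(2)], of 0] elim(1) by simp
      have It: "I \<omega> \<le> V t \<omega>" unfolding I_def by (rule cINF_lower[OF bdd[OF elim(2)] end_in_dyadic])
      have "(\<integral>\<^sup>+x. A x \<omega> \<partial>lborel) = (\<integral>\<^sup>+z. A (- V t \<omega> + 1 * z) \<omega> \<partial>lborel)"
        by (subst nn_integral_real_affine[where c=1 and t="- V t \<omega>"]) (auto simp: A_def)
      also have "\<dots> = (\<integral>\<^sup>+z. B z \<omega> \<partial>lborel)"
      proof (rule nn_integral_cong_AE)
        show "AE z in lborel. A (- V t \<omega> + 1 * z) \<omega> = B z \<omega>"
          using AE_lborel_singleton[of "V t \<omega> - I \<omega>"]
        proof eventually_elim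
          case (elim z)
          have "0 \<le> - V t \<omega> + z \<and> 0 < - V t \<omega> + z + I \<omega> \<longleftrightarrow> 0 < z \<and> V t \<omega> - I \<omega> \<le> z"
            using elim I0 It by auto
          moreover have "ennreal (exp (- q * (- V t \<omega> + z))) = ennreal (exp (- q * z)) * ennreal (exp (q * V t \<omega>))"
            by (simp add: ennreal_mult[symmetric] exp_add[symmetric] algebra_simps)
          ultimately show ?case by (simp add: A_def B_def mult_ac)
        qed
      qed
      finally show ?case .
    qed
  qed
  also have "\<dots> = (\<integral>\<^sup>+z. \<integral>\<^sup>+\<omega>. B z \<omega> \<partial>M \<partial>lborel)" by (rule P.Fubini') measurable
  also have "\<dots> = (\<integral>\<^sup>+z\<in>{0<..}. ennreal (exp (- q * z)) * f z * m q t z \<partial>lborel)"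
  proof (rule nn_integral_cong)
    fix z :: real
    have "(\<integral>\<^sup>+\<omega>. B z \<omega> \<partial>M) = ennreal (exp (- q * z)) * f z * (\<integral>\<^sup>+\<omega>. (if 0 < z \<and> V t \<omega> - I \<omega> \<le> z then ennreal (exp (q * V t \<omega>)) else 0) \<partial>M)"
      unfolding B_def by (rule nn_integral_cmult) measurable
    also have "(\<integral>\<^sup>+\<omega>. (if 0 < z \<and> V t \<omega> - I \<omega> \<le> z then ennreal (exp (q * V t \<omega>)) else 0) \<partial>M) = m q t z * indicator {0<..} z"
    proof (cases "0 < z")
      case True
      have "(\<integral>\<^sup>+\<omega>. (if 0 < z \<and> V t \<omega> - I \<omega> \<le> z then ennreal (exp (q * V t \<omega>)) else 0) \<partial>M)
        = (\<integral>\<^sup>+\<omega>. (if \<forall>s\<in>dyadic t. V t \<omega> - V s \<omega> \<le> z then ennreal (exp (q * V t \<omega>)) else 0) \<partial>M)"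
      proof (rule nn_integral_cong)
        fix \<omega> assume w: "\<omega> \<in> space M"
        have "V t \<omega> - z \<le> I \<omega> \<longleftrightarrow> (\<forall>s\<in>dyadic t. V t \<omega> - z \<le> V s \<omega>)"
          unfolding I_def using bdd[OF w] end_in_dyadic[of t] by (subst le_cINF_iff) auto
        then have "0 < z \<and> V t \<omega> - I \<omega> \<le> z \<longleftrightarrow> (\<forall>s\<in>dyadic t. V t \<omega> - V s \<omega> \<le> z)"
          using True by (simp add: algebra_simps)
        then show "(if 0 < z \<and> V t \<omega> - I \<omega> \<le> z then ennreal (exp (q * V t \<omega>)) else 0)
          = (if \<forall>s\<in>dyadic t. V t \<omega> - V s \<omega> \<le> z then ennreal (exp (q * V t \<omega>)) else 0)" by (simp only:)
      qed
      then show ?thesis using duality[OF t q True] True by simp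
    qed simp
    finally show "(\<integral>\<^sup>+\<omega>. B z \<omega> \<partial>M) = ennreal (exp (- q * z)) * f z * m q t z * indicator {0<..} z"
      by (simp add: mult.assoc)
  qed
  finally show ?thesis .
qed

end

text \<open>Evaluate at a grid time to the right of \<open>t\<close>: the result depends on time
  through a countable index only, and right-continuity recovers the process as the mesh
  shrinks.\<close>

lemma right_continuous_measurable_pair:
  fixes X :: "real \<Rightarrow> 'a \<Rightarrow> real"
  assumes meas: "\<And>t. 0 \<le> t \<Longrightarrow> X t \<in> borel_measurable M"
    and right: "\<And>\<omega> t. \<omega> \<in> space M \<Longrightarrow> 0 \<le> t \<Longrightarrow> ((\<lambda>s. X s \<omega>) \<longlongrightarrow> X t \<omega>) (at_right t)"
  shows "(\<lambda>(t, \<omega>). X (max 0 t) \<omega>) \<in> borel_measurable (borel \<Otimes>\<^sub>M M)"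
proof -
  \<comment> \<open>The \<open>+ 1\<close> keeps the grid time strictly above \<open>t\<close>,
    where right-continuity applies.\<close>
  define r where "r = (\<lambda>n t. (real (nat \<lfloor>max 0 t * real (Suc n)\<rfloor>) + 1) / real (Suc n))"
  define Y where "Y = (\<lambda>n p. X (r n (fst p)) (snd p))"
  have "(\<lambda>p. X (max 0 (fst p)) (snd p)) \<in> borel_measurable (borel \<Otimes>\<^sub>M M)"
  proof (rule borel_measurable_LIMSEQ_real)
    fix n :: nat
    have 1: "(\<lambda>p :: real \<times> 'a. X ((real k + 1) / real (Suc n)) (snd p)) \<in> borel_measurable (borel \<Otimes>\<^sub>M M)" for k :: nat
    proof -
      have [measurable]: "X ((real k + 1) / real (Suc n)) \<in> borel_measurable M" by (intro meas) auto
      show ?thesis by measurable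
    qed
    have 2: "(\<lambda>p. nat \<lfloor>max 0 (fst p) * real (Suc n)\<rfloor>) \<in> measurable (borel \<Otimes>\<^sub>M M) (count_space UNIV)"
      by measurable
    show "Y n \<in> borel_measurable (borel \<Otimes>\<^sub>M M)"
      unfolding Y_def r_def
      by (rule measurable_compose_countable[where f="\<lambda>k (p :: real \<times> 'a). X ((real k + 1) / real (Suc n)) (snd p)", OF 1 2])
  next
    fix p :: "real \<times> 'a" assume p: "p \<in> space (borel \<Otimes>\<^sub>M M)"
    define t where "t = max 0 (fst p)"
    have t: "0 \<le> t" by (simp add: t_def)
    have r: "t < r n (fst p)" "r n (fst p) \<le> t + 1 / real (Suc n)" for n
    proof -
      have "0 \<le> t * real (Suc n)" using t by simp
      then have "real (nat \<lfloor>t * real (Suc n)\<rfloor>) + 1 > t * real (Suc n)" "real (nat \<lfloor>t * real (Suc n)\<rfloor>) \<le> t * real (Suc n)"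
        by linarith+
      then show "t < r n (fst p)" "r n (fst p) \<le> t + 1 / real (Suc n)"
        unfolding r_def t_def[symmetric] by (simp_all add: field_simps del: of_nat_Suc)
    qed
    have "(\<lambda>n. r n (fst p)) \<longlonglongrightarrow> t"
    proof (rule tendsto_sandwich[of "\<lambda>_. t"])
      have "(\<lambda>n. t + inverse (real (Suc n))) \<longlonglongrightarrow> t + 0"
        by (intro tendsto_intros LIMSEQ_inverse_real_of_nat)
      then show "(\<lambda>n. t + 1 / real (Suc n)) \<longlonglongrightarrow> t" by (simp add: inverse_eq_divide)
    qed (use r in \<open>auto intro!: always_eventually less_imp_le\<close>)
    then have "filterlim (\<lambda>n. r n (fst p)) (at_right t) sequentially"
      using r by (auto simp: filterlim_at intro!: always_eventually)
    moreover have "((\<lambda>s. X s (snd p)) \<longlongrightarrow> X t (snd p)) (at_right t)"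
      using p t by (intro right) (auto simp: space_pair_measure)
    ultimately show "(\<lambda>n. Y n p) \<longlonglongrightarrow> X (max 0 (fst p)) (snd p)"
      unfolding Y_def t_def[symmetric] by (rule filterlim_compose[rotated])
  qed
  then show ?thesis by (simp add: split_beta)
qed

section \<open>The resolvent of the process killed below 0\<close>

context spectrally_negative
begin

text \<open>Transition semigroup of the process killed on leaving the positive half-line.\<close>

definition K :: "real \<Rightarrow> (real \<Rightarrow> ennreal) \<Rightarrow> real \<Rightarrow> ennreal" where
  "K t f x = (\<integral>\<^sup>+\<omega>. (if 0 < (INF s\<in>{0..t}. x + V s \<omega>) then f (x + V t \<omega>) else 0) \<partial>M)"

lemma V_pair_measurable: "(\<lambda>(t, \<omega>). V (max 0 t) \<omega>) \<in> borel_measurable (borel \<Otimes>\<^sub>M M)"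
  by (rule right_continuous_measurable_pair) (auto intro: cadlag_right_tendsto V_cadlag)

lemma m_measurable:
  "(\<lambda>(t, z). m q t z * indicator {0<..} t) \<in> borel_measurable (borel \<Otimes>\<^sub>M borel)"
proof -
  note [measurable] = V_pair_measurable T_measurable
  have "(\<lambda>x. (\<lambda>(t, \<omega>). V (max 0 t) \<omega>) (fst (fst x), snd x)) \<in> borel_measurable ((borel \<Otimes>\<^sub>M borel) \<Otimes>\<^sub>M M)"
    by measurable
  then have [measurable]: "(\<lambda>x. V (max 0 (fst (fst x))) (snd x)) \<in> borel_measurable ((borel \<Otimes>\<^sub>M borel) \<Otimes>\<^sub>M M)" by simp
  have "(\<lambda>x. (\<lambda>(z, \<omega>). T z \<omega>) (snd (fst x), snd x)) \<in> borel_measurable ((borel \<Otimes>\<^sub>M borel) \<Otimes>\<^sub>M M)"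
    by measurable
  then have [measurable]: "(\<lambda>x. T (snd (fst x)) (snd x)) \<in> borel_measurable ((borel \<Otimes>\<^sub>M borel) \<Otimes>\<^sub>M M)" by simp
  have "(\<lambda>p. \<integral>\<^sup>+\<omega>. (if T (snd p) \<omega> < ennreal (fst p) then 0 else ennreal (exp (q * V (max 0 (fst p)) \<omega>))) \<partial>M) \<in> borel_measurable (borel \<Otimes>\<^sub>M borel)"
    by (rule borel_measurable_nn_integral) (simp add: split_beta)
  then have "(\<lambda>p. (\<integral>\<^sup>+\<omega>. (if T (snd p) \<omega> < ennreal (fst p) then 0 else ennreal (exp (q * V (max 0 (fst p)) \<omega>))) \<partial>M) * indicator {0<..} (fst p))
     \<in> borel_measurable (borel \<Otimes>\<^sub>M borel)" by measurable
  moreover have "(\<lambda>(t, z). m q t z * indicator {0<..} t) = (\<lambda>p. (\<integral>\<^sup>+\<omega>. (if T (snd p) \<omega> < ennreal (fst p) then 0 else ennreal (exp (q * V (max 0 (fst p)) \<omega>))) \<partial>M) * indicator {0<..} (fst p))"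
  proof
    fix p :: "real \<times> real"
    show "(\<lambda>(t, z). m q t z * indicator {0<..} t) p = (\<integral>\<^sup>+\<omega>. (if T (snd p) \<omega> < ennreal (fst p) then 0 else ennreal (exp (q * V (max 0 (fst p)) \<omega>))) \<partial>M) * indicator {0<..} (fst p)"
    proof (cases "0 < fst p")
      case True
      then have "max 0 (fst p) = fst p" by simp
      then show ?thesis using True by (simp only: m_def split_beta)
    qed (simp add: split_beta)
  qed
  ultimately show ?thesis by (simp only:)
qed

text \<open>As a function of the starting point this is the transform of the familiar resolvent
  density \<open>exp (- p * z) * W x - W (x - z)\<close>, with the scale function of rate
  \<open>\<Psi> p\<close> in place of \<open>W\<close>. Staying with transforms spares the
  construction of these functions.\<close>

lemma killed_resolvent_laplace:
  assumes p: "0 \<le> p" "0 \<le> \<Psi> p" "\<And>q. p < q \<Longrightarrow> 0 < \<Psi> q" and q: "p < q" "\<Psi> p < \<Psi> q"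
    and f[measurable]: "f \<in> borel_measurable borel"
  shows "(\<integral>\<^sup>+t\<in>{0<..}. ennreal (exp (- \<Psi> p * t)) * (\<integral>\<^sup>+x\<in>{0..}. ennreal (exp (- q * x)) * K t f x \<partial>lborel) \<partial>lborel)
    = (\<integral>\<^sup>+z\<in>{0<..}. f z * ennreal ((exp (- p * z) - exp (- q * z)) / (\<Psi> q - \<Psi> p)) \<partial>lborel)"
proof -
  note [measurable] = m_measurable[of q]
  define H where "H = (\<lambda>t z. ennreal (exp (- \<Psi> p * t)) * (ennreal (exp (- q * z)) * f z * indicator {0<..} z) * (m q t z * indicator {0<..} t))"
  have mm[measurable]: "(\<lambda>x. m q (fst x) (snd x) * indicator {0<..} (fst x)) \<in> borel_measurable (borel \<Otimes>\<^sub>M borel)"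
    using m_measurable[of q] by (simp add: split_beta)
  have mt: "(\<lambda>t. m q t z * indicator {0<..} t) \<in> borel_measurable borel" for z
    using measurable_compose[OF _ mm, of "\<lambda>t. (t, z)" borel] by simp
  have mz: "(\<lambda>z. m q t z) \<in> borel_measurable borel" if "0 < t" for t
    using measurable_compose[OF _ mm, of "\<lambda>z. (t, z)" borel] that by simp
  have [measurable]: "(\<lambda>(t, z). H t z) \<in> borel_measurable (lborel \<Otimes>\<^sub>M lborel)"
    unfolding H_def split_beta by measurable
  have "(\<integral>\<^sup>+t\<in>{0<..}. ennreal (exp (- \<Psi> p * t)) * (\<integral>\<^sup>+x\<in>{0..}. ennreal (exp (- q * x)) * K t f x \<partial>lborel) \<partial>lborel)
    = (\<integral>\<^sup>+t. \<integral>\<^sup>+z. H t z \<partial>lborel \<partial>lborel)"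
  proof (rule nn_integral_cong)
    fix t :: real
    show "ennreal (exp (- \<Psi> p * t)) * (\<integral>\<^sup>+x\<in>{0..}. ennreal (exp (- q * x)) * K t f x \<partial>lborel) * indicator {0<..} t = (\<integral>\<^sup>+z. H t z \<partial>lborel)"
    proof (cases "0 < t")
      case True
      note [measurable] = mz[OF True]
      have "(\<integral>\<^sup>+z. H t z \<partial>lborel) = (\<integral>\<^sup>+z. ennreal (exp (- \<Psi> p * t)) * (ennreal (exp (- q * z)) * f z * m q t z * indicator {0<..} z) \<partial>lborel)"
        using True by (intro nn_integral_cong) (simp add: H_def mult_ac)
      also have "\<dots> = ennreal (exp (- \<Psi> p * t)) * (\<integral>\<^sup>+z\<in>{0<..}. ennreal (exp (- q * z)) * f z * m q t z \<partial>lborel)"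
        by (rule nn_integral_cmult) measurable
      finally show ?thesis
        using True killed_semigroup_laplace[OF True, of q f] p q by (simp add: K_def)
    qed (simp add: H_def)
  qed
  also have "\<dots> = (\<integral>\<^sup>+z. \<integral>\<^sup>+t. H t z \<partial>lborel \<partial>lborel)" by (rule lborel_pair.Fubini'[symmetric]) measurable
  also have "\<dots> = (\<integral>\<^sup>+z\<in>{0<..}. f z * ennreal ((exp (- p * z) - exp (- q * z)) / (\<Psi> q - \<Psi> p)) \<partial>lborel)"
  proof (rule nn_integral_cong)
    fix z :: real
    show "(\<integral>\<^sup>+t. H t z \<partial>lborel) = f z * ennreal ((exp (- p * z) - exp (- q * z)) / (\<Psi> q - \<Psi> p)) * indicator {0<..} z"
    proof (cases "0 < z")
      case True
      note [measurable] = mt[of z]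
      have "(\<integral>\<^sup>+t. H t z \<partial>lborel) = (\<integral>\<^sup>+t. ennreal (exp (- q * z)) * f z * (ennreal (exp (- \<Psi> p * t)) * (m q t z * indicator {0<..} t)) \<partial>lborel)"
        using True by (intro nn_integral_cong) (simp add: H_def mult_ac)
      also have "\<dots> = ennreal (exp (- q * z)) * f z * (\<integral>\<^sup>+t. ennreal (exp (- \<Psi> p * t)) * (m q t z * indicator {0<..} t) \<partial>lborel)"
        by (rule nn_integral_cmult) measurable
      also have "(\<integral>\<^sup>+t. ennreal (exp (- \<Psi> p * t)) * (m q t z * indicator {0<..} t) \<partial>lborel) = ennreal ((exp ((q - p) * z) - 1) / (\<Psi> q - \<Psi> p))"
        using laplace_m[OF True p q] by (simp add: mult.assoc)
      also have "ennreal (exp (- q * z)) * f z * ennreal ((exp ((q - p) * z) - 1) / (\<Psi> q - \<Psi> p))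
         = f z * ennreal (exp (- q * z) * ((exp ((q - p) * z) - 1) / (\<Psi> q - \<Psi> p)))"
        using True q by (subst ennreal_mult) (auto simp: mult_ac)
      also have "exp (- q * z) * ((exp ((q - p) * z) - 1) / (\<Psi> q - \<Psi> p)) = (exp (- p * z) - exp (- q * z)) / (\<Psi> q - \<Psi> p)"
        by (simp add: right_diff_distrib exp_add[symmetric] algebra_simps)
      finally show ?thesis using True by simp
    qed (simp add: H_def)
  qed
  finally show ?thesis .
qed

text \<open>Without discount, the passage identity at \<open>p = 0\<close> says that every level is
  passed almost surely, whereas a path drifting to minus infinity is bounded above. In
  contrapositive form it yields a point \<open>q > 0\<close> with \<open>\<Psi> q \<le> 0\<close>
  for a drifting process.\<close>

lemma not_drifting:
  assumes "\<And>q. 0 < q \<Longrightarrow> 0 < \<Psi> q"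
  shows "\<not> drifts_to_minus_infinity M V"
proof
  assume drift: "drifts_to_minus_infinity M V"
  have "AE \<omega> in M. T (real (Suc n)) \<omega> < \<infinity>" for n
  proof -
    have "(\<integral>\<^sup>+\<omega>. eT (\<Psi> 0) (real (Suc n)) \<omega> \<partial>M) = 1"
      using eT_nn_integral[of "real (Suc n)" 0] assms by (simp add: Psi_0)
    moreover have "eT (\<Psi> 0) (real (Suc n)) \<omega> = indicator {\<omega>. T (real (Suc n)) \<omega> < \<infinity>} \<omega>" for \<omega>
      by (simp add: eT_def Psi_0 indicator_def)
    moreover have "(\<integral>\<^sup>+\<omega>. indicator {\<omega>. T (real (Suc n)) \<omega> < \<infinity>} \<omega> \<partial>M) = emeasure M {\<omega> \<in> space M. T (real (Suc n)) \<omega> < \<infinity>}"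
    proof -
      have "(\<integral>\<^sup>+\<omega>. indicator {\<omega>. T (real (Suc n)) \<omega> < \<infinity>} \<omega> \<partial>M) = (\<integral>\<^sup>+\<omega>. indicator {\<omega> \<in> space M. T (real (Suc n)) \<omega> < \<infinity>} \<omega> \<partial>M)"
        by (intro nn_integral_cong) (simp add: indicator_def)
      also have "\<dots> = emeasure M {\<omega> \<in> space M. T (real (Suc n)) \<omega> < \<infinity>}"
        by (rule nn_integral_indicator) measurable
      finally show ?thesis .
    qed
    ultimately have "emeasure M {\<omega> \<in> space M. T (real (Suc n)) \<omega> < \<infinity>} = 1" by simp
    then show ?thesis by (intro AE_I_eq_1) measurable
  qed
  then have "AE \<omega> in M. \<forall>n. T (real (Suc n)) \<omega> < \<infinity>" by (simp add: AE_all_countable)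
  then have "AE \<omega> in M. False"
    using drift[unfolded drifts_to_minus_infinity_def] AE_space
  proof eventually_elim
    case (elim \<omega>)
    have "eventually (\<lambda>t. V t \<omega> \<le> 0) at_top" using elim(2) by (simp add: filterlim_at_bot)
    then obtain t0 where t0: "\<And>t. t \<ge> t0 \<Longrightarrow> V t \<omega> \<le> 0" by (auto simp: eventually_at_top_linorder)
    have "bounded ((\<lambda>t. V t \<omega>) ` {0..max 0 t0})" by (rule cadlag_bounded[OF V_cadlag[OF elim(3)]]) simp
    then obtain B where B: "\<And>t. t \<in> {0..max 0 t0} \<Longrightarrow> norm (V t \<omega>) \<le> B" unfolding bounded_iff by blast
    have le: "V t \<omega> \<le> max B 0" if "0 \<le> t" for t
      using that t0[of t] B[of t] by (cases "t \<le> t0") auto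
    obtain n where n: "max B 0 < real (Suc n)" using reals_Archimedean2 less_trans of_nat_less_iff lessI by (metis of_nat_Suc)
    have "T (real (Suc n)) \<omega> < \<infinity>" using elim(1) by simp
    then obtain s where "s \<in> \<rat> \<inter> {0..}" "(if real (Suc n) < V s \<omega> then ennreal s else \<infinity>) < \<infinity>"
      unfolding T_def passage_def by (subst (asm) INF_less_iff) blast
    then have "real (Suc n) < V s \<omega>" "0 \<le> s" by (auto split: if_splits)
    then show False using le[of s] n by simp
  qed
  then show False by simp
qed

end

section \<open>Feller semigroups\<close>

lemma continuous_on_max0:
  fixes h :: "real \<Rightarrow> 'a::topological_space"
  shows "continuous_on {0..} h \<Longrightarrow> continuous_on UNIV (\<lambda>x. h (max 0 x))"
  by (rule continuous_on_compose2[of "{0..}" h]) (auto intro!: continuous_intros)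

locale feller =
  fixes Q :: "real \<Rightarrow> real \<Rightarrow> real measure"
  assumes feller: "feller_semigroup Q"
begin

lemma Q_prob: "0 \<le> t \<Longrightarrow> 0 \<le> x \<Longrightarrow> prob_space (Q t x)"
  using feller by (simp add: feller_semigroup_def)

lemma Q_sets[measurable_cong]: "0 \<le> t \<Longrightarrow> 0 \<le> x \<Longrightarrow> sets (Q t x) = sets borel"
  using feller by (simp add: feller_semigroup_def)

lemma Q_space: "0 \<le> t \<Longrightarrow> 0 \<le> x \<Longrightarrow> space (Q t x) = UNIV"
  using sets_eq_imp_space_eq[OF Q_sets] by simp

lemma Q_nonneg: "0 \<le> t \<Longrightarrow> 0 \<le> x \<Longrightarrow> AE y in Q t x. 0 \<le> y"
proof -
  assume t: "0 \<le> t" "0 \<le> x"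
  interpret prob_space "Q t x" by (rule Q_prob[OF t])
  have "prob {0..} = 1" using feller t by (simp add: feller_semigroup_def)
  then have "AE y in Q t x. y \<in> {0..}"
    using t by (subst AE_in_set_eq_1) (auto simp: Q_sets)
  then show ?thesis by simp
qed

lemma Q_0: "0 \<le> x \<Longrightarrow> Q 0 x = return borel x"
  using feller by (simp add: feller_semigroup_def)

lemma Q_CK: "0 \<le> s \<Longrightarrow> 0 \<le> t \<Longrightarrow> 0 \<le> x \<Longrightarrow> B \<in> sets borel \<Longrightarrow>
    emeasure (Q (s + t) x) B = (\<integral>\<^sup>+y\<in>{0..}. emeasure (Q t y) B \<partial>Q s x)"
  using feller unfolding feller_semigroup_def by blast

lemma Q_measurable: "0 \<le> t \<Longrightarrow> 0 \<le> x \<Longrightarrow> f \<in> borel_measurable borel \<Longrightarrow> f \<in> borel_measurable (Q t x)"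
  by (simp add: measurable_cong_sets[OF Q_sets refl])

definition Pt :: "real \<Rightarrow> (real \<Rightarrow> real) \<Rightarrow> real \<Rightarrow> real" where
  "Pt t f x = (LINT y|Q t x. f y)"

lemma Pt_set: "0 \<le> t \<Longrightarrow> 0 \<le> x \<Longrightarrow> f \<in> borel_measurable borel \<Longrightarrow> (LINT y:{0..}|Q t x. f y) = Pt t f x"
proof -
  assume t: "0 \<le> t" "0 \<le> x" and f: "f \<in> borel_measurable borel"
  show ?thesis
    unfolding set_lebesgue_integral_def Pt_def
  proof (rule integral_cong_AE)
    have "(\<lambda>y. indicator {0..} y *\<^sub>R f y) \<in> borel_measurable borel" using f by measurable
    then show "(\<lambda>y. indicator {0..} y *\<^sub>R f y) \<in> borel_measurable (Q t x)" by (rule Q_measurable[OF t])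
    show "f \<in> borel_measurable (Q t x)" using f by (rule Q_measurable[OF t])
    show "AE y in Q t x. indicator {0..} y *\<^sub>R f y = f y"
      using Q_nonneg[OF t] by eventually_elim simp
  qed
qed

text \<open>Functions are extended to the whole line for measurability; decay is imposed at plus
  infinity, the only infinite end of the state space.\<close>

definition C0 :: "(real \<Rightarrow> real) \<Rightarrow> bool" where
  "C0 f \<longleftrightarrow> continuous_on UNIV f \<and> (f \<longlongrightarrow> 0) at_top"

lemma C0_measurable: "C0 f \<Longrightarrow> f \<in> borel_measurable borel"
  by (simp add: C0_def borel_measurable_continuous_onI)

lemma C0_Pt_continuous:
  assumes f: "C0 f" and t: "0 \<le> t"
  shows "continuous_on {0..} (Pt t f)"
proof -
  have "continuous_on {0..} f" "(f \<longlongrightarrow> 0) at_top"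
    using f by (auto simp: C0_def intro: continuous_on_subset)
  then have "continuous_on {0..} (\<lambda>x. LINT y:{0..}|Q t x. f y)"
    using feller t unfolding feller_semigroup_def by blast
  moreover have "(LINT y:{0..}|Q t x. f y) = Pt t f x" if "x \<in> {0..}" for x
    using t that by (simp add: Pt_set C0_measurable[OF f])
  ultimately show ?thesis using continuous_on_cong[OF refl, of "{0..}" "\<lambda>x. LINT y:{0..}|Q t x. f y" "Pt t f"] by blast
qed

lemma C0_Pt_uniform:
  assumes f: "C0 f" and e: "0 < e"
  shows "\<exists>d>0. \<forall>s. 0 \<le> s \<and> s < d \<longrightarrow> (\<forall>x\<ge>0. \<bar>Pt s f x - f x\<bar> < e)"
proof -
  have "continuous_on {0..} f" "(f \<longlongrightarrow> 0) at_top"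
    using f by (auto simp: C0_def intro: continuous_on_subset)
  then have "uniform_limit {0..} (\<lambda>t x. LINT y:{0..}|Q t x. f y) f (at_right 0)"
    using feller unfolding feller_semigroup_def by blast
  then have "eventually (\<lambda>t. \<forall>x\<in>{0..}. dist (LINT y:{0..}|Q t x. f y) (f x) < e) (at_right 0)"
    using e by (simp add: uniform_limit_iff)
  then obtain d where d: "d > 0" "\<And>t. 0 < t \<Longrightarrow> t < d \<Longrightarrow> \<forall>x\<in>{0..}. dist (LINT y:{0..}|Q t x. f y) (f x) < e"
    unfolding eventually_at_right_field by auto
  show ?thesis
  proof (intro exI[of _ d] conjI allI impI)
    fix s x :: real assume s: "0 \<le> s \<and> s < d" and x: "0 \<le> x"
    show "\<bar>Pt s f x - f x\<bar> < e"
    proof (cases "s = 0")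
      case True
      then have "Pt s f x = f x" using x C0_measurable[OF f] by (simp add: Pt_def Q_0 integral_return)
      then show ?thesis using e by simp
    next
      case False
      then have "dist (LINT y:{0..}|Q s x. f y) (f x) < e" using d(2)[of s] s x by auto
      then show ?thesis using s x by (simp add: Pt_set C0_measurable[OF f] dist_real_def)
    qed
  qed (rule d(1))
qed

lemma bounded_integrable:
  fixes f :: "real \<Rightarrow> real" and B :: real
  assumes "0 \<le> t" "0 \<le> x" "f \<in> borel_measurable borel" "\<And>y. 0 \<le> y \<Longrightarrow> \<bar>f y\<bar> \<le> B"
  shows "integrable (Q t x) f"
proof -
  interpret prob_space "Q t x" by (rule Q_prob[OF assms(1,2)])
  show ?thesis
    by (rule integrable_const_bound[where B=B])
       (use Q_nonneg[OF assms(1,2)] assms Q_measurable in \<open>auto elim!: eventually_mono\<close>)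
qed

lemma Pt_bounds:
  assumes "0 \<le> t" "0 \<le> x" "f \<in> borel_measurable borel" "\<And>y. 0 \<le> y \<Longrightarrow> a \<le> f y" "\<And>y. 0 \<le> y \<Longrightarrow> f y \<le> b"
  shows "a \<le> Pt t f x" "Pt t f x \<le> b"
proof -
  interpret prob_space "Q t x" by (rule Q_prob[OF assms(1,2)])
  have int: "integrable (Q t x) f"
    by (rule bounded_integrable[OF assms(1-3), of "max \<bar>a\<bar> \<bar>b\<bar>"]) (use assms(4,5) in \<open>fastforce simp: abs_le_iff\<close>)
  have "(LINT y|Q t x. a) \<le> Pt t f x"
    unfolding Pt_def by (intro integral_mono_AE int) (use Q_nonneg[OF assms(1,2)] assms(4) in \<open>auto elim!: eventually_mono\<close>)
  then show "a \<le> Pt t f x" by (simp add: prob_space)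
  have "Pt t f x \<le> (LINT y|Q t x. b)"
    unfolding Pt_def by (intro integral_mono_AE int) (use Q_nonneg[OF assms(1,2)] assms(5) in \<open>auto elim!: eventually_mono\<close>)
  then show "Pt t f x \<le> b" by (simp add: prob_space)
qed

lemma Pt_nn:
  assumes "0 \<le> t" "0 \<le> x" "f \<in> borel_measurable borel" "\<And>y. 0 \<le> f y" "\<And>y. 0 \<le> y \<Longrightarrow> f y \<le> B"
  shows "(\<integral>\<^sup>+y. ennreal (f y) \<partial>Q t x) = ennreal (Pt t f x)"
  unfolding Pt_def using assms
  by (intro nn_integral_eq_integral bounded_integrable[where B=B]) auto

definition cut :: "real \<Rightarrow> real \<Rightarrow> real" where
  "cut k y = max 0 (min 1 (k + 1 - \<bar>y\<bar>))"

lemma cut_bounds: "0 \<le> cut k y" "cut k y \<le> 1"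
  by (auto simp: cut_def)

lemma cut_tendsto: "(\<lambda>k. cut (real k) y) \<longlonglongrightarrow> 1"
proof (rule tendsto_eventually)
  obtain N where "\<bar>y\<bar> < real N" using reals_Archimedean2 by blast
  then have "cut (real k) y = 1" if "k \<ge> N" for k using that by (auto simp: cut_def)
  then show "eventually (\<lambda>k. cut (real k) y = 1) sequentially" by (auto simp: eventually_sequentially)
qed

lemma cut_C0: "continuous_on UNIV f \<Longrightarrow> C0 (\<lambda>y. f y * cut k y)"
  unfolding C0_def
proof
  assume "continuous_on UNIV f"
  then show "continuous_on UNIV (\<lambda>y. f y * cut k y)" unfolding cut_def by (intro continuous_intros)
  have "eventually (\<lambda>y. f y * cut k y = 0) at_top"
    using eventually_gt_at_top[of "\<bar>k\<bar> + 1"] by eventually_elim (auto simp: cut_def max_def)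
  then show "((\<lambda>y. f y * cut k y) \<longlongrightarrow> 0) at_top" by (rule tendsto_eventually)
qed

text \<open>Since no mass escapes to infinity, the Feller property extends from \<open>C0\<close> to bounded continuous functions.\<close>

lemma Pt_continuous:
  assumes f: "continuous_on UNIV f" and B: "\<And>y. 0 \<le> y \<Longrightarrow> \<bar>f y\<bar> \<le> B" and t: "0 \<le> t"
  shows "continuous_on {0..} (Pt t f)"
  unfolding continuous_on_iff
proof (intro ballI allI impI)
  fix x e :: real assume x: "x \<in> {0..}" and e: "0 < e"
  have B0: "0 \<le> B" using B[of 0] by simp
  have fm: "f \<in> borel_measurable borel" using f by (rule borel_measurable_continuous_onI)
  have cm: "cut k \<in> borel_measurable borel" for k unfolding cut_def by measurable
  have c1: "C0 (cut k)" for k using cut_C0[of "\<lambda>_. 1" k] by simp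
  have diff: "\<bar>Pt t f y - Pt t (\<lambda>y. f y * cut k y) y\<bar> \<le> B * (1 - Pt t (cut k) y)" if "0 \<le> y" for y k
  proof -
    interpret prob_space "Q t y" by (rule Q_prob[OF t that])
    have i1: "integrable (Q t y) f" by (rule bounded_integrable[OF t that fm B])
    have i2: "integrable (Q t y) (cut k)" by (rule bounded_integrable[OF t that cm, of _ 1]) (use cut_bounds in auto)
    have i3: "integrable (Q t y) (\<lambda>y. f y * cut k y)"
    proof (rule bounded_integrable[OF t that, of _ B])
      show "(\<lambda>y. f y * cut k y) \<in> borel_measurable borel" using fm cm by measurable
      show "\<bar>f y * cut k y\<bar> \<le> B" if "0 \<le> y" for y
        using mult_mono[OF B[OF that] cut_bounds(2)[of k y]] cut_bounds[of k y] B0 by (simp add: abs_mult)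
    qed
    have "Pt t f y - Pt t (\<lambda>y. f y * cut k y) y = (LINT z|Q t y. f z * (1 - cut k z))"
      unfolding Pt_def using i1 i3 by (simp add: right_diff_distrib)
    also have "\<bar>\<dots>\<bar> \<le> (LINT z|Q t y. \<bar>f z * (1 - cut k z)\<bar>)" by (rule integral_abs_bound)
    also have "\<dots> \<le> (LINT z|Q t y. B * (1 - cut k z))"
    proof (rule integral_mono_AE)
      show "integrable (Q t y) (\<lambda>z. \<bar>f z * (1 - cut k z)\<bar>)"
        using Bochner_Integration.integrable_diff[OF i1 i3] by (simp add: right_diff_distrib integrable_abs)
      show "integrable (Q t y) (\<lambda>z. B * (1 - cut k z))" using i2 by simp
      show "AE z in Q t y. \<bar>f z * (1 - cut k z)\<bar> \<le> B * (1 - cut k z)"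
        using Q_nonneg[OF t that]
      proof eventually_elim
        case (elim z)
        then show ?case using B[of z] cut_bounds[of k z] by (simp add: abs_mult mult_right_mono)
      qed
    qed
    also have "\<dots> = B * (1 - Pt t (cut k) y)" unfolding Pt_def using i2 by (simp add: prob_space)
    finally show ?thesis .
  qed
  have "(\<lambda>k. Pt t (cut (real k)) x) \<longlonglongrightarrow> (LINT y|Q t x. 1)"
    unfolding Pt_def
  proof (rule integral_dominated_convergence[where w="\<lambda>_. 1"])
    interpret prob_space "Q t x" using t x by (intro Q_prob) auto
    show "integrable (Q t x) (\<lambda>_. 1 :: real)" by simp
    show "cut (real k) \<in> borel_measurable (Q t x)" for k using cm t x by (intro Q_measurable) auto
  qed (use cut_tendsto cut_bounds in auto)
  moreover have "(LINT y|Q t x. 1 :: real) = 1"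
    using prob_space.prob_space[OF Q_prob[OF t, of x]] x by simp
  ultimately have "eventually (\<lambda>k. Pt t (cut (real k)) x > 1 - e / (4 * (B + 1))) sequentially"
    using e B0 by (intro order_tendstoD(1)) auto
  then obtain k where k: "Pt t (cut (real k)) x > 1 - e / (4 * (B + 1))" by (auto simp: eventually_sequentially)
  have "continuous_on {0..} (Pt t (cut (real k)))" by (rule C0_Pt_continuous[OF c1 t])
  moreover have "continuous_on {0..} (Pt t (\<lambda>y. f y * cut (real k) y))" by (rule C0_Pt_continuous[OF cut_C0[OF f] t])
  ultimately have "((Pt t (cut (real k))) \<longlongrightarrow> Pt t (cut (real k)) x) (at x within {0..})"
    "((Pt t (\<lambda>y. f y * cut (real k) y)) \<longlongrightarrow> Pt t (\<lambda>y. f y * cut (real k) y) x) (at x within {0..})"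
    using x by (auto simp: continuous_on_def)
  then have "eventually (\<lambda>y. Pt t (cut (real k)) y > 1 - e / (4 * (B + 1))) (at x within {0..})"
    "eventually (\<lambda>y. dist (Pt t (\<lambda>y. f y * cut (real k) y) y) (Pt t (\<lambda>y. f y * cut (real k) y) x) < e / 4) (at x within {0..})"
    using k e by (auto dest: order_tendstoD tendstoD[of _ _ _ "e / 4"])
  then have "eventually (\<lambda>y. Pt t (cut (real k)) y > 1 - e / (4 * (B + 1)) \<and>
     dist (Pt t (\<lambda>y. f y * cut (real k) y) y) (Pt t (\<lambda>y. f y * cut (real k) y) x) < e / 4) (at x within {0..})"
    by eventually_elim auto
  then obtain d where d: "d > 0" "\<And>y. y \<in> {0..} \<Longrightarrow> y \<noteq> x \<Longrightarrow> dist y x < d \<Longrightarrow> Pt t (cut (real k)) y > 1 - e / (4 * (B + 1)) \<and>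
     dist (Pt t (\<lambda>y. f y * cut (real k) y) y) (Pt t (\<lambda>y. f y * cut (real k) y) x) < e / 4"
    unfolding eventually_at by auto
  have small: "B * (1 - Pt t (cut (real k)) y) \<le> e / 4" if "Pt t (cut (real k)) y > 1 - e / (4 * (B + 1))" for y
  proof -
    have "B * (1 - Pt t (cut (real k)) y) \<le> B * (e / (4 * (B + 1)))" using that B0 by (intro mult_left_mono) auto
    also have "\<dots> \<le> (B + 1) * (e / (4 * (B + 1)))" using e B0 by (intro mult_right_mono) auto
    also have "\<dots> = e / 4" using B0 by (simp add: divide_simps)
    finally show ?thesis .
  qed
  show "\<exists>d>0. \<forall>x'\<in>{0..}. dist x' x < d \<longrightarrow> dist (Pt t f x') (Pt t f x) < e"
  proof (intro exI[of _ d] conjI ballI impI)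
    fix y assume y: "y \<in> {0..}" "dist y x < d"
    show "dist (Pt t f y) (Pt t f x) < e"
    proof (cases "y = x")
      case False
      note dy = d(2)[OF y(1) False y(2)]
      have 1: "\<bar>Pt t f y - Pt t (\<lambda>y. f y * cut (real k) y) y\<bar> \<le> e / 4"
        using diff[of y "real k"] small[of y] dy y by auto
      have 2: "\<bar>Pt t f x - Pt t (\<lambda>y. f y * cut (real k) y) x\<bar> \<le> e / 4"
        using diff[of x "real k"] small[of x] k x by auto
      from 1 2 dy show ?thesis unfolding dist_real_def using e by linarith
    qed (use e in simp)
  qed (rule d(1))
qed

text \<open>The transition law with the starting point clipped to the half-line, which makes it a
  kernel on all of \<open>borel\<close> and avoids restricted sigma-algebras.\<close>

definition kern :: "real \<Rightarrow> real \<Rightarrow> real measure" where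
  "kern t x = Q t (max 0 x)"

text \<open>Half-lines generate the Borel sets, and their indicators are limits of bounded
  continuous ramps, for which the Feller property gives continuity in the starting point.\<close>

lemma kern_measurable:
  assumes t: "0 \<le> t"
  shows "kern t \<in> measurable borel (subprob_algebra borel)"
proof (rule measurable_subprob_algebra_generated)
  show "sets (borel :: real measure) = sigma_sets UNIV (range (\<lambda>a::real. {..a}))"
    by (simp add: borel_eq_atMost)
  show "Int_stable (range (\<lambda>a::real. {..a}))" by (auto simp: Int_stable_def)
  fix x :: real
  interpret prob_space "kern t x" unfolding kern_def using t by (intro Q_prob) auto
  show "subprob_space (kern t x)" by (rule prob_space_imp_subprob_space) unfold_locales
  show "sets (kern t x) = sets borel" unfolding kern_def using t by (intro Q_sets) auto
next
  fix A :: "real set" assume "A \<in> range (\<lambda>a. {..a})"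
  then obtain a where A: "A = {..a}" by auto
  define c where "c = (\<lambda>k y. max 0 (min 1 (1 - real k * (y - a))))"
  have cc: "continuous_on UNIV (c k)" for k unfolding c_def by (intro continuous_intros)
  have cm: "c k \<in> borel_measurable borel" for k using cc by (rule borel_measurable_continuous_onI)
  have cb: "\<bar>c k y\<bar> \<le> 1" for k y by (auto simp: c_def)
  have "(\<lambda>x. ennreal (measure (kern t x) A)) \<in> borel_measurable borel"
  proof (rule measurable_compose[OF _ measurable_ennreal], rule borel_measurable_LIMSEQ_real)
    fix k
    have "continuous_on UNIV (\<lambda>x. Pt t (c k) (max 0 x))"
      by (intro continuous_on_max0 Pt_continuous[OF cc cb t])
    then show "(\<lambda>x. Pt t (c k) (max 0 x)) \<in> borel_measurable borel" by (rule borel_measurable_continuous_onI)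
  next
    fix x :: real
    have sk: "sets (kern t x) = sets borel" unfolding kern_def using t by (intro Q_sets) auto
    have "(\<lambda>k. LINT y|kern t x. c k y) \<longlonglongrightarrow> (LINT y|kern t x. indicator A y)"
    proof (rule integral_dominated_convergence[where w="\<lambda>_. 1"])
      interpret prob_space "kern t x" unfolding kern_def using t by (intro Q_prob) auto
      show "integrable (kern t x) (\<lambda>_. 1 :: real)" by simp
      show "c k \<in> borel_measurable (kern t x)" for k using cm sk by (simp cong: measurable_cong_sets)
      show "indicator A \<in> borel_measurable (kern t x)" using sk A by (simp cong: measurable_cong_sets)
      show "AE y in kern t x. (\<lambda>k. c k y) \<longlonglongrightarrow> indicator A y"
      proof (intro AE_I2 tendsto_eventually)
        fix y
        show "eventually (\<lambda>k. c k y = indicator A y) sequentially"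
        proof (cases "y \<le> a")
          case True
          then have "c k y = 1" for k by (auto simp: c_def min_def max_def mult_nonneg_nonpos)
          then show ?thesis using True A by simp
        next
          case False
          obtain N where N: "1 / (y - a) < real N" using reals_Archimedean2 by blast
          have "c k y = 0" if "k \<ge> N" for k
          proof -
            have "1 / (y - a) \<le> real k" using N that by (meson less_imp_le less_le_trans of_nat_le_iff)
            then have "1 \<le> real k * (y - a)" using False by (simp add: field_simps)
            then show ?thesis by (simp add: c_def)
          qed
          then show ?thesis using False A by (auto simp: eventually_sequentially)
        qed
      qed
    qed (use cb in auto)
    then show "(\<lambda>k. Pt t (c k) (max 0 x)) \<longlonglongrightarrow> measure (kern t x) A"
      using sk A by (simp add: Pt_def kern_def sets_eq_imp_space_eq[OF sk])
  qed
  moreover have "emeasure (kern t x) A = ennreal (measure (kern t x) A)" for x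
  proof -
    interpret prob_space "kern t x" unfolding kern_def using t by (intro Q_prob) auto
    show ?thesis by (rule emeasure_eq_measure)
  qed
  ultimately show "(\<lambda>x. emeasure (kern t x) A) \<in> borel_measurable borel" by simp
next
  have "emeasure (kern t x) UNIV = 1" for x
  proof -
    interpret prob_space "kern t x" unfolding kern_def using t by (intro Q_prob) auto
    show ?thesis using emeasure_space_1 Q_space[of t "max 0 x"] t by (simp add: kern_def)
  qed
  then show "(\<lambda>x. emeasure (kern t x) UNIV) \<in> borel_measurable borel" by simp
qed auto

section \<open>Chapman-Kolmogorov for functions and regularity in time\<close>

lemma kern_nn_measurable:
  "0 \<le> t \<Longrightarrow> f \<in> borel_measurable borel \<Longrightarrow> (\<lambda>x. \<integral>\<^sup>+y. f y \<partial>kern t x) \<in> borel_measurable borel"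
  by (rule measurable_compose[OF kern_measurable nn_integral_measurable_subprob_algebra])

text \<open>Phrasing Chapman-Kolmogorov as a bind extends it at once from sets to nonnegative
  functions.\<close>

lemma CK_bind:
  assumes "0 \<le> s" "0 \<le> t" "0 \<le> x"
  shows "Q (s + t) x = Q s x \<bind> kern t"
proof (rule measure_eqI)
  have km: "kern t \<in> measurable (Q s x) (subprob_algebra borel)"
    using kern_measurable[OF assms(2)] Q_sets[OF assms(1,3)] by (simp cong: measurable_cong_sets)
  have ne: "space (Q s x) \<noteq> {}" using Q_space[OF assms(1,3)] by simp
  show "sets (Q (s + t) x) = sets (Q s x \<bind> kern t)"
    using assms Q_sets[of "s + t" x] by (subst sets_bind[OF sets_kernel[OF km]]) (auto simp: ne)
  fix B assume "B \<in> sets (Q (s + t) x)"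
  then have B: "B \<in> sets borel" using Q_sets[of "s + t" x] assms by simp
  have "emeasure (Q (s + t) x) B = (\<integral>\<^sup>+y\<in>{0..}. emeasure (Q t y) B \<partial>Q s x)" by (rule Q_CK[OF assms B])
  also have "\<dots> = (\<integral>\<^sup>+y. emeasure (kern t y) B \<partial>Q s x)"
    by (rule nn_integral_cong_AE) (use Q_nonneg[OF assms(1,3)] in \<open>auto elim!: eventually_mono simp: kern_def\<close>)
  also have "\<dots> = emeasure (Q s x \<bind> kern t) B" by (rule emeasure_bind[OF ne km B, symmetric])
  finally show "emeasure (Q (s + t) x) B = emeasure (Q s x \<bind> kern t) B" .
qed

lemma CK_nn:
  assumes "0 \<le> s" "0 \<le> t" "0 \<le> x" "f \<in> borel_measurable borel"
  shows "(\<integral>\<^sup>+y. f y \<partial>Q (s + t) x) = (\<integral>\<^sup>+y. (\<integral>\<^sup>+z. f z \<partial>kern t y) \<partial>Q s x)"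
proof -
  have km: "kern t \<in> measurable (Q s x) (subprob_algebra borel)"
    using kern_measurable[OF assms(2)] Q_sets[OF assms(1,3)] by (simp cong: measurable_cong_sets)
  show ?thesis unfolding CK_bind[OF assms(1-3)] by (rule nn_integral_bind[OF assms(4) km])
qed

lemma CK_Pt:
  fixes B :: real
  assumes "0 \<le> s" "0 \<le> t" "0 \<le> x" and f: "f \<in> borel_measurable borel" "\<And>y. 0 \<le> f y" "\<And>y. 0 \<le> y \<Longrightarrow> f y \<le> B"
  shows "Pt (s + t) f x = Pt s (\<lambda>y. Pt t f (max 0 y)) x"
proof -
  have k: "(\<integral>\<^sup>+z. ennreal (f z) \<partial>kern t y) = ennreal (Pt t f (max 0 y))" for y
    unfolding kern_def using assms by (intro Pt_nn[where B=B]) auto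
  have b: "0 \<le> Pt t f (max 0 y)" "Pt t f (max 0 y) \<le> B" for y
    using Pt_bounds[of t "max 0 y" f 0 B] assms by auto
  have "(\<lambda>y. ennreal (Pt t f (max 0 y))) \<in> borel_measurable borel"
    using kern_nn_measurable[OF assms(2), of "\<lambda>y. ennreal (f y)"] f(1) unfolding k by simp
  then have "(\<lambda>y. enn2real (ennreal (Pt t f (max 0 y)))) \<in> borel_measurable borel" by measurable
  then have m: "(\<lambda>y. Pt t f (max 0 y)) \<in> borel_measurable borel" using b by simp
  have "ennreal (Pt (s + t) f x) = (\<integral>\<^sup>+y. ennreal (f y) \<partial>Q (s + t) x)"
    using assms by (intro Pt_nn[where B=B, symmetric]) auto
  also have "\<dots> = (\<integral>\<^sup>+y. ennreal (Pt t f (max 0 y)) \<partial>Q s x)"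
    using assms by (subst CK_nn) (auto simp: k)
  also have "\<dots> = ennreal (Pt s (\<lambda>y. Pt t f (max 0 y)) x)"
  proof (intro Pt_nn[where B=B] assms m)
    show "Pt t f (max 0 y) \<le> B" for y by (rule b(2))
  qed (rule b(1))
  finally have "ennreal (Pt (s + t) f x) = ennreal (Pt s (\<lambda>y. Pt t f (max 0 y)) x)" .
  moreover have "0 \<le> Pt (s + t) f x" by (rule Pt_bounds(1)[where b=B]) (use assms in auto)
  moreover have "0 \<le> Pt s (\<lambda>y. Pt t f (max 0 y)) x" by (rule Pt_bounds(1)[OF assms(1,3) m b])
  ultimately show ?thesis by (simp only: ennreal_inj)
qed

text \<open>A short extra time \<open>s\<close> changes \<open>f\<close> into \<open>Pt s f\<close>,
  uniformly close to \<open>f\<close>, and averaging under \<open>Q t x\<close> keeps the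
  distance.\<close>

lemma Pt_right_tendsto:
  fixes B :: real
  assumes f: "C0 f" "\<And>y. 0 \<le> f y" "\<And>y. 0 \<le> y \<Longrightarrow> f y \<le> B" and t: "0 \<le> t" and x: "0 \<le> x"
  shows "((\<lambda>s. Pt s f x) \<longlongrightarrow> Pt t f x) (at_right t)"
proof (rule tendstoI)
  fix e :: real assume e: "0 < e"
  note fm = C0_measurable[OF f(1)]
  obtain d where d: "d > 0" "\<And>s x. 0 \<le> s \<Longrightarrow> s < d \<Longrightarrow> 0 \<le> x \<Longrightarrow> \<bar>Pt s f x - f x\<bar> < e / 2"
    using C0_Pt_uniform[OF f(1), of "e / 2"] e by auto
  have "dist (Pt u f x) (Pt t f x) < e" if u: "t < u" "u < t + d" for u
  proof -
    define s where "s = u - t"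
    have s: "0 \<le> s" "s < d" using u by (auto simp: s_def)
    have m: "(\<lambda>y. Pt s f (max 0 y)) \<in> borel_measurable borel"
      by (intro borel_measurable_continuous_onI continuous_on_max0 C0_Pt_continuous f s)
    have bd: "0 \<le> Pt s f (max 0 y)" "Pt s f (max 0 y) \<le> B" for y
      using Pt_bounds[of s "max 0 y" f 0 B] s f fm by auto
    have i1: "integrable (Q t x) (\<lambda>y. Pt s f (max 0 y))"
    proof (rule bounded_integrable[OF t x m])
      show "\<bar>Pt s f (max 0 y)\<bar> \<le> B" for y unfolding abs_of_nonneg[OF bd(1)] by (rule bd(2))
    qed
    have i2: "integrable (Q t x) f"
      by (rule bounded_integrable[OF t x fm, of B]) (use f in auto)
    have "Pt u f x = Pt (t + s) f x" by (simp add: s_def)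
    also have "\<dots> = Pt t (\<lambda>y. Pt s f (max 0 y)) x" using t s x f fm by (intro CK_Pt[where B=B]) auto
    finally have "\<bar>Pt u f x - Pt t f x\<bar> = \<bar>LINT y|Q t x. Pt s f (max 0 y) - f y\<bar>"
      unfolding Pt_def[of t] using i1 i2 by simp
    also have "\<dots> \<le> (LINT y|Q t x. \<bar>Pt s f (max 0 y) - f y\<bar>)" by (rule integral_abs_bound)
    also have "\<dots> \<le> (LINT y|Q t x. e / 2)"
    proof (rule integral_mono_AE)
      show "integrable (Q t x) (\<lambda>y. \<bar>Pt s f (max 0 y) - f y\<bar>)" using i1 i2 by simp
      interpret prob_space "Q t x" by (rule Q_prob[OF t x])
      show "integrable (Q t x) (\<lambda>y. e / 2)" by simp
      show "AE y in Q t x. \<bar>Pt s f (max 0 y) - f y\<bar> \<le> e / 2"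
        using Q_nonneg[OF t x] by eventually_elim (use d(2)[OF s] in \<open>auto intro: less_imp_le\<close>)
    qed
    also have "\<dots> = e / 2" using prob_space.prob_space[OF Q_prob[OF t x]] by simp
    finally show ?thesis using e by (simp add: dist_real_def)
  qed
  then show "eventually (\<lambda>u. dist (Pt u f x) (Pt t f x) < e) (at_right t)"
    unfolding eventually_at_right_field using d(1) by (intro exI[of _ "t + d"]) auto
qed

lemma Pt_pair_measurable:
  fixes B :: real
  assumes f: "C0 f" "\<And>y. 0 \<le> f y" "\<And>y. 0 \<le> y \<Longrightarrow> f y \<le> B"
  shows "(\<lambda>(t, x). Pt (max 0 t) f (max 0 x)) \<in> borel_measurable (borel \<Otimes>\<^sub>M borel)"
proof (rule right_continuous_measurable_pair[of "\<lambda>t x. Pt t f (max 0 x)"])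
  show "(\<lambda>x. Pt t f (max 0 x)) \<in> borel_measurable borel" if "0 \<le> t" for t
    using that by (intro borel_measurable_continuous_onI continuous_on_max0 C0_Pt_continuous f)
  show "((\<lambda>s. Pt s f (max 0 x)) \<longlongrightarrow> Pt t f (max 0 x)) (at_right t)" if "0 \<le> t" for t x
    using that by (intro Pt_right_tendsto[where B=B] f) auto
qed

end

section \<open>The conditioned semigroup\<close>

text \<open>A single Laplace variable \<open>l\<close> is fixed. \<open>Q\<close> is the Feller
  semigroup of the conditioned process, given explicitly only from starting points
  \<open>x > 0\<close>.\<close>

locale conditioned = spectrally_negative M V \<Psi> + rv_scale "\<lambda>q. \<Psi> (q + \<kappa>)" \<alpha> W \<kappa> l + feller Q
  for M :: "'a measure" and V \<Psi> \<alpha> W \<kappa> l Q +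
  assumes Q_eq: "\<And>t x. 0 \<le> t \<Longrightarrow> 0 < x \<Longrightarrow> Q t x = p_up M V W t x"
    and kappa_nonneg: "0 \<le> \<kappa>"
begin

lemma Psi_kappa: "\<Psi> \<kappa> = 0"
  using P_zero by simp

lemma Psi_pos: "\<kappa> < q \<Longrightarrow> 0 < \<Psi> q"
  using P_pos[of "q - \<kappa>"] by simp

lemma Psi_less: "\<kappa> \<le> p \<Longrightarrow> p < q \<Longrightarrow> \<Psi> p < \<Psi> q"
  using P_strict_mono[of "p - \<kappa>" "q - \<kappa>"] Psi_kappa Psi_pos[of q] by (cases "p = \<kappa>") auto

lemma Psi_nonneg: "\<kappa> \<le> p \<Longrightarrow> 0 \<le> \<Psi> p"
  using Psi_kappa Psi_pos[of p] by (cases "p = \<kappa>") auto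

lemma W_hat: "\<kappa> < q \<Longrightarrow> (\<integral>\<^sup>+x\<in>{0..}. ennreal (exp (- q * x)) * ennreal (Wp x) \<partial>lborel) = ennreal (1 / \<Psi> q)"
  using W_laplace[of q] by (auto simp: Wp_def indicator_def intro!: nn_integral_cong elim!: back_subst[of "\<lambda>a. a = _"])

text \<open>If \<open>W x = 0\<close>, division by zero makes the density in \<open>p_up\<close>
  vanish, contradicting that \<open>Q\<close> consists of probability measures.\<close>

lemma W_pos: "0 < x \<Longrightarrow> 0 < W x"
proof (rule ccontr)
  assume x: "0 < x" and "\<not> 0 < W x"
  then have "W x = 0" using W_nonneg[of x] by simp
  then have "p_up M V W 1 x = density (distr (density M (indicator {\<omega> \<in> space M. 0 < (INF s\<in>{0..1}. x + V s \<omega>)})) borel (\<lambda>\<omega>. x + V 1 \<omega>)) (\<lambda>y. 0)"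
    unfolding p_up_def by (intro arg_cong2[where f=density]) auto
  then have "emeasure (Q 1 x) (space (Q 1 x)) = 0"
    using Q_eq[of 1 x] x by (simp add: emeasure_density)
  then show False using prob_space.emeasure_space_1[OF Q_prob[of 1 x]] x by simp
qed

lemma killed_event_measurable:
  assumes t: "0 < t"
  shows "{\<omega> \<in> space M. 0 < (INF s\<in>{0..t}. x + V s \<omega>)} \<in> sets M"
proof -
  have [measurable]: "(\<lambda>\<omega>. INF s\<in>dyadic t. V s \<omega>) \<in> borel_measurable M"
    using dyadic_subset[of t] t by (intro borel_measurable_cINF_real countable_dyadic) auto
  have "{\<omega> \<in> space M. 0 < (INF s\<in>{0..t}. x + V s \<omega>)} = {\<omega> \<in> space M. 0 < x + (INF s\<in>dyadic t. V s \<omega>)}"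
    using cadlag_INF_dyadic(1)[OF V_cadlag t] by auto
  also have "\<dots> \<in> sets M" by measurable
  finally show ?thesis .
qed

lemma killed_pos:
  assumes "\<omega> \<in> space M" "0 \<le> t" "0 < (INF s\<in>{0..t}. x + V s \<omega>)"
  shows "0 < x + V t \<omega>"
proof -
  have "bounded ((\<lambda>s. x + V s \<omega>) ` {0..t})"
    using bounded_translation[OF cadlag_bounded[OF V_cadlag[OF assms(1)] assms(2)], of x] by (simp add: image_image)
  then have "bdd_below ((\<lambda>s. x + V s \<omega>) ` {0..t})" by (rule bounded_imp_bdd_below)
  then have "(INF s\<in>{0..t}. x + V s \<omega>) \<le> x + V t \<omega>" using assms(2) by (intro cINF_lower) auto
  then show ?thesis using assms(3) by simp
qed

text \<open>Multiplication by \<open>W x\<close> removes the normalisation in \<open>p_up\<close>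
  and exhibits \<open>Q\<close> as the Doob transform of the killed semigroup.\<close>

lemma Q_h_transform:
  assumes t: "0 < t" and x: "0 < x" and f[measurable]: "f \<in> borel_measurable borel"
  shows "ennreal (W x) * (\<integral>\<^sup>+y. f y \<partial>Q t x) = K t (\<lambda>y. ennreal (Wp y) * f y) x"
proof -
  let ?A = "{\<omega> \<in> space M. 0 < (INF s\<in>{0..t}. x + V s \<omega>)}"
  note A[measurable] = killed_event_measurable[OF t, of x]
  have [measurable]: "V t \<in> borel_measurable M" using t by simp
  note Wx = W_pos[OF x]
  define d where "d = (\<lambda>y. ennreal (if 0 < y then Wp y / W x else 0))"
  have [measurable]: "d \<in> borel_measurable borel" unfolding d_def by measurable
  have "Q t x = density (distr (density M (indicator ?A)) borel (\<lambda>\<omega>. x + V t \<omega>)) d"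
    unfolding Q_eq[OF less_imp_le[OF t] x] p_up_def d_def
    by (intro arg_cong2[where f=density]) (auto simp: Wp_def fun_eq_iff max_def)
  then have "(\<integral>\<^sup>+y. f y \<partial>Q t x) = (\<integral>\<^sup>+\<omega>. indicator ?A \<omega> * (d (x + V t \<omega>) * f (x + V t \<omega>)) \<partial>M)"
    by (simp add: nn_integral_density nn_integral_distr)
  then have "ennreal (W x) * (\<integral>\<^sup>+y. f y \<partial>Q t x) = (\<integral>\<^sup>+\<omega>. ennreal (W x) * (indicator ?A \<omega> * (d (x + V t \<omega>) * f (x + V t \<omega>))) \<partial>M)"
    by (subst nn_integral_cmult) auto
  also have "\<dots> = K t (\<lambda>y. ennreal (Wp y) * f y) x"
    unfolding K_def
  proof (rule nn_integral_cong)
    fix \<omega> assume w: "\<omega> \<in> space M"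
    show "ennreal (W x) * (indicator ?A \<omega> * (d (x + V t \<omega>) * f (x + V t \<omega>)))
      = (if 0 < (INF s\<in>{0..t}. x + V s \<omega>) then ennreal (Wp (x + V t \<omega>)) * f (x + V t \<omega>) else 0)"
    proof (cases "0 < (INF s\<in>{0..t}. x + V s \<omega>)")
      case True
      then have "0 < x + V t \<omega>" using killed_pos[OF w, of t x] t by simp
      then have "ennreal (W x) * d (x + V t \<omega>) = ennreal (Wp (x + V t \<omega>))"
        using Wx Wp_nonneg by (simp add: d_def ennreal_mult[symmetric])
      then show ?thesis using True w by (simp add: mult.assoc[symmetric])
    qed simp
  qed
  finally show ?thesis .
qed

text \<open>Averaging the starting point over Lebesgue measure makes \<open>x + V t\<close> avoid
  null sets, whatever the law of \<open>V t\<close>. Identities known almost everywhere may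
  therefore be used under \<open>Q t x\<close> for almost every \<open>x\<close>.\<close>

lemma Q_null:
  assumes N[measurable]: "N \<in> sets borel" and null: "emeasure lborel N = 0" and t: "0 < t"
  shows "AE x in lborel. 0 < x \<longrightarrow> (AE y in Q t x. y \<notin> N)"
proof -
  have [measurable]: "V t \<in> borel_measurable M" using t by simp
  interpret P: pair_sigma_finite lborel M ..
  have "(\<integral>\<^sup>+x. \<integral>\<^sup>+\<omega>. indicator N (x + V t \<omega>) \<partial>M \<partial>lborel) = (\<integral>\<^sup>+\<omega>. \<integral>\<^sup>+x. indicator N (x + V t \<omega>) \<partial>lborel \<partial>M)"
    by (rule P.Fubini'[symmetric]) measurable
  also have "\<dots> = (\<integral>\<^sup>+\<omega>. \<integral>\<^sup>+x. indicator N x \<partial>lborel \<partial>M)"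
  proof (rule nn_integral_cong)
    fix \<omega>
    show "(\<integral>\<^sup>+x. indicator N (x + V t \<omega>) \<partial>lborel) = (\<integral>\<^sup>+x. indicator N x \<partial>lborel)"
      using nn_integral_real_affine[of "indicator N" 1 "V t \<omega>"] by (simp add: add.commute)
  qed
  also have "\<dots> = 0" using null by simp
  finally have "AE x in lborel. (\<integral>\<^sup>+\<omega>. indicator N (x + V t \<omega>) \<partial>M) = 0"
    by (subst (asm) nn_integral_0_iff_AE) auto
  then show ?thesis
  proof eventually_elim
    case (elim x)
    show ?case
    proof
      assume x: "0 < x"
      have ae: "AE \<omega> in M. (indicator N (x + V t \<omega>) :: ennreal) = 0"
        using elim by (subst (asm) nn_integral_0_iff_AE) auto
      have "ennreal (W x) * (\<integral>\<^sup>+y. indicator N y \<partial>Q t x) = K t (\<lambda>y. ennreal (Wp y) * indicator N y) x"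
        by (rule Q_h_transform[OF t x]) measurable
      also have "\<dots> = (\<integral>\<^sup>+\<omega>. 0 \<partial>M)"
        unfolding K_def by (rule nn_integral_cong_AE) (use ae in \<open>auto elim!: eventually_mono\<close>)
      finally have "(\<integral>\<^sup>+y. indicator N y \<partial>Q t x) = 0" using W_pos[OF x] by simp
      then have "AE y in Q t x. (indicator N y :: ennreal) = 0"
        using Q_measurable[of t x "indicator N :: real \<Rightarrow> ennreal"] t x by (subst (asm) nn_integral_0_iff_AE) auto
      then show "AE y in Q t x. y \<notin> N" by (auto elim!: eventually_mono simp: indicator_def split: if_splits)
    qed
  qed
qed

text \<open>Resolvent of the conditioned semigroup. Values in \<open>ennreal\<close> admit the rate
  0, that is, the potential, before its finiteness is known.\<close>

definition R :: "real \<Rightarrow> (real \<Rightarrow> real) \<Rightarrow> real \<Rightarrow> ennreal" where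
  "R r f x = (\<integral>\<^sup>+t\<in>{0<..}. ennreal (exp (- r * t)) * ennreal (Pt t f (max 0 x)) \<partial>lborel)"

lemma R_integrand_measurable:
  fixes B :: real
  assumes f: "C0 f" "\<And>y. 0 \<le> f y" "\<And>y. 0 \<le> y \<Longrightarrow> f y \<le> B"
  shows "(\<lambda>(t, x). ennreal (Pt t f (max 0 x)) * indicator {0<..} t) \<in> borel_measurable (borel \<Otimes>\<^sub>M borel)"
proof -
  note m = Pt_pair_measurable[of f B, OF f]
  have [measurable]: "(\<lambda>p. Pt (max 0 (fst p)) f (max 0 (snd p))) \<in> borel_measurable (borel \<Otimes>\<^sub>M borel)"
    using m by (simp add: split_beta)
  have "(\<lambda>p. ennreal (Pt (max 0 (fst p)) f (max 0 (snd p))) * indicator {0<..} (fst p)) \<in> borel_measurable (borel \<Otimes>\<^sub>M borel)"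
    by measurable
  moreover have "(\<lambda>p. ennreal (Pt (max 0 (fst p)) f (max 0 (snd p))) * indicator {0<..} (fst p))
    = (\<lambda>(t, x). ennreal (Pt t f (max 0 x)) * indicator {0<..} t)"
    by (auto simp: fun_eq_iff indicator_def)
  ultimately show ?thesis by (simp only:)
qed

lemma R_measurable:
  fixes B :: real
  assumes f: "C0 f" "\<And>y. 0 \<le> f y" "\<And>y. 0 \<le> y \<Longrightarrow> f y \<le> B"
  shows "R r f \<in> borel_measurable borel"
proof -
  note m = R_integrand_measurable[of f B, OF f]
  have [measurable]: "(\<lambda>p. ennreal (Pt (snd p) f (max 0 (fst p))) * indicator {0<..} (snd p)) \<in> borel_measurable (borel \<Otimes>\<^sub>M borel)"
    using measurable_compose[OF measurable_pair_swap' m] by (simp add: split_beta)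
  have "(\<lambda>p. ennreal (exp (- r * snd p)) * (ennreal (Pt (snd p) f (max 0 (fst p))) * indicator {0<..} (snd p))) \<in> borel_measurable (borel \<Otimes>\<^sub>M borel)"
    by measurable
  then have "(\<lambda>x. \<integral>\<^sup>+t. ennreal (exp (- r * t)) * (ennreal (Pt t f (max 0 x)) * indicator {0<..} t) \<partial>lborel) \<in> borel_measurable borel"
    by (intro lborel.borel_measurable_nn_integral) (simp add: split_beta)
  then show ?thesis unfolding R_def[abs_def] by (simp add: mult.assoc)
qed

lemma R_laplace:
  fixes B :: real
  assumes f: "C0 f" "\<And>y. 0 \<le> f y" "\<And>y. 0 \<le> y \<Longrightarrow> f y \<le> B" and p: "\<kappa> \<le> p" and q: "p < q"
  shows "(\<integral>\<^sup>+x\<in>{0..}. ennreal (exp (- q * x)) * (ennreal (Wp x) * R (\<Psi> p) f x) \<partial>lborel)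
    = (\<integral>\<^sup>+z\<in>{0<..}. ennreal (Wp z * f z) * ennreal ((exp (- p * z) - exp (- q * z)) / (\<Psi> q - \<Psi> p)) \<partial>lborel)"
proof -
  note [measurable] = C0_measurable[OF f(1)]
  note m = R_integrand_measurable[of f B, OF f]
  have [measurable]: "(\<lambda>p. ennreal (Pt (fst p) f (max 0 (snd p))) * indicator {0<..} (fst p)) \<in> borel_measurable (borel \<Otimes>\<^sub>M borel)"
    using m by (simp add: split_beta)
  have mt: "(\<lambda>t. ennreal (Pt t f (max 0 x)) * indicator {0<..} t) \<in> borel_measurable borel" for x
    using measurable_compose[OF _ m, of "\<lambda>t. (t, x)" borel] by simp
  have mx: "(\<lambda>x. ennreal (Pt t f (max 0 x))) \<in> borel_measurable borel" if "0 < t" for t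
    using measurable_compose[OF _ m, of "\<lambda>x. (t, x)" borel] that by simp
  define H where "H = (\<lambda>t x. (ennreal (exp (- q * x)) * ennreal (Wp x) * indicator {0..} x) * (ennreal (exp (- \<Psi> p * t)) * (ennreal (Pt t f (max 0 x)) * indicator {0<..} t)))"
  have [measurable]: "(\<lambda>(t, x). H t x) \<in> borel_measurable (lborel \<Otimes>\<^sub>M lborel)"
    unfolding H_def split_beta by measurable
  have "(\<integral>\<^sup>+x\<in>{0..}. ennreal (exp (- q * x)) * (ennreal (Wp x) * R (\<Psi> p) f x) \<partial>lborel) = (\<integral>\<^sup>+x. \<integral>\<^sup>+t. H t x \<partial>lborel \<partial>lborel)"
  proof (rule nn_integral_cong)
    fix x :: real
    note [measurable] = mt[of x]
    have "(\<integral>\<^sup>+t. H t x \<partial>lborel) = (ennreal (exp (- q * x)) * ennreal (Wp x) * indicator {0..} x) * (\<integral>\<^sup>+t. ennreal (exp (- \<Psi> p * t)) * (ennreal (Pt t f (max 0 x)) * indicator {0<..} t) \<partial>lborel)"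
      unfolding H_def by (rule nn_integral_cmult) measurable
    also have "(\<integral>\<^sup>+t. ennreal (exp (- \<Psi> p * t)) * (ennreal (Pt t f (max 0 x)) * indicator {0<..} t) \<partial>lborel) = R (\<Psi> p) f x"
      unfolding R_def by (simp add: mult.assoc)
    finally show "ennreal (exp (- q * x)) * (ennreal (Wp x) * R (\<Psi> p) f x) * indicator {0..} x = (\<integral>\<^sup>+t. H t x \<partial>lborel)"
      by (simp add: mult_ac)
  qed
  also have "\<dots> = (\<integral>\<^sup>+t. \<integral>\<^sup>+x. H t x \<partial>lborel \<partial>lborel)" by (rule lborel_pair.Fubini') measurable
  also have "\<dots> = (\<integral>\<^sup>+t\<in>{0<..}. ennreal (exp (- \<Psi> p * t)) * (\<integral>\<^sup>+x\<in>{0..}. ennreal (exp (- q * x)) * K t (\<lambda>y. ennreal (Wp y) * ennreal (f y)) x \<partial>lborel) \<partial>lborel)"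
  proof (rule nn_integral_cong)
    fix t :: real
    show "(\<integral>\<^sup>+x. H t x \<partial>lborel) = ennreal (exp (- \<Psi> p * t)) * (\<integral>\<^sup>+x\<in>{0..}. ennreal (exp (- q * x)) * K t (\<lambda>y. ennreal (Wp y) * ennreal (f y)) x \<partial>lborel) * indicator {0<..} t"
    proof (cases "0 < t")
      case True
      note [measurable] = mx[OF True]
      have "(\<integral>\<^sup>+x. H t x \<partial>lborel) = (\<integral>\<^sup>+x. ennreal (exp (- \<Psi> p * t)) * ((ennreal (exp (- q * x)) * ennreal (Wp x) * indicator {0..} x) * ennreal (Pt t f (max 0 x))) \<partial>lborel)"
        using True by (intro nn_integral_cong) (simp add: H_def mult_ac)
      also have "\<dots> = ennreal (exp (- \<Psi> p * t)) * (\<integral>\<^sup>+x. (ennreal (exp (- q * x)) * ennreal (Wp x) * indicator {0..} x) * ennreal (Pt t f (max 0 x)) \<partial>lborel)"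
        by (rule nn_integral_cmult) measurable
      also have "(\<integral>\<^sup>+x. (ennreal (exp (- q * x)) * ennreal (Wp x) * indicator {0..} x) * ennreal (Pt t f (max 0 x)) \<partial>lborel)
         = (\<integral>\<^sup>+x\<in>{0..}. ennreal (exp (- q * x)) * K t (\<lambda>y. ennreal (Wp y) * ennreal (f y)) x \<partial>lborel)"
      proof (rule nn_integral_cong_AE)
        show "AE x in lborel. (ennreal (exp (- q * x)) * ennreal (Wp x) * indicator {0..} x) * ennreal (Pt t f (max 0 x))
          = ennreal (exp (- q * x)) * K t (\<lambda>y. ennreal (Wp y) * ennreal (f y)) x * indicator {0..} x"
          using AE_lborel_singleton[of 0]
        proof eventually_elim
          case (elim x)
          show ?case
          proof (cases "0 < x")
            case x: True
            have "K t (\<lambda>y. ennreal (Wp y) * ennreal (f y)) x = ennreal (Wp x) * ennreal (Pt t f x)"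
              using Q_h_transform[OF True x, of "\<lambda>y. ennreal (f y)"] Pt_nn[of t x f B] True x f by (simp add: Wp_def)
            then show ?thesis using x by (simp add: mult_ac)
          qed (use elim in auto)
        qed
      qed
      finally show ?thesis using True by simp
    qed (simp add: H_def)
  qed
  also have "\<dots> = (\<integral>\<^sup>+z\<in>{0<..}. (ennreal (Wp z) * ennreal (f z)) * ennreal ((exp (- p * z) - exp (- q * z)) / (\<Psi> q - \<Psi> p)) \<partial>lborel)"
    by (rule killed_resolvent_laplace) (use p q kappa_nonneg Psi_nonneg Psi_pos Psi_less in auto)
  finally show ?thesis using f Wp_nonneg by (simp add: ennreal_mult)
qed

definition g :: "real \<Rightarrow> real" where
  "g x = (if x \<le> 0 then 1 else G x / Wp x)"

lemma Wp_eq: "0 \<le> x \<Longrightarrow> Wp x = W x"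
  by (simp add: Wp_def)

lemma Wp_pos: "0 < x \<Longrightarrow> 0 < Wp x"
  using W_pos by (simp add: Wp_eq)

lemma g_ge_1: "1 \<le> g x"
  using G_ge[of x] Wp_pos[of x] by (auto simp: g_def Wp_eq)

lemma g_upper: "g x \<le> exp (l * Wp x * max 0 x)"
  using G_le[of x] Wp_pos[of x] by (auto simp: g_def Wp_eq divide_le_eq mult.commute max_def)

text \<open>At 0 the quotient may be of the form 0/0; continuity there comes from squeezing
  \<open>g\<close> between 1 and \<open>exp (l * Wp x * max 0 x)\<close>.\<close>

lemma g_cont: "continuous_on UNIV g"
proof -
  have "isCont g x" for x
  proof (cases "x = 0")
    case True
    have "((\<lambda>x. exp (l * Wp x * max 0 x)) \<longlongrightarrow> exp (l * Wp 0 * max 0 0)) (at 0)"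
      using Wp_cont by (intro tendsto_intros) (auto simp: continuous_on_eq_continuous_at isCont_def)
    then have "(g \<longlongrightarrow> 1) (at 0)"
      by (intro tendsto_sandwich[of "\<lambda>_. 1" g "at 0" "\<lambda>x. exp (l * Wp x * max 0 x)"]) (auto simp: g_ge_1 g_upper)
    then show ?thesis using True by (simp add: isCont_def g_def)
  next
    case False
    have "continuous_on {..<0} g" by (rule continuous_on_eq[of _ "\<lambda>_. 1"]) (auto simp: g_def)
    moreover have "continuous_on {0<..} g"
    proof (rule continuous_on_eq[of _ "\<lambda>x. G x / Wp x"])
      show "continuous_on {0<..} (\<lambda>x. G x / Wp x)"
        using Wp_pos by (intro continuous_intros continuous_on_subset[OF G_cont] continuous_on_subset[OF Wp_cont]) force+
    qed (auto simp: g_def)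
    ultimately show ?thesis using False
      by (cases "x < 0") (auto simp: continuous_on_eq_continuous_at)
  qed
  then show ?thesis by (simp add: continuous_on_eq_continuous_at)
qed

lemma Gr_laplace_shift:
  assumes "\<kappa> \<le> p"
  shows "(\<integral>\<^sup>+z\<in>{0<..}. ennreal (exp (- p * z)) * ennreal (l * exp (- z) * G z) \<partial>lborel) = ennreal (l * Gr (p + 1))"
proof -
  have Gm[measurable]: "G \<in> borel_measurable borel" by (rule borel_measurable_continuous_onI[OF G_cont])
  have "(\<integral>\<^sup>+z\<in>{0<..}. ennreal (exp (- p * z)) * ennreal (l * exp (- z) * G z) \<partial>lborel)
     = (\<integral>\<^sup>+z. ennreal l * (ennreal (exp (- (p + 1) * z)) * ennreal (G z) * indicator {0..} z) \<partial>lborel)"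
  proof (rule nn_integral_cong_AE)
    show "AE z in lborel. ennreal (exp (- p * z)) * ennreal (l * exp (- z) * G z) * indicator {0<..} z
      = ennreal l * (ennreal (exp (- (p + 1) * z)) * ennreal (G z) * indicator {0..} z)"
      using AE_lborel_singleton[of 0]
    proof eventually_elim
      case (elim z)
      show ?case
      proof (cases "0 < z")
        case True
        then have "0 \<le> G z" using G_ge[of z] W_nonneg[of z] by simp
        then show ?thesis using True l_pos
          by (simp add: ennreal_mult[symmetric] exp_add[symmetric] algebra_simps)
      qed (use elim in auto)
    qed
  qed
  also have "\<dots> = ennreal l * ennreal (Gr (p + 1))"
    using assms G_laplace[of "p + 1"] by (subst nn_integral_cmult) auto
  also have "\<dots> = ennreal (l * Gr (p + 1))"
    using assms l_pos Gr_nonneg[of "p + 1"] by (simp add: ennreal_mult)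
  finally show ?thesis .
qed

text \<open>The integrand is a difference of two exponential weights, and each weight gives a value
  of \<open>Gr\<close> by \<open>Gr_laplace_shift\<close>. The additive form avoids truncated
  subtraction in \<open>ennreal\<close>.\<close>

lemma psi_integral:
  assumes p: "\<kappa> \<le> p" and q: "p < q"
  shows "(\<integral>\<^sup>+z\<in>{0<..}. ennreal (l * exp (- z) * G z) * ennreal ((exp (- p * z) - exp (- q * z)) / (\<Psi> q - \<Psi> p)) \<partial>lborel)
     + ennreal (l * Gr (q + 1) / (\<Psi> q - \<Psi> p)) = ennreal (l * Gr (p + 1) / (\<Psi> q - \<Psi> p))"
proof -
  have Gm[measurable]: "G \<in> borel_measurable borel" by (rule borel_measurable_continuous_onI[OF G_cont])
  define c where "c = 1 / (\<Psi> q - \<Psi> p)"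
  have c: "0 < c" using Psi_less[OF p q] by (simp add: c_def)
  have shift: "(\<integral>\<^sup>+z\<in>{0<..}. ennreal c * (ennreal (exp (- r * z)) * ennreal (l * exp (- z) * G z)) \<partial>lborel) = ennreal (l * Gr (r + 1) / (\<Psi> q - \<Psi> p))"
    if "\<kappa> \<le> r" for r
  proof -
    have "(\<integral>\<^sup>+z\<in>{0<..}. ennreal c * (ennreal (exp (- r * z)) * ennreal (l * exp (- z) * G z)) \<partial>lborel)
       = ennreal c * ennreal (l * Gr (r + 1))"
      unfolding Gr_laplace_shift[OF that, symmetric] by (subst nn_integral_cmult[symmetric]) (auto simp: mult.assoc)
    also have "\<dots> = ennreal (l * Gr (r + 1) / (\<Psi> q - \<Psi> p))"
      using c l_pos Gr_nonneg[of "r + 1"] that by (simp add: ennreal_mult[symmetric] c_def)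
    finally show ?thesis .
  qed
  have "(\<integral>\<^sup>+z\<in>{0<..}. ennreal (l * exp (- z) * G z) * ennreal ((exp (- p * z) - exp (- q * z)) / (\<Psi> q - \<Psi> p)) \<partial>lborel)
     + (\<integral>\<^sup>+z\<in>{0<..}. ennreal c * (ennreal (exp (- q * z)) * ennreal (l * exp (- z) * G z)) \<partial>lborel)
     = (\<integral>\<^sup>+z\<in>{0<..}. ennreal c * (ennreal (exp (- p * z)) * ennreal (l * exp (- z) * G z)) \<partial>lborel)"
  proof (subst nn_integral_add[symmetric])
    show "(\<integral>\<^sup>+z. ennreal (l * exp (- z) * G z) * ennreal ((exp (- p * z) - exp (- q * z)) / (\<Psi> q - \<Psi> p)) * indicator {0<..} z
       + ennreal c * (ennreal (exp (- q * z)) * ennreal (l * exp (- z) * G z)) * indicator {0<..} z \<partial>lborel)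
      = (\<integral>\<^sup>+z\<in>{0<..}. ennreal c * (ennreal (exp (- p * z)) * ennreal (l * exp (- z) * G z)) \<partial>lborel)"
    proof (rule nn_integral_cong)
      fix z :: real
      show "ennreal (l * exp (- z) * G z) * ennreal ((exp (- p * z) - exp (- q * z)) / (\<Psi> q - \<Psi> p)) * indicator {0<..} z
       + ennreal c * (ennreal (exp (- q * z)) * ennreal (l * exp (- z) * G z)) * indicator {0<..} z
       = ennreal c * (ennreal (exp (- p * z)) * ennreal (l * exp (- z) * G z)) * indicator {0<..} z"
      proof (cases "0 < z")
        case True
        then have G0: "0 \<le> l * exp (- z) * G z" using G_ge[of z] W_nonneg[of z] l_pos by simp
        have "p * z \<le> q * z" using q True by (intro mult_right_mono) auto
        then have e: "0 \<le> exp (- p * z) - exp (- q * z)" by simp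
        have "ennreal (l * exp (- z) * G z) * ennreal ((exp (- p * z) - exp (- q * z)) / (\<Psi> q - \<Psi> p))
          + ennreal c * (ennreal (exp (- q * z)) * ennreal (l * exp (- z) * G z))
          = ennreal ((l * exp (- z) * G z) * ((exp (- p * z) - exp (- q * z)) * c) + c * (exp (- q * z) * (l * exp (- z) * G z)))"
          using G0 e c by (simp add: ennreal_mult[symmetric] ennreal_plus[symmetric] c_def del: ennreal_plus)
        also have "(l * exp (- z) * G z) * ((exp (- p * z) - exp (- q * z)) * c) + c * (exp (- q * z) * (l * exp (- z) * G z))
          = c * (exp (- p * z) * (l * exp (- z) * G z))" by (simp add: algebra_simps)
        also have "ennreal \<dots> = ennreal c * (ennreal (exp (- p * z)) * ennreal (l * exp (- z) * G z))"
          using G0 c by (simp add: ennreal_mult)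
        finally show ?thesis using True by simp
      qed simp
    qed
  qed measurable
  then show ?thesis using shift[of p] shift[of q] p q by simp
qed

end

text \<open>A violation at \<open>x\<close> would persist on an interval to the right of
  \<open>x\<close>, which has positive measure. Since this works for \<open>x = 0\<close> too, it is
  one way of reaching the starting point 0.\<close>

lemma AE_nonneg_continuous_le:
  fixes F H :: "real \<Rightarrow> real"
  assumes F: "continuous_on {0..} F" and H: "continuous_on {0..} H"
    and ae: "AE x in lborel. 0 < x \<longrightarrow> F x \<le> H x" and x: "0 \<le> x"
  shows "F x \<le> H x"
proof (rule ccontr)
  assume "\<not> F x \<le> H x"
  then have pos: "0 < F x - H x" by simp
  have "continuous_on {0..} (\<lambda>x. F x - H x)" using F H by (intro continuous_intros)
  then have "((\<lambda>x. F x - H x) \<longlongrightarrow> F x - H x) (at x within {0..})" using x by (auto simp: continuous_on_def)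
  then have "eventually (\<lambda>y. 0 < F y - H y) (at x within {0..})" using pos by (rule order_tendstoD(1))
  then obtain d where d: "d > 0" "\<And>y. y \<in> {0..} \<Longrightarrow> y \<noteq> x \<Longrightarrow> dist y x < d \<Longrightarrow> 0 < F y - H y"
    unfolding eventually_at by auto
  have "AE y in lborel. y \<notin> {x<..<x + d}"
    using ae
  proof eventually_elim
    case (elim y)
    show ?case
    proof
      assume y: "y \<in> {x<..<x + d}"
      then have "0 < F y - H y" using x by (intro d(2)) (auto simp: dist_real_def)
      then show False using elim y x by auto
    qed
  qed
  then have "emeasure lborel {x<..<x + d} = 0"
    by (subst (asm) AE_iff_measurable[where N="{x<..<x + d}"]) auto
  then show False using d(1) by simp
qed

lemma AE_nonneg_continuous_eq:
  fixes F H :: "real \<Rightarrow> real"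
  assumes "continuous_on {0..} F" "continuous_on {0..} H"
    and "AE x in lborel. 0 < x \<longrightarrow> F x = H x" "0 \<le> x"
  shows "F x = H x"
proof (rule antisym)
  show "F x \<le> H x"
    by (rule AE_nonneg_continuous_le[OF assms(1,2) _ assms(4)]) (use assms(3) in \<open>auto elim!: eventually_mono\<close>)
  show "H x \<le> F x"
    by (rule AE_nonneg_continuous_le[OF assms(2,1) _ assms(4)]) (use assms(3) in \<open>auto elim!: eventually_mono\<close>)
qed

section \<open>Comparison of the potential with \<open>J l - g\<close>\<close>

context conditioned
begin

lemma G_measurable[measurable]: "G \<in> borel_measurable borel"
  by (rule borel_measurable_continuous_onI[OF G_cont])

lemma G_nonneg: "0 \<le> x \<Longrightarrow> 0 \<le> G x"
  using G_ge[of x] W_nonneg[of x] by simp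

lemma Wp_g: "0 < z \<Longrightarrow> Wp z * g z = G z"
  using Wp_pos[of z] by (simp add: g_def)

text \<open>By \<open>psi_integral\<close> and \<open>Gr_recursion\<close> the transforms of
  \<open>Wp * h\<close> and of \<open>G\<close> add up to
  \<open>(1 + l * Gr (\<kappa> + 1)) / \<Psi> q\<close>, which is \<open>J l\<close> times the
  transform of \<open>Wp\<close>. A general \<open>h\<close> is allowed because the identity serves
  both the limit of truncated potentials and the potential of \<open>psi\<close>.\<close>

lemma resolvent_unique:
  fixes h :: "real \<Rightarrow> ennreal"
  assumes [measurable]: "h \<in> borel_measurable borel"
    and eq: "\<And>q. \<kappa> < q \<Longrightarrow> (\<integral>\<^sup>+x\<in>{0..}. ennreal (exp (- q * x)) * (ennreal (Wp x) * h x) \<partial>lborel)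
      = (\<integral>\<^sup>+z\<in>{0<..}. ennreal (l * exp (- z) * G z) * ennreal ((exp (- \<kappa> * z) - exp (- q * z)) / (\<Psi> q - \<Psi> \<kappa>)) \<partial>lborel)"
  shows "AE x in lborel. 0 \<le> x \<longrightarrow> ennreal (Wp x) * h x + ennreal (G x) = ennreal (J l) * ennreal (Wp x)"
proof (rule laplace_transform_unique[of _ _ \<kappa>])
  fix q assume q: "\<kappa> < q"
  note psi = Psi_pos[OF q]
  have "(\<integral>\<^sup>+x\<in>{0..}. ennreal (exp (- q * x)) * (ennreal (Wp x) * h x + ennreal (G x)) \<partial>lborel)
     = (\<integral>\<^sup>+x\<in>{0..}. ennreal (exp (- q * x)) * (ennreal (Wp x) * h x) \<partial>lborel) + (\<integral>\<^sup>+x\<in>{0..}. ennreal (exp (- q * x)) * ennreal (G x) \<partial>lborel)"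
    by (subst nn_integral_add[symmetric]) (auto intro!: nn_integral_cong simp: distrib_left distrib_right)
  also have "(\<integral>\<^sup>+x\<in>{0..}. ennreal (exp (- q * x)) * ennreal (G x) \<partial>lborel) = ennreal (l * Gr (q + 1) / (\<Psi> q - \<Psi> \<kappa>)) + ennreal (1 / \<Psi> q)"
  proof -
    have "Gr q = l * Gr (q + 1) / (\<Psi> q - \<Psi> \<kappa>) + 1 / \<Psi> q"
      using Gr_recursion[OF q] psi by (simp add: Psi_kappa field_simps)
    then show ?thesis using G_laplace[OF q] psi l_pos Gr_nonneg[of "q + 1"] q by (simp add: Psi_kappa)
  qed
  also have "(\<integral>\<^sup>+x\<in>{0..}. ennreal (exp (- q * x)) * (ennreal (Wp x) * h x) \<partial>lborel) + (ennreal (l * Gr (q + 1) / (\<Psi> q - \<Psi> \<kappa>)) + ennreal (1 / \<Psi> q))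
     = ennreal (l * Gr (\<kappa> + 1) / (\<Psi> q - \<Psi> \<kappa>)) + ennreal (1 / \<Psi> q)"
    unfolding eq[OF q] using psi_integral[of \<kappa> q] q by (simp add: add.assoc[symmetric])
  also have "\<dots> = ennreal (J l * (1 / \<Psi> q))"
    using psi l_pos Gr_nonneg[of "\<kappa> + 1"] by (simp add: Psi_kappa J_eq_Gr ennreal_plus[symmetric] add_divide_distrib del: ennreal_plus)
  finally have F: "(\<integral>\<^sup>+x\<in>{0..}. ennreal (exp (- q * x)) * (ennreal (Wp x) * h x + ennreal (G x)) \<partial>lborel) = ennreal (J l * (1 / \<Psi> q))" .
  then show "(\<integral>\<^sup>+x\<in>{0..}. ennreal (exp (- q * x)) * (ennreal (Wp x) * h x + ennreal (G x)) \<partial>lborel) < \<infinity>" by simp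
  have "(\<integral>\<^sup>+x\<in>{0..}. ennreal (exp (- q * x)) * (ennreal (J l) * ennreal (Wp x)) \<partial>lborel)
     = (\<integral>\<^sup>+x. ennreal (J l) * (ennreal (exp (- q * x)) * ennreal (Wp x) * indicator {0..} x) \<partial>lborel)"
    by (intro nn_integral_cong) (simp add: mult_ac)
  also have "\<dots> = ennreal (J l) * ennreal (1 / \<Psi> q)"
    unfolding W_hat[OF q, symmetric] by (rule nn_integral_cmult) measurable
  also have "\<dots> = ennreal (J l * (1 / \<Psi> q))"
    using J_ge_1[of l] l_pos psi by (simp add: ennreal_mult[symmetric])
  finally show "(\<integral>\<^sup>+x\<in>{0..}. ennreal (exp (- q * x)) * (ennreal (Wp x) * h x + ennreal (G x)) \<partial>lborel)
     = (\<integral>\<^sup>+x\<in>{0..}. ennreal (exp (- q * x)) * (ennreal (J l) * ennreal (Wp x)) \<partial>lborel)"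
    using F by simp
qed measurable

text \<open>Truncation of \<open>l * exp (- x) * g x\<close>: the resolvent formula is available for
  bounded functions, and at this stage no bound on \<open>g\<close> is known.\<close>

definition psik :: "nat \<Rightarrow> real \<Rightarrow> real" where
  "psik k x = l * exp (- x) * min (g x) (real k)"

lemma psik_nonneg: "0 \<le> psik k x"
  using l_pos g_ge_1[of x] by (simp add: psik_def)

lemma psik_le: "0 \<le> x \<Longrightarrow> psik k x \<le> l * real k"
proof -
  assume "0 \<le> x"
  then have "exp (- x) * min (g x) (real k) \<le> 1 * real k"
    using g_ge_1[of x] by (intro mult_mono) auto
  then show ?thesis using l_pos by (simp add: psik_def mult.assoc)
qed

lemma C0_exp_bounded:
  fixes f :: "real \<Rightarrow> real"
  assumes "continuous_on UNIV f" "\<And>x. \<bar>f x\<bar> \<le> B"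
  shows "C0 (\<lambda>x. l * exp (- x) * f x)"
  unfolding C0_def
proof
  show "continuous_on UNIV (\<lambda>x. l * exp (- x) * f x)" using assms by (intro continuous_intros) auto
  show "((\<lambda>x. l * exp (- x) * f x) \<longlongrightarrow> 0) at_top"
  proof (rule Lim_null_comparison)
    show "eventually (\<lambda>x. norm (l * exp (- x) * f x) \<le> l * exp (- x) * B) at_top"
      using assms(2) l_pos by (intro always_eventually allI) (simp add: abs_mult mult_left_mono)
    show "((\<lambda>x. l * exp (- x) * B) \<longlongrightarrow> 0) at_top" by real_asymp
  qed
qed

lemma psik_C0: "C0 (psik k)"
  unfolding psik_def[abs_def]
proof (rule C0_exp_bounded)
  show "continuous_on UNIV (\<lambda>x. min (g x) (real k))" by (intro continuous_intros g_cont)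
  show "\<bar>min (g x) (real k)\<bar> \<le> real k" for x using g_ge_1[of x] by simp
qed

lemma psik_mono: "j \<le> k \<Longrightarrow> psik j x \<le> psik k x"
  using l_pos unfolding psik_def by (intro mult_left_mono min.mono) auto

lemma R_mono:
  fixes B C :: real
  assumes f: "f \<in> borel_measurable borel" "\<And>y. 0 \<le> y \<Longrightarrow> \<bar>f y\<bar> \<le> B"
    and h: "h \<in> borel_measurable borel" "\<And>y. 0 \<le> y \<Longrightarrow> \<bar>h y\<bar> \<le> C"
    and le: "\<And>y. 0 \<le> y \<Longrightarrow> f y \<le> h y"
  shows "R r f x \<le> R r h x"
  unfolding R_def
proof (rule nn_integral_mono)
  fix t :: real
  show "ennreal (exp (- r * t)) * ennreal (Pt t f (max 0 x)) * indicator {0<..} t \<le> ennreal (exp (- r * t)) * ennreal (Pt t h (max 0 x)) * indicator {0<..} t"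
  proof (cases "0 < t")
    case True
    have "Pt t f (max 0 x) \<le> Pt t h (max 0 x)"
      unfolding Pt_def using True Q_nonneg[of t "max 0 x"]
      by (intro integral_mono_AE bounded_integrable[OF _ _ f] bounded_integrable[OF _ _ h])
         (auto elim!: eventually_mono intro: le)
    then show ?thesis by (intro mult_right_mono mult_left_mono ennreal_leI) auto
  qed simp
qed

text \<open>Monotone convergence gives a nonnegative potential which, multiplied by
  \<open>Wp\<close> and added to \<open>G\<close>, equals \<open>J l * Wp\<close>. The resulting
  bound \<open>g \<le> J l\<close> makes \<open>psi\<close> bounded, so that the comparison can be
  repeated without truncation.\<close>

lemma G_le_J: "0 \<le> x \<Longrightarrow> G x \<le> J l * Wp x"
proof (rule AE_nonneg_continuous_le[where x=x])
  define h where "h = (\<lambda>x. SUP k. R (\<Psi> \<kappa>) (psik k) x)"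
  have Rm[measurable]: "R (\<Psi> \<kappa>) (psik k) \<in> borel_measurable borel" for k
    by (rule R_measurable[OF psik_C0 psik_nonneg psik_le])
  have [measurable]: "h \<in> borel_measurable borel" unfolding h_def by measurable
  have inc: "R (\<Psi> \<kappa>) (psik j) x \<le> R (\<Psi> \<kappa>) (psik k) x" if "j \<le> k" for j k x
    by (rule R_mono[where B="l * real j" and C="l * real k"])
       (use psik_le psik_nonneg psik_mono[OF that] C0_measurable[OF psik_C0] in auto)
  have "AE x in lborel. 0 \<le> x \<longrightarrow> ennreal (Wp x) * h x + ennreal (G x) = ennreal (J l) * ennreal (Wp x)"
  proof (rule resolvent_unique)
    fix q assume q: "\<kappa> < q"
    have "(\<integral>\<^sup>+x\<in>{0..}. ennreal (exp (- q * x)) * (ennreal (Wp x) * h x) \<partial>lborel)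
       = (\<integral>\<^sup>+x. (SUP k. ennreal (exp (- q * x)) * (ennreal (Wp x) * R (\<Psi> \<kappa>) (psik k) x) * indicator {0..} x) \<partial>lborel)"
    proof (rule nn_integral_cong)
      fix x
      have "ennreal (exp (- q * x)) * (ennreal (Wp x) * h x) * indicator {0..} x
        = (ennreal (exp (- q * x)) * ennreal (Wp x) * indicator {0..} x) * (SUP k. R (\<Psi> \<kappa>) (psik k) x)"
        by (simp add: h_def mult_ac)
      also have "\<dots> = (SUP k. (ennreal (exp (- q * x)) * ennreal (Wp x) * indicator {0..} x) * R (\<Psi> \<kappa>) (psik k) x)"
        by (rule SUP_mult_left_ennreal)
      finally show "ennreal (exp (- q * x)) * (ennreal (Wp x) * h x) * indicator {0..} x
        = (SUP k. ennreal (exp (- q * x)) * (ennreal (Wp x) * R (\<Psi> \<kappa>) (psik k) x) * indicator {0..} x)"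
        by (simp add: mult_ac)
    qed
    also have "\<dots> = (SUP k. \<integral>\<^sup>+x\<in>{0..}. ennreal (exp (- q * x)) * (ennreal (Wp x) * R (\<Psi> \<kappa>) (psik k) x) \<partial>lborel)"
    proof (rule nn_integral_monotone_convergence_SUP)
      show "incseq (\<lambda>k x. ennreal (exp (- q * x)) * (ennreal (Wp x) * R (\<Psi> \<kappa>) (psik k) x) * indicator {0..} x)"
        unfolding incseq_def le_fun_def by (intro allI impI mult_right_mono mult_left_mono inc) auto
    qed measurable
    also have "\<dots> = (SUP k. \<integral>\<^sup>+z\<in>{0<..}. ennreal (Wp z * psik k z) * ennreal ((exp (- \<kappa> * z) - exp (- q * z)) / (\<Psi> q - \<Psi> \<kappa>)) \<partial>lborel)"
      using R_laplace[OF psik_C0 psik_nonneg psik_le order_refl q] by simp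
    also have "\<dots> = (\<integral>\<^sup>+z. (SUP k. ennreal (Wp z * psik k z) * ennreal ((exp (- \<kappa> * z) - exp (- q * z)) / (\<Psi> q - \<Psi> \<kappa>)) * indicator {0<..} z) \<partial>lborel)"
    proof (rule nn_integral_monotone_convergence_SUP[symmetric])
      show "incseq (\<lambda>k z. ennreal (Wp z * psik k z) * ennreal ((exp (- \<kappa> * z) - exp (- q * z)) / (\<Psi> q - \<Psi> \<kappa>)) * indicator {0<..} z)"
        unfolding incseq_def le_fun_def
        by (intro allI impI mult_right_mono mult_left_mono ennreal_leI psik_mono Wp_nonneg) auto
      note [measurable] = C0_measurable[OF psik_C0]
      show "(\<lambda>z. ennreal (Wp z * psik k z) * ennreal ((exp (- \<kappa> * z) - exp (- q * z)) / (\<Psi> q - \<Psi> \<kappa>)) * indicator {0<..} z) \<in> borel_measurable lborel" for k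
        by measurable
    qed
    also have "\<dots> = (\<integral>\<^sup>+z\<in>{0<..}. ennreal (l * exp (- z) * G z) * ennreal ((exp (- \<kappa> * z) - exp (- q * z)) / (\<Psi> q - \<Psi> \<kappa>)) \<partial>lborel)"
    proof (rule nn_integral_cong)
      fix z :: real
      show "(SUP k. ennreal (Wp z * psik k z) * ennreal ((exp (- \<kappa> * z) - exp (- q * z)) / (\<Psi> q - \<Psi> \<kappa>)) * indicator {0<..} z)
        = ennreal (l * exp (- z) * G z) * ennreal ((exp (- \<kappa> * z) - exp (- q * z)) / (\<Psi> q - \<Psi> \<kappa>)) * indicator {0<..} z"
      proof (cases "0 < z")
        case True
        obtain N where N: "g z < real N" using reals_Archimedean2 by blast
        have top: "Wp z * psik k z \<le> l * exp (- z) * G z" for k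
        proof -
          have "Wp z * psik k z \<le> Wp z * (l * exp (- z) * g z)"
            unfolding psik_def using Wp_nonneg l_pos by (intro mult_left_mono) auto
          also have "\<dots> = l * exp (- z) * (Wp z * g z)" by (simp add: mult_ac)
          finally show ?thesis unfolding Wp_g[OF True] .
        qed
        have eqN: "Wp z * psik N z = l * exp (- z) * G z"
          using N Wp_g[OF True] by (simp add: psik_def min_absorb1 mult_ac)
        show ?thesis
        proof (rule antisym)
          show "(SUP k. ennreal (Wp z * psik k z) * ennreal ((exp (- \<kappa> * z) - exp (- q * z)) / (\<Psi> q - \<Psi> \<kappa>)) * indicator {0<..} z)
            \<le> ennreal (l * exp (- z) * G z) * ennreal ((exp (- \<kappa> * z) - exp (- q * z)) / (\<Psi> q - \<Psi> \<kappa>)) * indicator {0<..} z"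
            by (intro SUP_least mult_right_mono ennreal_leI top) auto
          show "ennreal (l * exp (- z) * G z) * ennreal ((exp (- \<kappa> * z) - exp (- q * z)) / (\<Psi> q - \<Psi> \<kappa>)) * indicator {0<..} z
            \<le> (SUP k. ennreal (Wp z * psik k z) * ennreal ((exp (- \<kappa> * z) - exp (- q * z)) / (\<Psi> q - \<Psi> \<kappa>)) * indicator {0<..} z)"
            unfolding eqN[symmetric] by (rule SUP_upper) simp
        qed
      qed simp
    qed
    finally show "(\<integral>\<^sup>+x\<in>{0..}. ennreal (exp (- q * x)) * (ennreal (Wp x) * h x) \<partial>lborel)
      = (\<integral>\<^sup>+z\<in>{0<..}. ennreal (l * exp (- z) * G z) * ennreal ((exp (- \<kappa> * z) - exp (- q * z)) / (\<Psi> q - \<Psi> \<kappa>)) \<partial>lborel)" .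
  qed measurable
  then show "AE x in lborel. 0 < x \<longrightarrow> G x \<le> J l * Wp x"
  proof eventually_elim
    case (elim x)
    show ?case
    proof
      assume "0 < x"
      then have "ennreal (Wp x) * h x + ennreal (G x) = ennreal (J l) * ennreal (Wp x)" using elim by simp
      moreover have "ennreal (G x) \<le> ennreal (Wp x) * h x + ennreal (G x)" by (rule add_increasing) simp_all
      ultimately have "ennreal (G x) \<le> ennreal (J l) * ennreal (Wp x)" by (simp only:)
      also have "\<dots> = ennreal (J l * Wp x)" using Wp_nonneg J_ge_1[of l] l_pos by (simp add: ennreal_mult)
      finally show "G x \<le> J l * Wp x"
        using Wp_nonneg[of x] J_ge_1[of l] l_pos by (subst (asm) ennreal_le_iff) auto
    qed
  qed
qed (auto intro!: continuous_intros continuous_on_subset[OF G_cont] continuous_on_subset[OF Wp_cont])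

lemma J_ge: "1 \<le> J l"
  using J_ge_1[of l] l_pos by simp

lemma g_le_J: "g x \<le> J l"
  using G_le_J[of x] Wp_pos[of x] J_ge by (auto simp: g_def divide_le_eq)

definition psi :: "real \<Rightarrow> real" where
  "psi x = l * exp (- x) * g x"

lemma psi_nonneg: "0 \<le> psi x"
  using l_pos g_ge_1[of x] by (simp add: psi_def)

lemma psi_le: "0 \<le> x \<Longrightarrow> psi x \<le> l * J l"
proof -
  assume "0 \<le> x"
  then have "exp (- x) * g x \<le> 1 * J l"
    using g_ge_1[of x] g_le_J[of x] J_ge by (intro mult_mono) auto
  then show ?thesis using l_pos by (simp add: psi_def mult.assoc)
qed

lemma psi_C0: "C0 psi"
  unfolding psi_def[abs_def]
proof (rule C0_exp_bounded[OF g_cont])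
  show "\<bar>g x\<bar> \<le> J l" for x using g_ge_1[of x] g_le_J[of x] by simp
qed

lemma psi_measurable[measurable]: "psi \<in> borel_measurable borel"
  by (rule C0_measurable[OF psi_C0])

lemma g_measurable[measurable]: "g \<in> borel_measurable borel"
  by (rule borel_measurable_continuous_onI[OF g_cont])

lemma Wp_psi: "0 < z \<Longrightarrow> Wp z * psi z = l * exp (- z) * G z"
  using Wp_g[of z] by (simp add: psi_def mult_ac)

lemma R_laplace_psi:
  assumes p: "\<kappa> \<le> p" "p < q"
  shows "(\<integral>\<^sup>+x\<in>{0..}. ennreal (exp (- q * x)) * (ennreal (Wp x) * R (\<Psi> p) psi x) \<partial>lborel)
    = (\<integral>\<^sup>+z\<in>{0<..}. ennreal (l * exp (- z) * G z) * ennreal ((exp (- p * z) - exp (- q * z)) / (\<Psi> q - \<Psi> p)) \<partial>lborel)"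
  by (rule trans[OF R_laplace[OF psi_C0 psi_nonneg psi_le p]])
     (auto intro!: nn_integral_cong simp: indicator_def Wp_psi)

lemma R_psi_measurable[measurable]: "R r psi \<in> borel_measurable borel"
  by (rule R_measurable[OF psi_C0 psi_nonneg psi_le])

lemma R0_psi: "AE x in lborel. 0 < x \<longrightarrow> R 0 psi x = ennreal (J l - g x)"
proof -
  have "AE x in lborel. 0 \<le> x \<longrightarrow> ennreal (Wp x) * R 0 psi x + ennreal (G x) = ennreal (J l) * ennreal (Wp x)"
    by (rule resolvent_unique) (use R_laplace_psi[of \<kappa>] in \<open>simp_all add: Psi_kappa\<close>)
  then show ?thesis
  proof eventually_elim
    case (elim x)
    show ?case
    proof
      assume x: "0 < x"
      note Wx = Wp_pos[OF x]
      have "ennreal (Wp x) * R 0 psi x + ennreal (G x) = ennreal (J l * Wp x)"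
        using elim x Wx J_ge by (simp add: ennreal_mult)
      then have "ennreal (Wp x) * R 0 psi x = ennreal (J l * Wp x) - ennreal (G x)"
        by (metis ennreal_add_diff_cancel_right ennreal_neq_top)
      also have "\<dots> = ennreal (J l * Wp x - G x)" using G_nonneg[of x] x by (intro ennreal_minus) simp
      also have "J l * Wp x - G x = Wp x * (J l - g x)" using Wp_g[OF x] by (simp add: algebra_simps)
      also have "ennreal \<dots> = ennreal (Wp x) * ennreal (J l - g x)"
        using Wx g_le_J[of x] by (intro ennreal_mult) auto
      finally show "R 0 psi x = ennreal (J l - g x)"
        using Wx by (subst (asm) ennreal_mult_cancel_left) auto
    qed
  qed
qed

text \<open>Common form of truncated potentials, with \<open>\<phi>\<close> an indicator, and of
  resolvents of positive rate, with \<open>\<phi>\<close> an exponential. An integrable weight in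
  time gives the domination behind continuity in the starting point, 0 included.\<close>

definition wpot :: "(real \<Rightarrow> real) \<Rightarrow> real \<Rightarrow> real" where
  "wpot \<phi> x = (LINT t|lborel. \<phi> t * Pt t psi (max 0 x))"

lemma Pt_psi_bounds:
  assumes "0 \<le> t" "0 \<le> x"
  shows "0 \<le> Pt t psi x" "Pt t psi x \<le> l * J l"
  using Pt_bounds[OF assms psi_measurable psi_nonneg psi_le] by auto

lemma Pt_psi_measurable_t:
  assumes [measurable]: "\<phi> \<in> borel_measurable borel" and supp: "\<And>t. t \<le> 0 \<Longrightarrow> \<phi> t = 0"
  shows "(\<lambda>t. \<phi> t * Pt t psi (max 0 x)) \<in> borel_measurable borel"
proof -
  note m = Pt_pair_measurable[of psi "l * J l", OF psi_C0 psi_nonneg psi_le]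
  have "(\<lambda>t. Pt (max 0 t) psi (max 0 x)) \<in> borel_measurable borel"
    using measurable_compose[OF _ m, of "\<lambda>t. (t, x)" borel] by simp
  then have "(\<lambda>t. \<phi> t * Pt (max 0 t) psi (max 0 x)) \<in> borel_measurable borel" by measurable
  moreover have "\<phi> t * Pt (max 0 t) psi (max 0 x) = \<phi> t * Pt t psi (max 0 x)" for t
    using supp[of t] by (cases "t \<le> 0") auto
  ultimately show ?thesis by simp
qed

lemma wpot_facts:
  assumes m: "\<phi> \<in> borel_measurable borel" and int: "integrable lborel \<phi>"
    and supp: "\<And>t. t \<le> 0 \<Longrightarrow> \<phi> t = 0" and nn: "\<And>t. 0 \<le> \<phi> t"
  shows "continuous_on {0..} (wpot \<phi>)"
    and "(\<integral>\<^sup>+t. ennreal (\<phi> t) * ennreal (Pt t psi (max 0 x)) \<partial>lborel) = ennreal (wpot \<phi> x)"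
    and "0 \<le> wpot \<phi> x" and "wpot \<phi> x \<le> l * J l * (LINT t|lborel. \<phi> t)"
proof -
  have b: "0 \<le> \<phi> t * Pt t psi (max 0 x)" "\<phi> t * Pt t psi (max 0 x) \<le> \<phi> t * (l * J l)" for t x
  proof -
    show "0 \<le> \<phi> t * Pt t psi (max 0 x)"
      using Pt_psi_bounds(1)[of t "max 0 x"] nn[of t] supp[of t] by (cases "t \<le> 0") auto
    show "\<phi> t * Pt t psi (max 0 x) \<le> \<phi> t * (l * J l)"
    proof (cases "t \<le> 0")
      case False
      then have "Pt t psi (max 0 x) \<le> l * J l" by (intro Pt_psi_bounds(2)) auto
      then show ?thesis using nn by (rule mult_left_mono)
    qed (simp add: supp)
  qed
  note mm = Pt_psi_measurable_t[OF m supp]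
  have i: "integrable lborel (\<lambda>t. \<phi> t * Pt t psi (max 0 x))" for x
  proof (rule Bochner_Integration.integrable_bound[OF integrable_mult_left[OF int, of "l * J l"]])
    show "AE t in lborel. norm (\<phi> t * Pt t psi (max 0 x)) \<le> norm (\<phi> t * (l * J l))"
      unfolding real_norm_def abs_of_nonneg[OF b(1)] by (intro AE_I2 order_trans[OF b(2) abs_ge_self])
  qed (use mm in simp)
  show "0 \<le> wpot \<phi> x" unfolding wpot_def using b by (intro integral_nonneg_AE AE_I2) auto
  have "wpot \<phi> x \<le> (LINT t|lborel. \<phi> t * (l * J l))"
    unfolding wpot_def by (intro integral_mono i integrable_mult_left int b)
  then show "wpot \<phi> x \<le> l * J l * (LINT t|lborel. \<phi> t)" by (simp add: mult_ac)
  have "(\<integral>\<^sup>+t. ennreal (\<phi> t) * ennreal (Pt t psi (max 0 x)) \<partial>lborel) = (\<integral>\<^sup>+t. ennreal (\<phi> t * Pt t psi (max 0 x)) \<partial>lborel)"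
  proof (rule nn_integral_cong)
    fix t
    show "ennreal (\<phi> t) * ennreal (Pt t psi (max 0 x)) = ennreal (\<phi> t * Pt t psi (max 0 x))"
      using Pt_psi_bounds(1)[of t "max 0 x"] supp[of t] nn[of t] by (cases "t \<le> 0") (auto simp: ennreal_mult)
  qed
  also have "\<dots> = ennreal (wpot \<phi> x)"
    unfolding wpot_def using b by (intro nn_integral_eq_integral i AE_I2) auto
  finally show "(\<integral>\<^sup>+t. ennreal (\<phi> t) * ennreal (Pt t psi (max 0 x)) \<partial>lborel) = ennreal (wpot \<phi> x)" .
  show "continuous_on {0..} (wpot \<phi>)"
    unfolding continuous_on_sequentially
  proof (intro allI ballI impI)
    fix s :: "nat \<Rightarrow> real" and a :: real assume a: "a \<in> {0..}" and s: "(\<forall>n. s n \<in> {0..}) \<and> s \<longlonglongrightarrow> a"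
    show "(wpot \<phi> \<circ> s) \<longlonglongrightarrow> wpot \<phi> a"
      unfolding wpot_def o_def
    proof (rule integral_dominated_convergence[where w="\<lambda>t. \<phi> t * (l * J l)"])
      show "AE t in lborel. (\<lambda>n. \<phi> t * Pt t psi (max 0 (s n))) \<longlonglongrightarrow> \<phi> t * Pt t psi (max 0 a)"
      proof (rule AE_I2)
        fix t
        show "(\<lambda>n. \<phi> t * Pt t psi (max 0 (s n))) \<longlonglongrightarrow> \<phi> t * Pt t psi (max 0 a)"
        proof (cases "t \<le> 0")
          case False
          have "continuous_on {0..} (Pt t psi)" using False by (intro C0_Pt_continuous psi_C0) auto
          then have "(\<lambda>n. Pt t psi (s n)) \<longlonglongrightarrow> Pt t psi a"
            using a s unfolding continuous_on_sequentially by (auto simp: o_def)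
          moreover have "max 0 (s n) = s n" for n using s by auto
          ultimately show ?thesis using a by (intro tendsto_mult_left) simp
        qed (simp add: supp)
      qed
      show "integrable lborel (\<lambda>t. \<phi> t * (l * J l))" using int by simp
      show "AE t in lborel. norm (\<phi> t * Pt t psi (max 0 (s n))) \<le> \<phi> t * (l * J l)" for n
      proof (rule AE_I2)
        fix t
        show "norm (\<phi> t * Pt t psi (max 0 (s n))) \<le> \<phi> t * (l * J l)"
          unfolding real_norm_def abs_of_nonneg[OF b(1)] by (rule b(2))
      qed
    qed (use mm in auto)
  qed
qed

section \<open>Dynkin's formula\<close>

lemma Q_pos: "0 < t \<Longrightarrow> 0 < x \<Longrightarrow> AE y in Q t x. 0 < y"
proof -
  assume t: "0 < t" and x: "0 < x"
  have "ennreal (W x) * (\<integral>\<^sup>+y. indicator {..0} y \<partial>Q t x) = K t (\<lambda>y. ennreal (Wp y) * indicator {..0} y) x"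
    by (rule Q_h_transform[OF t x]) measurable
  also have "\<dots> = (\<integral>\<^sup>+\<omega>. 0 \<partial>M)"
    unfolding K_def
  proof (rule nn_integral_cong)
    fix \<omega> assume "\<omega> \<in> space M"
    then show "(if 0 < (INF s\<in>{0..t}. x + V s \<omega>) then ennreal (Wp (x + V t \<omega>)) * indicator {..0} (x + V t \<omega>) else 0) = 0"
      using killed_pos[of \<omega> t x] t by auto
  qed
  finally have "(\<integral>\<^sup>+y. indicator {..0} y \<partial>Q t x) = 0" using W_pos[OF x] by simp
  then have "AE y in Q t x. (indicator {..0} y :: ennreal) = 0"
    using Q_measurable[of t x "indicator {..0} :: real \<Rightarrow> ennreal"] t x by (subst (asm) nn_integral_0_iff_AE) auto
  then show ?thesis by (auto elim!: eventually_mono simp: indicator_def split: if_splits)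
qed

definition I :: "real \<Rightarrow> real \<Rightarrow> real" where
  "I t = wpot (indicator {0<..t})"

lemma I_facts:
  assumes t: "0 \<le> t"
  shows "continuous_on {0..} (I t)"
    and "(\<integral>\<^sup>+s\<in>{0<..t}. ennreal (Pt s psi (max 0 x)) \<partial>lborel) = ennreal (I t x)"
    and "0 \<le> I t x"
proof -
  have int: "integrable lborel (indicator {0<..t} :: real \<Rightarrow> real)" using t by simp
  note f = wpot_facts[OF _ int]
  show "continuous_on {0..} (I t)" "0 \<le> I t x" unfolding I_def by (rule f; simp)+
  have "(\<integral>\<^sup>+s. ennreal (indicator {0<..t} s) * ennreal (Pt s psi (max 0 x)) \<partial>lborel) = ennreal (I t x)"
    unfolding I_def by (rule f) auto
  then show "(\<integral>\<^sup>+s\<in>{0<..t}. ennreal (Pt s psi (max 0 x)) \<partial>lborel) = ennreal (I t x)"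
    by (simp add: ennreal_indicator mult.commute)
qed

lemma R0_eq: "R 0 psi x = (\<integral>\<^sup>+s\<in>{0<..}. ennreal (Pt s psi (max 0 x)) \<partial>lborel)"
  by (simp add: R_def)

lemma Pt_psi_nn_measurable: "(\<lambda>s. ennreal (Pt s psi (max 0 x)) * indicator {0<..} s) \<in> borel_measurable borel"
proof -
  have "(\<lambda>s. ennreal (indicator {0<..} s * Pt s psi (max 0 x))) \<in> borel_measurable borel"
    by (intro measurable_compose[OF Pt_psi_measurable_t measurable_ennreal]) auto
  also have "(\<lambda>s. ennreal (indicator {0<..} s * Pt s psi (max 0 x))) = (\<lambda>s. ennreal (Pt s psi (max 0 x)) * indicator {0<..} s)"
    by (auto simp: fun_eq_iff indicator_def)
  finally show ?thesis .
qed

text \<open>Chapman-Kolmogorov under the time integral: what is accumulated after \<open>t\<close>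
  is the potential seen from the position at time \<open>t\<close>.\<close>

lemma R0_split:
  assumes t: "0 < t" and x: "0 \<le> x"
  shows "R 0 psi x = ennreal (I t x) + (\<integral>\<^sup>+y. R 0 psi y \<partial>Q t x)"
proof -
  note [measurable] = Pt_psi_nn_measurable
  interpret Qx: prob_space "Q t x" using t x by (intro Q_prob) auto
  interpret P: pair_sigma_finite lborel "Q t x" ..
  have qs[measurable_cong]: "sets (Q t x) = sets borel" using t x by (intro Q_sets) auto
  have m: "(\<lambda>(s, y). ennreal (Pt s psi (max 0 y)) * indicator {0<..} s) \<in> borel_measurable (borel \<Otimes>\<^sub>M borel)"
    by (rule R_integrand_measurable[OF psi_C0 psi_nonneg psi_le])
  then have m': "(\<lambda>(s, y). ennreal (Pt s psi (max 0 y)) * indicator {0<..} s) \<in> borel_measurable (lborel \<Otimes>\<^sub>M Q t x)"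
    by (simp cong: measurable_cong_sets sets_pair_measure_cong add: qs)
  have "(\<integral>\<^sup>+y. R 0 psi y \<partial>Q t x) = (\<integral>\<^sup>+y. \<integral>\<^sup>+s. ennreal (Pt s psi (max 0 y)) * indicator {0<..} s \<partial>lborel \<partial>Q t x)"
    unfolding R0_eq ..
  also have "\<dots> = (\<integral>\<^sup>+s. \<integral>\<^sup>+y. ennreal (Pt s psi (max 0 y)) * indicator {0<..} s \<partial>Q t x \<partial>lborel)"
    by (rule P.Fubini'[OF m'])
  also have "\<dots> = (\<integral>\<^sup>+s. ennreal (Pt (t + s) psi x) * indicator {0<..} s \<partial>lborel)"
  proof (rule nn_integral_cong)
    fix s :: real
    show "(\<integral>\<^sup>+y. ennreal (Pt s psi (max 0 y)) * indicator {0<..} s \<partial>Q t x) = ennreal (Pt (t + s) psi x) * indicator {0<..} s"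
    proof (cases "0 < s")
      case True
      have "(\<integral>\<^sup>+y. ennreal (Pt s psi (max 0 y)) \<partial>Q t x) = ennreal (Pt t (\<lambda>y. Pt s psi (max 0 y)) x)"
      proof (rule Pt_nn[where B="l * J l"])
        show "(\<lambda>y. Pt s psi (max 0 y)) \<in> borel_measurable borel"
          using True by (intro borel_measurable_continuous_onI continuous_on_max0 C0_Pt_continuous psi_C0) auto
      qed (use t x True Pt_psi_bounds in auto)
      also have "Pt t (\<lambda>y. Pt s psi (max 0 y)) x = Pt (t + s) psi x"
        using t x True by (intro CK_Pt[symmetric, where B="l * J l"] psi_measurable psi_nonneg psi_le) auto
      finally show ?thesis using True by simp
    qed simp
  qed
  also have "\<dots> = (\<integral>\<^sup>+s. (ennreal (Pt s psi (max 0 x)) * indicator {0<..} s) * indicator {t<..} s \<partial>lborel)"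
  proof -
    have "(\<integral>\<^sup>+s. (ennreal (Pt s psi (max 0 x)) * indicator {0<..} s) * indicator {t<..} s \<partial>lborel)
      = ennreal \<bar>1\<bar> * (\<integral>\<^sup>+s. (ennreal (Pt (t + 1 * s) psi (max 0 x)) * indicator {0<..} (t + 1 * s)) * indicator {t<..} (t + 1 * s) \<partial>lborel)"
    proof (rule nn_integral_real_affine)
      show "(\<lambda>s. (ennreal (Pt s psi (max 0 x)) * indicator {0<..} s) * indicator {t<..} s) \<in> borel_measurable borel"
        by (rule borel_measurable_times_ennreal[OF Pt_psi_nn_measurable]) simp
    qed simp
    also have "\<dots> = (\<integral>\<^sup>+s. ennreal (Pt (t + s) psi x) * indicator {0<..} s \<partial>lborel)"
      using t x by (auto intro!: nn_integral_cong simp: indicator_def)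
    finally show ?thesis by simp
  qed
  finally have B: "(\<integral>\<^sup>+y. R 0 psi y \<partial>Q t x) = (\<integral>\<^sup>+s. (ennreal (Pt s psi (max 0 x)) * indicator {0<..} s) * indicator {t<..} s \<partial>lborel)" .
  have A: "ennreal (I t x) = (\<integral>\<^sup>+s. (ennreal (Pt s psi (max 0 x)) * indicator {0<..} s) * indicator {..t} s \<partial>lborel)"
    unfolding I_facts(2)[OF less_imp_le[OF t], symmetric]
    by (rule nn_integral_cong) (auto simp: indicator_def)
  show ?thesis
    unfolding A B unfolding R0_eq
    by (subst nn_integral_add[symmetric]; (measurable)?) (auto intro!: nn_integral_cong simp: indicator_def)
qed

text \<open>Insert \<open>J l - g\<close> for the potential in \<open>R0_split\<close>. This is
  legitimate for almost every \<open>x > 0\<close>; both sides are continuous on the closed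
  half-line, so the result also holds at 0, where \<open>R0_psi\<close> is silent.\<close>

lemma dynkin:
  assumes t: "0 < t" and x: "0 \<le> x"
  shows "Pt t g x = g x + I t x"
proof -
  define w where "w = (\<lambda>y. J l - g y)"
  have wc: "continuous_on UNIV w" unfolding w_def by (intro continuous_intros g_cont)
  have wb: "0 \<le> w y" "w y \<le> J l" for y using g_ge_1[of y] g_le_J[of y] by (auto simp: w_def)
  have wm[measurable]: "w \<in> borel_measurable borel" by (rule borel_measurable_continuous_onI[OF wc])
  have "w x = I t x + Pt t w x"
  proof (rule AE_nonneg_continuous_eq[OF _ _ _ x])
    show "continuous_on {0..} w" by (rule continuous_on_subset[OF wc]) simp
    have "continuous_on {0..} (Pt t w)"
      by (rule Pt_continuous[OF wc, of "J l"]) (use wb t in \<open>auto simp: abs_of_nonneg[OF wb(1)]\<close>)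
    then show "continuous_on {0..} (\<lambda>x. I t x + Pt t w x)" using I_facts(1)[of t] t by (intro continuous_intros) auto
    \<comment> \<open>Exceptional set of \<open>R0_psi\<close>: it is null, hence not charged by
      \<open>Q t x\<close> for almost every \<open>x\<close>.\<close>
    define N where "N = {y. 0 < y \<and> R 0 psi y \<noteq> ennreal (w y)}"
    have N[measurable]: "N \<in> sets borel" unfolding N_def by measurable
    have ae0: "AE x in lborel. x \<notin> N" using R0_psi by (auto elim!: eventually_mono simp: N_def w_def)
    then have "emeasure lborel N = 0" by (subst (asm) AE_iff_measurable[where N=N]) auto
    from Q_null[OF N this t] ae0 show "AE x in lborel. 0 < x \<longrightarrow> w x = I t x + Pt t w x"
    proof eventually_elim
      case (elim x)
      show ?case
      proof
        assume x: "0 < x"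
        have "AE y in Q t x. R 0 psi y = ennreal (w y)"
          using Q_pos[OF t x] elim(1) x by (auto simp: N_def elim!: eventually_elim2)
        then have "(\<integral>\<^sup>+y. R 0 psi y \<partial>Q t x) = (\<integral>\<^sup>+y. ennreal (w y) \<partial>Q t x)" by (rule nn_integral_cong_AE)
        also have "\<dots> = ennreal (Pt t w x)" using t x by (intro Pt_nn[where B="J l"] wb wm) auto
        finally have "ennreal (w x) = ennreal (I t x) + ennreal (Pt t w x)"
          using R0_split[OF t less_imp_le[OF x]] elim(2) x by (auto simp: N_def)
        moreover have "0 \<le> Pt t w x" using Pt_bounds(1)[of t x w 0 "J l"] t x wb by auto
        ultimately show "w x = I t x + Pt t w x"
          using I_facts(3)[of t x] t wb(1)[of x] by (simp add: ennreal_plus[symmetric] del: ennreal_plus)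
      qed
    qed
  qed
  moreover have "Pt t w x = J l - Pt t g x"
  proof -
    interpret Qx: prob_space "Q t x" using t x by (intro Q_prob) auto
    have "integrable (Q t x) g"
      by (rule bounded_integrable[where B="J l"]) (use t x g_ge_1 g_le_J in \<open>auto simp: abs_of_nonneg order_trans[OF zero_le_one]\<close>)
    then show ?thesis unfolding Pt_def w_def by (simp add: Qx.prob_space)
  qed
  ultimately show ?thesis by (simp add: w_def)
qed

section \<open>The potential at the starting point 0\<close>

lemma Gr_antimono: "\<kappa> < p \<Longrightarrow> p \<le> q \<Longrightarrow> Gr q \<le> Gr p"
proof -
  assume p: "\<kappa> < p" "p \<le> q"
  have "ennreal (Gr q) \<le> ennreal (Gr p)"
    unfolding G_laplace[OF p(1), symmetric] G_laplace[OF less_le_trans[OF p], symmetric]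
    using p by (intro nn_integral_mono) (auto simp: indicator_def intro!: mult_right_mono ennreal_leI)
  then show ?thesis using Gr_nonneg[OF p(1)] by (simp add: ennreal_le_iff)
qed

text \<open>As a function of \<open>x\<close>, \<open>\<Psi> q * exp (- q * x) * Wp x\<close> is a
  probability density on the half-line, concentrating at 0 as \<open>q\<close> grows: beyond
  distance \<open>d\<close> the exponential decay beats the growth of \<open>\<Psi> q\<close>. It
  converts transforms into lower bounds for \<open>h 0\<close>.\<close>

lemma concentrate_at_0:
  fixes h :: "real \<Rightarrow> real"
  assumes h: "continuous_on {0..} h" and [measurable]: "h \<in> borel_measurable borel" and b: "\<And>x. 0 \<le> h x" "\<And>x. h x \<le> B" and e: "0 < e"
  shows "eventually (\<lambda>n. ennreal (\<Psi> (real n)) * (\<integral>\<^sup>+x\<in>{0..}. ennreal (exp (- real n * x)) * (ennreal (Wp x) * ennreal (h x)) \<partial>lborel) \<le> ennreal (h 0 + e)) sequentially"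
proof -
  have "(h \<longlongrightarrow> h 0) (at 0 within {0..})" using h by (auto simp: continuous_on_def)
  then have "eventually (\<lambda>x. h x < h 0 + e / 2) (at 0 within {0..})" using e by (intro order_tendstoD(2)) auto
  then obtain d where d: "d > 0" "\<And>x. x \<in> {0..} \<Longrightarrow> x \<noteq> 0 \<Longrightarrow> dist x 0 < d \<Longrightarrow> h x < h 0 + e / 2"
    unfolding eventually_at by auto
  have hd: "h x \<le> h 0 + e / 2" if "0 \<le> x" "x < d" for x
    using d(2)[of x] that e by (cases "x = 0") auto
  define q1 where "q1 = \<kappa> + 1"
  have q1: "\<kappa> < q1" by (simp add: q1_def)
  \<comment> \<open>Length of \<open>[d / 4, d / 2]\<close> times the least value of
    \<open>Wp\<close> on it. This bounds the transform of \<open>W\<close> from below, hence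
    \<open>\<Psi> q\<close> by \<open>exp (q * (d / 2)) / c\<close>, which uses up only half of the
    decay available beyond \<open>d\<close>.\<close>
  define c where "c = (d / 4) * Wp (d / 4)"
  have c: "0 < c" using d(1) Wp_pos[of "d / 4"] by (simp add: c_def)
  have psi_upper: "\<Psi> q \<le> exp (q * (d / 2)) / c" if q: "\<kappa> < q" for q
  proof -
    have "ennreal (exp (- q * (d / 2)) * c) = (\<integral>\<^sup>+x. ennreal (exp (- q * (d / 2)) * Wp (d / 4)) * indicator {d / 4..d / 2} x \<partial>lborel)"
      using d(1) Wp_nonneg[of "d / 4"] by (subst nn_integral_cmult_indicator) (auto simp: ennreal_mult[symmetric] c_def mult_ac)
    also have "\<dots> \<le> (\<integral>\<^sup>+x\<in>{0..}. ennreal (exp (- q * x)) * ennreal (Wp x) \<partial>lborel)"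
    proof (rule nn_integral_mono)
      fix x :: real
      show "ennreal (exp (- q * (d / 2)) * Wp (d / 4)) * indicator {d / 4..d / 2} x \<le> ennreal (exp (- q * x)) * ennreal (Wp x) * indicator {0..} x"
      proof (cases "x \<in> {d / 4..d / 2}")
        case True
        have "exp (- q * (d / 2)) * Wp (d / 4) \<le> exp (- q * x) * Wp x"
          using True q kappa_nonneg Wp_nonneg by (intro mult_mono Wp_mono) auto
        then show ?thesis using True d(1) Wp_nonneg by (simp add: ennreal_mult[symmetric] ennreal_leI)
      qed simp
    qed
    also have "\<dots> = ennreal (1 / \<Psi> q)" by (rule W_hat[OF q])
    finally have "exp (- q * (d / 2)) * c \<le> 1 / \<Psi> q"
      using Psi_pos[OF q] by (subst (asm) ennreal_le_iff) auto
    then show ?thesis using Psi_pos[OF q] c by (simp add: field_simps exp_minus)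
  qed
  have "(\<lambda>n::nat. (B * exp (q1 * d) / (c * \<Psi> q1)) * exp (- (real n * (d / 2)))) \<longlonglongrightarrow> 0"
    using d(1) by real_asymp
  then have "eventually (\<lambda>n::nat. (B * exp (q1 * d) / (c * \<Psi> q1)) * exp (- (real n * (d / 2))) < e / 2) sequentially"
    using e by (intro order_tendstoD(2)) auto
  moreover have "eventually (\<lambda>n. real n > q1) sequentially"
    using filterlim_real_sequentially by (auto simp: filterlim_at_top_dense)
  ultimately show ?thesis
  proof eventually_elim
    case (elim n)
    define q where "q = real n"
    have q: "q1 < q" "\<kappa> < q" using elim q1 by (auto simp: q_def)
    have B0: "0 \<le> B" using b[of 0] by linarith
    have "(\<integral>\<^sup>+x\<in>{0..}. ennreal (exp (- q * x)) * (ennreal (Wp x) * ennreal (h x)) \<partial>lborel)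
      \<le> (\<integral>\<^sup>+x. ennreal (h 0 + e / 2) * (ennreal (exp (- q * x)) * ennreal (Wp x) * indicator {0..} x)
           + ennreal (B * exp (- (q - q1) * d)) * (ennreal (exp (- q1 * x)) * ennreal (Wp x) * indicator {0..} x) \<partial>lborel)"
    proof (rule nn_integral_mono)
      fix x :: real
      show "ennreal (exp (- q * x)) * (ennreal (Wp x) * ennreal (h x)) * indicator {0..} x
        \<le> ennreal (h 0 + e / 2) * (ennreal (exp (- q * x)) * ennreal (Wp x) * indicator {0..} x)
           + ennreal (B * exp (- (q - q1) * d)) * (ennreal (exp (- q1 * x)) * ennreal (Wp x) * indicator {0..} x)"
      proof (cases "0 \<le> x")
        case x: True
        show ?thesis
        proof (cases "x < d")
          case True
          have "ennreal (h x) \<le> ennreal (h 0 + e / 2)" using hd[OF x True] by (rule ennreal_leI)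
          then have "(ennreal (exp (- q * x)) * ennreal (Wp x)) * ennreal (h x) \<le> (ennreal (exp (- q * x)) * ennreal (Wp x)) * ennreal (h 0 + e / 2)"
            by (intro mult_left_mono) auto
          then show ?thesis using x by (simp add: mult_ac add_increasing2)
        next
          case False
          have "(q - q1) * d \<le> (q - q1) * x" using False q by (intro mult_left_mono) auto
          then have "exp (- q * x) \<le> exp (- (q - q1) * d) * exp (- q1 * x)"
            unfolding exp_add[symmetric] by (simp add: algebra_simps)
          then have "exp (- q * x) * Wp x * h x \<le> (exp (- (q - q1) * d) * exp (- q1 * x)) * Wp x * B"
            using b Wp_nonneg by (intro mult_mono) auto
          then have "ennreal (exp (- q * x) * Wp x * h x) \<le> ennreal ((exp (- (q - q1) * d) * exp (- q1 * x)) * Wp x * B)"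
            by (rule ennreal_leI)
          also have "\<dots> = ennreal (B * exp (- (q - q1) * d)) * (ennreal (exp (- q1 * x)) * ennreal (Wp x))"
            using B0 Wp_nonneg by (simp add: ennreal_mult[symmetric] mult_ac)
          also have "ennreal (exp (- q * x) * Wp x * h x) = ennreal (exp (- q * x)) * (ennreal (Wp x) * ennreal (h x))"
            using b Wp_nonneg by (simp add: ennreal_mult mult.assoc)
          finally show ?thesis using x by (simp add: add_increasing)
        qed
      qed simp
    qed
    also have "\<dots> = ennreal (h 0 + e / 2) * ennreal (1 / \<Psi> q) + ennreal (B * exp (- (q - q1) * d)) * ennreal (1 / \<Psi> q1)"
      unfolding W_hat[OF q(2), symmetric] W_hat[OF q1, symmetric]
      by (subst nn_integral_add, measurable, subst nn_integral_cmult, measurable, subst nn_integral_cmult, measurable)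
    finally have "ennreal (\<Psi> q) * (\<integral>\<^sup>+x\<in>{0..}. ennreal (exp (- q * x)) * (ennreal (Wp x) * ennreal (h x)) \<partial>lborel)
      \<le> ennreal (\<Psi> q) * (ennreal (h 0 + e / 2) * ennreal (1 / \<Psi> q) + ennreal (B * exp (- (q - q1) * d)) * ennreal (1 / \<Psi> q1))"
      by (rule mult_left_mono) simp
    also have "\<dots> = ennreal (\<Psi> q * ((h 0 + e / 2) * (1 / \<Psi> q) + B * exp (- (q - q1) * d) * (1 / \<Psi> q1)))"
      using Psi_pos[OF q(2)] Psi_pos[OF q1] b(1)[of 0] e B0
      by (simp add: ennreal_mult[symmetric] ennreal_plus[symmetric] del: ennreal_plus)
    also have "\<dots> \<le> ennreal (h 0 + e)"
    proof (rule ennreal_leI)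
      have "\<Psi> q * (B * exp (- (q - q1) * d) * (1 / \<Psi> q1)) \<le> (exp (q * (d / 2)) / c) * (B * exp (- (q - q1) * d) * (1 / \<Psi> q1))"
        using psi_upper[OF q(2)] B0 Psi_pos[OF q1] by (intro mult_right_mono) auto
      also have "\<dots> = (B / (c * \<Psi> q1)) * (exp (q * (d / 2)) * exp (- (q - q1) * d))" by simp
      also have "exp (q * (d / 2)) * exp (- (q - q1) * d) = exp (q1 * d) * exp (- (q * (d / 2)))"
        unfolding exp_add[symmetric] by (simp add: algebra_simps)
      also have "(B / (c * \<Psi> q1)) * (exp (q1 * d) * exp (- (q * (d / 2)))) = (B * exp (q1 * d) / (c * \<Psi> q1)) * exp (- (q * (d / 2)))" by simp
      also have "\<dots> < e / 2" using elim(1) by (simp add: q_def)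
      finally have "\<Psi> q * (B * exp (- (q - q1) * d) * (1 / \<Psi> q1)) < e / 2" .
      moreover have "\<Psi> q * ((h 0 + e / 2) * (1 / \<Psi> q)) = h 0 + e / 2" using Psi_pos[OF q(2)] by simp
      ultimately show "\<Psi> q * ((h 0 + e / 2) * (1 / \<Psi> q) + B * exp (- (q - q1) * d) * (1 / \<Psi> q1)) \<le> h 0 + e"
        unfolding distrib_left by linarith
    qed
    finally show ?case by (simp add: q_def)
  qed
qed

text \<open>For a positive rate the resolvent is continuous at 0, so its value there is bounded
  below by the limit of \<open>\<Psi> q\<close> times its transform. In that limit
  \<open>l * Gr (q + 1)\<close> drops out, because the recursion bounds \<open>Gr (q + 1)\<close> by
  a constant over \<open>\<Psi> (q + 1)\<close>.\<close>

lemma R_psi_at_0: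
  assumes p: "\<kappa> < p"
  shows "ennreal (l * Gr (p + 1)) \<le> R (\<Psi> p) psi 0"
proof -
  define r where "r = \<Psi> p"
  have r: "0 < r" using Psi_pos[OF p] by (simp add: r_def)
  define \<phi> where "\<phi> = (\<lambda>t. indicator {0<..} t * exp (- r * t))"
  have ph[measurable]: "\<phi> \<in> borel_measurable borel" unfolding \<phi>_def by measurable
  have phi0: "\<phi> t = 0" if "t \<le> 0" for t using that by (simp add: \<phi>_def)
  have phinn: "0 \<le> \<phi> t" for t by (simp add: \<phi>_def)
  have nn: "(\<integral>\<^sup>+t. ennreal (\<phi> t) \<partial>lborel) = ennreal (1 / r)"
  proof -
    have "(\<integral>\<^sup>+t. ennreal (\<phi> t) \<partial>lborel) = (\<integral>\<^sup>+t. ennreal (exp (- r * t)) * indicator {0..} t \<partial>lborel)"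
      by (rule nn_integral_cong_AE) (use AE_lborel_singleton[of 0] in \<open>auto elim!: eventually_mono simp: \<phi>_def indicator_def\<close>)
    also have "\<dots> = ennreal (0 - (- exp (- r * 0) / r))"
    proof (rule nn_integral_FTC_atLeast)
      show "((\<lambda>t. - exp (- r * t) / r) has_real_derivative exp (- r * t)) (at t)" for t
        using r by (auto intro!: derivative_eq_intros)
      show "((\<lambda>t. - exp (- r * t) / r) \<longlongrightarrow> 0) at_top" using r by real_asymp
    qed auto
    finally show ?thesis by simp
  qed
  have int: "integrable lborel \<phi>" using nn phinn by (intro integrableI_nonneg) auto
  note wf = wpot_facts[OF ph int phi0 phinn]
  define h where "h = (\<lambda>x. wpot \<phi> (max 0 x))"
  have hc: "continuous_on UNIV h" unfolding h_def by (rule continuous_on_max0[OF wf(1)])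
  have [measurable]: "h \<in> borel_measurable borel" by (rule borel_measurable_continuous_onI[OF hc])
  have Rh: "R r psi x = ennreal (h x)" for x
  proof -
    have "R r psi x = (\<integral>\<^sup>+t. ennreal (\<phi> t) * ennreal (Pt t psi (max 0 (max 0 x))) \<partial>lborel)"
      unfolding R_def \<phi>_def by (intro nn_integral_cong) (auto simp: indicator_def)
    then show ?thesis using wf(2)[of "max 0 x"] by (simp only: h_def)
  qed
  have hb: "0 \<le> h x" "h x \<le> l * J l * (LINT t|lborel. \<phi> t)" for x using wf(3,4) by (simp_all only: h_def max.cobounded1)
  have "h 0 + e \<ge> l * Gr (p + 1)" if e: "e > 0" for e
  proof -
    have ev1: "eventually (\<lambda>n. ennreal (\<Psi> (real n)) * (\<integral>\<^sup>+x\<in>{0..}. ennreal (exp (- real n * x)) * (ennreal (Wp x) * ennreal (h x)) \<partial>lborel) \<le> ennreal (h 0 + e / 2)) sequentially"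
      by (rule concentrate_at_0[where B="l * J l * (LINT t|lborel. \<phi> t)"])
         (use hb e in \<open>auto intro: continuous_on_subset[OF hc]\<close>)
    have lim: "((\<lambda>x. (1 + l * Gr (\<kappa> + 1)) / \<Psi> (x + \<kappa>)) \<longlongrightarrow> 0) at_top"
      by (rule tendsto_divide_0[OF tendsto_const]) (rule filterlim_at_top_imp_at_infinity[OF P_at_top])
    have sh: "filterlim (\<lambda>n. real n + 1 - \<kappa>) at_top sequentially" by real_asymp
    have "(\<lambda>n. l * ((1 + l * Gr (\<kappa> + 1)) / \<Psi> (real n + 1))) \<longlonglongrightarrow> l * 0"
      using filterlim_compose[OF lim sh] by (intro tendsto_mult_left) simp
    then have "eventually (\<lambda>n. l * ((1 + l * Gr (\<kappa> + 1)) / \<Psi> (real n + 1)) < e / 2) sequentially"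
      using e by (intro order_tendstoD(2)) auto
    moreover have "eventually (\<lambda>n. real n > p) sequentially"
      using filterlim_real_sequentially by (auto simp: filterlim_at_top_dense)
    ultimately have "eventually (\<lambda>n. h 0 + e \<ge> l * Gr (p + 1)) sequentially"
      using ev1
    proof eventually_elim
      case (elim n)
      define q where "q = real n"
      have q: "p < q" "\<kappa> < q" using elim p by (auto simp: q_def)
      have pq: "r < \<Psi> q" using Psi_less[of p q] p q by (simp add: r_def)
      have "l * Gr (p + 1) - l * Gr (q + 1) \<le> h 0 + e / 2"
      proof -
        let ?X = "\<integral>\<^sup>+x\<in>{0..}. ennreal (exp (- q * x)) * (ennreal (Wp x) * ennreal (h x)) \<partial>lborel"
        have "?X = (\<integral>\<^sup>+z\<in>{0<..}. ennreal (l * exp (- z) * G z) * ennreal ((exp (- p * z) - exp (- q * z)) / (\<Psi> q - \<Psi> p)) \<partial>lborel)"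
          using R_laplace_psi[of p q] p q by (simp add: Rh r_def[symmetric])
        then have sum: "?X + ennreal (l * Gr (q + 1) / (\<Psi> q - r)) = ennreal (l * Gr (p + 1) / (\<Psi> q - r))"
          using psi_integral[of p q] p q by (simp add: r_def)
        have lg: "0 \<le> l * Gr (q + 1)" "0 \<le> l * Gr (p + 1)" using l_pos Gr_nonneg[of "q + 1"] Gr_nonneg[of "p + 1"] p q by auto
        obtain y where y: "?X = ennreal y" "0 \<le> y"
          using sum by (cases ?X) simp_all
        have "y + l * Gr (q + 1) / (\<Psi> q - r) = l * Gr (p + 1) / (\<Psi> q - r)"
          using sum y lg pq by (simp add: ennreal_plus[symmetric] del: ennreal_plus)
        then have "y * (\<Psi> q - r) = l * Gr (p + 1) - l * Gr (q + 1)" using pq by (simp add: field_simps)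
        moreover have "y * (\<Psi> q - r) \<le> \<Psi> q * y" using r y by (simp add: algebra_simps)
        moreover have "\<Psi> q * y \<le> h 0 + e / 2"
        proof -
          have "ennreal (\<Psi> q * y) \<le> ennreal (h 0 + e / 2)"
            using elim(3) y Psi_pos[OF q(2)] by (simp add: q_def[symmetric] ennreal_mult)
          moreover have "0 \<le> h 0" using wf(3) by (simp add: h_def)
          ultimately show ?thesis using e by (subst (asm) ennreal_le_iff) auto
        qed
        ultimately show ?thesis by linarith
      qed
      moreover have "l * Gr (q + 1) \<le> e / 2"
      proof -
        have "Gr (q + 1) * \<Psi> (q + 1) = 1 + l * Gr (q + 1 + 1)" using Gr_recursion[of "q + 1"] q by (simp add: mult.commute)
        also have "\<dots> \<le> 1 + l * Gr (\<kappa> + 1)" using l_pos q Gr_antimono[of "\<kappa> + 1" "q + 1 + 1"] by simp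
        finally have "Gr (q + 1) \<le> (1 + l * Gr (\<kappa> + 1)) / \<Psi> (q + 1)" using Psi_pos[of "q + 1"] q by (simp add: field_simps)
        then have "l * Gr (q + 1) \<le> l * ((1 + l * Gr (\<kappa> + 1)) / \<Psi> (q + 1))" using l_pos by (intro mult_left_mono) auto
        then show ?thesis using elim(1) unfolding q_def by linarith
      qed
      ultimately show ?case by linarith
    qed
    then show ?thesis by (auto simp: eventually_sequentially)
  qed
  then have "l * Gr (p + 1) \<le> h 0" by (rule field_le_epsilon)
  then show ?thesis using Rh[of 0] by (simp add: r_def[symmetric] ennreal_leI)
qed

text \<open>The potential dominates every resolvent of positive rate; letting that rate decrease to
  0, that is \<open>p\<close> to \<open>\<kappa>\<close>, gives
  \<open>l * Gr (\<kappa> + 1)\<close>, which is \<open>J l - 1\<close>.\<close>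

lemma R0_psi_at_0: "ennreal (J l - 1) \<le> R 0 psi 0"
proof -
  define s where "s = (\<lambda>n. 1 / real (Suc n))"
  have s: "0 < s n" for n by (simp add: s_def)
  have s0: "s \<longlonglongrightarrow> 0" unfolding s_def using LIMSEQ_inverse_real_of_nat by (simp add: inverse_eq_divide)
  have le: "ennreal (l * Gr (\<kappa> + s n + 1)) \<le> R 0 psi 0" for n
  proof -
    have "R (\<Psi> (\<kappa> + s n)) psi 0 \<le> R 0 psi 0"
      unfolding R_def
    proof (rule nn_integral_mono)
      fix t :: real
      show "ennreal (exp (- \<Psi> (\<kappa> + s n) * t)) * ennreal (Pt t psi (max 0 0)) * indicator {0<..} t
        \<le> ennreal (exp (- 0 * t)) * ennreal (Pt t psi (max 0 0)) * indicator {0<..} t"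
      proof (cases "0 < t")
        case True
        have "- \<Psi> (\<kappa> + s n) * t \<le> - 0 * t"
          using Psi_pos[of "\<kappa> + s n"] s[of n] True by simp
        then have "ennreal (exp (- \<Psi> (\<kappa> + s n) * t)) \<le> ennreal (exp (- 0 * t))" by (intro ennreal_leI iffD2[OF exp_le_cancel_iff])
        then show ?thesis by (intro mult_right_mono) auto
      qed (simp only: indicator_def greaterThan_iff, simp)
    qed
    then show ?thesis using R_psi_at_0[of "\<kappa> + s n"] s[of n] by (auto intro: order_trans)
  qed
  have "(\<lambda>n. \<integral>\<^sup>+z\<in>{0<..}. ennreal (exp (- (\<kappa> + s n) * z)) * ennreal (l * exp (- z) * G z) \<partial>lborel)
     \<longlonglongrightarrow> (\<integral>\<^sup>+z\<in>{0<..}. ennreal (exp (- \<kappa> * z)) * ennreal (l * exp (- z) * G z) \<partial>lborel)"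
  proof (rule nn_integral_dominated_convergence[where w="\<lambda>z. ennreal (exp (- \<kappa> * z)) * ennreal (l * exp (- z) * G z) * indicator {0<..} z"])
    show "(\<integral>\<^sup>+z\<in>{0<..}. ennreal (exp (- \<kappa> * z)) * ennreal (l * exp (- z) * G z) \<partial>lborel) < \<infinity>"
      unfolding Gr_laplace_shift[OF order_refl] by simp
    show "AE z in lborel. ennreal (exp (- (\<kappa> + s n) * z)) * ennreal (l * exp (- z) * G z) * indicator {0<..} z
       \<le> ennreal (exp (- \<kappa> * z)) * ennreal (l * exp (- z) * G z) * indicator {0<..} z" for n
      using s[of n] by (intro AE_I2) (auto simp: indicator_def left_diff_distrib intro!: mult_right_mono ennreal_leI)
    show "AE z in lborel. (\<lambda>n. ennreal (exp (- (\<kappa> + s n) * z)) * ennreal (l * exp (- z) * G z) * indicator {0<..} z)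
       \<longlonglongrightarrow> ennreal (exp (- \<kappa> * z)) * ennreal (l * exp (- z) * G z) * indicator {0<..} z"
    proof (rule AE_I2)
      fix z :: real
      have "(\<lambda>n. exp (- (\<kappa> + s n) * z) * (l * exp (- z) * G z) * indicator {0<..} z)
         \<longlonglongrightarrow> exp (- (\<kappa> + 0) * z) * (l * exp (- z) * G z) * indicator {0<..} z"
        by (intro tendsto_intros s0)
      then have "(\<lambda>n. ennreal (exp (- (\<kappa> + s n) * z) * (l * exp (- z) * G z) * indicator {0<..} z))
         \<longlonglongrightarrow> ennreal (exp (- (\<kappa> + 0) * z) * (l * exp (- z) * G z) * indicator {0<..} z)"
        by (rule tendsto_ennrealI)
      then show "(\<lambda>n. ennreal (exp (- (\<kappa> + s n) * z)) * ennreal (l * exp (- z) * G z) * indicator {0<..} z)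
         \<longlonglongrightarrow> ennreal (exp (- \<kappa> * z)) * ennreal (l * exp (- z) * G z) * indicator {0<..} z"
        by (cases "0 < z") (simp_all add: ennreal_mult')
    qed
  qed measurable
  then have "(\<lambda>n. ennreal (l * Gr (\<kappa> + s n + 1))) \<longlonglongrightarrow> ennreal (l * Gr (\<kappa> + 1))"
    unfolding Gr_laplace_shift[OF order_refl] Gr_laplace_shift[OF le_add_same_cancel1[THEN iffD2, OF less_imp_le[OF s]]] .
  then have "ennreal (l * Gr (\<kappa> + 1)) \<le> R 0 psi 0" by (rule LIMSEQ_le_const2) (use le in auto)
  then show ?thesis by (simp add: J_eq_Gr)
qed

text \<open>By Dynkin's formula at 0 the expectation is \<open>1 + I n 0\<close>, increasing to 1
  plus the potential at 0. The potential is at least \<open>J l - 1\<close> by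
  \<open>R0_psi_at_0\<close>, and at most that because \<open>g \<le> J l\<close>.\<close>

lemma Pt_g_tendsto: "(\<lambda>n. Pt (real n) g 0) \<longlonglongrightarrow> J l"
proof -
  have g0: "g 0 = 1" by (simp add: g_def)
  have eq: "Pt (real n) g 0 = 1 + I (real n) 0" if "n > 0" for n
    using dynkin[of "real n" 0] that g0 by simp
  have Ptle: "Pt (real n) g 0 \<le> J l" for n
    by (rule Pt_bounds(2)[where a=1]) (auto simp: g_ge_1 g_le_J)
  have "(\<lambda>n. ennreal (I (real n) 0)) \<longlonglongrightarrow> R 0 psi 0"
  proof -
    note [measurable] = Pt_psi_nn_measurable[of 0]
    have "(\<lambda>n. \<integral>\<^sup>+s. ennreal (Pt s psi (max 0 0)) * indicator {0<..} s * indicator {..real n} s \<partial>lborel) \<longlonglongrightarrow> (\<integral>\<^sup>+s\<in>{0<..}. ennreal (Pt s psi (max 0 0)) \<partial>lborel)"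
    proof (rule nn_integral_LIMSEQ)
      show "incseq (\<lambda>n s. ennreal (Pt s psi (max 0 0)) * indicator {0<..} s * indicator {..real n} s)"
        unfolding incseq_def le_fun_def by (auto simp: indicator_def)
      show "(\<lambda>n. ennreal (Pt s psi (max 0 0)) * indicator {0<..} s * indicator {..real n} s) \<longlonglongrightarrow> ennreal (Pt s psi (max 0 0)) * indicator {0<..} s" for s
      proof (rule tendsto_eventually)
        obtain N where "s < real N" using reals_Archimedean2 by blast
        then show "eventually (\<lambda>n. ennreal (Pt s psi (max 0 0)) * indicator {0<..} s * indicator {..real n} s = ennreal (Pt s psi (max 0 0)) * indicator {0<..} s) sequentially"
          unfolding eventually_sequentially by (intro exI[of _ N]) (auto simp: indicator_def)
      qed
    qed measurable
    moreover have "(\<integral>\<^sup>+s. ennreal (Pt s psi (max 0 0)) * indicator {0<..} s * indicator {..real n} s \<partial>lborel) = ennreal (I (real n) 0)" for n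
      unfolding I_facts(2)[of "real n" 0, OF of_nat_0_le_iff, symmetric]
      by (intro nn_integral_cong) (auto simp: indicator_def)
    ultimately show ?thesis by (simp add: R0_eq)
  qed
  moreover have "ennreal (I (real n) 0) \<le> ennreal (J l - 1)" if "n > 0" for n
    using eq[OF that] Ptle[of n] by (intro ennreal_leI) simp
  then have "R 0 psi 0 \<le> ennreal (J l - 1)"
    by (intro LIMSEQ_le_const2[OF calculation]) (auto intro!: exI[of _ 1])
  ultimately have "(\<lambda>n. ennreal (I (real n) 0)) \<longlonglongrightarrow> ennreal (J l - 1)"
    using R0_psi_at_0 by (simp add: order_antisym)
  then have "(\<lambda>n. I (real n) 0) \<longlonglongrightarrow> J l - 1"
    using I_facts(3)[of "real _" 0] J_ge by (subst (asm) tendsto_ennreal_iff) auto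
  then have "(\<lambda>n. 1 + I (real n) 0) \<longlonglongrightarrow> 1 + (J l - 1)" by (intro tendsto_intros)
  moreover have "eventually (\<lambda>n. 1 + I (real n) 0 = Pt (real n) g 0) sequentially"
    using eventually_gt_at_top[of 0] by eventually_elim (simp add: eq)
  ultimately show ?thesis by (simp add: Lim_transform_eventually)
qed

end

section \<open>The Feynman-Kac martingale\<close>

text \<open>The right end of the cell containing \<open>s\<close> tends to \<open>s\<close> from the
  right, so right-continuity gives pointwise convergence of the step functions; the uniform bound
  gives domination.\<close>

lemma riemann_sum_right:
  fixes f :: "real \<Rightarrow> real"
  assumes t: "0 < t" and meas: "(\<lambda>s. f (max 0 s)) \<in> borel_measurable borel"
    and right: "\<And>s. 0 \<le> s \<Longrightarrow> (f \<longlongrightarrow> f s) (at_right s)" and B: "\<And>s. 0 \<le> s \<Longrightarrow> \<bar>f s\<bar> \<le> B"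
  shows "(\<lambda>k. \<Sum>j<Suc k. t / Suc k * f (Suc j * (t / Suc k))) \<longlonglongrightarrow> (LINT s|lborel. indicator {0<..t} s * f (max 0 s))"
proof -
  define h where "h = (\<lambda>k. t / real (Suc k))"
  have h: "0 < h k" for k using t by (simp add: h_def)
  define \<phi> where "\<phi> = (\<lambda>k s. \<Sum>j<Suc k. f (real (Suc j) * h k) * indicator {real j * h k<..real (Suc j) * h k} s)"
  have val: "\<phi> k s = indicator {0<..t} s * f (real_of_int \<lceil>s / h k\<rceil> * h k)" for k s
  proof (cases "0 < s \<and> s \<le> t")
    case True
    define j where "j = nat (\<lceil>s / h k\<rceil> - 1)"
    have c1: "1 \<le> \<lceil>s / h k\<rceil>" using True h[of k] by (simp add: le_ceiling_iff)
    have "s / h k \<le> real (Suc k)"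
      using mult_right_mono[of s t "real (Suc k)"] True t by (simp add: h_def divide_le_eq)
    then have c2: "\<lceil>s / h k\<rceil> \<le> int (Suc k)" by (simp add: ceiling_le_iff del: of_nat_Suc)
    have jr: "real (Suc j) = real_of_int \<lceil>s / h k\<rceil>" using c1 by (simp add: j_def)
    have jl: "j < Suc k" using c1 c2 unfolding j_def by linarith
    have iff: "s \<in> {real i * h k<..real (Suc i) * h k} \<longleftrightarrow> i = j" for i
    proof -
      have "s \<in> {real i * h k<..real (Suc i) * h k} \<longleftrightarrow> real i < s / h k \<and> s / h k \<le> real (Suc i)"
        using h[of k] by (auto simp: field_simps)
      also have "\<dots> \<longleftrightarrow> \<lceil>s / h k\<rceil> = int (Suc i)" by (simp add: ceiling_eq_iff)
      also have "\<dots> \<longleftrightarrow> i = j" using c1 unfolding j_def by linarith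
      finally show ?thesis .
    qed
    have "\<phi> k s = (\<Sum>i<Suc k. if i = j then f (real (Suc j) * h k) else 0)"
      unfolding \<phi>_def by (intro sum.cong refl) (use iff in \<open>simp add: indicator_def del: greaterThanAtMost_iff of_nat_Suc\<close>)
    also have "\<dots> = f (real (Suc j) * h k)" using jl by (simp del: of_nat_Suc)
    finally show ?thesis using True by (simp add: jr del: of_nat_Suc)
  next
    case False
    have "s \<notin> {real j * h k<..real (Suc j) * h k}" if "j < Suc k" for j
    proof
      assume a: "s \<in> {real j * h k<..real (Suc j) * h k}"
      have "real (Suc j) * h k \<le> real (Suc k) * h k" using that h[of k] by (intro mult_right_mono) auto
      then have "s \<le> t" using a by (simp add: h_def del: of_nat_Suc)
      moreover have "0 \<le> real j * h k" using h[of k] by simp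
      ultimately show False using a False by auto
    qed
    then have "\<phi> k s = 0" unfolding \<phi>_def by (intro sum.neutral ballI) (simp add: indicator_def del: greaterThanAtMost_iff of_nat_Suc)
    then show ?thesis using False by auto
  qed
  have B0: "0 \<le> B" using B[of 0] by simp
  have int: "(LINT s|lborel. \<phi> k s) = (\<Sum>j<Suc k. h k * f (real (Suc j) * h k))" for k
  proof -
    have "(LINT s|lborel. \<phi> k s) = (\<Sum>j<Suc k. LINT s|lborel. f (real (Suc j) * h k) * indicator {real j * h k<..real (Suc j) * h k} s)"
      unfolding \<phi>_def using h[of k] by (intro Bochner_Integration.integral_sum integrable_mult_right) (auto simp: field_simps)
    also have "\<dots> = (\<Sum>j<Suc k. h k * f (real (Suc j) * h k))"
      using h[of k] by (intro sum.cong refl) (simp add: algebra_simps)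
    finally show ?thesis .
  qed
  have "(\<lambda>k. LINT s|lborel. \<phi> k s) \<longlonglongrightarrow> (LINT s|lborel. indicator {0<..t} s * f (max 0 s))"
  proof (rule integral_dominated_convergence[where w="\<lambda>s. B * indicator {0<..t} s"])
    show "(\<lambda>s. indicator {0<..t} s * f (max 0 s)) \<in> borel_measurable lborel"
      using meas by (intro borel_measurable_times) auto
    show "\<phi> k \<in> borel_measurable lborel" for k unfolding \<phi>_def by measurable
    show "integrable lborel (\<lambda>s. B * indicator {0<..t} s)" using t by (intro integrable_mult_right) auto
    show "AE s in lborel. norm (\<phi> k s) \<le> B * indicator {0<..t} s" for k
    proof (rule AE_I2)
      fix s :: real
      have "0 \<le> real_of_int \<lceil>s / h k\<rceil> * h k" if "0 < s"
        using h[of k] divide_pos_pos[OF that h[of k]]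
          le_of_int_ceiling[of "s / h k"] by (intro mult_nonneg_nonneg) linarith+
      then show "norm (\<phi> k s) \<le> B * indicator {0<..t} s" by (auto simp: val indicator_def intro: B)
    qed
    show "AE s in lborel. (\<lambda>k. \<phi> k s) \<longlonglongrightarrow> indicator {0<..t} s * f (max 0 s)"
    proof (rule AE_I2)
      fix s :: real
      show "(\<lambda>k. \<phi> k s) \<longlonglongrightarrow> indicator {0<..t} s * f (max 0 s)"
      proof (cases "0 < s \<and> s \<le> t")
        case True
        define c where "c = (\<lambda>k. real_of_int \<lceil>s / h k\<rceil> * h k)"
        have cs: "s \<le> c k" "c k \<le> s + h k" for k
        proof -
          have "s / h k * h k \<le> c k" "c k \<le> (s / h k + 1) * h k"
            unfolding c_def using h[of k] by (intro mult_right_mono; linarith)+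
          then show "s \<le> c k" "c k \<le> s + h k" using h[of k] by (simp_all add: distrib_right)
        qed
        have "h \<longlonglongrightarrow> 0" unfolding h_def by real_asymp
        then have "(\<lambda>k. s + h k) \<longlonglongrightarrow> s + 0" by (intro tendsto_intros)
        then have "c \<longlonglongrightarrow> s"
          by (intro tendsto_sandwich[of "\<lambda>_. s" c sequentially "\<lambda>k. s + h k"]) (simp_all add: cs)
        \<comment> \<open>The end of a cell may coincide with \<open>s\<close>, which a limit along
          \<open>at_right s\<close> excludes; hence the passage to continuity within
          \<open>{s..}\<close>.\<close>
        have "{s..} - {s} = {s<..} - {s}" by auto
        then have "at s within {s..} = at_right s" unfolding at_within_def by (rule arg_cong)
        then have "continuous (at s within {s..}) f" using right[of s] True by (simp add: continuous_within)
        then have "(\<lambda>k. f (c k)) \<longlonglongrightarrow> f s"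
          using \<open>c \<longlonglongrightarrow> s\<close> by (intro continuous_within_tendsto_compose'[of s "{s..}" f c]) (auto simp: cs)
        then show ?thesis using True by (simp add: val c_def)
      qed (simp add: val)
    qed
  qed
  then show ?thesis unfolding int by (simp add: h_def)
qed

section \<open>The Markov property along the path\<close>

locale feller_path = feller Q
  for Q +
  fixes N :: "'b measure" and X :: "real \<Rightarrow> 'b \<Rightarrow> real"
  assumes markov: "markov_process N X {0..} Q 0"
begin

sublocale N: prob_space N
  using markov by (simp add: markov_process_def)

lemma X_measurable: "0 \<le> t \<Longrightarrow> X t \<in> borel_measurable N"
  using markov by (simp add: markov_process_def)

lemma X_cadlag: "\<omega> \<in> space N \<Longrightarrow> cadlag (\<lambda>t. X t \<omega>)"
  using markov by (simp add: markov_process_def)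

lemma X_nonneg: "AE \<omega> in N. \<forall>t\<ge>0. 0 \<le> X t \<omega>"
  using markov by (simp add: markov_process_def)

lemma X_0: "AE \<omega> in N. X 0 \<omega> = 0"
  using markov by (simp add: markov_process_def)

lemma X_pair_measurable: "(\<lambda>(t, \<omega>). X (max 0 t) \<omega>) \<in> borel_measurable (borel \<Otimes>\<^sub>M N)"
  by (rule right_continuous_measurable_pair) (auto intro: cadlag_right_tendsto X_cadlag X_measurable)

abbreviation filt where "filt \<equiv> natural_filtration N X"

lemma filt_space: "space (filt s) = space N"
  by (simp add: natural_filtration_def space_measure_of_conv)

lemma filt_subalgebra: "subalgebra N (filt s)"
proof -
  have "sets (filt s) \<subseteq> sets N"
    unfolding natural_filtration_def
    by (subst sets_measure_of) (auto intro!: sets.sigma_sets_subset measurable_sets X_measurable)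
  then show ?thesis by (simp add: subalgebra_def filt_space)
qed

lemma filt_measurable: "0 \<le> u \<Longrightarrow> u \<le> s \<Longrightarrow> X u \<in> borel_measurable (filt s)"
  unfolding natural_filtration_def
  by (rule measurableI) (auto simp: space_measure_of_conv)

text \<open>The defining property of conditional expectation, tested against a bounded factor
  measurable for the past.\<close>

lemma markov_set:
  assumes s: "0 \<le> s" and t: "0 \<le> t" and B: "B \<in> sets borel"
    and Z: "Z \<in> borel_measurable (filt s)" "\<And>\<omega>. 0 \<le> Z \<omega>" "\<And>\<omega>. Z \<omega> \<le> (C::real)"
  shows "(\<integral>\<^sup>+\<omega>. ennreal (Z \<omega>) * indicator B (X (s + t) \<omega>) \<partial>N) = (\<integral>\<^sup>+\<omega>. ennreal (Z \<omega>) * emeasure (kern t (X s \<omega>)) B \<partial>N)"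
proof -
  interpret S: finite_measure_subalgebra N "filt s"
    by standard (rule filt_subalgebra)
  note [measurable] = X_measurable[OF s] X_measurable[of "s + t"] B
  have st: "0 \<le> s + t" using s t by simp
  note [measurable] = X_measurable[OF st]
  have Zm[measurable]: "Z \<in> borel_measurable N" by (rule measurable_from_subalg[OF filt_subalgebra Z(1)])
  define A where "A = X (s + t) -` B \<inter> space N"
  have A[measurable]: "A \<in> sets N" unfolding A_def by measurable
  have int: "integrable N (\<lambda>\<omega>. Z \<omega> * indicator A \<omega>)"
    using Z(2,3) by (intro N.integrable_const_bound[where B=C]) (auto simp: indicator_def intro!: AE_I2 order_trans[OF Z(2) Z(3)])
  have ce: "AE \<omega> in N. real_cond_exp N (filt s) (indicator A) \<omega> = measure (Q t (X s \<omega>)) B"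
    using markov s t B unfolding markov_process_def A_def by blast
  \<comment> \<open>Almost every path stays in the half-line, so the clipping in \<open>kern\<close>
    has no effect.\<close>
  have ce': "AE \<omega> in N. Z \<omega> * real_cond_exp N (filt s) (indicator A) \<omega> = Z \<omega> * measure (kern t (X s \<omega>)) B"
    using ce X_nonneg by eventually_elim (use s in \<open>simp add: kern_def max_absorb2\<close>)
  have pk: "prob_space (kern t y)" for y unfolding kern_def using t by (intro Q_prob) auto
  have "(\<lambda>y. emeasure (kern t y) B) \<in> borel_measurable borel"
    by (rule measurable_compose[OF kern_measurable[OF t] measurable_emeasure_subprob_algebra[OF B]])
  then have [measurable]: "(\<lambda>y. measure (kern t y) B) \<in> borel_measurable borel"
    unfolding measure_def by measurable
  have "(\<integral>\<^sup>+\<omega>. ennreal (Z \<omega>) * indicator B (X (s + t) \<omega>) \<partial>N) = (\<integral>\<^sup>+\<omega>. ennreal (Z \<omega> * indicator A \<omega>) \<partial>N)"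
    by (intro nn_integral_cong) (auto simp: A_def indicator_def)
  also have "\<dots> = ennreal (LINT \<omega>|N. Z \<omega> * indicator A \<omega>)"
    using Z(2) by (intro nn_integral_eq_integral int) auto
  also have "\<dots> = ennreal (LINT \<omega>|N. Z \<omega> * real_cond_exp N (filt s) (indicator A) \<omega>)"
    by (subst S.real_cond_exp_intg(2)[OF int Z(1)]) auto
  also have "\<dots> = ennreal (LINT \<omega>|N. Z \<omega> * measure (kern t (X s \<omega>)) B)"
    by (subst integral_cong_AE[OF _ _ ce']) auto
  also have "\<dots> = (\<integral>\<^sup>+\<omega>. ennreal (Z \<omega> * measure (kern t (X s \<omega>)) B) \<partial>N)"
  proof (rule nn_integral_eq_integral[symmetric])
    have "integrable N (\<lambda>\<omega>. Z \<omega> * real_cond_exp N (filt s) (indicator A) \<omega>)"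
      by (rule S.real_cond_exp_intg(1)[OF int Z(1)]) auto
    then show "integrable N (\<lambda>\<omega>. Z \<omega> * measure (kern t (X s \<omega>)) B)"
      by (subst (asm) integrable_cong_AE[OF _ _ ce']) auto
  qed (use Z(2) in auto)
  also have "\<dots> = (\<integral>\<^sup>+\<omega>. ennreal (Z \<omega>) * emeasure (kern t (X s \<omega>)) B \<partial>N)"
    using Z(2) by (intro nn_integral_cong) (simp add: ennreal_mult finite_measure.emeasure_eq_measure[OF prob_space.finite_measure[OF pk]])
  finally show ?thesis .
qed

text \<open>Both sides integrate \<open>f\<close> against a measure: the law of
  \<open>X (s + t)\<close> under the measure with density \<open>Z\<close>, and the bind of that
  measure with the kernel. By \<open>markov_set\<close> these agree on sets.\<close>

lemma markov_nn:
  assumes s: "0 \<le> s" and t: "0 \<le> t" and f[measurable]: "f \<in> borel_measurable borel"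
    and Z: "Z \<in> borel_measurable (filt s)" "\<And>\<omega>. 0 \<le> Z \<omega>" "\<And>\<omega>. Z \<omega> \<le> (C::real)"
  shows "(\<integral>\<^sup>+\<omega>. ennreal (Z \<omega>) * f (X (s + t) \<omega>) \<partial>N) = (\<integral>\<^sup>+\<omega>. ennreal (Z \<omega>) * (\<integral>\<^sup>+y. f y \<partial>kern t (X s \<omega>)) \<partial>N)"
proof -
  have st: "0 \<le> s + t" using s t by simp
  note [measurable] = X_measurable[OF st] X_measurable[OF s]
  have Zm[measurable]: "Z \<in> borel_measurable N" by (rule measurable_from_subalg[OF filt_subalgebra Z(1)])
  define D where "D = density N (\<lambda>\<omega>. ennreal (Z \<omega>))"
  have k0: "(\<lambda>\<omega>. kern t (X s \<omega>)) \<in> measurable N (subprob_algebra borel)"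
    by (rule measurable_compose[OF X_measurable[OF s] kern_measurable[OF t]])
  then have k: "(\<lambda>\<omega>. kern t (X s \<omega>)) \<in> measurable D (subprob_algebra borel)"
    by (simp add: D_def cong: measurable_cong_sets)
  have Xm: "X (s + t) \<in> borel_measurable D" using X_measurable[OF st] by (simp add: D_def cong: measurable_cong_sets)
  have ne: "space D \<noteq> {}" using N.not_empty by (simp add: D_def)
  have "distr D borel (X (s + t)) = D \<bind> (\<lambda>\<omega>. kern t (X s \<omega>))"
  proof (rule measure_eqI)
    show "sets (distr D borel (X (s + t))) = sets (D \<bind> (\<lambda>\<omega>. kern t (X s \<omega>)))"
      using sets_bind[OF _ ne, of "\<lambda>\<omega>. kern t (X s \<omega>)" borel] sets_kernel[OF k] by simp
    fix B assume "B \<in> sets (distr D borel (X (s + t)))"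
    then have B[measurable]: "B \<in> sets borel" by simp
    have em: "(\<lambda>\<omega>. emeasure (kern t (X s \<omega>)) B) \<in> borel_measurable N"
      by (rule measurable_compose[OF k0 measurable_emeasure_subprob_algebra[OF B]])
    have "emeasure (distr D borel (X (s + t))) B = (\<integral>\<^sup>+\<omega>. indicator B (X (s + t) \<omega>) \<partial>D)"
      using Xm by (simp add: nn_integral_indicator[symmetric] nn_integral_distr del: nn_integral_indicator)
    also have "\<dots> = (\<integral>\<^sup>+\<omega>. ennreal (Z \<omega>) * indicator B (X (s + t) \<omega>) \<partial>N)"
      unfolding D_def by (rule nn_integral_density) measurable
    also have "\<dots> = (\<integral>\<^sup>+\<omega>. ennreal (Z \<omega>) * emeasure (kern t (X s \<omega>)) B \<partial>N)"
      by (rule markov_set[OF s t B Z])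
    also have "\<dots> = (\<integral>\<^sup>+\<omega>. emeasure (kern t (X s \<omega>)) B \<partial>D)"
      unfolding D_def by (rule nn_integral_density[symmetric]) (use em in measurable)
    also have "\<dots> = emeasure (D \<bind> (\<lambda>\<omega>. kern t (X s \<omega>))) B"
      by (rule emeasure_bind[OF ne k B, symmetric])
    finally show "emeasure (distr D borel (X (s + t))) B = emeasure (D \<bind> (\<lambda>\<omega>. kern t (X s \<omega>))) B" .
  qed
  then have "(\<integral>\<^sup>+y. f y \<partial>distr D borel (X (s + t))) = (\<integral>\<^sup>+y. f y \<partial>(D \<bind> (\<lambda>\<omega>. kern t (X s \<omega>))))" by simp
  then have "(\<integral>\<^sup>+\<omega>. f (X (s + t) \<omega>) \<partial>D) = (\<integral>\<^sup>+\<omega>. (\<integral>\<^sup>+y. f y \<partial>kern t (X s \<omega>)) \<partial>D)"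
    using nn_integral_bind[OF f k] nn_integral_distr[OF Xm, of f] by simp
  moreover have "(\<lambda>\<omega>. \<integral>\<^sup>+y. f y \<partial>kern t (X s \<omega>)) \<in> borel_measurable N"
    by (rule measurable_compose[OF X_measurable[OF s] kern_nn_measurable[OF t f]])
  ultimately show ?thesis unfolding D_def by (simp add: nn_integral_density)
qed

lemma markov_Pt:
  fixes f :: "real \<Rightarrow> real" and B C :: real
  assumes s: "0 \<le> s" and t: "0 \<le> t"
    and f[measurable]: "f \<in> borel_measurable borel" and fB: "\<And>y. 0 \<le> f y" "\<And>y. f y \<le> B"
    and Z: "Z \<in> borel_measurable (filt s)" "\<And>\<omega>. 0 \<le> Z \<omega>" "\<And>\<omega>. Z \<omega> \<le> C"
  shows "(LINT \<omega>|N. Z \<omega> * f (X (s + t) \<omega>)) = (LINT \<omega>|N. Z \<omega> * Pt t f (max 0 (X s \<omega>)))"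
proof -
  have st: "0 \<le> s + t" using s t by simp
  note [measurable] = X_measurable[OF st] X_measurable[OF s]
  have Zm[measurable]: "Z \<in> borel_measurable N" by (rule measurable_from_subalg[OF filt_subalgebra Z(1)])
  have k: "(\<integral>\<^sup>+y. ennreal (f y) \<partial>kern t x) = ennreal (Pt t f (max 0 x))" for x
    unfolding kern_def using t fB by (intro Pt_nn[where B=B]) auto
  have "(\<lambda>x. \<integral>\<^sup>+y. ennreal (f y) \<partial>kern t x) \<in> borel_measurable borel" by (rule kern_nn_measurable[OF t]) measurable
  then have "(\<lambda>x. enn2real (\<integral>\<^sup>+y. ennreal (f y) \<partial>kern t x)) \<in> borel_measurable borel" by measurable
  moreover have P0: "0 \<le> Pt t f (max 0 x)" for x
    by (rule Pt_bounds(1)[where b=B]) (use t fB in auto)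
  ultimately have [measurable]: "(\<lambda>x. Pt t f (max 0 x)) \<in> borel_measurable borel" by (simp add: k)
  have "(LINT \<omega>|N. Z \<omega> * f (X (s + t) \<omega>)) = enn2real (\<integral>\<^sup>+\<omega>. ennreal (Z \<omega> * f (X (s + t) \<omega>)) \<partial>N)"
    using Z fB by (intro integral_eq_nn_integral) auto
  also have "(\<integral>\<^sup>+\<omega>. ennreal (Z \<omega> * f (X (s + t) \<omega>)) \<partial>N) = (\<integral>\<^sup>+\<omega>. ennreal (Z \<omega> * Pt t f (max 0 (X s \<omega>))) \<partial>N)"
    using markov_nn[OF s t _ Z, of "\<lambda>y. ennreal (f y)"] Z fB P0 by (simp add: ennreal_mult k)
  also have "enn2real \<dots> = (LINT \<omega>|N. Z \<omega> * Pt t f (max 0 (X s \<omega>)))"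
    using Z P0 by (intro integral_eq_nn_integral[symmetric]) auto
  finally show ?thesis .
qed

end

section \<open>Discretised Feynman-Kac weights\<close>

locale conditioned_path = conditioned M V \<Psi> \<alpha> W \<kappa> l Q + feller_path Q N X
  for M :: "'a measure" and V \<Psi> \<alpha> W \<kappa> l Q and N :: "'b measure" and X
begin

text \<open>Discount over a time step of length \<open>h\<close> at killing rate
  \<open>l * exp (- y)\<close>, with the position frozen at \<open>y\<close>.\<close>

definition Eh :: "real \<Rightarrow> real \<Rightarrow> real" where
  "Eh h y = exp (- (l * h * exp (- y)))"

lemma Eh_bounds: "0 \<le> h \<Longrightarrow> 0 < Eh h y" "0 \<le> h \<Longrightarrow> Eh h y \<le> 1"
  using l_pos by (auto simp: Eh_def)

lemma Eh_measurable[measurable]: "Eh h \<in> borel_measurable borel"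
  unfolding Eh_def[abs_def] by measurable

lemma Eg_bounds:
  assumes "0 \<le> h"
  shows "0 \<le> Eh h y * g y" "Eh h y * g y \<le> J l"
  using mult_mono[of "Eh h y" 1 "g y" "J l"] Eh_bounds[OF assms, of y] g_ge_1[of y] g_le_J[of y] by auto

lemma exp_minus_le_quadratic:
  fixes u :: real
  assumes "0 \<le> u"
  shows "exp (- u) \<le> 1 - u + u\<^sup>2"
proof -
  have "exp (- u) \<le> 1 / (1 + u)"
    using exp_ge_add_one_self[of u] assms by (simp add: exp_minus field_simps)
  also have "\<dots> \<le> 1 - u + u\<^sup>2"
  proof -
    have "1 \<le> (1 - u + u\<^sup>2) * (1 + u)" using assms by (simp add: algebra_simps power2_eq_square)
    then show ?thesis using assms by (simp add: divide_le_eq)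
  qed
  finally show ?thesis .
qed

text \<open>Expansion of the discount to second order; multiplied by \<open>g\<close>, its
  first-order term is exactly \<open>h * psi y\<close>.\<close>

lemma Eh_g_bounds:
  assumes h: "0 \<le> h" and y: "0 \<le> y"
  shows "g y - h * psi y \<le> Eh h y * g y" "Eh h y * g y \<le> g y - h * psi y + (l * h)\<^sup>2 * J l"
proof -
  define u where "u = l * h * exp (- y)"
  have u: "0 \<le> u" "u \<le> l * h"
    using l_pos h y by (auto simp: u_def intro!: mult_left_le)
  have g: "0 \<le> g y" "g y \<le> J l" using g_ge_1[of y] g_le_J[of y] by auto
  have hp: "h * psi y = u * g y" by (simp add: psi_def u_def)
  have Eu: "Eh h y = exp (- u)" by (simp add: Eh_def u_def)
  have "(1 - u) * g y \<le> exp (- u) * g y"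
    using exp_ge_add_one_self[of "- u"] g by (intro mult_right_mono) auto
  then show "g y - h * psi y \<le> Eh h y * g y" by (simp add: Eu hp algebra_simps)
  have "exp (- u) * g y \<le> (1 - u + u\<^sup>2) * g y"
    using exp_minus_le_quadratic[OF u(1)] g by (intro mult_right_mono) auto
  also have "\<dots> = g y - h * psi y + u\<^sup>2 * g y" by (simp add: hp algebra_simps)
  also have "u\<^sup>2 * g y \<le> (l * h)\<^sup>2 * J l" using u g by (intro mult_mono power_mono) auto
  finally show "Eh h y * g y \<le> g y - h * psi y + (l * h)\<^sup>2 * J l" by (simp add: Eu)
qed

lemma I_close:
  assumes h: "0 < h" and x: "0 \<le> x" and e: "\<And>s. 0 \<le> s \<Longrightarrow> s \<le> h \<Longrightarrow> \<bar>Pt s psi x - psi x\<bar> \<le> e"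
  shows "\<bar>I h x - h * psi x\<bar> \<le> h * e"
proof -
  have e0: "0 \<le> e" using e[of 0] h by simp
  have I: "(\<integral>\<^sup>+s\<in>{0<..h}. ennreal (Pt s psi x) \<partial>lborel) = ennreal (I h x)"
    using I_facts(2)[of h x] h x by (simp add: max_absorb2)
  have "ennreal (I h x) \<le> (\<integral>\<^sup>+s. ennreal (psi x + e) * indicator {0<..h} s \<partial>lborel)"
    unfolding I[symmetric]
  proof (rule nn_integral_mono)
    fix s :: real
    show "ennreal (Pt s psi x) * indicator {0<..h} s \<le> ennreal (psi x + e) * indicator {0<..h} s"
      using e[of s] by (cases "s \<in> {0<..h}") (auto intro!: ennreal_leI)
  qed
  also have "\<dots> = ennreal (h * (psi x + e))"
    using h psi_nonneg[of x] e0 by (subst nn_integral_cmult_indicator) (simp_all add: ennreal_mult[symmetric] mult.commute del: ennreal_plus)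
  finally have u: "I h x \<le> h * (psi x + e)"
    using h psi_nonneg[of x] e0 by (subst (asm) ennreal_le_iff) auto
  \<comment> \<open>Clipped at 0 so that the constant can be integrated in \<open>ennreal\<close>
    and its integral is \<open>h * c\<close>.\<close>
  define c where "c = max 0 (psi x - e)"
  have c0: "0 \<le> c" by (simp add: c_def)
  have "ennreal (h * c) = (\<integral>\<^sup>+s. ennreal (c) * indicator {0<..h} s \<partial>lborel)"
    using h by (subst nn_integral_cmult_indicator) (simp_all add: ennreal_mult[symmetric] mult.commute c0)
  also have "\<dots> \<le> ennreal (I h x)"
    unfolding I[symmetric]
  proof (rule nn_integral_mono)
    fix s :: real
    show "ennreal (c) * indicator {0<..h} s \<le> ennreal (Pt s psi x) * indicator {0<..h} s"
      using e[of s] Pt_psi_bounds(1)[of s x] x by (cases "s \<in> {0<..h}") (auto simp: c_def intro!: ennreal_leI)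
  qed
  finally have "h * c \<le> I h x"
    using I_facts(3)[of h x] h by (simp add: ennreal_le_iff)
  moreover have "h * (psi x - e) \<le> h * c" using h unfolding c_def by (intro mult_left_mono) auto
  ultimately show ?thesis using u by (simp add: abs_le_iff algebra_simps)
qed

text \<open>To first order, Dynkin's formula makes the mean of \<open>g\<close> grow by
  \<open>h * psi x\<close> and the discount takes the same amount away. The error is small relative
  to \<open>h\<close>, uniformly in the starting point, as \<open>e\<close> is a modulus of the
  semigroup at \<open>psi\<close>.\<close>

lemma one_step:
  assumes h: "0 < h" and x: "0 \<le> x" and e: "\<And>s. 0 \<le> s \<Longrightarrow> s \<le> h \<Longrightarrow> \<bar>Pt s psi x - psi x\<bar> \<le> e"
  shows "\<bar>Pt h (\<lambda>y. Eh h y * g y) x - g x\<bar> \<le> h * (2 * e) + (l * h)\<^sup>2 * J l"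
proof -
  interpret Qx: prob_space "Q h x" using h x by (intro Q_prob) auto
  have h0: "0 \<le> h" using h by simp
  have gi: "integrable (Q h x) g"
    by (rule bounded_integrable[where B="J l"]) (use h x g_ge_1 g_le_J in \<open>auto simp: abs_of_nonneg order_trans[OF zero_le_one]\<close>)
  have pi: "integrable (Q h x) psi"
    by (rule bounded_integrable[where B="l * J l"]) (use h x psi_nonneg psi_le in auto)
  note Egb = Eg_bounds[OF h0]
  have Ei: "integrable (Q h x) (\<lambda>y. Eh h y * g y)"
    by (rule bounded_integrable[where B="J l"]) (use h x Egb in auto)
  have AEy: "AE y in Q h x. 0 \<le> y" using h x by (intro Q_nonneg) auto
  have "Pt h g x - h * Pt h psi x = (LINT y|Q h x. g y - h * psi y)"
    unfolding Pt_def using gi pi by simp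
  also have "\<dots> \<le> Pt h (\<lambda>y. Eh h y * g y) x"
    unfolding Pt_def by (intro integral_mono_AE Ei Bochner_Integration.integrable_diff gi integrable_mult_right pi)
      (use AEy Eh_g_bounds(1)[OF h0] in \<open>auto elim!: eventually_mono\<close>)
  finally have lo: "Pt h g x - h * Pt h psi x \<le> Pt h (\<lambda>y. Eh h y * g y) x" .
  have "Pt h (\<lambda>y. Eh h y * g y) x \<le> (LINT y|Q h x. g y - h * psi y + (l * h)\<^sup>2 * J l)"
    unfolding Pt_def by (intro integral_mono_AE Ei Bochner_Integration.integrable_add Bochner_Integration.integrable_diff gi integrable_mult_right pi Qx.integrable_const)
      (use AEy Eh_g_bounds(2)[OF h0] in \<open>auto elim!: eventually_mono\<close>)
  also have "\<dots> = Pt h g x - h * Pt h psi x + (l * h)\<^sup>2 * J l"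
    unfolding Pt_def using gi pi by (simp add: Qx.prob_space)
  finally have up: "Pt h (\<lambda>y. Eh h y * g y) x \<le> Pt h g x - h * Pt h psi x + (l * h)\<^sup>2 * J l" .
  have "\<bar>I h x - h * psi x\<bar> \<le> h * e" by (rule I_close[OF h x e])
  moreover have "\<bar>h * Pt h psi x - h * psi x\<bar> \<le> h * e"
  proof -
    have "h * \<bar>Pt h psi x - psi x\<bar> \<le> h * e" using e[of h] h by (intro mult_left_mono) auto
    then show ?thesis using h by (simp add: right_diff_distrib[symmetric] abs_mult)
  qed
  moreover have "0 \<le> (l * h)\<^sup>2 * J l" using J_ge by simp
  ultimately show ?thesis using lo up dynkin[OF h x] by (simp add: abs_le_iff algebra_simps)
qed

text \<open>Discount accumulated over \<open>k\<close> steps, sampled at right endpoints so that one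
  more step is a function of the new position and fits the Markov property at time
  \<open>k * h\<close>.\<close>

definition D :: "real \<Rightarrow> nat \<Rightarrow> 'b \<Rightarrow> real" where
  "D h k \<omega> = (\<Prod>j<k. Eh h (X (real (Suc j) * h) \<omega>))"

lemma D_bounds: "0 \<le> h \<Longrightarrow> 0 \<le> D h k \<omega>" "0 \<le> h \<Longrightarrow> D h k \<omega> \<le> 1"
  unfolding D_def by (auto intro!: prod_nonneg prod_le_1 simp: Eh_bounds less_imp_le)

lemma D_filt: "0 \<le> h \<Longrightarrow> D h k \<in> borel_measurable (filt (real k * h))"
  unfolding D_def[abs_def]
  by (intro borel_measurable_prod measurable_compose[OF filt_measurable Eh_measurable])
     (auto intro!: mult_right_mono mult_nonneg_nonneg)

lemma D_measurable: "0 \<le> h \<Longrightarrow> D h k \<in> borel_measurable N"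
  by (rule measurable_from_subalg[OF filt_subalgebra D_filt])

text \<open>Conditioning on the past up to \<open>k * h\<close> reduces the change to
  \<open>one_step\<close>, and the past discount, being at most 1, does not enlarge the
  error.\<close>

lemma D_step:
  assumes h: "0 < h" and e: "\<And>s x. 0 \<le> s \<Longrightarrow> s \<le> h \<Longrightarrow> 0 \<le> x \<Longrightarrow> \<bar>Pt s psi x - psi x\<bar> \<le> e"
  shows "\<bar>(LINT \<omega>|N. D h (Suc k) \<omega> * g (X (real (Suc k) * h) \<omega>)) - (LINT \<omega>|N. D h k \<omega> * g (X (real k * h) \<omega>))\<bar>
    \<le> h * (2 * e) + (l * h)\<^sup>2 * J l"
proof -
  have h0: "0 \<le> h" using h by simp
  have kh: "0 \<le> real k * h" using h by simp
  note [measurable] = D_measurable[OF h0] X_measurable[OF kh]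
  let ?E = "\<lambda>y. Eh h y * g y"
  let ?b = "h * (2 * e) + (l * h)\<^sup>2 * J l"
  note Egb = Eg_bounds[OF h0]
  have "D h (Suc k) \<omega> * g (X (real (Suc k) * h) \<omega>) = D h k \<omega> * ?E (X (real k * h + h) \<omega>)" for \<omega>
    by (simp add: D_def algebra_simps)
  then have "(LINT \<omega>|N. D h (Suc k) \<omega> * g (X (real (Suc k) * h) \<omega>)) = (LINT \<omega>|N. D h k \<omega> * Pt h ?E (max 0 (X (real k * h) \<omega>)))"
    using markov_Pt[OF kh h0, of ?E "J l" "D h k" 1, OF _ Egb D_filt[OF h0] D_bounds[OF h0]] by simp
  moreover have "(LINT \<omega>|N. D h k \<omega> * g (X (real k * h) \<omega>)) = (LINT \<omega>|N. D h k \<omega> * g (max 0 (X (real k * h) \<omega>)))"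
  proof (rule integral_cong_AE)
    show "AE \<omega> in N. D h k \<omega> * g (X (real k * h) \<omega>) = D h k \<omega> * g (max 0 (X (real k * h) \<omega>))"
      using X_nonneg by eventually_elim (simp add: max_absorb2 kh)
  qed measurable
  moreover have "\<bar>(LINT \<omega>|N. D h k \<omega> * Pt h ?E (max 0 (X (real k * h) \<omega>))) - (LINT \<omega>|N. D h k \<omega> * g (max 0 (X (real k * h) \<omega>)))\<bar> \<le> ?b"
  proof -
    have "continuous_on {0..} (Pt h ?E)"
      by (rule Pt_continuous[where B="J l"]) (use Egb h0 in \<open>auto simp: Eh_def intro!: continuous_intros g_cont\<close>)
    then have [measurable]: "(\<lambda>x. Pt h ?E (max 0 x)) \<in> borel_measurable borel"
      by (intro borel_measurable_continuous_onI continuous_on_max0)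
    have Pb: "0 \<le> Pt h ?E (max 0 x)" "Pt h ?E (max 0 x) \<le> J l" for x
      using Pt_bounds[of h "max 0 x" ?E 0 "J l"] Egb h0 by auto
    have "norm (D h k \<omega> * Pt h ?E (max 0 (X (real k * h) \<omega>))) \<le> J l" for \<omega>
      using mult_mono[OF D_bounds(2)[OF h0, of k \<omega>] Pb(2)[of "X (real k * h) \<omega>"]] D_bounds(1)[OF h0] Pb(1) by (simp add: abs_mult)
    then have i1: "integrable N (\<lambda>\<omega>. D h k \<omega> * Pt h ?E (max 0 (X (real k * h) \<omega>)))"
      by (intro N.integrable_const_bound[where B="J l"]) auto
    have "norm (D h k \<omega> * g (max 0 (X (real k * h) \<omega>))) \<le> J l" for \<omega>
      using mult_mono[OF D_bounds(2)[OF h0, of k \<omega>] g_le_J[of "max 0 (X (real k * h) \<omega>)"]] D_bounds(1)[OF h0]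
        order_trans[OF zero_le_one g_ge_1] by (simp add: abs_mult)
    then have i2: "integrable N (\<lambda>\<omega>. D h k \<omega> * g (max 0 (X (real k * h) \<omega>)))"
      by (intro N.integrable_const_bound[where B="J l"]) auto
    have "\<bar>(LINT \<omega>|N. D h k \<omega> * Pt h ?E (max 0 (X (real k * h) \<omega>)) - D h k \<omega> * g (max 0 (X (real k * h) \<omega>)))\<bar>
       \<le> (LINT \<omega>|N. \<bar>D h k \<omega> * Pt h ?E (max 0 (X (real k * h) \<omega>)) - D h k \<omega> * g (max 0 (X (real k * h) \<omega>))\<bar>)"
      by (rule integral_abs_bound)
    also have "\<dots> \<le> (LINT \<omega>|N. ?b)"
    proof (rule integral_mono)
      show "integrable N (\<lambda>\<omega>. \<bar>D h k \<omega> * Pt h ?E (max 0 (X (real k * h) \<omega>)) - D h k \<omega> * g (max 0 (X (real k * h) \<omega>))\<bar>)"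
        by (intro integrable_abs Bochner_Integration.integrable_diff i1 i2)
      fix \<omega>
      have s: "\<bar>Pt h ?E (max 0 (X (real k * h) \<omega>)) - g (max 0 (X (real k * h) \<omega>))\<bar> \<le> ?b"
        by (rule one_step[OF h]) (use e in auto)
      have "\<bar>D h k \<omega>\<bar> * \<bar>Pt h ?E (max 0 (X (real k * h) \<omega>)) - g (max 0 (X (real k * h) \<omega>))\<bar> \<le> 1 * ?b"
        using D_bounds[OF h0, of k \<omega>] s by (intro mult_mono) auto
      then show "\<bar>D h k \<omega> * Pt h ?E (max 0 (X (real k * h) \<omega>)) - D h k \<omega> * g (max 0 (X (real k * h) \<omega>))\<bar> \<le> ?b"
        by (simp add: right_diff_distrib[symmetric] abs_mult)
    qed simp
    finally show ?thesis using i1 i2 by (simp add: N.prob_space)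
  qed
  ultimately show ?thesis by simp
qed

lemma D_total:
  assumes h: "0 < h" and e: "\<And>s x. 0 \<le> s \<Longrightarrow> s \<le> h \<Longrightarrow> 0 \<le> x \<Longrightarrow> \<bar>Pt s psi x - psi x\<bar> \<le> e"
  shows "\<bar>(LINT \<omega>|N. D h k \<omega> * g (X (real k * h) \<omega>)) - 1\<bar> \<le> real k * (h * (2 * e) + (l * h)\<^sup>2 * J l)"
proof (induction k)
  case 0
  have "(LINT \<omega>|N. D h 0 \<omega> * g (X (real 0 * h) \<omega>)) = (LINT \<omega>|N. 1)"
  proof (rule integral_cong_AE)
    show "(\<lambda>\<omega>. D h 0 \<omega> * g (X (real 0 * h) \<omega>)) \<in> borel_measurable N"
      using X_measurable[of 0] by (simp add: D_def)
  qed (use X_0 in \<open>auto elim!: eventually_mono simp: D_def g_def\<close>)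
  then show ?case by (simp add: N.prob_space)
next
  case (Suc k)
  have "real (Suc k) * (h * (2 * e) + (l * h)\<^sup>2 * J l) = real k * (h * (2 * e) + (l * h)\<^sup>2 * J l) + (h * (2 * e) + (l * h)\<^sup>2 * J l)"
    by (simp add: algebra_simps)
  then show ?case using Suc.IH D_step[OF h e, of k] by linarith
qed

definition A :: "real \<Rightarrow> 'b \<Rightarrow> real" where
  "A t \<omega> = (LINT s|lborel. indicator {0<..t} s * exp (- X (max 0 s) \<omega>))"

lemma A_measurable[measurable]: "A t \<in> borel_measurable N"
proof -
  have "(\<lambda>(s, \<omega>). X (max 0 s) \<omega>) \<in> borel_measurable (lborel \<Otimes>\<^sub>M N)"
    using X_pair_measurable by (simp cong: measurable_cong_sets sets_pair_measure_cong)
  then have [measurable]: "(\<lambda>(\<omega>, s). X (max 0 s) \<omega>) \<in> borel_measurable (N \<Otimes>\<^sub>M lborel)"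
    by (subst measurable_pair_swap_iff) (simp add: case_prod_beta')
  show ?thesis unfolding A_def[abs_def] by measurable
qed

lemma path_measurable:
  assumes \<omega>: "\<omega> \<in> space N"
  shows "(\<lambda>s. exp (- X (max 0 s) \<omega>)) \<in> borel_measurable borel"
proof -
  have "(\<lambda>s. X (max 0 s) \<omega>) \<in> borel_measurable borel"
    using measurable_Pair1[OF X_pair_measurable \<omega>] by simp
  then show ?thesis by measurable
qed

lemma D_tendsto:
  assumes t: "0 < t" and \<omega>: "\<omega> \<in> space N" "\<forall>t\<ge>0. 0 \<le> X t \<omega>"
  shows "(\<lambda>k. D (t / real (Suc k)) (Suc k) \<omega>) \<longlonglongrightarrow> exp (- (l * A t \<omega>))"
proof -
  have "(\<lambda>k. \<Sum>j<Suc k. t / Suc k * exp (- X (Suc j * (t / Suc k)) \<omega>)) \<longlonglongrightarrow> A t \<omega>"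
    unfolding A_def
  proof (rule riemann_sum_right[OF t, where B=1])
    show "((\<lambda>s. exp (- X s \<omega>)) \<longlongrightarrow> exp (- X s \<omega>)) (at_right s)" if "0 \<le> s" for s
      using cadlag_right_tendsto[OF X_cadlag[OF \<omega>(1)] that] by (intro tendsto_intros)
  qed (use path_measurable \<omega> in auto)
  then have "(\<lambda>k. exp (- (l * (\<Sum>j<Suc k. t / Suc k * exp (- X (Suc j * (t / Suc k)) \<omega>))))) \<longlonglongrightarrow> exp (- (l * A t \<omega>))"
    by (intro tendsto_intros)
  moreover have "exp (- (l * (\<Sum>j<Suc k. t / Suc k * exp (- X (Suc j * (t / Suc k)) \<omega>)))) = D (t / real (Suc k)) (Suc k) \<omega>" for k
    unfolding D_def Eh_def sum_distrib_left sum_negf[symmetric] exp_sum[OF finite_lessThan] by (simp add: mult.assoc)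
  ultimately show ?thesis by simp
qed

text \<open>Along meshes \<open>t / n\<close> the discretised expectations tend to 1, since
  \<open>n\<close> one-step errors of order \<open>o(1 / n)\<close> vanish in total; by Riemann sums
  the discount converges pathwise to the exponential of the time integral.\<close>

lemma martingale:
  assumes t: "0 < t"
  shows "(LINT \<omega>|N. exp (- (l * A t \<omega>)) * g (X t \<omega>)) = 1"
proof -
  define h where "h = (\<lambda>k. t / real (Suc k))"
  have h: "0 < h k" for k using t by (simp add: h_def)
  have hk: "real (Suc k) * h k = t" for k by (simp add: h_def)
  define a where "a = (\<lambda>k. LINT \<omega>|N. D (h k) (Suc k) \<omega> * g (X t \<omega>))"
  have t0: "0 \<le> t" using t by simp
  note [measurable] = X_measurable[OF t0]
  have "a \<longlonglongrightarrow> (LINT \<omega>|N. exp (- (l * A t \<omega>)) * g (X t \<omega>))"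
    unfolding a_def
  proof (rule integral_dominated_convergence[where w="\<lambda>_. J l"])
    show "(\<lambda>\<omega>. D (h k) (Suc k) \<omega> * g (X t \<omega>)) \<in> borel_measurable N" for k
      using D_measurable[of "h k" "Suc k"] h[of k] by simp
    show "AE \<omega> in N. (\<lambda>k. D (h k) (Suc k) \<omega> * g (X t \<omega>)) \<longlonglongrightarrow> exp (- (l * A t \<omega>)) * g (X t \<omega>)"
      using X_nonneg AE_space by eventually_elim (unfold h_def, intro tendsto_intros D_tendsto t)
    show "AE \<omega> in N. norm (D (h k) (Suc k) \<omega> * g (X t \<omega>)) \<le> J l" for k
    proof (rule AE_I2)
      fix \<omega>
      have "D (h k) (Suc k) \<omega> * g (X t \<omega>) \<le> 1 * J l"
        using D_bounds[of "h k" "Suc k" \<omega>] h[of k] g_ge_1[of "X t \<omega>"] g_le_J by (intro mult_mono) auto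
      moreover have "0 \<le> D (h k) (Suc k) \<omega> * g (X t \<omega>)"
        using D_bounds[of "h k" "Suc k" \<omega>] h[of k] g_ge_1[of "X t \<omega>"] by (intro mult_nonneg_nonneg) auto
      ultimately show "norm (D (h k) (Suc k) \<omega> * g (X t \<omega>)) \<le> J l" by simp
    qed
  qed simp_all
  moreover have "a \<longlonglongrightarrow> 1"
  proof (rule LIMSEQ_I)
    fix r :: real assume r: "0 < r"
    \<comment> \<open>The first-order errors \<open>h * (2 * e)\<close> over steps of total length
      \<open>t\<close> add up to \<open>2 * t * e = r / 2\<close>.\<close>
    define e where "e = r / (4 * t)"
    have e: "0 < e" using r t by (simp add: e_def)
    obtain d where d: "d > 0" "\<And>s x. 0 \<le> s \<Longrightarrow> s < d \<Longrightarrow> 0 \<le> x \<Longrightarrow> \<bar>Pt s psi x - psi x\<bar> < e"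
      using C0_Pt_uniform[OF psi_C0 e] by blast
    have h0: "h \<longlonglongrightarrow> 0" unfolding h_def by real_asymp
    then have "(\<lambda>k. t * l\<^sup>2 * J l * h k) \<longlonglongrightarrow> t * l\<^sup>2 * J l * 0" by (intro tendsto_intros)
    then have "eventually (\<lambda>k. t * l\<^sup>2 * J l * h k < r / 2) sequentially"
      using r by (intro order_tendstoD(2)) auto
    moreover have "eventually (\<lambda>k. h k < d) sequentially" using h0 d(1) by (rule order_tendstoD(2))
    ultimately have "eventually (\<lambda>k. norm (a k - 1) < r) sequentially"
    proof eventually_elim
      case (elim k)
      have "\<bar>a k - 1\<bar> \<le> real (Suc k) * (h k * (2 * e) + (l * h k)\<^sup>2 * J l)"
        using D_total[OF h[of k], of e "Suc k"] d(2) elim(2) unfolding a_def hk by fastforce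
      also have "\<dots> = (real (Suc k) * h k) * (2 * e) + (real (Suc k) * h k) * l\<^sup>2 * J l * h k"
        by (simp add: algebra_simps power2_eq_square)
      also have "\<dots> = r / 2 + t * l\<^sup>2 * J l * h k" unfolding hk using t by (simp add: e_def)
      also have "\<dots> < r" using elim(1) by simp
      finally show ?case by simp
    qed
    then show "\<exists>no. \<forall>n\<ge>no. norm (a n - 1) < r" by (simp add: eventually_sequentially)
  qed
  ultimately show ?thesis by (rule LIMSEQ_unique)
qed

lemma expectation_g: "(LINT \<omega>|N. g (X (real n) \<omega>)) = Pt (real n) g 0"
proof -
  have "(LINT \<omega>|N. 1 * g (X (0 + real n) \<omega>)) = (LINT \<omega>|N. 1 * Pt (real n) g (max 0 (X 0 \<omega>)))"
    by (rule markov_Pt[where B="J l" and C=1]) (use g_ge_1 g_le_J in \<open>auto intro: order_trans[OF zero_le_one]\<close>)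
  also have "\<dots> = (LINT \<omega>|N. Pt (real n) g 0)"
  proof (rule integral_cong_AE)
    have "continuous_on {0..} (Pt (real n) g)"
      by (rule Pt_continuous[OF g_cont, of "J l"]) (use g_ge_1 g_le_J in \<open>auto simp: abs_of_nonneg order_trans[OF zero_le_one]\<close>)
    then have "(\<lambda>x. Pt (real n) g (max 0 x)) \<in> borel_measurable borel"
      by (intro borel_measurable_continuous_onI continuous_on_max0)
    then show "(\<lambda>\<omega>. 1 * Pt (real n) g (max 0 (X 0 \<omega>))) \<in> borel_measurable N"
      using measurable_compose[OF X_measurable[of 0]] by simp
  qed (use X_0 in \<open>auto elim!: eventually_mono\<close>)
  finally show ?thesis by (simp add: N.prob_space)
qed

text \<open>The value 0 at infinity makes this the limit of \<open>exp (- (l * A n))\<close> also on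
  paths with infinite functional, so finiteness of the functional need not be settled
  beforehand.\<close>

definition eexp :: "ennreal \<Rightarrow> real" where
  "eexp a = (if a = \<top> then 0 else exp (- (l * enn2real a)))"

lemma A_nonneg: "0 \<le> A t \<omega>"
  unfolding A_def by (rule integral_nonneg_AE) auto

lemma A_tendsto:
  assumes \<omega>: "\<omega> \<in> space N" "\<forall>t\<ge>0. 0 \<le> X t \<omega>"
  shows "(\<lambda>n. exp (- (l * A (real n) \<omega>))) \<longlonglongrightarrow> eexp (exponential_functional (\<lambda>t. X t \<omega>))"
proof -
  let ?f = "\<lambda>s. exp (- X (max 0 s) \<omega>)"
  have m: "?f \<in> borel_measurable borel" by (rule path_measurable[OF \<omega>(1)])
  note [measurable] = m
  have AA: "ennreal (A (real n) \<omega>) = (\<integral>\<^sup>+s. ennreal (?f s) * indicator {0<..} s * indicator {..real n} s \<partial>lborel)" for n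
  proof -
    have "integrable lborel (\<lambda>s. indicator {0<..real n} s * ?f s)"
    proof (rule Bochner_Integration.integrable_bound[of lborel "indicator {0<..real n} :: real \<Rightarrow> real"])
      show "AE s in lborel. norm (indicator {0<..real n} s * ?f s) \<le> norm (indicator {0<..real n} s :: real)"
        using \<omega>(2) by (intro AE_I2) (auto simp: indicator_def)
    qed auto
    then have "ennreal (A (real n) \<omega>) = (\<integral>\<^sup>+s. ennreal (indicator {0<..real n} s * ?f s) \<partial>lborel)"
      unfolding A_def by (intro nn_integral_eq_integral[symmetric]) auto
    also have "\<dots> = (\<integral>\<^sup>+s. ennreal (?f s) * indicator {0<..} s * indicator {..real n} s \<partial>lborel)"
      by (intro nn_integral_cong) (auto simp: indicator_def)
    finally show ?thesis .
  qed
  have "(\<lambda>n. \<integral>\<^sup>+s. ennreal (?f s) * indicator {0<..} s * indicator {..real n} s \<partial>lborel) \<longlonglongrightarrow> (\<integral>\<^sup>+s. ennreal (?f s) * indicator {0<..} s \<partial>lborel)"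
  proof (rule nn_integral_LIMSEQ)
    show "incseq (\<lambda>n s. ennreal (?f s) * indicator {0<..} s * indicator {..real n} s)"
      unfolding incseq_def le_fun_def by (auto simp: indicator_def)
    show "(\<lambda>n. ennreal (?f s) * indicator {0<..} s * indicator {..real n} s) \<longlonglongrightarrow> ennreal (?f s) * indicator {0<..} s" for s
    proof (rule tendsto_eventually)
      obtain K where "s < real K" using reals_Archimedean2 by blast
      then show "eventually (\<lambda>n. ennreal (?f s) * indicator {0<..} s * indicator {..real n} s = ennreal (?f s) * indicator {0<..} s) sequentially"
        unfolding eventually_sequentially by (intro exI[of _ K]) (auto simp: indicator_def)
    qed
  qed measurable
  moreover have "(\<integral>\<^sup>+s. ennreal (?f s) * indicator {0<..} s \<partial>lborel) = exponential_functional (\<lambda>t. X t \<omega>)"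
    unfolding exponential_functional_def
    by (rule nn_integral_cong_AE) (use AE_lborel_singleton[of 0] in \<open>auto elim!: eventually_mono simp: indicator_def max_absorb2\<close>)
  ultimately have lim: "(\<lambda>n. ennreal (A (real n) \<omega>)) \<longlonglongrightarrow> exponential_functional (\<lambda>t. X t \<omega>)" by (simp add: AA)
  show ?thesis
  proof (cases "exponential_functional (\<lambda>t. X t \<omega>) = \<top>")
    case True
    have "filterlim (\<lambda>n. A (real n) \<omega>) at_top sequentially"
      unfolding filterlim_at_top_dense
    proof
      fix z :: real
      have "eventually (\<lambda>n. ennreal z < ennreal (A (real n) \<omega>)) sequentially"
        using lim True by (intro order_tendstoD(1)) auto
      then show "eventually (\<lambda>n. z < A (real n) \<omega>) sequentially"
        by eventually_elim (meson ennreal_leI not_le)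
    qed
    then have "filterlim (\<lambda>n. l * A (real n) \<omega>) at_top sequentially"
      using l_pos by (intro filterlim_tendsto_pos_mult_at_top[OF tendsto_const]) auto
    then have "(\<lambda>n. exp (- (l * A (real n) \<omega>))) \<longlonglongrightarrow> 0"
      by (intro filterlim_compose[OF exp_at_bot] filterlim_uminus_at_bot_at_top filterlim_compose[OF filterlim_uminus_at_bot_at_top])
    then show ?thesis using True by (simp add: eexp_def)
  next
    case False
    then obtain r where r: "exponential_functional (\<lambda>t. X t \<omega>) = ennreal r" "0 \<le> r" by (cases "exponential_functional (\<lambda>t. X t \<omega>)") auto
    have "(\<lambda>n. A (real n) \<omega>) \<longlonglongrightarrow> r"
      using lim r A_nonneg by (simp add: tendsto_ennreal_iff)
    then show ?thesis using r by (simp add: eexp_def) (intro tendsto_intros)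
  qed
qed

lemma functional_measurable: "(\<lambda>\<omega>. exponential_functional (\<lambda>t. X t \<omega>)) \<in> borel_measurable N"
proof -
  have "(\<lambda>(s, \<omega>). X (max 0 s) \<omega>) \<in> borel_measurable (lborel \<Otimes>\<^sub>M N)"
    using X_pair_measurable by (simp cong: measurable_cong_sets sets_pair_measure_cong)
  then have [measurable]: "(\<lambda>(\<omega>, s). X (max 0 s) \<omega>) \<in> borel_measurable (N \<Otimes>\<^sub>M lborel)"
    by (subst measurable_pair_swap_iff) (simp add: case_prod_beta')
  have "(\<lambda>\<omega>. \<integral>\<^sup>+s\<in>{0..}. ennreal (exp (- X (max 0 s) \<omega>)) \<partial>lborel) \<in> borel_measurable N" by measurable
  also have "(\<lambda>\<omega>. \<integral>\<^sup>+s\<in>{0..}. ennreal (exp (- X (max 0 s) \<omega>)) \<partial>lborel) = (\<lambda>\<omega>. exponential_functional (\<lambda>t. X t \<omega>))"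
    unfolding exponential_functional_def by (intro ext nn_integral_cong) (auto simp: indicator_def max_absorb2)
  finally show ?thesis .
qed

text \<open>Replacing \<open>g (X n)\<close> by its upper bound \<open>J l\<close> in the martingale
  identity raises the expectation by at most \<open>J l\<close> minus the mean of
  \<open>g (X n)\<close>, because the discount is at most 1. This error tends to 0 by
  \<open>Pt_g_tendsto\<close>.\<close>

theorem functional_laplace: "(LINT \<omega>|N. eexp (exponential_functional (\<lambda>t. X t \<omega>))) = 1 / J l"
proof -
  note [measurable] = functional_measurable
  define b where "b = (\<lambda>n. LINT \<omega>|N. exp (- (l * A (real n) \<omega>)))"
  have em[measurable]: "eexp \<in> borel_measurable borel" unfolding eexp_def[abs_def] by measurable
  have e01: "exp (- (l * A t \<omega>)) \<le> 1" for t \<omega> using l_pos A_nonneg[of t \<omega>] by simp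
  have bl: "b \<longlonglongrightarrow> (LINT \<omega>|N. eexp (exponential_functional (\<lambda>t. X t \<omega>)))"
    unfolding b_def
  proof (rule integral_dominated_convergence[where w="\<lambda>_. 1"])
    show "AE \<omega> in N. (\<lambda>n. exp (- (l * A (real n) \<omega>))) \<longlonglongrightarrow> eexp (exponential_functional (\<lambda>t. X t \<omega>))"
      using X_nonneg AE_space by eventually_elim (rule A_tendsto)
  qed (use e01 in auto)
  have bi: "integrable N (\<lambda>\<omega>. exp (- (l * A t \<omega>)))" for t
    by (rule N.integrable_const_bound[where B=1]) (use e01 in auto)
  have bounds: "1 \<le> J l * b n" "J l * b n - 1 \<le> J l - Pt (real n) g 0" if n: "0 < n" for n
  proof -
    note [measurable] = X_measurable[of "real n", OF of_nat_0_le_iff]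
    have gi: "integrable N (\<lambda>\<omega>. g (X (real n) \<omega>))"
      by (rule N.integrable_const_bound[where B="J l"]) (use g_ge_1 g_le_J in \<open>auto simp: abs_of_nonneg order_trans[OF zero_le_one]\<close>)
    have "norm (exp (- (l * A (real n) \<omega>)) * g (X (real n) \<omega>)) \<le> J l" for \<omega>
      using mult_mono[OF e01[of "real n" \<omega>] g_le_J[of "X (real n) \<omega>"]] g_ge_1[of "X (real n) \<omega>"] by (simp add: abs_mult)
    then have mi: "integrable N (\<lambda>\<omega>. exp (- (l * A (real n) \<omega>)) * g (X (real n) \<omega>))"
      by (intro N.integrable_const_bound[where B="J l"]) auto
    have m: "(LINT \<omega>|N. exp (- (l * A (real n) \<omega>)) * g (X (real n) \<omega>)) = 1" by (rule martingale) (use n in simp)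
    have "(LINT \<omega>|N. exp (- (l * A (real n) \<omega>)) * g (X (real n) \<omega>)) \<le> (LINT \<omega>|N. J l * exp (- (l * A (real n) \<omega>)))"
      by (intro integral_mono mi integrable_mult_right bi) (use g_le_J in \<open>auto simp: mult.commute intro!: mult_right_mono\<close>)
    then show "1 \<le> J l * b n" by (simp add: m b_def)
    have "J l * b n - 1 = (LINT \<omega>|N. J l * exp (- (l * A (real n) \<omega>)) - exp (- (l * A (real n) \<omega>)) * g (X (real n) \<omega>))"
      using mi bi[of "real n"] by (simp add: m b_def)
    also have "\<dots> \<le> (LINT \<omega>|N. J l - g (X (real n) \<omega>))"
    proof (intro integral_mono Bochner_Integration.integrable_diff integrable_mult_right bi mi gi N.integrable_const)
      fix \<omega>
      have "exp (- (l * A (real n) \<omega>)) * (J l - g (X (real n) \<omega>)) \<le> 1 * (J l - g (X (real n) \<omega>))"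
        using e01 g_le_J by (intro mult_right_mono) auto
      then show "J l * exp (- (l * A (real n) \<omega>)) - exp (- (l * A (real n) \<omega>)) * g (X (real n) \<omega>) \<le> J l - g (X (real n) \<omega>)"
        by (simp add: algebra_simps)
    qed
    also have "\<dots> = J l - Pt (real n) g 0" using gi by (simp add: N.prob_space expectation_g)
    finally show "J l * b n - 1 \<le> J l - Pt (real n) g 0" .
  qed
  have "(\<lambda>n. J l * b n) \<longlonglongrightarrow> 1"
  proof (rule tendsto_sandwich)
    show "eventually (\<lambda>n. 1 \<le> J l * b n) sequentially"
      using eventually_gt_at_top[of 0] by eventually_elim (rule bounds(1))
    show "eventually (\<lambda>n. J l * b n \<le> 1 + (J l - Pt (real n) g 0)) sequentially"
      using eventually_gt_at_top[of 0] by eventually_elim (drule bounds(2), linarith)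
    have "(\<lambda>n. 1 + (J l - Pt (real n) g 0)) \<longlonglongrightarrow> 1 + (J l - J l)" by (intro tendsto_intros Pt_g_tendsto)
    then show "(\<lambda>n. 1 + (J l - Pt (real n) g 0)) \<longlonglongrightarrow> 1" by simp
  qed simp
  moreover have "(\<lambda>n. J l * b n) \<longlonglongrightarrow> J l * (LINT \<omega>|N. eexp (exponential_functional (\<lambda>t. X t \<omega>)))"
    by (intro tendsto_intros bl)
  ultimately have "J l * (LINT \<omega>|N. eexp (exponential_functional (\<lambda>t. X t \<omega>))) = 1" by (rule LIMSEQ_unique[symmetric])
  then show ?thesis using J_ge by (simp add: field_simps)
qed

end

section \<open>The exponent at its largest root\<close>

lemma scale_function_nn:
  assumes scale: "scale_function \<Psi> \<kappa> W" and q: "\<kappa> < q"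
  shows "(\<integral>\<^sup>+x\<in>{0..}. ennreal (exp (- q * x)) * ennreal (W x) \<partial>lborel) = ennreal (1 / \<Psi> q)" and "0 \<le> \<Psi> q"
proof -
  have W: "0 \<le> W x" if "0 \<le> x" for x using scale that by (simp add: scale_function_def)
  have int: "set_integrable lborel {0..} (\<lambda>x. exp (- q * x) * W x)"
    and eq: "(LBINT x:{0..}. exp (- q * x) * W x) = 1 / \<Psi> q"
    using scale q by (auto simp: scale_function_def)
  have nn: "0 \<le> indicator {0..} x *\<^sub>R (exp (- q * x) * W x)" for x
    using W[of x] by (simp add: indicator_def)
  have "(\<integral>\<^sup>+x\<in>{0..}. ennreal (exp (- q * x)) * ennreal (W x) \<partial>lborel) = (\<integral>\<^sup>+x. ennreal (indicator {0..} x *\<^sub>R (exp (- q * x) * W x)) \<partial>lborel)"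
    by (intro nn_integral_cong) (auto simp: indicator_def W ennreal_mult)
  also have "\<dots> = ennreal (1 / \<Psi> q)"
    unfolding eq[symmetric] set_lebesgue_integral_def using int unfolding set_integrable_def
    by (intro nn_integral_eq_integral) (use nn in auto)
  finally show "(\<integral>\<^sup>+x\<in>{0..}. ennreal (exp (- q * x)) * ennreal (W x) \<partial>lborel) = ennreal (1 / \<Psi> q)" .
  have "0 \<le> (LBINT x:{0..}. exp (- q * x) * W x)"
    unfolding set_lebesgue_integral_def using nn by (intro integral_nonneg_AE AE_I2)
  then show "0 \<le> \<Psi> q" unfolding eq by (simp add: zero_le_divide_iff)
qed

text \<open>A zero of \<open>\<Psi>\<close> beyond \<open>\<kappa>\<close> would, with
  \<open>1 / 0 = 0\<close>, make \<open>W\<close> vanish almost everywhere and hence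
  \<open>\<Psi>\<close> vanish on all of that half-line. The ratio in regular variation with
  \<open>t = 1\<close> would then be constantly \<open>0 / 0 = 0\<close> instead of tending to
  1.\<close>

lemma scale_function_exponent_pos:
  assumes scale: "scale_function \<Psi> \<kappa> W" and rv: "regularly_varying \<alpha> \<Psi>" and q: "\<kappa> < q"
  shows "0 < \<Psi> q"
proof (rule ccontr)
  assume "\<not> 0 < \<Psi> q"
  then have z: "\<Psi> q = 0" using scale_function_nn(2)[OF scale q] by simp
  have int: "set_integrable lborel {0..} (\<lambda>x. exp (- p * x) * W x)" if "\<kappa> < p" for p
    using scale that by (auto simp: scale_function_def)
  have m: "(\<lambda>x. ennreal (exp (- p * x)) * ennreal (W x) * indicator {0..} x) \<in> borel_measurable lborel" if "\<kappa> < p" for p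
  proof -
    have "(\<lambda>x. ennreal (indicator {0..} x *\<^sub>R (exp (- p * x) * W x))) \<in> borel_measurable lborel"
      using int[OF that] unfolding set_integrable_def by measurable
    also have "(\<lambda>x. ennreal (indicator {0..} x *\<^sub>R (exp (- p * x) * W x))) = (\<lambda>x. ennreal (exp (- p * x)) * ennreal (W x) * indicator {0..} x)"
      using scale by (auto simp: fun_eq_iff indicator_def ennreal_mult scale_function_def)
    finally show ?thesis .
  qed
  have "AE x in lborel. ennreal (exp (- q * x)) * ennreal (W x) * indicator {0..} x = 0"
    using scale_function_nn(1)[OF scale q] z nn_integral_0_iff_AE[OF m[OF q]] by simp
  then have ae: "AE x in lborel. ennreal (W x) * indicator {0..} x = 0"
    by (auto elim!: eventually_mono simp: mult.assoc)
  have "\<Psi> p = 0" if p: "\<kappa> < p" for p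
  proof -
    have "(\<integral>\<^sup>+x\<in>{0..}. ennreal (exp (- p * x)) * ennreal (W x) \<partial>lborel) = 0"
      by (subst nn_integral_0_iff_AE[OF m[OF p]]) (use ae in \<open>auto elim!: eventually_mono simp: mult.assoc\<close>)
    then show ?thesis using scale_function_nn[OF scale p] by (simp add: ennreal_eq_0_iff)
  qed
  then have zero: "\<And>p. \<kappa> < p \<Longrightarrow> \<Psi> p = 0" .
  have "eventually (\<lambda>l. \<Psi> (1 * l) / \<Psi> l = 0) at_top"
    using eventually_gt_at_top[of \<kappa>] by eventually_elim (simp add: zero)
  then have "((\<lambda>l. \<Psi> (1 * l) / \<Psi> l) \<longlongrightarrow> 0) at_top" by (rule tendsto_eventually)
  moreover have "((\<lambda>l. \<Psi> (1 * l) / \<Psi> l) \<longlongrightarrow> 1 powr \<alpha>) at_top" using rv zero_less_one unfolding regularly_varying_def by blast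
  ultimately have "0 = 1 powr \<alpha>" by (intro tendsto_unique[OF trivial_limit_at_top_linorder])
  then show False by simp
qed

text \<open>For large \<open>l\<close>, \<open>t * l + k\<close> is bounded below by
  \<open>s * (l + k)\<close> with \<open>s\<close> just below \<open>t\<close>, and above with
  \<open>s\<close> just above \<open>t\<close>. Monotonicity transfers the limits
  \<open>s powr \<alpha>\<close>, which are continuous in \<open>s\<close>.\<close>

lemma regularly_varying_shift:
  assumes rv: "regularly_varying \<alpha> f" and pos: "\<And>q. k < q \<Longrightarrow> 0 < f q"
    and mono: "\<And>p q. k \<le> p \<Longrightarrow> p \<le> q \<Longrightarrow> f p \<le> f q" and \<alpha>: "0 \<le> \<alpha>"
  shows "regularly_varying \<alpha> (\<lambda>q. f (q + k))"
  unfolding regularly_varying_def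
proof (intro allI impI)
  fix t :: real assume t: "0 < t"
  have shift: "filterlim (\<lambda>l. l + k) at_top at_top" by real_asymp
  have lim: "((\<lambda>l. f (s * (l + k)) / f (l + k)) \<longlongrightarrow> s powr \<alpha>) at_top" if "0 < s" for s
    using filterlim_compose[OF _ shift, of "\<lambda>l. f (s * l) / f l"] rv that unfolding regularly_varying_def by blast
  have ppos: "eventually (\<lambda>l. 0 < f (l + k)) at_top"
    using eventually_gt_at_top[of 0] by eventually_elim (simp add: pos)
  have cont: "((\<lambda>s. s powr \<alpha>) \<longlongrightarrow> t powr \<alpha>) (at t)" using t by (intro tendsto_intros) auto
  show "((\<lambda>l. f (t * l + k) / f (l + k)) \<longlongrightarrow> t powr \<alpha>) at_top"
  proof (rule order_tendstoI)
    fix a assume a: "a < t powr \<alpha>"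
    have "eventually (\<lambda>s. a < s powr \<alpha>) (at_left t)" by (rule order_tendstoD(1)[OF filterlim_mono[OF cont order_refl at_le] a]) simp
    moreover have "eventually (\<lambda>s. 0 < s) (at_left t)" using t by (intro order_tendstoD(1)[OF tendsto_ident_at])
    moreover have "eventually (\<lambda>s. s < t) (at_left t)" by (simp add: eventually_at_filter)
    ultimately have "eventually (\<lambda>s. a < s powr \<alpha> \<and> 0 < s \<and> s < t) (at_left t)" by (intro eventually_conj)
    then obtain s where s: "a < s powr \<alpha>" "0 < s" "s < t"
      using eventually_happens'[OF trivial_limit_at_left_real] by blast
    have "eventually (\<lambda>l. a < f (s * (l + k)) / f (l + k)) at_top" by (rule order_tendstoD(1)[OF lim[OF s(2)] s(1)])
    moreover have "eventually (\<lambda>l. s * (l + k) \<le> t * l + k) at_top" using s by real_asymp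
    moreover have "eventually (\<lambda>l. k \<le> s * (l + k)) at_top" using s by real_asymp
    ultimately show "eventually (\<lambda>l. a < f (t * l + k) / f (l + k)) at_top"
      using ppos
    proof eventually_elim
      case (elim l)
      have "f (s * (l + k)) / f (l + k) \<le> f (t * l + k) / f (l + k)"
        using elim by (intro divide_right_mono mono) auto
      then show ?case using elim by linarith
    qed
  next
    fix a assume a: "t powr \<alpha> < a"
    have "eventually (\<lambda>s. s powr \<alpha> < a) (at_right t)" by (rule order_tendstoD(2)[OF filterlim_mono[OF cont order_refl at_le] a]) simp
    moreover have "eventually (\<lambda>s. t < s) (at_right t)" by (simp add: eventually_at_filter)
    ultimately have "eventually (\<lambda>s. s powr \<alpha> < a \<and> t < s) (at_right t)" by (intro eventually_conj)
    then obtain s where s: "s powr \<alpha> < a" "t < s"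
      using eventually_happens'[OF trivial_limit_at_right_real] by blast
    have s0: "0 < s" using s t by simp
    have "eventually (\<lambda>l. f (s * (l + k)) / f (l + k) < a) at_top" by (rule order_tendstoD(2)[OF lim[OF s0] s(1)])
    moreover have "eventually (\<lambda>l. t * l + k \<le> s * (l + k)) at_top" using s t by real_asymp
    moreover have "eventually (\<lambda>l. k \<le> t * l + k) at_top" using t by real_asymp
    ultimately show "eventually (\<lambda>l. f (t * l + k) / f (l + k) < a) at_top"
      using ppos
    proof eventually_elim
      case (elim l)
      have "f (t * l + k) / f (l + k) \<le> f (s * (l + k)) / f (l + k)"
        using elim by (intro divide_right_mono mono) auto
      then show ?case using elim by linarith
    qed
  qed
qed

context spectrally_negative
begin

text \<open>In the drifting case \<open>not_drifting\<close> provides \<open>q > 0\<close> with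
  \<open>\<Psi> q \<le> 0\<close>, and the intermediate value theorem a root at or beyond it. Since
  \<open>\<Psi>\<close> is positive past \<open>\<kappa>\<close>, that root is
  \<open>\<kappa>\<close>, so the infimum is attained.\<close>

lemma kappa_root:
  assumes k: "\<kappa> = kappa M V \<Psi>" and pos: "\<And>q. \<kappa> < q \<Longrightarrow> 0 < \<Psi> q"
  shows "0 \<le> \<kappa>" "\<Psi> \<kappa> = 0"
proof -
  have "0 \<le> \<kappa> \<and> \<Psi> \<kappa> = 0"
  proof (cases "drifts_to_minus_infinity M V")
    case False
    then show ?thesis using k by (simp add: kappa_def Psi_0)
  next
    case True
    define S where "S = {q. 0 < q \<and> \<Psi> q = 0}"
    have kS: "\<kappa> = Inf S" using True k by (simp add: kappa_def S_def)
    obtain q where q: "0 < q" "\<Psi> q \<le> 0" using not_drifting True by (meson not_le)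
    define r where "r = max q \<kappa> + 1"
    have r: "q < r" "0 < \<Psi> r" using pos[of r] by (auto simp: r_def)
    have "continuous_on {0<..} \<Psi>"
      by (rule convex_on_continuous) (auto intro: convex_on_subset[OF Psi_convex])
    then have "continuous_on {q..r} \<Psi>" by (rule continuous_on_subset) (use q in auto)
    then obtain z where z: "q \<le> z" "z \<le> r" "\<Psi> z = 0"
      using IVT'[of \<Psi> q 0 r] q r by auto
    have zS: "z \<in> S" using z q by (simp add: S_def)
    have "\<kappa> \<le> z" unfolding kS by (rule cInf_lower[OF zS]) (auto simp: S_def intro!: bdd_belowI[of _ 0])
    moreover have "z \<le> \<kappa>" using pos[of z] z(3) by (cases "\<kappa> < z") auto
    ultimately show ?thesis using z q by simp
  qed
  then show "0 \<le> \<kappa>" "\<Psi> \<kappa> = 0" by auto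
qed

lemma shifted_exponent_convex_rv:
  assumes k: "0 \<le> \<kappa>" "\<Psi> \<kappa> = 0" and pos: "\<And>q. \<kappa> < q \<Longrightarrow> 0 < \<Psi> q"
    and rv: "regularly_varying \<alpha> \<Psi>" and \<alpha>: "1 < \<alpha>"
  shows "convex_rv (\<lambda>q. \<Psi> (q + \<kappa>)) \<alpha>"
proof
  show convex: "convex_on {0..} (\<lambda>q. \<Psi> (q + \<kappa>))"
  proof (rule convex_onI)
    fix t x y :: real assume t: "0 < t" "t < 1" and xy: "x \<in> {0..}" "y \<in> {0..}"
    have "\<Psi> ((1 - t) *\<^sub>R (x + \<kappa>) + t *\<^sub>R (y + \<kappa>)) \<le> (1 - t) * \<Psi> (x + \<kappa>) + t * \<Psi> (y + \<kappa>)"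
      using t xy k by (intro convex_onD[OF Psi_convex]) auto
    moreover have "(1 - t) *\<^sub>R (x + \<kappa>) + t *\<^sub>R (y + \<kappa>) = (1 - t) *\<^sub>R x + t *\<^sub>R y + \<kappa>" by (simp add: algebra_simps)
    ultimately show "\<Psi> ((1 - t) *\<^sub>R x + t *\<^sub>R y + \<kappa>) \<le> (1 - t) * \<Psi> (x + \<kappa>) + t * \<Psi> (y + \<kappa>)" by simp
  qed simp
  show "\<Psi> (0 + \<kappa>) = 0" using k by simp
  show "0 < \<Psi> (x + \<kappa>)" if "0 < x" for x using pos that by simp
  have mono: "\<Psi> p \<le> \<Psi> q" if "\<kappa> \<le> p" "p \<le> q" for p q
  proof (cases "p = q \<or> p = \<kappa>")
    case True
    then show ?thesis using k pos[of q] that by fastforce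
  next
    case False
    define s where "s = (p - \<kappa>) / (q - \<kappa>)"
    have s: "0 \<le> s" "s \<le> 1" using that False by (auto simp: s_def)
    have e: "(1 - s) *\<^sub>R \<kappa> + s *\<^sub>R q = p"
    proof -
      have "s * (q - \<kappa>) = p - \<kappa>" using False that by (simp add: s_def)
      then show ?thesis by (simp add: algebra_simps)
    qed
    have "\<Psi> ((1 - s) *\<^sub>R \<kappa> + s *\<^sub>R q) \<le> (1 - s) * \<Psi> \<kappa> + s * \<Psi> q"
      using that k s by (intro convex_onD[OF Psi_convex]) auto
    also have "\<dots> \<le> 1 * \<Psi> q" using k s pos[of q] that False by (simp add: mult_right_le_one_le)
    finally show ?thesis by (simp only: e mult_1)
  qed
  show "((\<lambda>l. \<Psi> (t * l + \<kappa>) / \<Psi> (l + \<kappa>)) \<longlongrightarrow> t powr \<alpha>) at_top" if "0 < t" for t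
    using regularly_varying_shift[OF rv pos mono, of \<kappa>] \<alpha> that unfolding regularly_varying_def by simp
qed (rule \<alpha>)

end

theorem theorem1p5:
  fixes M :: "'a measure" and V :: "real \<Rightarrow> 'a \<Rightarrow> real"
    and N :: "real \<Rightarrow> 'b measure" and Vup :: "real \<Rightarrow> real \<Rightarrow> 'b \<Rightarrow> real"
    and \<Psi> W :: "real \<Rightarrow> real" and \<kappa> \<alpha> :: real
  assumes "spectrally_negative_levy_process M V"
    and "\<not> subordinator M (\<lambda>t \<omega>. - V t \<omega>)"
    and "laplace_exponent M V \<Psi>"
    and "\<kappa> = kappa M V \<Psi>"
    and "scale_function \<Psi> \<kappa> W"
    and "conditioned_to_stay_positive M V W N Vup"
    and "1 < \<alpha>" and "\<alpha> \<le> 2"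
    and "regularly_varying \<alpha> \<Psi>"
  shows "(\<lambda>x. ln (measure (N 0)
              {\<omega> \<in> space (N 0). exponential_functional (\<lambda>t. Vup 0 t \<omega>) \<le> ennreal x}))
         \<sim>[at_right 0] (\<lambda>x. - (\<alpha> - 1) * phi \<Psi> \<kappa> (1 / x))"
proof -
  interpret SN: spectrally_negative M V \<Psi> by standard (rule assms)+
  have pos: "0 < \<Psi> q" if "\<kappa> < q" for q by (rule scale_function_exponent_pos[OF assms(5,9) that])
  have k: "0 \<le> \<kappa>" "\<Psi> \<kappa> = 0" using SN.kappa_root[OF assms(4) pos] by auto
  interpret C: convex_rv "\<lambda>q. \<Psi> (q + \<kappa>)" \<alpha>
    by (rule SN.shifted_exponent_convex_rv[OF k pos assms(9,7)])
  obtain Q where Q: "feller_semigroup Q" "\<And>t x. 0 \<le> t \<Longrightarrow> 0 < x \<Longrightarrow> Q t x = p_up M V W t x"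
      "markov_process (N 0) (Vup 0) {0..} Q 0"
    using assms(6) unfolding conditioned_to_stay_positive_def by blast
  \<comment> \<open>The constructions depend on the Laplace variable, so the locale is instantiated
    afresh for every \<open>l > 0\<close>.\<close>
  have path: "conditioned_path M V \<Psi> \<alpha> W \<kappa> l Q (N 0) (Vup 0)" if l: "0 < l" for l
  proof
    show "continuous_on {0..} W" "mono_on {0..} W" using assms(5) by (auto simp: scale_function_def)
    show "0 \<le> W x" if "0 \<le> x" for x using assms(5) that by (simp add: scale_function_def)
    show "(\<integral>\<^sup>+x\<in>{0..}. ennreal (exp (- q * x)) * ennreal (W x) \<partial>lborel) = ennreal (1 / \<Psi> (q - \<kappa> + \<kappa>))" if "\<kappa> < q" for q
      using scale_function_nn(1)[OF assms(5) that] by simp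
  qed (use l Q k in auto)
  interpret N: prob_space "N 0" using Q(3) by (simp add: markov_process_def)
  define Z where "Z = (\<lambda>\<omega>. exponential_functional (\<lambda>t. Vup 0 t \<omega>))"
  have Z[measurable]: "Z \<in> borel_measurable (N 0)"
    unfolding Z_def by (rule conditioned_path.functional_measurable[OF path[OF zero_less_one]])
  \<comment> \<open>With the value 0 at infinity, the pointwise inequalities below hold also where
    the functional is infinite.\<close>
  define E where "E = (\<lambda>l a. if a = \<top> then 0 else exp (- (l * enn2real a)))"
  have Em[measurable]: "E l \<in> borel_measurable borel" for l :: real unfolding E_def by measurable
  have E01: "0 \<le> E l a" "0 \<le> l \<Longrightarrow> E l a \<le> 1" for l a by (auto simp: E_def)
  have Ei: "integrable (N 0) (\<lambda>\<omega>. E l (Z \<omega>))" if "0 \<le> l" for l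
    using E01 that by (intro N.integrable_const_bound[where B=1]) auto
  define L where "L = (\<lambda>l. LINT \<omega>|N 0. E l (Z \<omega>))"
  define F where "F = (\<lambda>x. measure (N 0) {\<omega> \<in> space (N 0). Z \<omega> \<le> ennreal x})"
  have Fi: "F x = (LINT \<omega>|N 0. indicator {..ennreal x} (Z \<omega>))" for x
  proof -
    have "F x = (LINT \<omega>|N 0. indicator {\<omega> \<in> space (N 0). Z \<omega> \<le> ennreal x} \<omega>)" by (simp add: F_def Collect_conj_eq inf_absorb2)
    also have "\<dots> = (LINT \<omega>|N 0. indicator {..ennreal x} (Z \<omega>))" by (intro Bochner_Integration.integral_cong) (auto simp: indicator_def)
    finally show ?thesis .
  qed
  have Ii: "integrable (N 0) (\<lambda>\<omega>. indicator {..ennreal x} (Z \<omega>) :: real)" for x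
    by (intro N.integrable_const_bound[where B=1]) (auto simp: indicator_def)
  have "(\<lambda>x. ln (F x)) \<sim>[at_right 0] (\<lambda>x. - (\<alpha> - 1) * C.inv_ratio (Lim (at_right 0) (\<lambda>l. \<Psi> (l + \<kappa>) / l)) (1 / x))"
  proof (rule C.tauberian[of L F])
    fix l :: real assume l: "0 < l"
    interpret conditioned_path M V \<Psi> \<alpha> W \<kappa> l Q "N 0" "Vup 0" by (rule path[OF l])
    show "L l = 1 / C.J l" using functional_laplace by (simp add: L_def E_def eexp_def Z_def)
  next
    fix x l :: real assume x: "0 < x" and l: "0 < l"
    have "F x \<le> (LINT \<omega>|N 0. exp (l * x) * E l (Z \<omega>))"
      unfolding Fi
    proof (intro integral_mono Ii integrable_mult_right Ei)
      fix \<omega>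
      show "indicator {..ennreal x} (Z \<omega>) \<le> exp (l * x) * E l (Z \<omega>)"
      proof (cases "Z \<omega>")
        case (real r)
        then show ?thesis using l x
          by (auto simp: E_def indicator_def exp_add[symmetric] ennreal_le_iff mult_left_mono)
      qed (simp add: E_def indicator_def top_unique)
    qed (use l in simp)
    then show "F x \<le> exp (l * x) * L l" by (simp add: L_def)
  next
    fix a b l d :: real assume a: "0 < a" "a < b" and l: "0 < l" and d: "0 < d" "d < 1"
    have "L l \<le> (LINT \<omega>|N 0. exp (- l * a) * indicator {..ennreal b} (Z \<omega>) + exp (d * l * a) * E ((1 + d) * l) (Z \<omega>) + exp (- d * l * b) * E ((1 - d) * l) (Z \<omega>))"
      unfolding L_def
    proof (intro integral_mono Ei Bochner_Integration.integrable_add integrable_mult_right Ii)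
      fix \<omega>
      show "E l (Z \<omega>) \<le> exp (- l * a) * indicator {..ennreal b} (Z \<omega>) + exp (d * l * a) * E ((1 + d) * l) (Z \<omega>) + exp (- d * l * b) * E ((1 - d) * l) (Z \<omega>)"
      proof (cases "Z \<omega>")
        case (real r)
        \<comment> \<open>Below \<open>a\<close> the variable is tilted up to
          \<open>(1 + d) * l\<close>, above \<open>b\<close> down to \<open>(1 - d) * l\<close>;
          between the two the exponential is at most \<open>exp (- l * a)\<close> and the indicator
          is 1.\<close>
        consider "r \<le> a" | "a < r" "r \<le> b" | "b < r" by linarith
        then show ?thesis
        proof cases
          case 1
          have "d * l * r \<le> d * l * a" using 1 d l by (intro mult_left_mono) auto
          then have "exp (- (l * r)) \<le> exp (d * l * a) * exp (- ((1 + d) * l * r))"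
            unfolding exp_add[symmetric] by (simp add: algebra_simps)
          then have "E l (Z \<omega>) \<le> exp (d * l * a) * E ((1 + d) * l) (Z \<omega>)" using real by (simp add: E_def)
          moreover have "0 \<le> exp (- l * a) * indicator {..ennreal b} (Z \<omega>)" "0 \<le> exp (- d * l * b) * E ((1 - d) * l) (Z \<omega>)"
            using E01 by auto
          ultimately show ?thesis by linarith
        next
          case 2
          have "l * a \<le> l * r" using 2 l by (intro mult_left_mono) auto
          then have "E l (Z \<omega>) \<le> exp (- l * a) * indicator {..ennreal b} (Z \<omega>)"
            using real 2 by (simp add: E_def indicator_def ennreal_leI)
          moreover have "0 \<le> exp (d * l * a) * E ((1 + d) * l) (Z \<omega>)" "0 \<le> exp (- d * l * b) * E ((1 - d) * l) (Z \<omega>)"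
            using E01 by auto
          ultimately show ?thesis by linarith
        next
          case 3
          have "d * l * b \<le> d * l * r" using 3 d l by (intro mult_left_mono) auto
          then have "exp (- (l * r)) \<le> exp (- d * l * b) * exp (- ((1 - d) * l * r))"
            unfolding exp_add[symmetric] by (simp add: algebra_simps)
          then have "E l (Z \<omega>) \<le> exp (- d * l * b) * E ((1 - d) * l) (Z \<omega>)" using real by (simp add: E_def)
          moreover have "0 \<le> exp (- l * a) * indicator {..ennreal b} (Z \<omega>)" "0 \<le> exp (d * l * a) * E ((1 + d) * l) (Z \<omega>)"
            using E01 by auto
          ultimately show ?thesis by linarith
        qed
      qed (auto simp: E_def indicator_def)
    qed (use l d in auto)
    also have "\<dots> = exp (- l * a) * F b + exp (d * l * a) * L ((1 + d) * l) + exp (- d * l * b) * L ((1 - d) * l)"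
      using Ei[of "(1 + d) * l"] Ei[of "(1 - d) * l"] Ii[of b] l d by (simp add: L_def Fi)
    finally show "L l \<le> exp (- l * a) * F b + exp (d * l * a) * L ((1 + d) * l) + exp (- d * l * b) * L ((1 - d) * l)" .
  next
    show "mono F"
      unfolding F_def by (intro monoI N.finite_measure_mono) (auto intro: order_trans ennreal_leI)
  qed
  \<comment> \<open>The parameter of \<open>inv_ratio\<close> is the right-hand limit that
    \<open>phi_ratio\<close> assigns at 0, so the two infima are over the same set.\<close>
  moreover have "C.inv_ratio (Lim (at_right 0) (\<lambda>l. \<Psi> (l + \<kappa>) / l)) y = phi \<Psi> \<kappa> y" for y
    by (simp add: C.inv_ratio_def phi_def phi_ratio_def)
  ultimately show ?thesis by (simp add: F_def Z_def)
qed

end
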